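(* Suppose that the overlap and ignorability assumption (Assumption 1) and the regularity assumption (Assumption 2) stated in the context hold, and that both nuisance models are correctly specified at $\theta^*$: $e(X,\alpha^* )=\mathbb{P}(A=1\mid X)$ a.s. and $u_a(X,\beta_a^* )=\mathbb{E}\{Y(a)\mid X\}$ a.s. for $a=0,1$. Let $e^*=e(X,\alpha^* )$ and $\pi_a(e^* )=\mathbb{P}(A=a\mid e^* )$. Then, as $n\to\infty$ (with $K=K_n\to\infty$ and $K/n\to0$), $n^{1/2}(\hat\tau_{\mathrm{AMW}}^{\theta^*}-\tau)$ converges in distribution to a centered normal law whose variance is $$\mathbb{E}\left[\frac{\mathbb{V}\{Y(0)\mid X\}}{\pi_0(e^* )}+\frac{\mathbb{V}\{Y(1)\mid X\}}{\pi_1(e^* )}+\{u_1(X,\beta_1^* )-u_0(X,\beta_0^* )-\tau\}^2\right],$$ and this variance equals the semiparametric efficiency bound for estimating $\tau$ from i.i.d. observations of $(X,A,Y)$.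
   Context: Setting. $\{X_i,A_i,Y_i(0),Y_i(1)\}_{i=1}^n$ are i.i.d. copies of $\{X,A,Y(0),Y(1)\}$, with $X$ pre-treatment covariates, $A\in\{0,1\}$ a binary treatment, $Y(a)$ potential outcomes. The observed outcome is $Y_i=A_iY_i(1)+(1-A_i)Y_i(0)$. The estimand is the average treatment effect $\tau=\mathbb{E}\{Y(1)-Y(0)\}$. $\mathbb{V}$ denotes variance. Models. $e(X,\alpha)$ is a parametric model for $\mathbb{P}(A=1\mid X)$ and $u_a(X,\beta_a)$ is a parametric model for $\mathbb{E}\{Y(a)\mid X\}$, $a=0,1$; $\theta^\top=(\alpha^\top,\beta_0^\top,\beta_1^\top)$. Here $\theta^*=(\alpha^{*\top},\beta_0^{*\top},\beta_1^{*\top})^\top$ is a fixed, known parameter value. Write $e_i^*=e(X_i,\alpha^* )$, $e^*=e(X,\alpha^* )$, $R_i^*(a)=Y_i(a)-u_a(X_i,\beta_a^* )$. Matching. For each unit $l$, let $\mathcal{J}(l)$ be the set of indices of the $K$ units $j$ with $A_j=1-A_l$ having the smallest distances $|e_j^*-e_l^*|$ (matching with replacement). Let $M_{e(X),i}=\sum_{l=1}^n I\{i\in\mathcal{J}(l)\}$. The number of matches $K=K_n$ grows with $n$: $K\to\infty$ and $K/n\to0$. Augmented match weighted (AMW) estimator at $\theta^*$: $$\hat\tau_{\mathrm{AMW}}^{\theta^*}=\frac1n\sum_{i=1}^n\{u_1(X_i,\beta_1^* )-u_0(X_i,\beta_0^* )\}+\frac1n\sum_{i=1}^n\left[A_i\left\{1+\frac{M_{e(X),i}}{K}\right\}R_i^*(1)-(1-A_i)\left\{1+\frac{M_{e(X),i}}{K}\right\}R_i^*(0)\right].$$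 Assumption 1. There are constants $c_0,c_1$ with $0<c_0\le \mathbb{P}(A=1\mid X)\le c_1<1$ a.s., and $\{Y(0),Y(1)\}\perp A\mid X$. Assumption 2. The density $f$ of $e_i^*$ and the conditional mean of $R_i^*(A_i)$ (as a function of the score $e_i^*$) under the model with parameter $\theta^*$ are continuously differentiable and bounded; $R_i^*(A_i)$ and $\mathbb{E}\{R_i^*(A_i)^3\mid\theta^*\}$ are uniformly bounded; and $u_a(\cdot,\beta_a^* )$ and the conditional variance function $\sigma_a^2(\beta_a^* )$ of $Y(a)$ are Lipschitz continuous, $a=0,1$.
   Formalization: The potential outcomes Y(0), Y(1) are additionally assumed to have finite second moments; without this the displayed variance can be infinite (e.g. u_1(X)−u_0(X) linear in a heavy-tailed X), and no such normal limit exists. *)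

theory Defs
  imports "HOL-Probability.Probability"
begin

section \<open>Laws of a unit and conditioning\<close>

text \<open>
  A unit is a tuple \<open>(X, A, Y(0), Y(1))\<close> and a population is a probability law on such tuples;
  the generic random variables \<open>X, A, Y(0), Y(1)\<close> are the coordinate functions below.
\<close>

type_synonym 'x unit_data = "'x \<times> bool \<times> real \<times> real"

abbreviation full_space :: "'x::euclidean_space unit_data measure" where
  "full_space \<equiv> borel \<Otimes>\<^sub>M (count_space UNIV \<Otimes>\<^sub>M (borel \<Otimes>\<^sub>M borel))"

abbreviation obs_space :: "('x::euclidean_space \<times> bool \<times> real) measure" where
  "obs_space \<equiv> borel \<Otimes>\<^sub>M (count_space UNIV \<Otimes>\<^sub>M borel)"

definition cov :: "'x unit_data \<Rightarrow> 'x" where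
  "cov z = fst z"

definition trt :: "'x unit_data \<Rightarrow> bool" where
  "trt z = fst (snd z)"

definition pot :: "bool \<Rightarrow> 'x unit_data \<Rightarrow> real" where
  "pot a z = (if a then snd (snd (snd z)) else fst (snd (snd z)))"

definition obs_outcome :: "'x unit_data \<Rightarrow> real" where
  "obs_outcome z = of_bool (trt z) * pot True z + (1 - of_bool (trt z)) * pot False z"

definition obs_law :: "'x::euclidean_space unit_data measure \<Rightarrow> ('x \<times> bool \<times> real) measure" where
  "obs_law Q = distr Q obs_space (\<lambda>z. (cov z, trt z, obs_outcome z))"

text \<open>\<open>E(f | U)\<close>, \<open>P(S | U)\<close> and \<open>V(f | U)\<close> for a random variable \<open>U\<close>, as random variables on \<open>Q\<close>.\<close>

definition cexp :: "'a measure \<Rightarrow> ('a \<Rightarrow> 'b::topological_space) \<Rightarrow> ('a \<Rightarrow> real) \<Rightarrow> 'a \<Rightarrow> real" where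
  "cexp Q U f = real_cond_exp Q (vimage_algebra (space Q) U borel) f"

definition cprob :: "'a measure \<Rightarrow> ('a \<Rightarrow> 'b::topological_space) \<Rightarrow> ('a \<Rightarrow> bool) \<Rightarrow> 'a \<Rightarrow> real" where
  "cprob Q U S = cexp Q U (\<lambda>z. of_bool (S z))"

definition cvar :: "'a measure \<Rightarrow> ('a \<Rightarrow> 'b::topological_space) \<Rightarrow> ('a \<Rightarrow> real) \<Rightarrow> 'a \<Rightarrow> real" where
  "cvar Q U f = cexp Q U (\<lambda>z. (f z - cexp Q U f z)\<^sup>2)"

definition ate :: "'x unit_data measure \<Rightarrow> real" where
  "ate Q = (\<integral>z. pot True z - pot False z \<partial>Q)"

section \<open>Assumptions\<close>

definition overlap :: "'x::euclidean_space unit_data measure \<Rightarrow> bool" where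
  "overlap Q \<longleftrightarrow>
     (\<exists>c0 c1. 0 < c0 \<and> c0 \<le> c1 \<and> c1 < 1 \<and>
        (AE z in Q. c0 \<le> cprob Q cov trt z \<and> cprob Q cov trt z \<le> c1))"

text \<open>\<open>(Y(0), Y(1))\<close> and \<open>A\<close> are conditionally independent given \<open>X\<close>.\<close>

definition ignorability :: "'x::euclidean_space unit_data measure \<Rightarrow> bool" where
  "ignorability Q \<longleftrightarrow>
     (\<forall>a. \<forall>S \<in> sets (borel \<Otimes>\<^sub>M borel).
        AE z in Q. cprob Q cov (\<lambda>z. trt z = a \<and> (pot False z, pot True z) \<in> S) z =
          cprob Q cov (\<lambda>z. trt z = a) z * cprob Q cov (\<lambda>z. (pot False z, pot True z) \<in> S) z)"

definition assumption1 :: "'x::euclidean_space unit_data measure \<Rightarrow> bool" where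
  "assumption1 Q \<longleftrightarrow> overlap Q \<and> ignorability Q"

definition square_integrable_outcomes :: "'x::euclidean_space unit_data measure \<Rightarrow> bool" where
  "square_integrable_outcomes Q \<longleftrightarrow> (\<forall>a. integrable Q (\<lambda>z. (pot a z)\<^sup>2))"

text \<open>The residual \<open>R(a)\<close> with respect to outcome regression functions \<open>m\<close>.\<close>

definition resid :: "(bool \<Rightarrow> 'x \<Rightarrow> real) \<Rightarrow> bool \<Rightarrow> 'x unit_data \<Rightarrow> real" where
  "resid m a z = pot a z - m a (cov z)"

definition outcome_model ::
    "('x \<Rightarrow> 'b0 \<Rightarrow> real) \<Rightarrow> ('x \<Rightarrow> 'b1 \<Rightarrow> real) \<Rightarrow> 'b0 \<Rightarrow> 'b1 \<Rightarrow> bool \<Rightarrow> 'x \<Rightarrow> real" where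
  "outcome_model u0 u1 \<beta>0 \<beta>1 a x = (if a then u1 x \<beta>1 else u0 x \<beta>0)"

definition C1_bounded_on :: "real set \<Rightarrow> (real \<Rightarrow> real) \<Rightarrow> bool" where
  "C1_bounded_on S f \<longleftrightarrow>
     (\<exists>f'. (\<forall>x\<in>S. (f has_real_derivative f' x) (at x within S)) \<and> continuous_on S f') \<and> bounded (f ` S)"

text \<open>
  Here \<open>s\<close> is the score function \<open>x \<mapsto> e(x, \<alpha>*)\<close> and \<open>m\<close> the outcome regressions at \<open>\<beta>*\<close>.
  The density of the score is \<open>C\<^sup>1\<close> and bounded on an interval \<open>[l, h]\<close> outside of which it vanishes;
  it may jump at the end points (for example a uniform score is allowed). A density that is
  \<open>C\<^sup>1\<close> on the whole line is covered, since the score takes values in a compact interval.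
\<close>

definition assumption2 ::
    "'x::euclidean_space unit_data measure \<Rightarrow> ('x \<Rightarrow> real) \<Rightarrow> (bool \<Rightarrow> 'x \<Rightarrow> real) \<Rightarrow> bool" where
  "assumption2 Q s m \<longleftrightarrow>
     (let e = (\<lambda>z. s (cov z)); R = (\<lambda>z. resid m (trt z) z) in
       (\<exists>l h f r. l < h \<and> (\<forall>x. 0 \<le> f x) \<and> (\<forall>x. x \<notin> {l..h} \<longrightarrow> f x = 0) \<and>
          distributed Q lborel e (\<lambda>x. ennreal (f x)) \<and> C1_bounded_on {l..h} f \<and>
          (AE z in Q. cexp Q e R z = r (e z)) \<and> C1_bounded_on {l..h} r) \<and>
       (\<exists>B. (AE z in Q. \<bar>R z\<bar> \<le> B) \<and> (AE z in Q. \<bar>cexp Q e (\<lambda>z. R z ^ 3) z\<bar> \<le> B)) \<and>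
       (\<forall>a. (\<exists>L. L-lipschitz_on UNIV (m a)) \<and>
          (\<exists>v L. L-lipschitz_on UNIV v \<and> (AE z in Q. cvar Q cov (pot a) z = v (cov z)))))"

section \<open>Matching and the augmented match weighted estimator\<close>

text \<open>
  The \<open>K\<close> units of the opposite treatment group closest to unit \<open>l\<close>; the units are \<open>0, \<dots>, n - 1\<close>.
  Equal distances (a null event if the score has a density) are ordered by the index. If the opposite
  group has fewer than \<open>K\<close> members, all of them are matched.
\<close>

definition match_set ::
    "nat \<Rightarrow> nat \<Rightarrow> (nat \<Rightarrow> bool) \<Rightarrow> (nat \<Rightarrow> real) \<Rightarrow> nat \<Rightarrow> nat set" where
  "match_set n K A e l =
     {j. j < n \<and> A j = (\<not> A l) \<and>
        card {k. k < n \<and> A k = (\<not> A l) \<and>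
          (\<bar>e k - e l\<bar> < \<bar>e j - e l\<bar> \<or> \<bar>e k - e l\<bar> = \<bar>e j - e l\<bar> \<and> k < j)} < K}"

definition match_count ::
    "nat \<Rightarrow> nat \<Rightarrow> (nat \<Rightarrow> bool) \<Rightarrow> (nat \<Rightarrow> real) \<Rightarrow> nat \<Rightarrow> nat" where
  "match_count n K A e i = (\<Sum>l<n. of_bool (i \<in> match_set n K A e l))"

definition amw ::
    "('x \<Rightarrow> real) \<Rightarrow> (bool \<Rightarrow> 'x \<Rightarrow> real) \<Rightarrow> nat \<Rightarrow> nat \<Rightarrow> (nat \<Rightarrow> 'x unit_data) \<Rightarrow> real" where
  "amw s m n K z =
     (let w = (\<lambda>i. 1 + real (match_count n K (\<lambda>j. trt (z j)) (\<lambda>j. s (cov (z j))) i) / real K) in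
       (1 / real n) * (\<Sum>i<n. m True (cov (z i)) - m False (cov (z i))) +
       (1 / real n) * (\<Sum>i<n. of_bool (trt (z i)) * w i * resid m True (z i) -
          (1 - of_bool (trt (z i))) * w i * resid m False (z i)))"

text \<open>The law \<open>N(0, v)\<close>, including the point mass at 0 when \<open>v = 0\<close>.\<close>

definition centered_normal :: "real \<Rightarrow> real measure" where
  "centered_normal v = distr std_normal_distribution borel (\<lambda>x. sqrt v * x)"

section \<open>The semiparametric efficiency bound\<close>

text \<open>
  The model: all laws of \<open>(X, A, Y(0), Y(1))\<close> satisfying overlap and ignorability, with outcomes of
  finite variance, and no other restriction.
\<close>

definition causal_model :: "'x::euclidean_space unit_data measure set" where
  "causal_model =
     {Q. prob_space Q \<and> sets Q = sets full_space \<and> assumption1 Q \<and> square_integrable_outcomes Q}"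

text \<open>
  A regular one-dimensional submodel \<open>t \<mapsto> P t\<close> through \<open>Q\<close> with score \<open>g\<close>: the laws of the observed
  data \<open>(X, A, Y)\<close> are dominated by a sigma-finite \<open>\<nu>\<close> and differentiable in quadratic mean at 0,
  and \<open>d\<close> is the derivative of the estimand there. Only the observed data law is required to vary
  smoothly, since the score and the information are those of the observed data.
  The outcomes have locally bounded second moments, the usual regularity condition for
  estimands that are moments: without it an unbounded outcome permits a mass \<open>t\<^sup>3\<close> placed at
  \<open>1 / t\<^sup>2\<close>, which moves the mean at unit rate but does not contribute to the score.
\<close>

definition regular_submodel ::
    "'x::euclidean_space unit_data measure \<Rightarrow> (real \<Rightarrow> 'x unit_data measure) \<Rightarrow>
     ('x \<times> bool \<times> real \<Rightarrow> real) \<Rightarrow> real \<Rightarrow> bool" where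
  "regular_submodel Q P g d \<longleftrightarrow>
     P 0 = Q \<and>
     g \<in> borel_measurable obs_space \<and> integrable (obs_law Q) (\<lambda>y. (g y)\<^sup>2) \<and>
     ((\<lambda>t. ate (P t)) has_real_derivative d) (at 0) \<and>
     (\<exists>\<epsilon> > 0. \<exists>B \<nu> p. sigma_finite_measure \<nu> \<and> sets \<nu> = sets obs_space \<and>
        (\<forall>t. \<bar>t\<bar> < \<epsilon> \<longrightarrow> P t \<in> causal_model \<and>
           (\<forall>a. (\<integral>z. (pot a z)\<^sup>2 \<partial>(P t)) \<le> B) \<and>
           p t \<in> borel_measurable \<nu> \<and> (\<forall>y. 0 \<le> p t y) \<and>
           obs_law (P t) = density \<nu> (\<lambda>y. ennreal (p t y))) \<and>
        ((\<lambda>t. \<integral>\<^sup>+ y. ennreal (((sqrt (p t y) - sqrt (p 0 y)) / t - g y * sqrt (p 0 y) / 2)\<^sup>2) \<partial>\<nu>)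
           \<longlongrightarrow> 0) (at 0))"

text \<open>
  The supremum of the Cramer-Rao bounds \<open>d\<^sup>2 / E g\<^sup>2\<close> over the regular submodels with positive
  information.
\<close>

definition efficiency_bound :: "'x::euclidean_space unit_data measure \<Rightarrow> ennreal" where
  "efficiency_bound Q =
     Sup {ennreal (d\<^sup>2 / (\<integral>y. (g y)\<^sup>2 \<partial>obs_law Q)) | P g d.
            regular_submodel Q P g d \<and> 0 < (\<integral>y. (g y)\<^sup>2 \<partial>obs_law Q)}"

end

(*
 With A = a and w = 1 + M / K, the estimator equals the sample mean of the efficient influence
 function at theta* up to the sum of (w_i - 1 / P(A = a | e)) times the residuals. Given covariates
 and treatments the residuals are centred and independent, so the error is negligible as soon as
 M / K converges in mean square to the odds of the opposite arm. The number of matches of a unit is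
 a sum of indicators of binomial tail events: l is matched to i iff fewer than K units of
 the group of i are closer to l than i is, a binomial event governed by the density of the score.

 For the bound, along a regular submodel inverse probability weighting writes each arm mean as an
 observed-data mean, so d is the inner product of the score and the influence function and
 Cauchy-Schwarz gives the upper bound. It is approached by tilting the law of X by a truncation of
 the influence function and the law of each outcome given X by its weighted residual.
*)
theory Submission
 imports Defs "HOL-Real_Asymp.Real_Asymp"
begin

text \<open>Whether l and l' are both matched to i depends on the same remaining units, so the joint
  probability is not a product. Reading the binomial tail as the probability that a Beta variable u
  exceeds a threshold repairs this: for fixed u the conditions on l and l' separate, and the second
  moment of M turns into a Beta integral of the squared catchment mass of i. That mass is bounded
  linearly for all u, and its slope at u = 0 is at most the odds; a reverse Fatou argument then
  bounds the limit. One-sided bounds suffice, an upper one for the second moment and a lower one for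
  the cross moment with the odds, because the mean square error is nonnegative. For the efficiency
  bound the obstacle is that only the observed laws vary smoothly. The overlap constants of the laws
  along a submodel may degenerate as t tends to 0, and the regression functions of Q are square
  integrable under Q alone. The mean of each arm is therefore split over a set of covariates on
  which both are under control and its complement; the complement has mass o(t^2), and the bounded
  second moments turn this into an error o(t).\<close>

section \<open>Binomial tails and Beta moments\<close>

definition binom_tail :: "nat => nat => real => real" where
 "binom_tail N K p = (\<Sum>j<K. real (N choose j) * p ^ j * (1 - p) ^ (N - j))"

text \<open>For 1 <= K <= N this is the Beta(K, N - K + 1) density, the law of the K-th smallest of
  N independent uniform variables, and \<open>binom_tail N K p\<close> is the probability that a
  Binomial(N, p) variable stays below K.\<close>

definition order_density :: "nat => nat => real => real" where
 "order_density N K u = real K * real (N choose K) * u ^ (K - 1) * (1 - u) ^ (N - K)"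

lemma binom_tail_0 [simp]: "binom_tail N 0 p = 0"
 by (simp add: binom_tail_def)

lemma binom_tail_zero_trials: "binom_tail 0 (Suc K) p = 1"
 unfolding binom_tail_def by (simp add: sum.lessThan_Suc_shift del: sum.lessThan_Suc)

text \<open>Condition on one trial: a success uses up one of the admissible successes, a failure
  leaves the bound unchanged.\<close>

lemma binom_tail_Suc:
 "binom_tail (Suc N) (Suc K) p = p * binom_tail N K p + (1 - p) * binom_tail N (Suc K) p"
proof (induction K)
 case 0
 then show ?case by (simp add: binom_tail_def)
next
 case (Suc K)
 have *: "real (Suc N choose Suc K) * p ^ Suc K * (1 - p) ^ (Suc N - Suc K) =
   p * (real (N choose K) * p ^ K * (1 - p) ^ (N - K)) +
   (1 - p) * (real (N choose Suc K) * p ^ Suc K * (1 - p) ^ (N - Suc K))"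
 proof (cases "Suc K <= N")
  case True
  then have "(1 - p) ^ (N - K) = (1 - p) * (1 - p) ^ (N - Suc K)"
   by (metis Suc_diff_Suc Suc_le_lessD power_Suc)
  then show ?thesis by (simp add: distrib_left distrib_right mult_ac)
 next
  case False
  then have "N choose Suc K = 0" by (simp add: binomial_eq_0)
  then have "real (N choose Suc K) = 0" by (simp only: of_nat_0)
  then show ?thesis using False by (simp del: of_nat_eq_0_iff)
 qed
 have "binom_tail (Suc N) (Suc (Suc K)) p = binom_tail (Suc N) (Suc K) p +
   real (Suc N choose Suc K) * p ^ Suc K * (1 - p) ^ (Suc N - Suc K)"
  by (simp add: binom_tail_def)
 moreover have "binom_tail N (Suc (Suc K)) p = binom_tail N (Suc K) p +
   real (N choose Suc K) * p ^ Suc K * (1 - p) ^ (N - Suc K)"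
  by (simp add: binom_tail_def)
 moreover have "binom_tail N (Suc K) p = binom_tail N K p + real (N choose K) * p ^ K * (1 - p) ^ (N - K)"
  by (simp add: binom_tail_def)
 ultimately show ?case using Suc.IH * by (simp add: algebra_simps)
qed

lemma binom_tail_nonneg: "0 <= p ==> p <= 1 ==> 0 <= binom_tail N K p"
 unfolding binom_tail_def by (intro sum_nonneg mult_nonneg_nonneg) auto

text \<open>Each coordinate is a Bernoulli trial with success probability
  \<open>measure Q S\<close>. Integrating out one coordinate reproduces the recursion
  \<open>binom_tail_Suc\<close>, so induction on the index set applies for all K at once.\<close>

lemma emeasure_PiM_count_less:
 assumes "prob_space Q" and S [measurable]: "S \<in> sets Q" and "finite T"
 shows "(\<integral>\<^sup>+ x. indicator {x. card {k \<in> T. x k \<in> S} < K} x \<partial>(\<Pi>\<^sub>M k\<in>T. Q)) =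
  ennreal (binom_tail (card T) K (measure Q S))"
 using \<open>finite T\<close>
proof (induction T arbitrary: K rule: finite_induct)
 case empty
 interpret prob_space Q by fact
 interpret product_sigma_finite "%_. Q" ..
 show ?case
  by (cases K) (simp_all add: nn_integral_empty binom_tail_zero_trials PiM_empty
    nn_integral_count_space_finite del: nn_integral_indicator nn_integral_indicator')
next
 case (insert k T)
 interpret prob_space Q by fact
 interpret product_sigma_finite "%_. Q" ..
 show ?case
 proof (cases K)
  case 0
  then show ?thesis by simp
 next
  case (Suc K')
  have [measurable]: "(%x. x i) \<in> measurable (\<Pi>\<^sub>M k\<in>insert k T. Q) Q" if "i \<in> insert k T" for i
   using that by (rule measurable_component_singleton)
  have [measurable]: "(%x. x i) \<in> measurable (\<Pi>\<^sub>M k\<in>T. Q) Q" if "i \<in> T" for i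
   using that by (rule measurable_component_singleton)
  have m: "(indicator {x. card {k \<in> T'. x k \<in> S} < K} :: _ => ennreal) \<in> borel_measurable (\<Pi>\<^sub>M k\<in>T'. Q)"
   if "finite T'" for T' K
  proof -
   have [measurable]: "(%x. x i) \<in> measurable (\<Pi>\<^sub>M k\<in>T'. Q) Q" if "i \<in> T'" for i
    using that by (rule measurable_component_singleton)
   have eq: "card {k \<in> T'. x k \<in> S} = (\<Sum>k\<in>T'. indicator S (x k) :: nat)" for x
    using that by (simp add: indicator_def sum.If_cases Collect_conj_eq Int_commute if_distrib)
   show ?thesis unfolding eq by measurable
  qed
  have c: "card {i \<in> insert k T. (x(k := y)) i \<in> S} = (if y \<in> S then Suc (card {i \<in> T. x i \<in> S}) else card {i \<in> T. x i \<in> S})" for x y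
  proof -
   have "{i \<in> insert k T. (x(k := y)) i \<in> S} = (if y \<in> S then insert k {i \<in> T. x i \<in> S} else {i \<in> T. x i \<in> S})"
    using insert.hyps by auto
   then show ?thesis using insert.hyps by auto
  qed
  have "(\<integral>\<^sup>+ x. indicator {x. card {j \<in> insert k T. x j \<in> S} < K} x \<partial>(\<Pi>\<^sub>M k\<in>insert k T. Q)) =
   (\<integral>\<^sup>+ y. (\<integral>\<^sup>+ x. indicator {x. card {j \<in> insert k T. x j \<in> S} < K} (x(k := y)) \<partial>(\<Pi>\<^sub>M k\<in>T. Q)) \<partial>Q)"
   using insert.hyps by (intro product_nn_integral_insert_rev m) auto
  also have "... = (\<integral>\<^sup>+ y. ennreal (binom_tail (card T) K' (measure Q S)) * indicator S y +
     ennreal (binom_tail (card T) K (measure Q S)) * indicator (space Q - S) y \<partial>Q)"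
  proof (rule nn_integral_cong)
   fix y assume y: "y \<in> space Q"
   show "(\<integral>\<^sup>+ x. indicator {x. card {j \<in> insert k T. x j \<in> S} < K} (x(k := y)) \<partial>(\<Pi>\<^sub>M k\<in>T. Q)) =
    ennreal (binom_tail (card T) K' (measure Q S)) * indicator S y +
     ennreal (binom_tail (card T) K (measure Q S)) * indicator (space Q - S) y"
   proof (cases "y \<in> S")
    case True
    have "(\<integral>\<^sup>+ x. indicator {x. card {j \<in> insert k T. x j \<in> S} < K} (x(k := y)) \<partial>(\<Pi>\<^sub>M k\<in>T. Q)) =
     (\<integral>\<^sup>+ x. indicator {x. card {k \<in> T. x k \<in> S} < K'} x \<partial>(\<Pi>\<^sub>M k\<in>T. Q))"
     using True c Suc by (intro nn_integral_cong) (simp add: indicator_def)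
    then show ?thesis using True insert.IH[of K'] by simp
   next
    case False
    have "(\<integral>\<^sup>+ x. indicator {x. card {j \<in> insert k T. x j \<in> S} < K} (x(k := y)) \<partial>(\<Pi>\<^sub>M k\<in>T. Q)) =
     (\<integral>\<^sup>+ x. indicator {x. card {k \<in> T. x k \<in> S} < K} x \<partial>(\<Pi>\<^sub>M k\<in>T. Q))"
     using False c by (intro nn_integral_cong) (simp add: indicator_def)
    then show ?thesis using False y insert.IH[of K] by simp
   qed
  qed
  also have "... = ennreal (binom_tail (card T) K' (measure Q S)) * measure Q S + ennreal (binom_tail (card T) K (measure Q S)) * measure Q (space Q - S)"
   by (simp add: nn_integral_add nn_integral_cmult emeasure_eq_measure)
  also have "... = ennreal (binom_tail (card T) K' (measure Q S) * measure Q S + binom_tail (card T) K (measure Q S) * (1 - measure Q S))"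
   by (simp add: prob_compl binom_tail_nonneg ennreal_plus ennreal_mult)
  also have "... = ennreal (binom_tail (card (insert k T)) K (measure Q S))"
   using insert.hyps Suc by (simp add: binom_tail_Suc algebra_simps)
  finally show ?thesis .
 qed
qed

lemma order_density_nonneg: "0 <= u ==> u <= 1 ==> 0 <= order_density N K u"
 unfolding order_density_def by auto

lemma order_density_measurable [measurable]: "order_density N K \<in> borel_measurable borel"
 unfolding order_density_def[abs_def] by measurable

text \<open>The derivative of the K-th binomial weight is the difference of two consecutive order
  densities, so the sum telescopes.\<close>

lemma binom_tail_deriv:
 assumes "K <= N"
 shows "(binom_tail N K has_real_derivative - order_density N K u) (at u)"
 using assms
proof (induction K)
 case 0
 then show ?case by (simp add: binom_tail_def[abs_def] order_density_def)
next
 case (Suc K)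
 have ab: "real (Suc K) * real (N choose Suc K) = real (N - K) * real (N choose K)"
  by (metis binomial_absorb_comp binomial_absorption of_nat_mult)
 have eq: "binom_tail N (Suc K) = (%p. binom_tail N K p + real (N choose K) * p ^ K * (1 - p) ^ (N - K))"
  by (simp add: binom_tail_def fun_eq_iff)
 have "((%p. real (N choose K) * p ^ K * (1 - p) ^ (N - K)) has_real_derivative
   order_density N K u - order_density N (Suc K) u) (at u)"
  apply (rule derivative_eq_intros refl)+
  unfolding order_density_def ab
  by (simp add: algebra_simps)
 then have "((%p. binom_tail N K p + real (N choose K) * p ^ K * (1 - p) ^ (N - K)) has_real_derivative
   - order_density N K u + (order_density N K u - order_density N (Suc K) u)) (at u)"
  using Suc by (intro DERIV_add) auto
 then show ?case unfolding eq by simp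
qed

text \<open>Fewer than K of N uniform variables lie below p exactly when the K-th smallest lies
  above p. The threshold p now enters only through an indicator, which is what allows several
  thresholds to be combined later.\<close>

lemma binom_tail_eq_integral:
 assumes "1 <= K" "K <= N" "0 <= p" "p <= 1"
 shows "(\<integral>\<^sup>+ u. ennreal (order_density N K u) * indicator {p..1} u \<partial>lborel) = ennreal (binom_tail N K p)"
proof -
 have z: "binom_tail N K 1 = 0"
  using assms unfolding binom_tail_def by (intro sum.neutral) auto
 have "(\<integral>\<^sup>+ u. ennreal (order_density N K u) * indicator {p..1} u \<partial>lborel) =
   ennreal ((%u. - binom_tail N K u) 1 - (%u. - binom_tail N K u) p)"
 proof (rule nn_integral_FTC_Icc)
  show "((%u. - binom_tail N K u) has_real_derivative order_density N K u) (at u)" for u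
   using DERIV_minus[OF binom_tail_deriv[OF assms(2), of u]] by simp
 qed (use assms in \<open>auto intro: order_density_nonneg\<close>)
 then show ?thesis using z by simp
qed

text \<open>Multiplying a Beta density by u raises its first parameter. All moments thereby reduce
  to the total mass of another Beta density.\<close>

lemma order_density_shift:
 assumes "1 <= K"
 shows "u * order_density N K u = real K / real (N + 1) * order_density (N + 1) (K + 1) u"
proof -
 have "real (Suc K) * real (Suc N choose Suc K) = real (Suc N) * real (N choose K)"
  by (metis Suc_times_binomial of_nat_mult)
 moreover have "u ^ K = u * u ^ (K - 1)"
  using assms by (cases K) auto
 ultimately show ?thesis
  unfolding order_density_def by (simp add: field_simps)
qed

lemma order_density_total:
 assumes "1 <= K" "K <= N"
 shows "(\<integral>\<^sup>+ u. ennreal (order_density N K u) * indicator {0..1} u \<partial>lborel) = 1"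
proof -
 have "binom_tail N K 0 = 1"
 proof -
  have "binom_tail N K 0 = (\<Sum>j<K. if j = 0 then 1 else 0)"
   unfolding binom_tail_def by (intro sum.cong) auto
  then show ?thesis using assms by (simp add: sum.delta)
 qed
 then show ?thesis using binom_tail_eq_integral[OF assms, of 0] by simp
qed

lemma order_density_moment1:
 assumes "1 <= K" "K <= N"
 shows "(\<integral>\<^sup>+ u. ennreal (u * order_density N K u) * indicator {0..1} u \<partial>lborel) = ennreal (real K / real (N + 1))"
proof -
 have "(\<integral>\<^sup>+ u. ennreal (u * order_density N K u) * indicator {0..1} u \<partial>lborel) =
  (\<integral>\<^sup>+ u. ennreal (real K / real (N + 1)) * (ennreal (order_density (N + 1) (K + 1) u) * indicator {0..1} u) \<partial>lborel)"
  unfolding order_density_shift[OF assms(1)]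
  by (intro nn_integral_cong) (auto simp: indicator_def order_density_nonneg ennreal_mult[symmetric] simp del: of_nat_add)
 also have "... = ennreal (real K / real (N + 1))"
  using order_density_total[of "K + 1" "N + 1"] assms by (simp add: nn_integral_cmult)
 finally show ?thesis .
qed

lemma order_density_moment2:
 assumes "1 <= K" "K <= N"
 shows "(\<integral>\<^sup>+ u. ennreal (u ^ 2 * order_density N K u) * indicator {0..1} u \<partial>lborel) =
  ennreal (real K / real (N + 1) * (real (K + 1) / real (N + 2)))"
proof -
 have "u ^ 2 * order_density N K u = real K / real (N + 1) * (u * order_density (N + 1) (K + 1) u)" for u
  using arg_cong[OF order_density_shift[OF assms(1), of u N], of "%v. u * v"]
  by (simp only: power2_eq_square mult_ac)
 then have "(\<integral>\<^sup>+ u. ennreal (u ^ 2 * order_density N K u) * indicator {0..1} u \<partial>lborel) =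
  (\<integral>\<^sup>+ u. ennreal (real K / real (N + 1)) * (ennreal (u * order_density (N + 1) (K + 1) u) * indicator {0..1} u) \<partial>lborel)"
  by (intro nn_integral_cong) (auto simp: indicator_def order_density_nonneg ennreal_mult[symmetric] simp del: of_nat_add)
 also have "... = ennreal (real K / real (N + 1)) * ennreal (real (K + 1) / real (N + 2))"
  using order_density_moment1[of "K + 1" "N + 1"] assms by (simp add: nn_integral_cmult)
 also have "... = ennreal (real K / real (N + 1) * (real (K + 1) / real (N + 2)))"
  by (subst ennreal_mult) auto
 finally show ?thesis .
qed

lemma order_density_moment3:
 assumes "1 <= K" "K <= N"
 shows "(\<integral>\<^sup>+ u. ennreal (u ^ 3 * order_density N K u) * indicator {0..1} u \<partial>lborel) =
  ennreal (real K / real (N + 1) * (real (K + 1) / real (N + 2) * (real (K + 2) / real (N + 3))))"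
proof -
 have "u ^ 3 * order_density N K u = real K / real (N + 1) * (u ^ 2 * order_density (N + 1) (K + 1) u)" for u
  using arg_cong[OF order_density_shift[OF assms(1), of u N], of "%v. u * (u * v)"]
  by (simp only: power3_eq_cube power2_eq_square mult_ac)
 then have "(\<integral>\<^sup>+ u. ennreal (u ^ 3 * order_density N K u) * indicator {0..1} u \<partial>lborel) =
  (\<integral>\<^sup>+ u. ennreal (real K / real (N + 1)) * (ennreal (u ^ 2 * order_density (N + 1) (K + 1) u) * indicator {0..1} u) \<partial>lborel)"
  by (intro nn_integral_cong) (auto simp: indicator_def order_density_nonneg ennreal_mult[symmetric] simp del: of_nat_add)
 also have "... = ennreal (real K / real (N + 1)) * ennreal (real (K + 1) / real (N + 2) * (real (K + 2) / real (N + 3)))"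
  using order_density_moment2[of "K + 1" "N + 1"] assms by (simp add: nn_integral_cmult add.commute)
 also have "... = ennreal (real K / real (N + 1) * (real (K + 1) / real (N + 2) * (real (K + 2) / real (N + 3))))"
  by (subst ennreal_mult) auto
 finally show ?thesis .
qed

text \<open>Markov's inequality for the Beta variable, whose mean is K / (N + 1).\<close>

lemma binom_tail_le_Markov:
 assumes "1 <= K" "K <= N" "0 < p" "p <= 1"
 shows "binom_tail N K p <= real K / (real (N + 1) * p)"
proof -
 have "ennreal p * ennreal (binom_tail N K p) = (\<integral>\<^sup>+ u. ennreal p * (ennreal (order_density N K u) * indicator {p..1} u) \<partial>lborel)"
  using binom_tail_eq_integral[of K N p] assms by (simp add: nn_integral_cmult)
 also have "... <= (\<integral>\<^sup>+ u. ennreal (u * order_density N K u) * indicator {0..1} u \<partial>lborel)"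
  using assms by (intro nn_integral_mono)
   (auto simp: indicator_def order_density_nonneg ennreal_mult[symmetric] intro!: ennreal_leI mult_right_mono)
 also have "... = ennreal (real K / real (N + 1))"
  by (rule order_density_moment1) fact+
 finally have "p * binom_tail N K p <= real K / real (N + 1)"
  using assms by (simp add: ennreal_mult[symmetric] binom_tail_nonneg)
 then have "binom_tail N K p <= real K / real (N + 1) / p"
  using assms by (simp only: pos_le_divide_eq mult.commute)
 then show ?thesis by simp
qed

section \<open>Combinatorics of nearest neighbour matches\<close>

text \<open>In a strict total order the number of predecessors increases strictly along
  \<open>r\<close>, so it is a bijection of \<open>A\<close> onto \<open>{..<card A}\<close>;
  counting ranks below K is then immediate.\<close>

lemma card_rank_less:
 fixes r :: "'a => 'a => bool"
 assumes "finite A" and irr: "!!a. ~ r a a" and tr: "!!a b c. r a b ==> r b c ==> r a c"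
  and tot: "!!a b. a ~= b ==> r a b | r b a"
 shows "card {j \<in> A. card {k \<in> A. r k j} < K} = min K (card A)"
proof -
 define \<rho> where "\<rho> j = card {k \<in> A. r k j}" for j
 have less: "\<rho> j < \<rho> j'" if "j \<in> A" "r j j'" for j j'
  unfolding \<rho>_def
 proof (intro psubset_card_mono psubsetI)
  show "{k \<in> A. r k j} ~= {k \<in> A. r k j'}" using that irr by blast
 qed (use that \<open>finite A\<close> tr in auto)
 have inj: "inj_on \<rho> A"
  using less tot by (metis inj_onI less_irrefl)
 have "\<rho> ` A \<subseteq> {..<card A}"
 proof safe
  fix j assume "j \<in> A"
  then show "\<rho> j < card A"
   unfolding \<rho>_def using \<open>finite A\<close> irr by (intro psubset_card_mono) auto
 qed
 then have img: "\<rho> ` A = {..<card A}"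
  using card_image[OF inj] by (intro card_subset_eq) auto
 have "\<rho> ` {j \<in> A. \<rho> j < K} = {..<card A} \<inter> {..<K}"
  unfolding img[symmetric] by auto
 also have "... = {..<min K (card A)}" by auto
 finally have "card (\<rho> ` {j \<in> A. \<rho> j < K}) = min K (card A)" by simp
 moreover have "card (\<rho> ` {j \<in> A. \<rho> j < K}) = card {j \<in> A. \<rho> j < K}"
  by (rule card_image) (use inj in \<open>auto intro: inj_on_subset\<close>)
 ultimately show ?thesis by (simp add: \<rho>_def)
qed

lemma finite_match_set [simp]: "finite (match_set n K A e l)"
 unfolding match_set_def by auto

lemma card_match_set:
 "card (match_set n K A e l) = min K (card {k. k < n & A k = (~ A l)})"
proof -
 define r where "r k j \<longleftrightarrow> (\<bar>e k - e l\<bar> < \<bar>e j - e l\<bar> | \<bar>e k - e l\<bar> = \<bar>e j - e l\<bar> & k < j)" for k j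
 have "card {j \<in> {k. k < n & A k = (~ A l)}. card {k \<in> {k. k < n & A k = (~ A l)}. r k j} < K} =
   min K (card {k. k < n & A k = (~ A l)})"
  by (rule card_rank_less) (auto simp: r_def)
 moreover have "match_set n K A e l =
  {j \<in> {k. k < n & A k = (~ A l)}. card {k \<in> {k. k < n & A k = (~ A l)}. r k j} < K}"
  unfolding match_set_def r_def by (simp add: conj_ac)
 ultimately show ?thesis by simp
qed

lemma card_match_set_le: "card (match_set n K A e l) <= K"
 by (simp add: card_match_set)

text \<open>The last claim discards ties and counts competitors only within a chosen set
  \<open>T\<close>. With \<open>T\<close> the units other than those under discussion, the event
  becomes one about independent coordinates.\<close>

lemma match_setD:
 assumes "i \<in> match_set n K A e l"
 shows "i < n" "A i \<longleftrightarrow> ~ A l" "i ~= l"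
  "finite T ==> T \<subseteq> {..<n} ==> card {k \<in> T. A k = A i & \<bar>e k - e l\<bar> < \<bar>e i - e l\<bar>} < K"
proof -
 show 1: "i < n" "A i \<longleftrightarrow> ~ A l" "i ~= l"
  using assms by (auto simp: match_set_def)
 assume T: "finite T" "T \<subseteq> {..<n}"
 have "card {k \<in> T. A k = A i & \<bar>e k - e l\<bar> < \<bar>e i - e l\<bar>} <= card {k. k < n & A k = (~ A l) &
     (\<bar>e k - e l\<bar> < \<bar>e i - e l\<bar> | \<bar>e k - e l\<bar> = \<bar>e i - e l\<bar> & k < i)}"
  using T 1 by (intro card_mono) auto
 also have "... < K" using assms by (simp add: match_set_def)
 finally show "card {k \<in> T. A k = A i & \<bar>e k - e l\<bar> < \<bar>e i - e l\<bar>} < K" .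
qed

text \<open>A match at distance at least \<delta> would have K strictly closer competitors. Unit l
  is removed from the index set so that, given its own data, the count runs over independent
  units.\<close>

lemma match_set_close:
 assumes K: "K <= card {k \<in> {..<n} - {l}. A k = (~ A l) & \<bar>e k - e l\<bar> < \<delta>}"
 shows "card (match_set n K A e l) = K" "i \<in> match_set n K A e l ==> \<bar>e i - e l\<bar> < \<delta>"
proof -
 have "card {k \<in> {..<n} - {l}. A k = (~ A l) & \<bar>e k - e l\<bar> < \<delta>} <= card {k. k < n & A k = (~ A l)}"
  by (intro card_mono) auto
 then show "card (match_set n K A e l) = K"
  using K by (simp add: card_match_set)
 assume i: "i \<in> match_set n K A e l"
 show "\<bar>e i - e l\<bar> < \<delta>"
 proof (rule ccontr)
  assume "~ ?thesis"
  then have "card {k \<in> {..<n} - {l}. A k = (~ A l) & \<bar>e k - e l\<bar> < \<delta>} <=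
   card {k \<in> {..<n}. A k = A i & \<bar>e k - e l\<bar> < \<bar>e i - e l\<bar>}"
   using match_setD(2)[OF i] by (intro card_mono) auto
  also have "... < K" using match_setD(4)[OF i, of "{..<n}"] by simp
  finally show False using K by simp
 qed
qed

lemma match_set_cong:
 assumes "!!k. k < n ==> A k = A' k" "!!k. k < n ==> e k = e' k" "l < n"
 shows "match_set n K A e l = match_set n K A' e' l"
proof -
 have "{k. k < n & A k = (~ A l) & (\<bar>e k - e l\<bar> < \<bar>e j - e l\<bar> | \<bar>e k - e l\<bar> = \<bar>e j - e l\<bar> & k < j)} =
   {k. k < n & A' k = (~ A' l) & (\<bar>e' k - e' l\<bar> < \<bar>e' j - e' l\<bar> | \<bar>e' k - e' l\<bar> = \<bar>e' j - e' l\<bar> & k < j)}"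
  if "j < n" for j
  using assms that by auto
 then show ?thesis unfolding match_set_def using assms by auto
qed

lemma match_count_cong:
 assumes "!!k. k < n ==> A k = A' k" "!!k. k < n ==> e k = e' k"
 shows "match_count n K A e i = match_count n K A' e' i"
 unfolding match_count_def by (intro sum.cong refl) (use match_set_cong[OF assms] in auto)

lemma match_count_le: "match_count n K A e i <= n"
proof -
 have "match_count n K A e i <= (\<Sum>l<n. 1)"
  unfolding match_count_def by (intro sum_mono) auto
 then show ?thesis by simp
qed

text \<open>Double counting of the pairs (l, i) with i matched to l. It moves a sum over matched
  units to a sum over the units that look for matches.\<close>

lemma sum_match_count:
 fixes \<phi> :: "nat => real"
 shows "(\<Sum>i<n. real (match_count n K A e i) * \<phi> i) = (\<Sum>l<n. \<Sum>i\<in>match_set n K A e l. \<phi> i)"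
proof -
 have "(\<Sum>i<n. real (match_count n K A e i) * \<phi> i) = (\<Sum>i<n. \<Sum>l<n. of_bool (i \<in> match_set n K A e l) * \<phi> i)"
  unfolding match_count_def by (simp add: sum_distrib_right)
 also have "... = (\<Sum>l<n. \<Sum>i<n. of_bool (i \<in> match_set n K A e l) * \<phi> i)"
  by (rule sum.swap)
 also have "... = (\<Sum>l<n. \<Sum>i\<in>match_set n K A e l. \<phi> i)"
 proof (rule sum.cong[OF refl])
  fix l
  have "(\<Sum>i\<in>match_set n K A e l. \<phi> i) = (\<Sum>i\<in>match_set n K A e l. of_bool (i \<in> match_set n K A e l) * \<phi> i)"
   by (intro sum.cong) auto
  also have "... = (\<Sum>i<n. of_bool (i \<in> match_set n K A e l) * \<phi> i)"
   by (intro sum.mono_neutral_left) (auto dest: match_setD)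
  finally show "(\<Sum>i<n. of_bool (i \<in> match_set n K A e l) * \<phi> i) = (\<Sum>i\<in>match_set n K A e l. \<phi> i)"
   by (rule sym)
 qed
 finally show ?thesis .
qed

lemma sum_match_count_le: "(\<Sum>i<n. real (match_count n K A e i)) <= real n * real K"
proof -
 have "(\<Sum>i<n. real (match_count n K A e i)) = (\<Sum>l<n. real (card (match_set n K A e l)))"
  using sum_match_count[of n K A e "%_. 1"] by simp
 also have "... <= (\<Sum>l<n. real K)"
  by (intro sum_mono) (simp add: card_match_set_le)
 finally show ?thesis by simp
qed

text \<open>The diagonal of the double sum of indicators is the count itself; the rest counts
  ordered pairs of distinct units sharing the match i.\<close>

lemma match_count_square:
 "(real (match_count n K A e i))^2 = real (match_count n K A e i) +
   (\<Sum>l<n. \<Sum>l'\<in>{..<n} - {l}. of_bool (i \<in> match_set n K A e l & i \<in> match_set n K A e l'))"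
proof -
 have "(real (match_count n K A e i))^2 =
  (\<Sum>l<n. \<Sum>l'<n. of_bool (i \<in> match_set n K A e l & i \<in> match_set n K A e l'))"
  unfolding match_count_def power2_eq_square of_nat_sum of_nat_of_bool sum_product of_bool_conj ..
 also have "... = (\<Sum>l<n. of_bool (i \<in> match_set n K A e l) +
   (\<Sum>l'\<in>{..<n} - {l}. of_bool (i \<in> match_set n K A e l & i \<in> match_set n K A e l')))"
  by (intro sum.cong refl) (subst sum.remove, auto)
 finally show ?thesis by (simp add: sum.distrib match_count_def)
qed

section \<open>Match probabilities in an i.i.d. sample\<close>

locale matching_sample = prob_space Q for Q :: "'z measure" +
 fixes t :: "'z => bool" and e :: "'z => real"
 assumes t_measurable [measurable]: "t \<in> measurable Q (count_space UNIV)"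
  and e_measurable [measurable]: "e \<in> borel_measurable Q"
begin

definition grp :: "bool => real set => real" where
 "grp a S = prob {z \<in> space Q. t z = a & e z \<in> S}"

text \<open>The success probability of the binomial events: the chance that a fresh unit lies in arm
  \<open>a\<close> and is closer to the score y than x is.\<close>

definition ball_mass :: "bool => real => real => real" where
 "ball_mass a x y = grp a {v. \<bar>v - y\<bar> < \<bar>x - y\<bar>}"

text \<open>Population version of the region from which x is picked as a match, with the number of
  closer competitors replaced by their probability mass and the bound K by the level u.\<close>

definition catchment :: "bool => real => real => real" where
 "catchment a x u = prob {w \<in> space Q. t w = (~ a) & ball_mass a x (e w) <= u}"

lemma grp_nonneg [simp]: "0 <= grp a S" and grp_le_1 [simp]: "grp a S <= 1"
 by (simp_all add: grp_def)

lemma ball_mass_nonneg [simp]: "0 <= ball_mass a x y" and ball_mass_le_1 [simp]: "ball_mass a x y <= 1"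
 by (simp_all add: ball_mass_def)

text \<open>Joint measurability in all arguments comes from Fubini, after writing the mass as an
  integral of a jointly measurable indicator.\<close>

lemma ball_mass_measurable [measurable (raw)]:
 assumes [measurable]: "g \<in> borel_measurable M" "k \<in> borel_measurable M" "b \<in> measurable M (count_space UNIV)"
 shows "(%w. ball_mass (b w) (g w) (k w)) \<in> borel_measurable M"
proof -
 interpret sigma_finite_measure Q by unfold_locales
 have "ball_mass (b w) (g w) (k w) =
  enn2real (\<integral>\<^sup>+ v. indicator {v. t v = b w & \<bar>e v - k w\<bar> < \<bar>g w - k w\<bar>} v \<partial>Q)" for w
 proof -
  have "(\<integral>\<^sup>+ v. indicator {v. t v = b w & \<bar>e v - k w\<bar> < \<bar>g w - k w\<bar>} v \<partial>Q) =
    (\<integral>\<^sup>+ v. indicator {v \<in> space Q. t v = b w & \<bar>e v - k w\<bar> < \<bar>g w - k w\<bar>} v \<partial>Q)"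
   by (intro nn_integral_cong) (simp add: indicator_def)
  also have "... = emeasure Q {v \<in> space Q. t v = b w & \<bar>e v - k w\<bar> < \<bar>g w - k w\<bar>}"
   by (intro nn_integral_indicator) measurable
  finally show ?thesis
   by (simp add: ball_mass_def grp_def measure_def)
 qed
 moreover have "(%w. \<integral>\<^sup>+ v. indicator {v. t v = b w & \<bar>e v - k w\<bar> < \<bar>g w - k w\<bar>} v \<partial>Q) \<in> borel_measurable M"
  unfolding indicator_def by measurable
 ultimately show ?thesis by simp
qed

lemma catchment_eq:
 "ennreal (catchment a x u) = (\<integral>\<^sup>+ w. indicator {w. t w = (~ a) & ball_mass a x (e w) <= u} w \<partial>Q)"
proof -
 have "(\<integral>\<^sup>+ w. indicator {w. t w = (~ a) & ball_mass a x (e w) <= u} w \<partial>Q) =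
    (\<integral>\<^sup>+ w. indicator {w \<in> space Q. t w = (~ a) & ball_mass a x (e w) <= u} w \<partial>Q)"
  by (intro nn_integral_cong) (simp add: indicator_def)
 also have "... = emeasure Q {w \<in> space Q. t w = (~ a) & ball_mass a x (e w) <= u}"
  by (intro nn_integral_indicator) measurable
 finally show ?thesis by (simp add: catchment_def emeasure_eq_measure)
qed

lemma catchment_measurable [measurable (raw)]:
 assumes [measurable]: "g \<in> borel_measurable M" "k \<in> borel_measurable M" "b \<in> measurable M (count_space UNIV)"
 shows "(%w. catchment (b w) (g w) (k w)) \<in> borel_measurable M"
proof -
 interpret sigma_finite_measure Q by unfold_locales
 have "catchment (b w) (g w) (k w) =
  enn2real (\<integral>\<^sup>+ v. indicator {v. t v = (~ b w) & ball_mass (b w) (g w) (e v) <= k w} v \<partial>Q)" for w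
  unfolding catchment_eq[symmetric] by (simp add: catchment_def)
 moreover have "(%w. \<integral>\<^sup>+ v. indicator {v. t v = (~ b w) & ball_mass (b w) (g w) (e v) <= k w} v \<partial>Q) \<in> borel_measurable M"
  unfolding indicator_def by measurable
 ultimately show ?thesis by simp
qed

text \<open>The smaller of the two tails belongs to the larger threshold, and u exceeds that
  threshold iff it exceeds both. The integrand is a product of a factor in p and a factor in p',
  although the minimum on the left is not.\<close>

lemma nn_integral_order_density_two:
 fixes p p' :: real
 assumes "1 <= K" "K <= N" "0 <= p" "p <= 1" "0 <= p'" "p' <= 1"
 shows "ennreal (min (binom_tail N K p) (binom_tail N K p')) <=
  (\<integral>\<^sup>+ u. ennreal (order_density N K u) * indicator {0..1} u * (indicator {p..} u * indicator {p'..} u) \<partial>lborel)"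
proof -
 define m where "m = max p p'"
 have "ennreal (min (binom_tail N K p) (binom_tail N K p')) <= ennreal (binom_tail N K m)"
  by (intro ennreal_leI) (auto simp: m_def max_def)
 also have "... = (\<integral>\<^sup>+ u. ennreal (order_density N K u) * indicator {m..1} u \<partial>lborel)"
  using assms by (intro binom_tail_eq_integral[symmetric]) (auto simp: m_def)
 also have "... = (\<integral>\<^sup>+ u. ennreal (order_density N K u) * indicator {0..1} u * (indicator {p..} u * indicator {p'..} u) \<partial>lborel)"
  using assms by (intro nn_integral_cong) (auto simp: m_def indicator_def)
 finally show ?thesis .
qed

text \<open>Given the units i, l and l', each of the two matches forces a binomial event in the
  remaining n - 3 units. The joint probability is at most the smaller of the two, which
  \<open>nn_integral_order_density_two\<close> writes as a mixture over u. For fixed u and i the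
  conditions on l and on l' are independent and equally likely, whence the square.\<close>

lemma joint_match_bound:
 assumes n: "i < n" "l < n" "l' < n" and d: "l ~= i" "l' ~= i" "l ~= l'" and K: "1 <= K" "K <= n - 3"
 shows "(\<integral>\<^sup>+ x. indicator {x. i \<in> match_set n K (%k. t (x k)) (%k. e (x k)) l &
       i \<in> match_set n K (%k. t (x k)) (%k. e (x k)) l'} x \<partial>(\<Pi>\<^sub>M k\<in>{..<n}. Q)) <=
  (\<integral>\<^sup>+ z. (\<integral>\<^sup>+ u. ennreal (order_density (n - 3) K u) * indicator {0..1} u *
       (ennreal (catchment (t z) (e z) u))\<^sup>2 \<partial>lborel) \<partial>Q)"
proof -
 interpret product_sigma_finite "%_. Q" ..
 interpret QL: pair_sigma_finite Q "lborel :: real measure" ..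
 define T where "T = {..<n} - {i, l, l'}"
 have T: "finite T" "i \<notin> T" "l \<notin> T" "l' \<notin> T" "T \<subseteq> {..<n}" by (auto simp: T_def)
 have cT: "card T = n - 3"
  using n d unfolding T_def by (subst card_Diff_subset) auto
 have I: "{..<n} = insert i (insert l (insert l' T))" using n by (auto simp: T_def)
 define cnt where "cnt z w x = card {k \<in> T. t (x k) = t z & \<bar>e (x k) - e w\<bar> < \<bar>e z - e w\<bar>}" for z w and x :: "nat => 'z"
 have cnt_sum: "cnt z w x = (\<Sum>k\<in>T. if t (x k) = t z & \<bar>e (x k) - e w\<bar> < \<bar>e z - e w\<bar> then 1 else 0)" for z w x
  unfolding cnt_def using T by (simp add: sum.If_cases Collect_conj_eq Int_commute)
 \<comment> \<open>\<open>G\<close> relaxes the two matches to conditions on arms and on competitors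
   in \<open>T\<close>, so that the coordinates i, l, l' and those in \<open>T\<close> can be
   integrated out in turn.\<close>
 define G where "G x = (if t (x l) ~= t (x i) & t (x l') ~= t (x i) &
   cnt (x i) (x l) x < K & cnt (x i) (x l') x < K then 1 else 0 :: ennreal)" for x
 have comp: "(%x. x k) \<in> measurable (\<Pi>\<^sub>M k\<in>{..<n}. Q) Q" if "k < n" for k
  using that by (intro measurable_component_singleton) auto
 have comps: "(%x. x i) \<in> measurable (\<Pi>\<^sub>M k\<in>{..<n}. Q) Q" "(%x. x l) \<in> measurable (\<Pi>\<^sub>M k\<in>{..<n}. Q) Q"
  "(%x. x l') \<in> measurable (\<Pi>\<^sub>M k\<in>{..<n}. Q) Q" "!!k. k \<in> T ==> (%x. x k) \<in> measurable (\<Pi>\<^sub>M k\<in>{..<n}. Q) Q"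
  using n T by (auto intro!: comp)
 have G_meas: "G \<in> borel_measurable (\<Pi>\<^sub>M k\<in>{..<n}. Q)"
  unfolding G_def[abs_def] cnt_sum using comps[measurable] by measurable
 have upd: "(%x. x(j := z)) \<in> measurable (\<Pi>\<^sub>M k\<in>J. Q) (\<Pi>\<^sub>M k\<in>insert j J. Q)" if "z \<in> space Q" for j :: nat and z J
  using that by (intro measurable_fun_upd[where J=J]) auto
 define b where "b z w = ball_mass (t z) (e z) (e w)" for z w
 have inner: "(\<integral>\<^sup>+ x. G (((x(l' := w'))(l := w))(i := z)) \<partial>(\<Pi>\<^sub>M k\<in>T. Q)) <=
   (if t w ~= t z & t w' ~= t z then
    (\<integral>\<^sup>+ u. ennreal (order_density (n - 3) K u) * indicator {0..1} u * (indicator {b z w..} u * indicator {b z w'..} u) \<partial>lborel)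
    else 0)" (is "?L <= ?R")
  if z: "z \<in> space Q" and w: "w \<in> space Q" and w': "w' \<in> space Q" for z w w'
 proof (cases "t w ~= t z & t w' ~= t z")
  case True
  \<comment> \<open>Dropping one of the two count conditions leaves a single binomial event;
    applying this to w and to w' bounds the joint event by the minimum.\<close>
  have one: "?L <= ennreal (binom_tail (n - 3) K (b z v))" if v: "v = w | v = w'" "v \<in> space Q" for v
  proof -
   let ?S = "{y \<in> space Q. t y = t z & \<bar>e y - e v\<bar> < \<bar>e z - e v\<bar>}"
   have "?L <= (\<integral>\<^sup>+ x. indicator {x. card {k \<in> T. x k \<in> ?S} < K} x \<partial>(\<Pi>\<^sub>M k\<in>T. Q))"
   proof (rule nn_integral_mono)
    fix x assume x: "x \<in> space (\<Pi>\<^sub>M k\<in>T. Q)"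
    have "cnt z v (((x(l' := w'))(l := w))(i := z)) = card {k \<in> T. x k \<in> ?S}"
     unfolding cnt_def using T x
     by (intro arg_cong[where f=card]) (auto simp: space_PiM PiE_def Pi_def)
    then show "G (((x(l' := w'))(l := w))(i := z)) <= indicator {x. card {k \<in> T. x k \<in> ?S} < K} x"
     unfolding G_def using d v by (auto simp: indicator_def)
   qed
   also have "... = ennreal (binom_tail (card T) K (measure Q ?S))"
    by (intro emeasure_PiM_count_less) (use T prob_space_axioms in auto)
   also have "measure Q ?S = b z v"
    by (simp add: b_def ball_mass_def grp_def)
   finally show ?thesis unfolding cT .
  qed
  have "?L <= ennreal (min (binom_tail (n - 3) K (b z w)) (binom_tail (n - 3) K (b z w')))"
   using one[of w] one[of w'] w w' by (simp add: min_def)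
  also have "... <= (\<integral>\<^sup>+ u. ennreal (order_density (n - 3) K u) * indicator {0..1} u * (indicator {b z w..} u * indicator {b z w'..} u) \<partial>lborel)"
   using K by (intro nn_integral_order_density_two) (auto simp: b_def)
  finally show ?thesis using True by simp
 next
  case False
  have "?L = (\<integral>\<^sup>+ x. 0 \<partial>(\<Pi>\<^sub>M k\<in>T. Q))"
   using False d by (intro nn_integral_cong) (auto simp: G_def)
  then show ?thesis by simp
 qed
 have "(\<integral>\<^sup>+ x. indicator {x. i \<in> match_set n K (%k. t (x k)) (%k. e (x k)) l &
       i \<in> match_set n K (%k. t (x k)) (%k. e (x k)) l'} x \<partial>(\<Pi>\<^sub>M k\<in>{..<n}. Q)) <= (\<integral>\<^sup>+ x. G x \<partial>(\<Pi>\<^sub>M k\<in>{..<n}. Q))"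
 proof (rule nn_integral_mono)
  fix x
  show "indicator {x. i \<in> match_set n K (%k. t (x k)) (%k. e (x k)) l &
       i \<in> match_set n K (%k. t (x k)) (%k. e (x k)) l'} x <= G x"
  proof (cases "i \<in> match_set n K (%k. t (x k)) (%k. e (x k)) l & i \<in> match_set n K (%k. t (x k)) (%k. e (x k)) l'")
   case True
   then have m: "i \<in> match_set n K (%k. t (x k)) (%k. e (x k)) v" if "v = l | v = l'" for v
    using that by blast
   have "t (x i) \<longleftrightarrow> ~ t (x v)" "cnt (x i) (x v) x < K" if v: "v = l | v = l'" for v
    using match_setD(2)[OF m[OF v]] match_setD(4)[OF m[OF v] T(1) T(5)] unfolding cnt_def by simp_all
   from this[of l] this[of l'] have "G x = 1" unfolding G_def by auto
   then show ?thesis using True by (simp add: indicator_def)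
  qed (auto simp: indicator_def)
 qed
 also have "... = (\<integral>\<^sup>+ z. (\<integral>\<^sup>+ x. G (x(i := z)) \<partial>(\<Pi>\<^sub>M k\<in>insert l (insert l' T). Q)) \<partial>Q)"
  using G_meas T d unfolding I by (intro product_nn_integral_insert_rev) auto
 also have "... = (\<integral>\<^sup>+ z. (\<integral>\<^sup>+ w. (\<integral>\<^sup>+ x. G ((x(l := w))(i := z)) \<partial>(\<Pi>\<^sub>M k\<in>insert l' T. Q)) \<partial>Q) \<partial>Q)"
 proof (rule nn_integral_cong)
  fix z assume z: "z \<in> space Q"
  show "(\<integral>\<^sup>+ x. G (x(i := z)) \<partial>(\<Pi>\<^sub>M k\<in>insert l (insert l' T). Q)) =
   (\<integral>\<^sup>+ w. (\<integral>\<^sup>+ x. G ((x(l := w))(i := z)) \<partial>(\<Pi>\<^sub>M k\<in>insert l' T. Q)) \<partial>Q)"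
   using measurable_compose[OF upd[OF z] G_meas[unfolded I]] T d
   by (intro product_nn_integral_insert_rev) auto
 qed
 also have "... = (\<integral>\<^sup>+ z. (\<integral>\<^sup>+ w. (\<integral>\<^sup>+ w'. (\<integral>\<^sup>+ x. G (((x(l' := w'))(l := w))(i := z)) \<partial>(\<Pi>\<^sub>M k\<in>T. Q)) \<partial>Q) \<partial>Q) \<partial>Q)"
 proof (intro nn_integral_cong)
  fix z w assume z: "z \<in> space Q" and w: "w \<in> space Q"
  show "(\<integral>\<^sup>+ x. G ((x(l := w))(i := z)) \<partial>(\<Pi>\<^sub>M k\<in>insert l' T. Q)) =
   (\<integral>\<^sup>+ w'. (\<integral>\<^sup>+ x. G (((x(l' := w'))(l := w))(i := z)) \<partial>(\<Pi>\<^sub>M k\<in>T. Q)) \<partial>Q)"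
   using measurable_compose[OF upd[OF w] measurable_compose[OF upd[OF z] G_meas[unfolded I]]] T d
   by (intro product_nn_integral_insert_rev) auto
 qed
 also have "... <= (\<integral>\<^sup>+ z. (\<integral>\<^sup>+ w. (\<integral>\<^sup>+ w'. (if t w ~= t z & t w' ~= t z then
    (\<integral>\<^sup>+ u. ennreal (order_density (n - 3) K u) * indicator {0..1} u * (indicator {b z w..} u * indicator {b z w'..} u) \<partial>lborel)
    else 0) \<partial>Q) \<partial>Q) \<partial>Q)"
  by (intro nn_integral_mono inner)
 also have "... = (\<integral>\<^sup>+ z. (\<integral>\<^sup>+ u. ennreal (order_density (n - 3) K u) * indicator {0..1} u *
       (ennreal (catchment (t z) (e z) u))\<^sup>2 \<partial>lborel) \<partial>Q)"
 proof (rule nn_integral_cong)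
  fix z assume z: "z \<in> space Q"
  define H where "H w u = (indicator {w. t w = (~ t z) & ball_mass (t z) (e z) (e w) <= u} w :: ennreal)" for w u
  have H_meas [measurable]: "(%(w, u). H w u) \<in> borel_measurable (Q \<Otimes>\<^sub>M lborel)"
   unfolding H_def indicator_def by measurable
  have H_meas' [measurable]: "H w \<in> borel_measurable borel" for w
   unfolding H_def indicator_def by measurable
  have H_meas'' [measurable]: "(%w. H w u) \<in> borel_measurable Q" for u
   unfolding H_def indicator_def by measurable
  define \<beta> where "\<beta> u = (ennreal (order_density (n - 3) K u) * indicator {0..1} u)" for u
  have [measurable]: "\<beta> \<in> borel_measurable borel" unfolding \<beta>_def[abs_def] by measurable
  have Hc: "(\<integral>\<^sup>+ w. H w u \<partial>Q) = ennreal (catchment (t z) (e z) u)" for u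
   unfolding H_def by (rule catchment_eq[symmetric])
  have "(\<integral>\<^sup>+ w. (\<integral>\<^sup>+ w'. (if t w ~= t z & t w' ~= t z then
    (\<integral>\<^sup>+ u. ennreal (order_density (n - 3) K u) * indicator {0..1} u * (indicator {b z w..} u * indicator {b z w'..} u) \<partial>lborel)
    else 0) \<partial>Q) \<partial>Q) = (\<integral>\<^sup>+ w. (\<integral>\<^sup>+ w'. (\<integral>\<^sup>+ u. \<beta> u * (H w u * H w' u) \<partial>lborel) \<partial>Q) \<partial>Q)"
   by (intro nn_integral_cong) (auto simp: H_def \<beta>_def b_def indicator_def intro!: nn_integral_cong)
  also have "... = (\<integral>\<^sup>+ w. (\<integral>\<^sup>+ u. (\<integral>\<^sup>+ w'. \<beta> u * (H w u * H w' u) \<partial>Q) \<partial>lborel) \<partial>Q)"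
   \<comment> \<open>Exchanging the integrals over the matched units with the one over u lets the
     two catchment conditions be integrated separately at each level u.\<close>
   by (intro nn_integral_cong QL.Fubini'[symmetric]) measurable
  also have "... = (\<integral>\<^sup>+ w. (\<integral>\<^sup>+ u. \<beta> u * ennreal (catchment (t z) (e z) u) * H w u \<partial>lborel) \<partial>Q)"
  proof (intro nn_integral_cong)
   fix w u
   have "(\<integral>\<^sup>+ w'. \<beta> u * (H w u * H w' u) \<partial>Q) = (\<integral>\<^sup>+ w'. \<beta> u * H w u * H w' u \<partial>Q)"
    by (simp only: mult.assoc)
   also have "... = \<beta> u * H w u * ennreal (catchment (t z) (e z) u)"
    by (subst nn_integral_cmult) (auto simp: Hc)
   finally show "(\<integral>\<^sup>+ w'. \<beta> u * (H w u * H w' u) \<partial>Q) = \<beta> u * ennreal (catchment (t z) (e z) u) * H w u"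
    by (simp only: mult_ac)
  qed
  also have "... = (\<integral>\<^sup>+ u. (\<integral>\<^sup>+ w. \<beta> u * ennreal (catchment (t z) (e z) u) * H w u \<partial>Q) \<partial>lborel)"
   by (intro QL.Fubini'[symmetric]) measurable
  also have "... = (\<integral>\<^sup>+ u. \<beta> u * (ennreal (catchment (t z) (e z) u))^2 \<partial>lborel)"
   by (intro nn_integral_cong) (simp add: nn_integral_cmult Hc power2_eq_square mult.assoc)
  finally show "(\<integral>\<^sup>+ w. (\<integral>\<^sup>+ w'. (if t w ~= t z & t w' ~= t z then
    (\<integral>\<^sup>+ u. ennreal (order_density (n - 3) K u) * indicator {0..1} u * (indicator {b z w..} u * indicator {b z w'..} u) \<partial>lborel)
    else 0) \<partial>Q) \<partial>Q) = (\<integral>\<^sup>+ u. ennreal (order_density (n - 3) K u) * indicator {0..1} u *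
       (ennreal (catchment (t z) (e z) u))\<^sup>2 \<partial>lborel)"
   by (simp add: \<beta>_def)
 qed
 finally show ?thesis .
qed

text \<open>Conditionally on unit l, the number of opposite units within \<delta> of it is binomial
  with n - 1 trials.\<close>

lemma few_neighbours_bound:
 assumes l: "l < n" and K: "1 <= K" "K <= n - 1"
 shows "(\<integral>\<^sup>+ x. indicator {x. card {k \<in> {..<n} - {l}. t (x k) = (~ t (x l)) & \<bar>e (x k) - e (x l)\<bar> < \<delta>} < K} x \<partial>(\<Pi>\<^sub>M k\<in>{..<n}. Q)) =
  (\<integral>\<^sup>+ z. ennreal (binom_tail (n - 1) K (grp (~ t z) {v. \<bar>v - e z\<bar> < \<delta>})) \<partial>Q)"
proof -
 interpret product_sigma_finite "%_. Q" ..
 define T where "T = {..<n} - {l}"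
 have T: "finite T" "l \<notin> T" "card T = n - 1" "T \<subseteq> {..<n}" and I: "{..<n} = insert l T" using l by (auto simp: T_def)
 have comps: "(%x. x l) \<in> measurable (\<Pi>\<^sub>M k\<in>{..<n}. Q) Q" "!!k. k \<in> T ==> (%x. x k) \<in> measurable (\<Pi>\<^sub>M k\<in>{..<n}. Q) Q"
  using l T by (auto intro!: measurable_component_singleton)
 have eq: "card {k \<in> T. t (x k) = (~ t (x l)) & \<bar>e (x k) - e (x l)\<bar> < \<delta>} =
  (\<Sum>k\<in>T. if t (x k) = (~ t (x l)) & \<bar>e (x k) - e (x l)\<bar> < \<delta> then 1 else 0)" for x
  using T by (simp add: sum.If_cases Collect_conj_eq Int_commute)
 have m: "(%x. indicator {x. card {k \<in> T. t (x k) = (~ t (x l)) & \<bar>e (x k) - e (x l)\<bar> < \<delta>} < K} x :: ennreal)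
    \<in> borel_measurable (\<Pi>\<^sub>M k\<in>{..<n}. Q)"
  unfolding indicator_def mem_Collect_eq eq using comps[measurable] by measurable
 have "(\<integral>\<^sup>+ x. indicator {x. card {k \<in> T. t (x k) = (~ t (x l)) & \<bar>e (x k) - e (x l)\<bar> < \<delta>} < K} x \<partial>(\<Pi>\<^sub>M k\<in>insert l T. Q)) =
  (\<integral>\<^sup>+ z. (\<integral>\<^sup>+ x. indicator {x. card {k \<in> T. t (x k) = (~ t (x l)) & \<bar>e (x k) - e (x l)\<bar> < \<delta>} < K} (x(l := z)) \<partial>(\<Pi>\<^sub>M k\<in>T. Q)) \<partial>Q)"
  using T m unfolding I by (intro product_nn_integral_insert_rev) auto
 also have "... = (\<integral>\<^sup>+ z. ennreal (binom_tail (n - 1) K (grp (~ t z) {v. \<bar>v - e z\<bar> < \<delta>})) \<partial>Q)"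
 proof (rule nn_integral_cong)
  fix z
  let ?S = "{y \<in> space Q. t y = (~ t z) & e y \<in> {v. \<bar>v - e z\<bar> < \<delta>}}"
  have "(\<integral>\<^sup>+ x. indicator {x. card {k \<in> T. t (x k) = (~ t (x l)) & \<bar>e (x k) - e (x l)\<bar> < \<delta>} < K} (x(l := z)) \<partial>(\<Pi>\<^sub>M k\<in>T. Q)) =
   (\<integral>\<^sup>+ x. indicator {x. card {k \<in> T. x k \<in> ?S} < K} x \<partial>(\<Pi>\<^sub>M k\<in>T. Q))"
  proof (rule nn_integral_cong)
   fix x assume x: "x \<in> space (\<Pi>\<^sub>M k\<in>T. Q)"
   have "{k \<in> T. t ((x(l := z)) k) = (~ t ((x(l := z)) l)) & \<bar>e ((x(l := z)) k) - e ((x(l := z)) l)\<bar> < \<delta>} = {k \<in> T. x k \<in> ?S}"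
    using T x by (auto simp: space_PiM PiE_def Pi_def)
   then show "indicator {x. card {k \<in> T. t (x k) = (~ t (x l)) & \<bar>e (x k) - e (x l)\<bar> < \<delta>} < K} (x(l := z)) =
     (indicator {x. card {k \<in> T. x k \<in> ?S} < K} x :: ennreal)"
    by (simp add: indicator_def)
  qed
  also have "... = ennreal (binom_tail (card T) K (measure Q ?S))"
   by (intro emeasure_PiM_count_less) (use T prob_space_axioms in auto)
  finally show "(\<integral>\<^sup>+ x. indicator {x. card {k \<in> T. t (x k) = (~ t (x l)) & \<bar>e (x k) - e (x l)\<bar> < \<delta>} < K} (x(l := z)) \<partial>(\<Pi>\<^sub>M k\<in>T. Q)) =
   ennreal (binom_tail (n - 1) K (grp (~ t z) {v. \<bar>v - e z\<bar> < \<delta>}))"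
   by (simp add: grp_def T)
 qed
 finally show ?thesis unfolding T_def[symmetric] I[symmetric] .
qed

end

section \<open>Mass of catchment areas\<close>

text \<open>\<open>{x<..<2 * y - x}\<close> is the open ball around y that has x on its boundary,
  and it contains \<open>{x<..y}\<close> when x < y. With s the supremum of the admissible y, the
  interval (x, s) is an increasing union of sets contained in admissible balls, so its mass is at
  most u; the end points carry no mass. An unbounded set of admissible y is exhausted in the same
  way.\<close>

lemma atomless_initial_segment:
 fixes M :: "real measure"
 assumes "finite_measure M" and S [measurable_cong, simp]: "sets M = sets borel"
  and atom: "!!x. measure M {x} = 0" and u: "0 <= u"
  and E: "{y. x <= y & measure M {x<..<2 * y - x} <= u} \<in> sets borel"
 shows "measure M {y. x <= y & measure M {x<..<2 * y - x} <= u} <= u"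
proof -
 interpret finite_measure M by fact
 let ?E = "{y. x <= y & measure M {x<..<2 * y - x} <= u}"
 have xE: "x \<in> ?E" using u by simp
 have *: "measure M (\<Union>n. A n) <= u"
  if A: "incseq A" "!!n::nat. A n \<in> sets borel" "!!n. \<exists>y\<in>?E. A n \<subseteq> {x<..<2 * y - x}" for A
 proof (rule LIMSEQ_le_const2)
  show "(%n. measure M (A n)) \<longlonglongrightarrow> measure M (\<Union>n. A n)"
   using A by (intro finite_Lim_measure_incseq) auto
  show "\<exists>N. \<forall>n\<ge>N. measure M (A n) <= u"
  proof (intro exI allI impI)
   fix n
   obtain y where "y \<in> ?E" "A n \<subseteq> {x<..<2 * y - x}" using A(3) by blast
   then show "measure M (A n) <= u"
    using finite_measure_mono[of "A n" "{x<..<2 * y - x}"] by simp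
  qed
 qed
 show ?thesis
 proof (cases "bdd_above ?E")
  case True
  define s where "s = Sup ?E"
  have "x <= s" unfolding s_def using True xE by (intro cSup_upper) auto
  define A where "A n = {x<..s - 1 / real (Suc n)}" for n
  have "(\<Union>n. A n) = {x<..<s}"
  proof (intro equalityI subsetI)
   fix v assume "v \<in> {x<..<s}"
   then obtain n where "1 / real (Suc n) < s - v" "x < v"
    using nat_approx_posE[of "s - v"] by auto
   then show "v \<in> (\<Union>n. A n)" by (auto simp: A_def intro!: exI[of _ n])
  next
   fix v assume "v \<in> (\<Union>n. A n)"
   then obtain n where n: "x < v" "v <= s - 1 / real (Suc n)" by (auto simp: A_def)
   moreover have "0 < 1 / real (Suc n)" by simp
   ultimately show "v \<in> {x<..<s}" by (auto simp only: greaterThanLessThan_iff)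
  qed
  moreover have "measure M (\<Union>n. A n) <= u"
  proof (rule *)
   show "incseq A"
   proof (rule incseq_SucI)
    fix n
    have "1 / real (Suc (Suc n)) <= 1 / real (Suc n)" by (simp add: frac_le)
    then show "A n <= A (Suc n)" unfolding A_def by (auto simp del: of_nat_Suc)
   qed
   show "A n \<in> sets borel" for n by (simp add: A_def)
   show "\<exists>y\<in>?E. A n \<subseteq> {x<..<2 * y - x}" for n
   proof (cases "A n = {}")
    case True
    then show ?thesis using xE by blast
   next
    case False
    have "s - 1 / real (Suc n) < Sup ?E" by (simp add: s_def)
    then obtain y where y: "y \<in> ?E" "s - 1 / real (Suc n) < y"
     using less_cSup_iff[of ?E] True xE by blast
    then have "A n \<subseteq> {x<..<2 * y - x}"
     by (auto simp: A_def)
    then show ?thesis using y by blast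
   qed
  qed
  ultimately have "measure M {x<..<s} <= u" by simp
  moreover have "measure M ?E <= measure M ({x} \<union> {x<..<s} \<union> {s})"
  proof (intro finite_measure_mono)
   show "?E \<subseteq> {x} \<union> {x<..<s} \<union> {s}"
   proof
    fix v assume v: "v \<in> ?E"
    then have "v <= s" unfolding s_def using True by (intro cSup_upper) auto
    then show "v \<in> {x} \<union> {x<..<s} \<union> {s}" using v by auto
   qed
  qed simp
  moreover have "measure M ({x} \<union> {x<..<s} \<union> {s}) <= measure M {x} + measure M {x<..<s} + measure M {s}"
   by (intro order_trans[OF measure_Un_le] add_right_mono measure_Un_le) auto
  ultimately show ?thesis using atom by simp
 next
  case False
  define A where "A n = {x<..x + real n}" for n :: nat
  have "(\<Union>n. A n) = {x<..}"
  proof (intro equalityI subsetI)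
   fix v assume v: "v \<in> {x<..}"
   obtain n where "v - x <= real n" using real_arch_simple by blast
   then show "v \<in> (\<Union>n. A n)" using v by (auto simp: A_def intro!: exI[of _ n])
  qed (auto simp: A_def)
  moreover have "measure M (\<Union>n. A n) <= u"
  proof (rule *)
   show "incseq A" unfolding A_def by (intro incseq_SucI) auto
   show "A n \<in> sets borel" for n by (simp add: A_def)
   show "\<exists>y\<in>?E. A n \<subseteq> {x<..<2 * y - x}" for n
   proof -
    obtain y where "y \<in> ?E" "x + real n < y"
     using False unfolding bdd_above_def by (meson not_le)
    then show ?thesis by (intro bexI[of _ y]) (auto simp: A_def)
   qed
  qed
  ultimately have "measure M {x<..} <= u" by simp
  moreover have "measure M ?E <= measure M ({x} \<union> {x<..})"
   by (intro finite_measure_mono) auto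
  moreover have "measure M ({x} \<union> {x<..}) <= measure M {x} + measure M {x<..}"
   by (intro measure_Un_le) auto
  ultimately show ?thesis using atom by simp
 qed
qed

text \<open>The \<open>propensity\<close> assumption says that the score is its own treatment
  probability. With the density \<open>f\<close> of the score, arm \<open>a\<close> then has density
  \<open>f x * pr a x\<close>, and both arms have comparable mass by overlap.\<close>

locale matching_population = matching_sample +
 fixes c :: real and f :: "real => real" and lo hi :: real
 assumes c_pos: "0 < c" and c_half: "c <= 1 / 2"
  and e_bounds: "AE z in Q. c <= e z & e z <= 1 - c"
  and propensity: "!!S. S \<in> sets borel ==> measure Q {z \<in> space Q. t z & e z \<in> S} = (LINT z|Q. e z * indicator S (e z))"
  and f_density: "distributed Q lborel e (%x. ennreal (f x))"
  and f_nonneg: "!!x. 0 <= f x" and f_outside: "!!x. x \<notin> {lo..hi} ==> f x = 0"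
  and f_cont: "continuous_on {lo..hi} f"
begin

definition pr :: "bool => real => real" where
 "pr a x = (if a then x else 1 - x)"

text \<open>The limit of M / K for a unit of arm \<open>a\<close>: the odds of the opposite arm at
  score x. Clipping to [c, 1 - c] makes the function bounded and Lipschitz everywhere and changes it
  only on a null set of scores.\<close>

definition odds :: "bool => real => real" where
 "odds a x = 1 / pr a (max c (min (1 - c) x)) - 1"

lemma pr_measurable [measurable (raw)]:
 assumes [measurable]: "b \<in> measurable M (count_space UNIV)" "g \<in> borel_measurable M"
 shows "(%w. pr (b w) (g w)) \<in> borel_measurable M"
 unfolding pr_def by measurable

lemma odds_measurable [measurable (raw)]:
 assumes [measurable]: "b \<in> measurable M (count_space UNIV)" "g \<in> borel_measurable M"
 shows "(%w. odds (b w) (g w)) \<in> borel_measurable M"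
 unfolding odds_def by measurable

lemma clip_bounds: "c <= pr a (max c (min (1 - c) x))" "pr a (max c (min (1 - c) x)) <= 1 - c"
 using c_half by (auto simp: pr_def)

lemma odds_eq: "c <= x ==> x <= 1 - c ==> odds a x = pr (~ a) x / pr a x"
 using c_pos by (auto simp: odds_def pr_def min_def max_def field_simps)

lemma odds_nonneg: "0 <= odds a x" and odds_le: "odds a x <= 1 / c"
proof -
 have "1 <= 1 / pr a (max c (min (1 - c) x))" "1 / pr a (max c (min (1 - c) x)) <= 1 / c"
  using clip_bounds[of a x] c_pos by (auto simp: field_simps)
 then show "0 <= odds a x" "odds a x <= 1 / c" by (auto simp: odds_def)
qed

lemma odds_lipschitz: "\<bar>odds a x - odds a y\<bar> <= \<bar>x - y\<bar> / c\<^sup>2"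
proof -
 define p q where "p = pr a (max c (min (1 - c) x))" and "q = pr a (max c (min (1 - c) y))"
 have pq: "c <= p" "c <= q" using clip_bounds by (auto simp: p_def q_def)
 have d: "\<bar>q - p\<bar> <= \<bar>x - y\<bar>" by (auto simp: p_def q_def pr_def)
 have "odds a x - odds a y = (q - p) / (p * q)"
  unfolding odds_def p_def[symmetric] q_def[symmetric] using pq c_pos by (simp add: field_simps)
 then have "\<bar>odds a x - odds a y\<bar> = \<bar>q - p\<bar> / (p * q)"
  using pq c_pos by (simp add: abs_mult)
 also have "... <= \<bar>x - y\<bar> / c\<^sup>2"
  using pq c_pos d by (intro frac_le) (auto simp: power2_eq_square intro: mult_mono)
 finally show ?thesis .
qed

lemma grp_eq_integral:
 assumes [measurable]: "S \<in> sets borel"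
 shows "grp a S = (LINT z|Q. pr a (e z) * indicator S (e z))"
  and "integrable Q (%z. pr a (e z) * indicator S (e z))"
proof -
 have int: "integrable Q (%z. pr a (e z) * indicator S (e z))" for a
 proof (rule integrable_const_bound[where B=1])
  show "AE z in Q. norm (pr a (e z) * indicator S (e z)) <= 1"
   using e_bounds by eventually_elim (use c_pos in \<open>auto simp: pr_def indicator_def\<close>)
 qed measurable
 then show "integrable Q (%z. pr a (e z) * indicator S (e z))" .
 have T: "grp True S = (LINT z|Q. pr True (e z) * indicator S (e z))"
  using propensity[OF assms] by (simp add: grp_def pr_def)
 have "prob {z \<in> space Q. e z \<in> S} = prob ({z \<in> space Q. t z = True & e z \<in> S} \<union> {z \<in> space Q. t z = False & e z \<in> S})"
  by (intro arg_cong[where f=prob]) auto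
 also have "... = grp True S + grp False S"
  unfolding grp_def by (intro finite_measure_Union) auto
 finally have "grp False S = prob {z \<in> space Q. e z \<in> S} - grp True S" by simp
 also have "prob {z \<in> space Q. e z \<in> S} = (LINT z|Q. indicator {z \<in> space Q. e z \<in> S} z)"
  by simp
 also have "... = (LINT z|Q. pr True (e z) * indicator S (e z) + pr False (e z) * indicator S (e z))"
  by (intro Bochner_Integration.integral_cong) (auto simp: pr_def indicator_def)
 also have "... = grp True S + (LINT z|Q. pr False (e z) * indicator S (e z))"
  using int by (simp add: T)
 finally show "grp a S = (LINT z|Q. pr a (e z) * indicator S (e z))"
  using T by (cases a) auto
qed

text \<open>By overlap \<open>pr (~ a)\<close> is at most 1 and \<open>pr a\<close> at least c
  wherever the score lives.\<close>

lemma grp_compare: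
 assumes [measurable]: "S \<in> sets borel"
 shows "grp (~ a) S <= 1 / c * grp a S"
proof -
 have "grp (~ a) S <= (LINT z|Q. 1 / c * (pr a (e z) * indicator S (e z)))"
  unfolding grp_eq_integral[OF assms]
 proof (rule integral_mono_AE)
  show "AE z in Q. pr (~ a) (e z) * indicator S (e z) <= 1 / c * (pr a (e z) * indicator S (e z))"
   using e_bounds
  proof eventually_elim
   case (elim z)
   then have "pr (~ a) (e z) <= 1" "c <= pr a (e z)" using c_pos by (auto simp: pr_def)
   then have "c * pr (~ a) (e z) <= pr a (e z)"
    using mult_left_mono[of "pr (~ a) (e z)" 1 c] c_pos by linarith
   then show ?case using c_pos by (auto simp: indicator_def field_simps)
  qed
 qed (use grp_eq_integral(2)[OF assms] in auto)
 then show ?thesis by (simp add: grp_eq_integral)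
qed

lemma grp_eq_nn_integral:
 assumes [measurable]: "S \<in> sets borel"
 shows "ennreal (grp a S) = (\<integral>\<^sup>+ x. ennreal (f x * pr a x) * indicator S x \<partial>lborel)"
proof -
 have "ennreal (grp a S) = (\<integral>\<^sup>+ z. ennreal (pr a (e z) * indicator S (e z)) \<partial>Q)"
  unfolding grp_eq_integral(1)[OF assms]
 proof (rule nn_integral_eq_integral[symmetric])
  show "AE z in Q. 0 <= pr a (e z) * indicator S (e z)"
   using e_bounds by eventually_elim (use c_pos in \<open>auto simp: pr_def\<close>)
 qed (rule grp_eq_integral(2)[OF assms])
 also have "... = (\<integral>\<^sup>+ x. ennreal (f x) * ennreal (pr a x * indicator S x) \<partial>lborel)"
  by (intro distributed_nn_integral[OF f_density, symmetric]) measurable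
 also have "... = (\<integral>\<^sup>+ x. ennreal (f x * pr a x) * indicator S x \<partial>lborel)"
  by (intro nn_integral_cong) (simp add: ennreal_mult'[OF f_nonneg] indicator_def)
 finally show ?thesis .
qed

lemma grp_atomless: "grp a {x} = 0"
proof -
 have "ennreal (grp a {x}) = (\<integral>\<^sup>+ x. 0 \<partial>(lborel :: real measure))"
  unfolding grp_eq_nn_integral[OF borel_singleton[OF sets.empty_sets, of x]]
  by (intro nn_integral_cong_AE AE_I[where N="{x}"]) (auto simp: indicator_def)
 then show ?thesis by simp
qed

lemma grp_mono: "S \<subseteq> S' ==> S' \<in> sets borel ==> grp a S <= grp a S'"
 unfolding grp_def by (intro finite_measure_mono) (auto, measurable)

lemma grp_subadditive: "S \<in> sets borel ==> S' \<in> sets borel ==> grp a (S \<union> S') <= grp a S + grp a S'"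
proof -
 assume [measurable]: "S \<in> sets borel" "S' \<in> sets borel"
 have "{z \<in> space Q. t z = a & e z \<in> S \<union> S'} = {z \<in> space Q. t z = a & e z \<in> S} \<union> {z \<in> space Q. t z = a & e z \<in> S'}"
  by auto
 then show ?thesis unfolding grp_def by (simp add: measure_Un_le)
qed

lemma catchment_eq_grp: "catchment a x u = grp (~ a) {y. ball_mass a x y <= u}"
 by (simp add: catchment_def grp_def)

lemma sublevel_borel [measurable]: "{y. ball_mass a x y <= u} \<in> sets borel"
 by measurable

text \<open>Pushing the arm forward to the line reduces the claim to
  \<open>atomless_initial_segment\<close>, since for y >= x the ball through x is
  \<open>{x<..<2 * y - x}\<close>.\<close>

lemma grp_right_le:
 assumes "0 <= u"
 shows "grp a {y. x <= y & ball_mass a x y <= u} <= u"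
proof -
 define M where "M = distr (density Q (indicator {z. t z = a})) borel e"
 have M: "measure M S = grp a S" if [measurable]: "S \<in> sets borel" for S
 proof -
  have "emeasure M S = (\<integral>\<^sup>+ z. indicator {z. t z = a} z * indicator (e -` S \<inter> space Q) z \<partial>Q)"
   unfolding M_def by (subst emeasure_distr) (auto simp: emeasure_density)
  also have "... = (\<integral>\<^sup>+ z. indicator {z \<in> space Q. t z = a & e z \<in> S} z \<partial>Q)"
   by (intro nn_integral_cong) (auto simp: indicator_def)
  finally show ?thesis by (simp add: measure_def grp_def)
 qed
 interpret M: finite_measure M
 proof
  have "emeasure M (space M) = (\<integral>\<^sup>+ z. indicator {z. t z = a} z * indicator (space Q) z \<partial>Q)"
   unfolding M_def by (subst emeasure_distr) (auto simp: emeasure_density)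
  also have "... <= (\<integral>\<^sup>+ z. 1 \<partial>Q)" by (intro nn_integral_mono) (auto simp: indicator_def)
  finally show "emeasure M (space M) ~= \<infinity>" by (auto simp: emeasure_space_1 top_unique)
 qed
 have b: "ball_mass a x y = measure M {x<..<2 * y - x}" if "x <= y" for y
  unfolding ball_mass_def using that by (subst M) (auto intro!: arg_cong[where f="grp a"])
 have eq: "{y. x <= y & ball_mass a x y <= u} = {y. x <= y & measure M {x<..<2 * y - x} <= u}"
  using b by auto
 have m [measurable]: "{y. x <= y & ball_mass a x y <= u} \<in> sets borel" by measurable
 have "measure M {y. x <= y & measure M {x<..<2 * y - x} <= u} <= u"
  by (rule atomless_initial_segment[OF M.finite_measure_axioms _ _ assms])
   (simp add: M_def, simp add: M grp_atomless, simp add: eq[symmetric])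
 then show ?thesis unfolding eq[symmetric] by (subst (asm) M) auto
qed

text \<open>Reflection of the line turns balls to the left of x into balls to the right of
  -x.\<close>

lemma grp_left_le:
 assumes "0 <= u"
 shows "grp a {y. y <= x & ball_mass a x y <= u} <= u"
proof -
 define M where "M = distr (density Q (indicator {z. t z = a})) borel (%z. - e z)"
 have M: "measure M S = grp a (uminus -` S)" if [measurable]: "S \<in> sets borel" for S
 proof -
  have "emeasure M S = (\<integral>\<^sup>+ z. indicator {z. t z = a} z * indicator ((%z. - e z) -` S \<inter> space Q) z \<partial>Q)"
   unfolding M_def by (subst emeasure_distr) (auto simp: emeasure_density)
  also have "... = (\<integral>\<^sup>+ z. indicator {z \<in> space Q. t z = a & - e z \<in> S} z \<partial>Q)"
   by (intro nn_integral_cong) (auto simp: indicator_def)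
  finally show ?thesis by (simp add: measure_def grp_def)
 qed
 interpret M: finite_measure M
 proof
  have "emeasure M (space M) = (\<integral>\<^sup>+ z. indicator {z. t z = a} z * indicator (space Q) z \<partial>Q)"
   unfolding M_def by (subst emeasure_distr) (auto simp: emeasure_density)
  also have "... <= (\<integral>\<^sup>+ z. 1 \<partial>Q)" by (intro nn_integral_mono) (auto simp: indicator_def)
  finally show "emeasure M (space M) ~= \<infinity>" by (auto simp: emeasure_space_1 top_unique)
 qed
 have b: "ball_mass a x y = measure M {- x<..<2 * (- y) - (- x)}" if "y <= x" for y
  unfolding ball_mass_def using that by (subst M) (auto intro!: arg_cong[where f="grp a"])
 have eq: "{y. - x <= y & measure M {- x<..<2 * y - (- x)} <= u} = uminus -` {y. y <= x & ball_mass a x y <= u}"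
  using b[of "- y" for y] by fastforce
 have [measurable]: "{y. y <= x & ball_mass a x y <= u} \<in> sets borel" by measurable
 have [measurable]: "uminus -` {y. y <= x & ball_mass a x y <= u} \<in> sets borel"
  using measurable_sets[OF borel_measurable_uminus[OF measurable_ident] \<open>{y. y <= x & ball_mass a x y <= u} \<in> sets borel\<close>] by simp
 have un: "uminus -` uminus -` S = S" for S :: "real set" by (auto simp: vimage_def)
 have at: "measure M {v} = 0" for v
 proof -
  have "uminus -` {v} = {- v}" by auto
  then show ?thesis by (subst M) (auto simp: grp_atomless)
 qed
 have "measure M {y. - x <= y & measure M {- x<..<2 * y - (- x)} <= u} <= u"
  by (rule atomless_initial_segment[OF M.finite_measure_axioms _ at assms]) (simp add: M_def, simp only: eq, fact)
 then show ?thesis unfolding eq by (subst (asm) M) (auto simp: un)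
qed

text \<open>The factor 2 counts the two sides of x, and 1 / c transfers the mass from arm
  \<open>a\<close> to the opposite arm. The bound is crude but holds for every u and serves as the
  dominating bound.\<close>

lemma catchment_le:
 assumes "0 <= u"
 shows "catchment a x u <= 2 / c * u"
proof -
 have [measurable]: "{y. x <= y & ball_mass a x y <= u} \<in> sets borel" "{y. y <= x & ball_mass a x y <= u} \<in> sets borel"
  by measurable
 have "grp a {y. ball_mass a x y <= u} <= grp a ({y. x <= y & ball_mass a x y <= u} \<union> {y. y <= x & ball_mass a x y <= u})"
  by (intro grp_mono) auto
 also have "... <= grp a {y. x <= y & ball_mass a x y <= u} + grp a {y. y <= x & ball_mass a x y <= u}"
  by (intro grp_subadditive) measurable
 also have "... <= u + u"
  by (intro add_mono grp_right_le grp_left_le assms)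
 finally have "1 / c * grp a {y. ball_mass a x y <= u} <= 1 / c * (2 * u)"
  using c_pos by (intro mult_left_mono) auto
 then show ?thesis
  unfolding catchment_eq_grp using grp_compare[OF sublevel_borel, of a a x u] by simp
qed

text \<open>Near x both arms have almost constant densities. A ball around y through x has mass
  about 2 |y - x| times the density of arm \<open>a\<close>, so the catchment at level u is about an
  interval of length u divided by that density. Its mass in the other arm is u times the ratio of
  the densities, which is the odds.\<close>

lemma catchment_local:
 assumes x: "lo < x" "x < hi" "0 < f x" "c <= x" "x <= 1 - c" and \<eta>: "0 < \<eta>"
 obtains u0 where "0 < u0" "!!u. 0 <= u ==> u <= u0 ==> catchment a x u <= (odds a x + \<eta>) * u"
proof -
 define w where "w a y = f y * pr a y" for a y
 have w_pos: "0 < w a x" for a using x c_pos by (auto simp: w_def pr_def)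
 have "isCont f x"
  using f_cont x by (metis at_within_Icc_at continuous_on_eq_continuous_within atLeastAtMost_iff less_imp_le)
 then have w_cont: "isCont (w a) x" for a
  unfolding w_def[abs_def] pr_def by (cases a) (auto intro!: continuous_intros)
 \<comment> \<open>Chooses a tolerance k for the two densities such that the ratio of their
   perturbed values still exceeds the odds by less than \<eta>.\<close>
 have "((%k. (w (~ a) x + k) / (w a x - k)) \<longlongrightarrow> (w (~ a) x + 0) / (w a x - 0)) (at_right 0)"
  using w_pos[of a] by (intro tendsto_intros) auto
 moreover have "(w (~ a) x + 0) / (w a x - 0) < odds a x + \<eta>"
  using x \<eta> c_pos by (simp add: w_def odds_eq)
 ultimately have "\<forall>\<^sub>F k in at_right 0. (w (~ a) x + k) / (w a x - k) < odds a x + \<eta>"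
  by (rule order_tendstoD)
 moreover have "\<forall>\<^sub>F k in at_right 0. 0 < k & k < w a x"
  using w_pos[of a] by (auto simp: eventually_at_right intro!: exI[of _ "w a x"])
 ultimately have "\<forall>\<^sub>F k in at_right (0::real). 0 < k & k < w a x & (w (~ a) x + k) / (w a x - k) < odds a x + \<eta>"
  by eventually_elim auto
 then obtain k where k: "0 < k" "k < w a x" "(w (~ a) x + k) / (w a x - k) < odds a x + \<eta>"
  by (auto dest: eventually_happens'[rotated])
 define A B where "A = w a x - k" and "B = w (~ a) x + k"
 have AB: "0 < A" "0 < B" using k w_pos[of "~ a"] by (auto simp: A_def B_def)
 have "\<exists>d>0. \<forall>y. \<bar>y - x\<bar> < d --> \<bar>w b y - w b x\<bar> < k" for b
  using w_cont[of b] k(1) unfolding continuous_at_eps_delta dist_real_def by blast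
 then obtain d1 d2 where d12: "0 < d1" "0 < d2" "!!y. \<bar>y - x\<bar> < d1 ==> \<bar>w a y - w a x\<bar> < k"
  "!!y. \<bar>y - x\<bar> < d2 ==> \<bar>w (~ a) y - w (~ a) x\<bar> < k"
  by metis
 \<comment> \<open>Half of the radius of continuity: the ball around y through x reaches out to
   distance 2 |y - x| from x.\<close>
 define \<delta> where "\<delta> = min d1 d2 / 2"
 have \<delta>: "0 < \<delta>" using d12 by (simp add: \<delta>_def)
 have lower: "A <= w a y" and upper: "w (~ a) y <= B" if "\<bar>y - x\<bar> < 2 * \<delta>" for y
  using d12(3)[of y] d12(4)[of y] that by (auto simp: \<delta>_def A_def B_def)
 have lower_grp: "A * (q - p) <= grp a {p<..<q}" if pq: "x - 2 * \<delta> <= p" "p <= q" "q <= x + 2 * \<delta>" for p q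
 proof -
  have "ennreal (A * (q - p)) = (\<integral>\<^sup>+ y. ennreal A * indicator {p<..<q} y \<partial>lborel)"
   using pq AB by (simp add: nn_integral_cmult_indicator ennreal_mult)
  also have "... <= ennreal (grp a {p<..<q})"
   unfolding grp_eq_nn_integral[OF borel_open[OF open_greaterThanLessThan]]
   using lower pq by (intro nn_integral_mono) (auto simp: indicator_def w_def intro!: ennreal_leI)
  finally show ?thesis by simp
 qed
 have upper_grp: "grp (~ a) {p..q} <= B * (q - p)" if pq: "x - 2 * \<delta> < p" "p <= q" "q < x + 2 * \<delta>" for p q
 proof -
  have "ennreal (grp (~ a) {p..q}) <= (\<integral>\<^sup>+ y. ennreal B * indicator {p..q} y \<partial>lborel)"
   unfolding grp_eq_nn_integral[OF borel_closed[OF closed_atLeastAtMost]]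
   using upper pq by (intro nn_integral_mono) (auto simp: indicator_def w_def intro!: ennreal_leI)
  also have "... = ennreal (B * (q - p))"
   using pq AB by (simp add: nn_integral_cmult_indicator ennreal_mult)
  finally show ?thesis using AB pq by simp
 qed
 have close: "\<bar>y - x\<bar> <= u / (2 * A)" "\<bar>y - x\<bar> < \<delta>" if u: "0 <= u" "u <= A * \<delta>" and y: "ball_mass a x y <= u" for u y
 proof -
  have *: "A * (2 * min \<bar>y - x\<bar> \<delta>) <= ball_mass a x y"
  proof (cases "x <= y")
   case True
   have "A * (2 * min \<bar>y - x\<bar> \<delta>) <= grp a {x<..<x + 2 * min \<bar>y - x\<bar> \<delta>}"
    using lower_grp[of x "x + 2 * min \<bar>y - x\<bar> \<delta>"] \<delta> by (simp add: min_def)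
   also have "... <= ball_mass a x y"
    unfolding ball_mass_def using True \<delta> by (intro grp_mono) (auto simp: min_def split: if_splits)
   finally show ?thesis .
  next
   case False
   have "A * (2 * min \<bar>y - x\<bar> \<delta>) <= grp a {x - 2 * min \<bar>y - x\<bar> \<delta><..<x}"
    using lower_grp[of "x - 2 * min \<bar>y - x\<bar> \<delta>" x] \<delta> by (simp add: min_def)
   also have "... <= ball_mass a x y"
    unfolding ball_mass_def using False \<delta> by (intro grp_mono) (auto simp: min_def split: if_splits)
   finally show ?thesis .
  qed
  have "A * \<delta> < A * (2 * \<delta>)" using AB \<delta> by simp
  then show c: "\<bar>y - x\<bar> < \<delta>"
   using * u y by (cases "\<bar>y - x\<bar> < \<delta>") (auto simp: min_def split: if_splits)
  then have "A * (2 * \<bar>y - x\<bar>) <= u" using * y by (simp add: min_def)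
  then show "\<bar>y - x\<bar> <= u / (2 * A)" using AB by (simp add: field_simps)
 qed
 show ?thesis
 proof (rule that[of "A * \<delta>"])
  show "0 < A * \<delta>" using AB \<delta> by simp
  fix u assume u: "0 <= u" "u <= A * \<delta>"
  have "A * \<delta> < A * (\<delta> * 4)" using AB \<delta> by simp
  then have "u < A * (\<delta> * 4)" using u by linarith
  then have u2: "u / (2 * A) < 2 * \<delta>" using AB by (simp add: field_simps)
  have "catchment a x u <= grp (~ a) {x - u / (2 * A)..x + u / (2 * A)}"
   unfolding catchment_eq_grp
  proof (rule grp_mono)
   show "{y. ball_mass a x y <= u} \<subseteq> {x - u / (2 * A)..x + u / (2 * A)}"
   proof
    fix y assume "y \<in> {y. ball_mass a x y <= u}"
    then have "\<bar>y - x\<bar> <= u / (2 * A)" using close(1)[OF u] by simp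
    then show "y \<in> {x - u / (2 * A)..x + u / (2 * A)}" by (simp only: atLeastAtMost_iff) linarith
   qed
  qed simp
  also have "... <= B * ((x + u / (2 * A)) - (x - u / (2 * A)))"
   using u2 u AB by (intro upper_grp) auto
  also have "... = B / A * u" using AB by (simp add: field_simps)
  also have "... <= (odds a x + \<eta>) * u"
   using k(3) u(1) unfolding A_def[symmetric] B_def[symmetric] by (intro mult_right_mono) auto
  finally show "catchment a x u <= (odds a x + \<eta>) * u" .
 qed
qed

end

section \<open>Second moment of the match counts\<close>

context matching_sample
begin

abbreviation sample :: "nat => (nat => 'z) measure" where
 "sample n \<equiv> \<Pi>\<^sub>M k\<in>{..<n}. Q"

abbreviation matches :: "nat => nat => (nat => 'z) => nat => nat set" where
 "matches n K x \<equiv> match_set n K (%k. t (x k)) (%k. e (x k))"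

abbreviation count :: "nat => nat => (nat => 'z) => nat => nat" where
 "count n K x \<equiv> match_count n K (%k. t (x k)) (%k. e (x k))"

lemma prob_space_sample: "prob_space (sample n)"
 by (intro prob_space_PiM prob_space_axioms)

lemma sample_component: "k < n ==> (%x. x k) \<in> measurable (sample n) Q"
 by (intro measurable_component_singleton) auto

lemma integral_sample_component:
 assumes "k < n" and [measurable]: "\<phi> \<in> borel_measurable Q"
 shows "(\<integral>x. \<phi> (x k) \<partial>sample n) = (\<integral>z. \<phi> z \<partial>Q :: real)"
proof -
 interpret product_prob_space "%_. Q" "{..<n}" ..
 note sample_component[measurable]
 have "(LINT z|Q. \<phi> z) = (\<integral>z. \<phi> z \<partial>distr (sample n) Q (%x. x k))"
  using assms(1) PiM_component[of k] by simp
 also have "... = (\<integral>x. \<phi> (x k) \<partial>sample n)"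
  using assms(1) by (intro integral_distr) auto
 finally show ?thesis ..
qed

lemma closer_measurable:
 assumes [measurable]: "a \<in> measurable M Q" "b \<in> measurable M Q" "d \<in> measurable M Q"
 shows "Measurable.pred M (%w. t (a w) = (~ t (b w)) &
  (\<bar>e (a w) - e (b w)\<bar> < \<bar>e (d w) - e (b w)\<bar> | \<bar>e (a w) - e (b w)\<bar> = \<bar>e (d w) - e (b w)\<bar> & c))"
  and "Measurable.pred M (%w. t (a w) = (~ t (b w)))"
 by measurable

lemma matches_measurable [measurable]:
 assumes "l < n"
 shows "Measurable.pred (sample n) (%x. i \<in> matches n K x l)"
proof (cases "i < n")
 case True
 define P where "P k x \<longleftrightarrow> t (x k) = (~ t (x l)) &
   (\<bar>e (x k) - e (x l)\<bar> < \<bar>e (x i) - e (x l)\<bar> | \<bar>e (x k) - e (x l)\<bar> = \<bar>e (x i) - e (x l)\<bar> & k < i)" for k x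
 have P: "Measurable.pred (sample n) (P k)" if "k < n" for k
  unfolding P_def[abs_def] using that True assms by (intro closer_measurable sample_component)
 have "{k. k < n & P k x} = {k \<in> {..<n}. P k x}" for x by auto
 then have c: "card {k. k < n & P k x} = (\<Sum>k\<in>{..<n}. if P k x then 1 else 0)" for x
  by (simp add: sum.If_cases Collect_conj_eq Int_commute lessThan_def)
 have [measurable]: "(%x. \<Sum>k\<in>{..<n}. if P k x then 1 else 0 :: nat) \<in> measurable (sample n) (count_space UNIV)"
  using P by (intro measurable_sum_nat measurable_If) auto
 have [measurable]: "Measurable.pred (sample n) (%x. t (x i) = (~ t (x l)))"
  using True assms by (intro closer_measurable(2)[where d="%x. x i"] sample_component)
 have "(%x. i \<in> matches n K x l) = (%x. t (x i) = (~ t (x l)) & (\<Sum>k\<in>{..<n}. if P k x then 1 else 0) < K)"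
  by (simp only: match_set_def mem_Collect_eq P_def[symmetric] c True simp_thms)
 also have "Measurable.pred (sample n) ..."
  by measurable
 finally show ?thesis .
next
 case False
 then have "~ i \<in> matches n K x l" for x by (auto dest: match_setD)
 then show ?thesis by simp
qed

lemma count_measurable [measurable]: "(%x. count n K x i) \<in> measurable (sample n) (count_space UNIV)"
proof -
 have "(%x. \<Sum>l\<in>{..<n}. (if i \<in> matches n K x l then 1 else 0 :: nat)) \<in> measurable (sample n) (count_space UNIV)"
  by (intro measurable_sum_nat) measurable
 then show ?thesis
  unfolding match_count_def by (simp add: of_bool_def)
qed

text \<open>Bounds the probability that two given other units are both matched to a unit with data z
  in a sample of size n; see \<open>joint_match_bound\<close>.\<close>

definition joint_mass :: "nat => nat => 'z => ennreal" where
 "joint_mass n K z = (\<integral>\<^sup>+ u. ennreal (order_density (n - 3) K u) * indicator {0..1} u *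
       (ennreal (catchment (t z) (e z) u))\<^sup>2 \<partial>lborel)"

lemma joint_mass_measurable [measurable]: "joint_mass n K \<in> borel_measurable Q"
proof -
 interpret L: sigma_finite_measure "lborel :: real measure" by unfold_locales
 show ?thesis unfolding joint_mass_def[abs_def] by measurable
qed

text \<open>After \<open>match_count_square\<close> the diagonal sums to at most n K, because every
  unit has at most K matches, and each of the at most n^3 triples is bounded by
  \<open>joint_match_bound\<close>. A triple in which the match i coincides with l or l' contributes
  nothing.\<close>

lemma second_moment_bound:
 assumes K: "1 <= K" "K <= n - 3"
 shows "(\<integral>\<^sup>+ x. ennreal (\<Sum>i<n. (real (count n K x i))\<^sup>2) \<partial>sample n) <=
  ennreal (real n * real K) + ennreal (real n ^ 3) * (\<integral>\<^sup>+ z. joint_mass n K z \<partial>Q)"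
proof -
 let ?J = "\<integral>\<^sup>+ z. joint_mass n K z \<partial>Q"
 interpret P: prob_space "sample n" by (rule prob_space_sample)
 define I where "I i l l' x = (indicator {x. i \<in> matches n K x l & i \<in> matches n K x l'} x :: ennreal)" for i l l' x
 have I_meas: "I i l l' \<in> borel_measurable (sample n)" if "l < n" "l' < n" for i l l'
  unfolding I_def[abs_def] indicator_def mem_Collect_eq using that by measurable
 have I_le: "(\<integral>\<^sup>+ x. I i l l' x \<partial>sample n) <= ?J" if "i < n" "l < n" "l' < n" "l ~= l'" for i l l'
 proof (cases "l = i | l' = i")
  case True
  then have "I i l l' x = 0" for x
   by (auto simp: I_def indicator_def dest: match_setD)
  then show ?thesis by simp
 next
  case False
  then show ?thesis unfolding I_def joint_mass_def using that K by (intro joint_match_bound) auto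
 qed
 define r where "r i l l' x = (of_bool (i \<in> matches n K x l & i \<in> matches n K x l') :: real)" for i l l' x
 have r: "0 <= r i l l' x" "I i l l' x = ennreal (r i l l' x)" for i l l' x
  by (simp_all add: r_def I_def indicator_def)
 have pw: "ennreal (\<Sum>i<n. (real (count n K x i))\<^sup>2) <=
   ennreal (real n * real K) + (\<Sum>i<n. \<Sum>l<n. \<Sum>l'\<in>{..<n} - {l}. I i l l' x)" for x
 proof -
  have "(\<Sum>i<n. (real (count n K x i))\<^sup>2) <= real n * real K + (\<Sum>i<n. \<Sum>l<n. \<Sum>l'\<in>{..<n} - {l}. r i l l' x)"
   unfolding match_count_square sum.distrib r_def by (intro add_right_mono sum_match_count_le)
  then have "ennreal (\<Sum>i<n. (real (count n K x i))\<^sup>2) <=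
    ennreal (real n * real K + (\<Sum>i<n. \<Sum>l<n. \<Sum>l'\<in>{..<n} - {l}. r i l l' x))"
   by (rule ennreal_leI)
  also have "... = ennreal (real n * real K) + ennreal (\<Sum>i<n. \<Sum>l<n. \<Sum>l'\<in>{..<n} - {l}. r i l l' x)"
   using r(1) by (intro ennreal_plus sum_nonneg) auto
  also have "ennreal (\<Sum>i<n. \<Sum>l<n. \<Sum>l'\<in>{..<n} - {l}. r i l l' x) = (\<Sum>i<n. \<Sum>l<n. \<Sum>l'\<in>{..<n} - {l}. I i l l' x)"
   using r(1) by (simp add: r(2) sum_ennreal sum_nonneg)
  finally show ?thesis .
 qed
 have "(\<integral>\<^sup>+ x. ennreal (\<Sum>i<n. (real (count n K x i))\<^sup>2) \<partial>sample n) <=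
   (\<integral>\<^sup>+ x. ennreal (real n * real K) + (\<Sum>i<n. \<Sum>l<n. \<Sum>l'\<in>{..<n} - {l}. I i l l' x) \<partial>sample n)"
  by (intro nn_integral_mono pw)
 also have "... = ennreal (real n * real K) + (\<integral>\<^sup>+ x. (\<Sum>i<n. \<Sum>l<n. \<Sum>l'\<in>{..<n} - {l}. I i l l' x) \<partial>sample n)"
  using I_meas by (subst nn_integral_add) (auto simp: P.emeasure_space_1 intro!: borel_measurable_sum)
 also have "(\<integral>\<^sup>+ x. (\<Sum>i<n. \<Sum>l<n. \<Sum>l'\<in>{..<n} - {l}. I i l l' x) \<partial>sample n) =
   (\<Sum>i<n. \<Sum>l<n. \<Sum>l'\<in>{..<n} - {l}. (\<integral>\<^sup>+ x. I i l l' x \<partial>sample n))"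
  using I_meas by (subst nn_integral_sum, force intro!: borel_measurable_sum, intro sum.cong refl)+
 also have "... <= (\<Sum>i<n. \<Sum>l<n. \<Sum>l'\<in>{..<n} - {l}. ?J)"
  by (intro sum_mono I_le) auto
 also have "... <= (\<Sum>i<n. \<Sum>l<n. \<Sum>l'<n. ?J)"
  by (intro sum_mono sum_mono2) auto
 also have "... = ennreal (real n ^ 3) * ?J"
  by (simp add: ennreal_of_nat_eq_real_of_nat power3_eq_cube ennreal_mult mult.assoc)
 finally show ?thesis by (simp add: add_left_mono)
qed

end

context matching_population
begin

lemma joint_mass_le:
 assumes K: "1 <= K" "K <= N" and N: "N = n - 3"
  and C: "0 <= C" "0 <= D" "!!u. 0 <= u ==> u <= 1 ==> (catchment (t z) (e z) u)\<^sup>2 <= C * u ^ 2 + D * u ^ 3"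
 shows "joint_mass n K z <= ennreal (C * (real K / real (N + 1) * (real (K + 1) / real (N + 2))) +
  D * (real K / real (N + 1) * (real (K + 1) / real (N + 2) * (real (K + 2) / real (N + 3)))))"
proof -
 have "joint_mass n K z <= (\<integral>\<^sup>+ u. ennreal C * (ennreal (u ^ 2 * order_density N K u) * indicator {0..1} u) +
   ennreal D * (ennreal (u ^ 3 * order_density N K u) * indicator {0..1} u) \<partial>lborel)"
  unfolding joint_mass_def N[symmetric]
 proof (rule nn_integral_mono)
  fix u :: real
  show "ennreal (order_density N K u) * indicator {0..1} u * (ennreal (catchment (t z) (e z) u))^2 <=
   ennreal C * (ennreal (u ^ 2 * order_density N K u) * indicator {0..1} u) +
   ennreal D * (ennreal (u ^ 3 * order_density N K u) * indicator {0..1} u)"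
  proof (cases "0 <= u & u <= 1")
   case True
   have nn: "0 <= order_density N K u" using True by (intro order_density_nonneg) auto
   have "0 <= catchment (t z) (e z) u" by (simp add: catchment_def)
   then have "ennreal (order_density N K u) * (ennreal (catchment (t z) (e z) u))^2 =
    ennreal (order_density N K u * (catchment (t z) (e z) u)^2)"
    using nn by (simp add: ennreal_mult ennreal_power)
   also have "... <= ennreal (order_density N K u * (C * u ^ 2 + D * u ^ 3))"
    using True nn C by (intro ennreal_leI mult_left_mono) auto
   also have "order_density N K u * (C * u ^ 2 + D * u ^ 3) = C * (u ^ 2 * order_density N K u) + D * (u ^ 3 * order_density N K u)"
    by (simp add: algebra_simps)
   also have "ennreal ... = ennreal C * ennreal (u ^ 2 * order_density N K u) + ennreal D * ennreal (u ^ 3 * order_density N K u)"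
    using True nn C by (simp add: ennreal_plus ennreal_mult)
   finally show ?thesis using True by simp
  qed simp
 qed
 also have "... = ennreal C * ennreal (real K / real (N + 1) * (real (K + 1) / real (N + 2))) +
   ennreal D * ennreal (real K / real (N + 1) * (real (K + 1) / real (N + 2) * (real (K + 2) / real (N + 3))))"
  using order_density_moment2[OF K] order_density_moment3[OF K]
  by (simp add: nn_integral_add nn_integral_cmult)
 also have "... = ennreal (C * (real K / real (N + 1) * (real (K + 1) / real (N + 2))) +
  D * (real K / real (N + 1) * (real (K + 1) / real (N + 2) * (real (K + 2) / real (N + 3)))))"
  using C by (subst ennreal_plus) (auto simp flip: ennreal_mult)
 finally show ?thesis .
qed

end

section \<open>Mean square limit of the match weights\<close>

context matching_population
begin

text \<open>The common limiting value against which both the second moment of M / K and its cross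
  moment with the odds are compared.\<close>

definition odds_sq :: real where
 "odds_sq = (LINT z|Q. (odds (t z) (e z))^2)"

lemma odds_sq_le: "(odds a x)^2 <= (1 / c)^2"
 using odds_nonneg odds_le by (intro power_mono) auto

lemma integrable_odds_sq: "integrable Q (%z. (odds (t z) (e z))^2)"
 by (rule integrable_const_bound[where B="(1 / c)^2"]) (use odds_sq_le in auto)

text \<open>Almost every score is a point at which \<open>catchment_local\<close> applies: interior
  to the interval, where \<open>f\<close> is continuous, and of positive density.\<close>

lemma AE_good: "AE z in Q. lo < e z & e z < hi & 0 < f (e z) & c <= e z & e z <= 1 - c"
proof -
 have "AE z in Q. e z \<in> S" if S: "S \<in> sets borel" "AE x in lborel. x \<notin> S --> f x = 0" for S
 proof (rule AE_I)
  have [measurable]: "- S \<in> sets borel" using S(1) by (rule borel_comp)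
  have "emeasure Q (e -` (- S) \<inter> space Q) = (\<integral>\<^sup>+ x. ennreal (f x) * indicator (- S) x \<partial>lborel)"
   using distributed_emeasure[OF f_density, of "- S"] by simp
  also have "... = (\<integral>\<^sup>+ x. 0 \<partial>(lborel :: real measure))"
   using S(2) by (intro nn_integral_cong_AE) (auto simp: indicator_def elim: eventually_mono)
  finally show "emeasure Q (e -` (- S) \<inter> space Q) = 0" by simp
  show "e -` (- S) \<inter> space Q \<in> sets Q" by measurable
 qed auto
 note * = this
 have [measurable]: "(%x. ennreal (f x)) \<in> borel_measurable borel"
  using distributed_borel_measurable[OF f_density] by simp
 have "(%x. enn2real (ennreal (f x))) \<in> borel_measurable borel" by measurable
 then have [measurable]: "f \<in> borel_measurable borel" by (simp add: f_nonneg)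
 have "AE z in Q. e z \<in> {x. 0 < f x}"
  by (rule *) (use f_nonneg in \<open>auto simp: order_less_le\<close>)
 moreover have "AE z in Q. e z \<in> {lo<..<hi}"
 proof (rule *)
  have "AE x in (lborel :: real measure). x \<notin> {lo, hi}"
   by (intro AE_lborel_singleton[THEN AE_conjI, THEN eventually_mono, OF AE_lborel_singleton, of lo hi]) auto
  then show "AE x in lborel. x \<notin> {lo<..<hi} --> f x = 0"
   by eventually_elim (use f_outside in force)
 qed simp
 ultimately show ?thesis using e_bounds by eventually_elim auto
qed

lemma grp_ball_pos:
 assumes x: "lo < x" "x < hi" "0 < f x" "c <= x" "x <= 1 - c" and \<delta>: "0 < \<delta>"
 shows "0 < grp a {v. \<bar>v - x\<bar> < \<delta>}"
proof -
 define w where "w y = f y * pr a y" for y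
 have w_pos: "0 < w x" using x c_pos by (auto simp: w_def pr_def)
 have "isCont f x"
  using f_cont x by (metis at_within_Icc_at continuous_on_eq_continuous_within atLeastAtMost_iff less_imp_le)
 then have "isCont w x"
  unfolding w_def[abs_def] pr_def by (cases a) (auto intro!: continuous_intros)
 then obtain d where d: "0 < d" "!!y. \<bar>y - x\<bar> < d ==> \<bar>w y - w x\<bar> < w x / 2"
  using w_pos unfolding continuous_at_eps_delta dist_real_def by (meson half_gt_zero)
 define r where "r = min d \<delta>"
 have r: "0 < r" using d \<delta> by (simp add: r_def)
 have "0 < ennreal (w x / 2) * emeasure lborel {x - r<..<x + r}"
  using w_pos r by (simp add: ennreal_zero_less_mult_iff)
 also have "... = (\<integral>\<^sup>+ y. ennreal (w x / 2) * indicator {x - r<..<x + r} y \<partial>lborel)"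
  by (simp add: nn_integral_cmult_indicator)
 also have "... <= (\<integral>\<^sup>+ y. ennreal (f y * pr a y) * indicator {v. \<bar>v - x\<bar> < \<delta>} y \<partial>lborel)"
 proof (rule nn_integral_mono)
  fix y :: real
  show "ennreal (w x / 2) * indicator {x - r<..<x + r} y <= ennreal (f y * pr a y) * indicator {v. \<bar>v - x\<bar> < \<delta>} y"
  proof (cases "y \<in> {x - r<..<x + r}")
   case True
   then have "\<bar>y - x\<bar> < d" "\<bar>y - x\<bar> < \<delta>" by (auto simp: r_def)
   with d(2)[of y] have "w x / 2 <= f y * pr a y" by (auto simp: w_def abs_if split: if_splits)
   then show ?thesis using True \<open>\<bar>y - x\<bar> < \<delta>\<close> by (simp add: ennreal_leI)
  qed simp
 qed
 also have "... = ennreal (grp a {v. \<bar>v - x\<bar> < \<delta>})"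
  by (intro grp_eq_nn_integral[symmetric]) measurable
 finally show ?thesis by simp
qed

lemma binom_tail_le_1: "0 <= p ==> p <= 1 ==> 1 <= K ==> K <= N ==> binom_tail N K p <= 1"
proof -
 assume a: "0 <= p" "p <= 1" "1 <= K" "K <= N"
 have "ennreal (binom_tail N K p) <= (\<integral>\<^sup>+ u. ennreal (order_density N K u) * indicator {0..1} u \<partial>lborel)"
  unfolding binom_tail_eq_integral[OF a(3,4,1,2), symmetric]
  using a by (intro nn_integral_mono) (auto simp: indicator_def)
 also have "... = 1" using a by (intro order_density_total)
 finally show ?thesis by simp
qed

text \<open>Both sides integrate \<phi> against an image measure on the line, and the two measures
  agree on Borel sets by \<open>grp_eq_integral\<close>.\<close>

lemma grp_change_of_measure:
 assumes [measurable]: "\<phi> \<in> borel_measurable borel" and \<phi>: "!!x. 0 <= \<phi> x" "!!x. \<phi> x <= B"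
 shows "(LINT z|Q. of_bool (t z = a) * \<phi> (e z)) = (LINT z|Q. pr a (e z) * \<phi> (e z))"
proof -
 have int: "integrable Q (%z. pr a (e z))"
  using grp_eq_integral(2)[of UNIV a] by simp
 have pos: "AE z in Q. 0 <= pr a (e z)"
  using e_bounds by eventually_elim (use c_pos in \<open>auto simp: pr_def\<close>)
 let ?M = "distr (density Q (indicator {z. t z = a})) borel e"
 let ?N = "distr (density Q (%z. ennreal (pr a (e z)))) borel e"
 have eq: "?M = ?N"
 proof (rule measure_eqI)
  fix S assume "S \<in> sets ?M"
  then have [measurable]: "S \<in> sets borel" by simp
  have "emeasure ?M S = (\<integral>\<^sup>+ z. indicator {z. t z = a} z * indicator (e -` S \<inter> space Q) z \<partial>Q)"
   by (subst emeasure_distr) (auto simp: emeasure_density)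
  also have "... = (\<integral>\<^sup>+ z. indicator {z \<in> space Q. t z = a & e z \<in> S} z \<partial>Q)"
   by (intro nn_integral_cong) (auto simp: indicator_def)
  also have "... = ennreal (grp a S)" by (simp add: grp_def emeasure_eq_measure)
  also have "... = (\<integral>\<^sup>+ z. ennreal (pr a (e z) * indicator S (e z)) \<partial>Q)"
   unfolding grp_eq_integral(1)[OF \<open>S \<in> sets borel\<close>]
   using pos by (intro nn_integral_eq_integral[symmetric] grp_eq_integral(2)) (auto elim: eventually_mono)
  also have "... = emeasure ?N S"
   by (subst emeasure_distr) (auto simp: emeasure_density indicator_def intro!: nn_integral_cong)
  finally show "emeasure ?M S = emeasure ?N S" .
 qed simp
 have "ennreal (LINT z|Q. of_bool (t z = a) * \<phi> (e z)) = (\<integral>\<^sup>+ z. ennreal (of_bool (t z = a) * \<phi> (e z)) \<partial>Q)"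
  by (intro nn_integral_eq_integral[symmetric] integrable_const_bound[where B=B]) (use \<phi> in \<open>auto simp: abs_mult intro: order_trans\<close>)
 also have "... = (\<integral>\<^sup>+ x. ennreal (\<phi> x) \<partial>?M)"
  by (subst nn_integral_distr, simp, simp, subst nn_integral_density)
    (auto intro!: nn_integral_cong simp: indicator_def)
 also have "... = (\<integral>\<^sup>+ z. ennreal (pr a (e z)) * ennreal (\<phi> (e z)) \<partial>Q)"
  unfolding eq by (subst nn_integral_distr, simp, simp, subst nn_integral_density) auto
 also have "... = (\<integral>\<^sup>+ z. ennreal (pr a (e z) * \<phi> (e z)) \<partial>Q)"
  by (intro nn_integral_cong) (simp add: ennreal_mult''[OF \<phi>(1)])
 also have "... = ennreal (LINT z|Q. pr a (e z) * \<phi> (e z))"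
 proof (intro nn_integral_eq_integral)
  show "AE z in Q. 0 <= pr a (e z) * \<phi> (e z)"
   using pos by eventually_elim (use \<phi> in auto)
  show "integrable Q (%z. pr a (e z) * \<phi> (e z))"
  proof (rule integrable_const_bound[where B="B"])
   show "AE z in Q. norm (pr a (e z) * \<phi> (e z)) <= B"
    using e_bounds
   proof eventually_elim
    case (elim z)
    then have "\<bar>pr a (e z)\<bar> <= 1" using c_pos by (auto simp: pr_def)
    then have "\<bar>pr a (e z)\<bar> * \<bar>\<phi> (e z)\<bar> <= 1 * B" using \<phi> by (intro mult_mono) auto
    then show ?case by (simp add: abs_mult)
   qed
  qed measurable
 qed
 finally show ?thesis
 proof (subst (asm) ennreal_inj)
  show "0 <= (LINT z|Q. of_bool (t z = a) * \<phi> (e z))" using \<phi> by (intro Bochner_Integration.integral_nonneg) auto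
  have "AE z in Q. 0 <= pr a (e z) * \<phi> (e z)"
   using pos by eventually_elim (use \<phi> in auto)
  then show "0 <= (LINT z|Q. pr a (e z) * \<phi> (e z))" by (rule integral_nonneg_AE)
 qed
qed

text \<open>A unit's expected weight does not change when the expectation is taken from the side of the
 units it is matched to; this is what makes the cross term in \<open>match_weight_L2\<close> equal to the limiting
 second moment.\<close>

lemma integral_odds_opposite: "(LINT z|Q. odds (~ t z) (e z)) = odds_sq"
proof -
 have int: "integrable Q (%z. of_bool (t z = a) * \<phi> (e z))" if "\<phi> \<in> borel_measurable borel" "!!x. 0 <= \<phi> x" "!!x. \<phi> x <= B"
  for a B and \<phi> :: "real => real"
  by (rule integrable_const_bound[where B=B]) (use that in \<open>auto simp: abs_mult intro: order_trans\<close>)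
 have int2: "integrable Q (%z. pr a (e z) * \<phi> (e z))" if [measurable]: "\<phi> \<in> borel_measurable borel" and "!!x. 0 <= \<phi> x" "!!x. \<phi> x <= B"
  for a B and \<phi> :: "real => real"
 proof (rule integrable_const_bound[where B="B"])
  show "AE z in Q. norm (pr a (e z) * \<phi> (e z)) <= B"
   using e_bounds
  proof eventually_elim
   case (elim z)
   then have "\<bar>pr a (e z)\<bar> <= 1" using c_pos by (auto simp: pr_def)
   then have "\<bar>pr a (e z)\<bar> * \<bar>\<phi> (e z)\<bar> <= 1 * B" using that by (intro mult_mono) auto
   then show ?case by (simp add: abs_mult)
  qed
 qed measurable
 have split: "(LINT z|Q. \<phi> (t z) (e z)) = (LINT z|Q. pr True (e z) * \<phi> True (e z) + pr False (e z) * \<phi> False (e z))"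
  if m: "!!a. \<phi> a \<in> borel_measurable borel" and p: "!!a x. 0 <= \<phi> a x" "!!a x. \<phi> a x <= B"
  for B and \<phi> :: "bool => real => real"
 proof -
  have "(LINT z|Q. \<phi> (t z) (e z)) = (LINT z|Q. of_bool (t z = True) * \<phi> True (e z) + of_bool (t z = False) * \<phi> False (e z))"
   by (intro Bochner_Integration.integral_cong) auto
  also have "... = (LINT z|Q. of_bool (t z = True) * \<phi> True (e z)) + (LINT z|Q. of_bool (t z = False) * \<phi> False (e z))"
   by (intro Bochner_Integration.integral_add int[OF m p])
  also have "... = (LINT z|Q. pr True (e z) * \<phi> True (e z)) + (LINT z|Q. pr False (e z) * \<phi> False (e z))"
   by (simp only: grp_change_of_measure[OF m p])
  also have "... = (LINT z|Q. pr True (e z) * \<phi> True (e z) + pr False (e z) * \<phi> False (e z))"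
   by (intro Bochner_Integration.integral_add[symmetric] int2[OF m p])
  finally show ?thesis .
 qed
 have "(LINT z|Q. odds (~ t z) (e z)) = (LINT z|Q. pr True (e z) * odds False (e z) + pr False (e z) * odds True (e z))"
  using split[of "%a. odds (~ a)" "1 / c"] odds_nonneg odds_le by simp
 \<comment> \<open>With p the score, both integrands equal p^2 / (1 - p) + (1 - p)^2 / p.\<close>
 also have "... = (LINT z|Q. pr True (e z) * (odds True (e z))^2 + pr False (e z) * (odds False (e z))^2)"
 proof (rule integral_cong_AE)
  show "AE z in Q. pr True (e z) * odds False (e z) + pr False (e z) * odds True (e z) =
    pr True (e z) * (odds True (e z))^2 + pr False (e z) * (odds False (e z))^2"
   using e_bounds
  proof eventually_elim
   case (elim z)
   then have "e z ~= 0" "1 - e z ~= 0" using c_pos by auto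
   with elim show ?case
    by (simp add: odds_eq pr_def divide_simps power2_eq_square)
  qed
 qed measurable
 also have "... = odds_sq"
  unfolding odds_sq_def using split[of "%a x. (odds a x)^2" "(1 / c)^2"] odds_sq_le by simp
 finally show ?thesis .
qed

text \<open>For almost every z the rescaled \<open>joint_mass\<close> has limit superior at most the
  squared odds, by the local slope, and it is bounded uniformly by \<open>catchment_le\<close>.
  Reverse Fatou passes this to the integral; the diagonal contributes only 1 / K.\<close>

lemma limsup_second_moment:
 fixes K :: "nat => nat"
 assumes K: "filterlim K at_top sequentially" "(%n. real (K n) / real n) \<longlonglongrightarrow> 0" and \<epsilon>: "0 < \<epsilon>"
 shows "\<forall>\<^sub>F n in sequentially. (\<integral>x. (\<Sum>i<n. (real (count n (K n) x i) / real (K n))\<^sup>2) / real n \<partial>sample n) <= odds_sq + \<epsilon>"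
proof -
 \<comment> \<open>Second and third Beta moments with N = n - 3, rescaled by (n / K)^2; this is the
   factor that remains of n^3 after division by n K^2. They tend to 1 and to 0.\<close>
 define r2 where "r2 n = (real n / real (K n))^2 * (real (K n) / real (n - 3 + 1) * (real (K n + 1) / real (n - 3 + 2)))" for n
 define r3 where "r3 n = (real n / real (K n))^2 * (real (K n) / real (n - 3 + 1) * (real (K n + 1) / real (n - 3 + 2) * (real (K n + 2) / real (n - 3 + 3))))" for n
 have K1: "\<forall>\<^sub>F n in sequentially. 1 <= K n"
  using K(1) by (simp add: filterlim_at_top)
 have realK: "filterlim (%n. real (K n)) at_top sequentially"
  using K(1) by (rule filterlim_compose[OF filterlim_real_sequentially])
 \<comment> \<open>From 2 K < n and n >= 6 it follows that K <= n / 2 <= n - 3, as the Beta formulas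
   require.\<close>
 have K3: "\<forall>\<^sub>F n in sequentially. K n <= n - 3 & 6 <= n"
 proof -
  have "\<forall>\<^sub>F n in sequentially. real (K n) / real n < 1 / 2"
   using order_tendstoD(2)[OF K(2), of "1 / 2"] by simp
  with eventually_ge_at_top[of 6] show ?thesis
  proof eventually_elim
   case (elim n)
   then have "2 * real (K n) < real n" by (simp add: field_simps)
   then show ?case using elim by linarith
  qed
 qed
 have inv: "(%n. 1 / real (K n)) \<longlonglongrightarrow> 0"
  using realK by (intro tendsto_divide_0[OF tendsto_const] filterlim_at_top_imp_at_infinity)
 have r2_lim: "r2 \<longlonglongrightarrow> 1"
 proof (rule Lim_transform_eventually)
  have "(%n. real n / (real n - 2)) \<longlonglongrightarrow> 1" "(%n. real n / (real n - 1)) \<longlonglongrightarrow> 1"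
   by real_asymp+
  from tendsto_mult[OF tendsto_mult[OF this] tendsto_add[OF tendsto_const inv, of 1]]
  show "(%n. real n / (real n - 2) * (real n / (real n - 1)) * (1 + 1 / real (K n))) \<longlonglongrightarrow> 1"
   by simp
  show "\<forall>\<^sub>F n in sequentially. real n / (real n - 2) * (real n / (real n - 1)) * (1 + 1 / real (K n)) = r2 n"
   using K1 K3
  proof eventually_elim
   case (elim n)
   then have "real (n - 3 + 1) = real n - 2" "real (n - 3 + 2) = real n - 1" by (simp_all add: of_nat_diff)
   moreover have "real n / (real n - 2) * (real n / (real n - 1)) * (1 + 1 / real (K n)) =
    (real n / real (K n))^2 * (real (K n) / (real n - 2) * ((real (K n) + 1) / (real n - 1)))"
   proof -
    have "real (K n) ~= 0" "real n - 2 ~= 0" "real n - 1 ~= 0" using elim by auto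
    then show ?thesis by (simp add: divide_simps power2_eq_square)
   qed
   ultimately show ?case by (simp add: r2_def)
  qed
 qed
 have r3_lim: "r3 \<longlonglongrightarrow> 0"
 proof (rule Lim_transform_eventually)
  have "(%n. 2 / real n) \<longlonglongrightarrow> 0" by real_asymp
  from tendsto_mult[OF r2_lim tendsto_add[OF K(2) this]]
  show "(%n. r2 n * (real (K n) / real n + 2 / real n)) \<longlonglongrightarrow> 0" by simp
  show "\<forall>\<^sub>F n in sequentially. r2 n * (real (K n) / real n + 2 / real n) = r3 n"
   using K3
  proof eventually_elim
   case (elim n)
   then have "real (n - 3 + 3) = real n" by simp
   then show ?case unfolding r2_def r3_def by (simp add: add_divide_distrib)
  qed
 qed
 define good where "good n \<longleftrightarrow> 1 <= K n & K n <= n - 3 & 6 <= n & r2 n <= 2" for n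
 have good: "\<forall>\<^sub>F n in sequentially. good n"
 proof -
  have "\<forall>\<^sub>F n in sequentially. r2 n < 2" using order_tendstoD(2)[OF r2_lim, of 2] by simp
  with K1 K3 show ?thesis by eventually_elim (auto simp: good_def)
 qed
 have F_bound: "ennreal ((real n / real (K n))^2) * joint_mass n (K n) z <= ennreal (C * r2 n + D * r3 n)"
  if "good n" "0 <= C" "0 <= D" "!!u. 0 <= u ==> u <= 1 ==> (catchment (t z) (e z) u)\<^sup>2 <= C * u ^ 2 + D * u ^ 3"
  for C D n z
 proof -
  have "joint_mass n (K n) z <= ennreal (C * (real (K n) / real (n - 3 + 1) * (real (K n + 1) / real (n - 3 + 2))) +
   D * (real (K n) / real (n - 3 + 1) * (real (K n + 1) / real (n - 3 + 2) * (real (K n + 2) / real (n - 3 + 3)))))"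
   using that by (intro joint_mass_le) (auto simp: good_def)
  then have "ennreal ((real n / real (K n))^2) * joint_mass n (K n) z <= ennreal ((real n / real (K n))^2) *
    ennreal (C * (real (K n) / real (n - 3 + 1) * (real (K n + 1) / real (n - 3 + 2))) +
   D * (real (K n) / real (n - 3 + 1) * (real (K n + 1) / real (n - 3 + 2) * (real (K n + 2) / real (n - 3 + 3)))))"
   by (rule mult_left_mono) simp
  also have "... = ennreal (C * r2 n + D * r3 n)"
   unfolding r2_def r3_def using that(2,3) by (subst ennreal_mult[symmetric]) (auto simp: algebra_simps)
  finally show ?thesis .
 qed
 \<comment> \<open>The value 0 at the finitely many bad n gives one dominating constant valid for
   all n.\<close>
 define F where "F n z = (if good n then ennreal ((real n / real (K n))^2) * joint_mass n (K n) z else 0)" for n z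
 have [measurable]: "F n \<in> borel_measurable Q" for n
  unfolding F_def by (cases "good n") simp_all
 have catch_nn: "0 <= catchment a x u" for a x u by (simp add: catchment_def)
 have catch_sq: "(catchment a x u)^2 <= (2 / c)^2 * u ^ 2" if "0 <= u" for a x u
  using power_mono[OF catchment_le[OF that, of a x] catch_nn, of 2] by (simp only: power_mult_distrib)
 have dom: "F n z <= ennreal ((2 / c)^2 * 2)" for n z
 proof (cases "good n")
  case True
  then have "F n z <= ennreal ((2 / c)^2 * r2 n + 0 * r3 n)"
   using F_bound[of n "(2 / c)^2" 0 z] catch_sq by (simp add: F_def)
  also have "... <= ennreal ((2 / c)^2 * 2)"
   using True by (intro ennreal_leI) (auto simp: good_def intro!: mult_left_mono)
  finally show ?thesis .
 qed (simp add: F_def)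
 have ptw: "AE z in Q. limsup (%n. F n z) <= ennreal ((odds (t z) (e z))^2)"
  using AE_good
 proof eventually_elim
  case (elim z)
  let ?o = "odds (t z) (e z)"
  have o: "0 <= ?o" by (rule odds_nonneg)
  show ?case
  proof (rule ennreal_le_epsilon)
   fix \<epsilon> :: real assume \<epsilon>: "0 < \<epsilon>"
   \<comment> \<open>Chosen such that (o + \<eta>)^2 exceeds o^2 by at most \<eta> (2 o + 1) <=
     \<epsilon> / 2, where \<eta>^2 <= \<eta> is used.\<close>
   define \<eta> where "\<eta> = min 1 (\<epsilon> / (2 * (2 * ?o + 1)))"
   have \<eta>: "0 < \<eta>" "\<eta> <= 1" using \<epsilon> o by (auto simp: \<eta>_def)
   have "\<eta> * (2 * ?o + 1) <= \<epsilon> / (2 * (2 * ?o + 1)) * (2 * ?o + 1)"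
    using o by (intro mult_right_mono) (auto simp: \<eta>_def)
   also have "... = \<epsilon> / 2" using o by (simp add: field_simps)
   finally have "\<eta> * (2 * ?o + 1) <= \<epsilon> / 2" .
   moreover have "\<eta> * \<eta> <= \<eta> * 1" using \<eta> by (intro mult_left_mono) auto
   ultimately have sq: "(?o + \<eta>)^2 <= ?o\<^sup>2 + \<epsilon> / 2" by (simp add: power2_eq_square algebra_simps)
   obtain u0 where u0: "0 < u0" "!!u. 0 <= u ==> u <= u0 ==> catchment (t z) (e z) u <= (?o + \<eta>) * u"
    using catchment_local[of "e z" \<eta> "t z"] elim \<eta> by blast
   \<comment> \<open>For u > u0 the global quadratic bound is at most this constant times u^3, since
     u / u0 > 1.\<close>
   define D where "D = (2 / c)^2 / u0"
   have D: "0 <= D" using u0 by (simp add: D_def)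
   have cub: "(catchment (t z) (e z) u)^2 <= (?o + \<eta>)^2 * u ^ 2 + D * u ^ 3" if u: "0 <= u" for u
   proof (cases "u <= u0")
    case True
    have "(catchment (t z) (e z) u)^2 <= ((?o + \<eta>) * u)^2"
     using u0(2)[OF u True] by (intro power_mono catch_nn)
    moreover have "0 <= D * u ^ 3" using D u by simp
    ultimately show ?thesis by (simp add: power_mult_distrib)
   next
    case False
    have "(2 / c)^2 * u ^ 2 * 1 <= (2 / c)^2 * u ^ 2 * (u / u0)"
     using False u0 by (intro mult_left_mono) auto
    also have "... = D * u ^ 3" by (simp add: D_def power2_eq_square power3_eq_cube)
    finally have "(2 / c)^2 * u ^ 2 <= D * u ^ 3" by simp
    moreover have "0 <= (?o + \<eta>)^2 * u ^ 2" by simp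
    ultimately show ?thesis using catch_sq[OF u, of "t z" "e z"] by linarith
   qed
   have "(%n. (?o + \<eta>)^2 * r2 n + D * r3 n) \<longlonglongrightarrow> (?o + \<eta>)\<^sup>2 * 1 + D * 0"
    by (intro tendsto_intros r2_lim r3_lim)
   moreover have "(?o + \<eta>)^2 * 1 + D * 0 < ?o\<^sup>2 + \<epsilon>" using sq \<epsilon> by simp
   ultimately have "\<forall>\<^sub>F n in sequentially. (?o + \<eta>)\<^sup>2 * r2 n + D * r3 n < ?o\<^sup>2 + \<epsilon>"
    by (rule order_tendstoD)
   then have "\<forall>\<^sub>F n in sequentially. F n z <= ennreal (?o\<^sup>2 + \<epsilon>)"
   proof eventually_elim
    case (elim n)
    show ?case
    proof (cases "good n")
     case True
     then have "F n z <= ennreal ((?o + \<eta>)^2 * r2 n + D * r3 n)"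
      using F_bound[OF True _ D cub] by (simp add: F_def)
     also have "... <= ennreal (?o\<^sup>2 + \<epsilon>)" using elim by (intro ennreal_leI) simp
     finally show ?thesis .
    qed (simp add: F_def)
   qed
   then have "limsup (%n. F n z) <= ennreal (?o\<^sup>2 + \<epsilon>)" by (rule Limsup_bounded)
   then show "limsup (%n. F n z) <= ennreal (?o\<^sup>2) + ennreal \<epsilon>" using \<epsilon> by (simp add: ennreal_plus)
  qed
 qed
 have "limsup (%n. integral\<^sup>N Q (F n)) <= (\<integral>\<^sup>+ z. limsup (%n. F n z) \<partial>Q)"
  by (rule nn_integral_limsup[where w="%_. ennreal ((2 / c)^2 * 2)"])
    (use dom in \<open>auto simp: emeasure_space_1 ennreal_mult_less_top\<close>)
 also have "... <= (\<integral>\<^sup>+ z. ennreal ((odds (t z) (e z))^2) \<partial>Q)"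
  by (rule nn_integral_mono_AE[OF ptw])
 also have "... = ennreal odds_sq"
  unfolding odds_sq_def by (intro nn_integral_eq_integral integrable_odds_sq) simp
 also have "... < ennreal (odds_sq + \<epsilon> / 2)"
  using \<epsilon> by (subst ennreal_less_iff) (auto simp: odds_sq_def)
 finally have "\<forall>\<^sub>F n in sequentially. integral\<^sup>N Q (F n) < ennreal (odds_sq + \<epsilon> / 2)"
  by (rule Limsup_lessD)
 moreover have "\<forall>\<^sub>F n in sequentially. 1 / real (K n) < \<epsilon> / 2"
  using order_tendstoD(2)[OF inv, of "\<epsilon> / 2"] \<epsilon> by simp
 ultimately show ?thesis using good
 proof eventually_elim
  case (elim n)
  have n: "0 < real n" "0 < real (K n)" using elim by (auto simp: good_def)
  interpret P: prob_space "sample n" by (rule prob_space_sample)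
  let ?s = "%x. (\<Sum>i<n. (real (count n (K n) x i))\<^sup>2)"
  have eq: "(\<Sum>i<n. (real (count n (K n) x i) / real (K n))\<^sup>2) / real n = 1 / (real n * real (K n) ^ 2) * ?s x" for x
   by (simp add: power_divide sum_divide_distrib mult.commute)
  have nn: "0 <= ?s x" for x by (intro sum_nonneg) auto
  have int: "integrable (sample n) ?s"
  proof (rule P.integrable_const_bound[where B="\<Sum>i<n. (real n)\<^sup>2"])
   show "AE x in sample n. norm (?s x) <= (\<Sum>i<n. (real n)\<^sup>2)"
    using nn by (auto intro!: sum_mono power_mono simp: match_count_le simp del: sum_constant)
  qed measurable
  have "ennreal (\<integral>x. ?s x \<partial>sample n) = (\<integral>\<^sup>+ x. ennreal (?s x) \<partial>sample n)"
   by (intro nn_integral_eq_integral[symmetric] int) (simp add: nn)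
  also have "... <= ennreal (real n * real (K n)) + ennreal (real n ^ 3) * (\<integral>\<^sup>+ z. joint_mass n (K n) z \<partial>Q)"
   using elim by (intro second_moment_bound) (auto simp: good_def)
  finally have "ennreal (1 / (real n * real (K n) ^ 2)) * ennreal (\<integral>x. ?s x \<partial>sample n) <=
   ennreal (1 / (real n * real (K n) ^ 2)) * (ennreal (real n * real (K n)) + ennreal (real n ^ 3) * (\<integral>\<^sup>+ z. joint_mass n (K n) z \<partial>Q))"
   by (rule mult_left_mono) simp
  also have "... = ennreal (1 / real (K n)) + ennreal ((real n / real (K n))^2) * (\<integral>\<^sup>+ z. joint_mass n (K n) z \<partial>Q)"
   using n by (simp add: distrib_left mult.assoc[symmetric] ennreal_mult[symmetric] power_divide power2_eq_square power3_eq_cube)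
  also have "ennreal ((real n / real (K n))^2) * (\<integral>\<^sup>+ z. joint_mass n (K n) z \<partial>Q) = integral\<^sup>N Q (F n)"
  proof -
   have "F n = (%z. ennreal ((real n / real (K n))^2) * joint_mass n (K n) z)"
    using elim by (simp add: F_def fun_eq_iff)
   then show ?thesis by (simp add: nn_integral_cmult)
  qed
  also have "ennreal (1 / real (K n)) + integral\<^sup>N Q (F n) <= ennreal (\<epsilon> / 2) + ennreal (odds_sq + \<epsilon> / 2)"
   using elim by (intro add_mono ennreal_leI) auto
  also have "... = ennreal (odds_sq + \<epsilon>)"
   using \<epsilon> by (subst ennreal_plus[symmetric]) (auto simp: odds_sq_def intro!: add_nonneg_nonneg)
  finally have "ennreal (1 / (real n * real (K n) ^ 2) * (\<integral>x. ?s x \<partial>sample n)) <= ennreal (odds_sq + \<epsilon>)"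
   by (subst ennreal_mult) (auto intro!: Bochner_Integration.integral_nonneg nn)
  moreover have "0 <= odds_sq + \<epsilon>" using \<epsilon> by (auto simp: odds_sq_def intro!: add_nonneg_nonneg)
  ultimately have "1 / (real n * real (K n) ^ 2) * (\<integral>x. ?s x \<partial>sample n) <= odds_sq + \<epsilon>"
   by simp
  then show ?case unfolding eq by (simp only: integral_mult_right_zero)
 qed
qed

lemma count_bounded_integrable:
 assumes "\<phi> \<in> borel_measurable (sample n)" "!!x. \<bar>\<phi> x\<bar> <= B"
 shows "integrable (sample n) (\<phi> :: _ => real)"
proof -
 interpret P: prob_space "sample n" by (rule prob_space_sample)
 show ?thesis by (rule P.integrable_const_bound[where B=B]) (use assms in auto)
qed

text \<open>At almost every score the opposite arm has positive mass \<gamma> within \<delta>, so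
  Markov bounds the tail by (K / n) / \<gamma>. Outside 1 <= K <= n - 1 the guard inserts 0, which
  keeps the integrands bounded by 1 for every n.\<close>

lemma few_neighbours_limit:
 fixes K :: "nat => nat"
 assumes K: "filterlim K at_top sequentially" "(%n. real (K n) / real n) \<longlonglongrightarrow> 0" and \<delta>: "0 < \<delta>"
 shows "(%n. \<integral>z. (if 1 <= K n & K n <= n - 1 then binom_tail (n - 1) (K n) (grp (~ t z) {v. \<bar>v - e z\<bar> < \<delta>}) else 0) \<partial>Q) \<longlonglongrightarrow> 0"
proof -
 define \<gamma> where "\<gamma> z = grp (~ t z) {v. \<bar>v - e z\<bar> < \<delta>}" for z
 have \<gamma>_eq: "\<gamma> z = ball_mass (~ t z) (e z + \<delta>) (e z)" for z
  using \<delta> by (simp add: \<gamma>_def ball_mass_def)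
 have [measurable]: "\<gamma> \<in> borel_measurable Q" unfolding \<gamma>_eq[abs_def] by measurable
 have \<gamma>: "0 <= \<gamma> z" "\<gamma> z <= 1" for z by (simp_all add: \<gamma>_def)
 have [measurable]: "(%z. binom_tail N k (\<gamma> z)) \<in> borel_measurable Q" for N k
  unfolding binom_tail_def by measurable
 have "(%n. \<integral>z. (if 1 <= K n & K n <= n - 1 then binom_tail (n - 1) (K n) (\<gamma> z) else 0) \<partial>Q) \<longlonglongrightarrow> (LINT z|Q. 0)"
 proof (rule integral_dominated_convergence[where w="%_. 1"])
  show "AE z in Q. (%n. if 1 <= K n & K n <= n - 1 then binom_tail (n - 1) (K n) (\<gamma> z) else 0) \<longlonglongrightarrow> 0"
   using AE_good
  proof eventually_elim
   case (elim z)
   then have p: "0 < \<gamma> z" unfolding \<gamma>_def using \<delta> by (intro grp_ball_pos) auto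
   show ?case
   proof (rule tendsto_sandwich[OF _ _ tendsto_const])
    show "\<forall>\<^sub>F n in sequentially. 0 <= (if 1 <= K n & K n <= n - 1 then binom_tail (n - 1) (K n) (\<gamma> z) else 0)"
     using \<gamma> binom_tail_nonneg by auto
    show "\<forall>\<^sub>F n in sequentially. (if 1 <= K n & K n <= n - 1 then binom_tail (n - 1) (K n) (\<gamma> z) else 0) <= real (K n) / real n * (1 / \<gamma> z)"
    proof (intro always_eventually allI)
     fix n
     show "(if 1 <= K n & K n <= n - 1 then binom_tail (n - 1) (K n) (\<gamma> z) else 0) <= real (K n) / real n * (1 / \<gamma> z)"
     proof (cases "1 <= K n & K n <= n - 1")
      case True
      then have "binom_tail (n - 1) (K n) (\<gamma> z) <= real (K n) / (real (n - 1 + 1) * \<gamma> z)"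
       using p \<gamma> by (intro binom_tail_le_Markov) auto
      moreover have "n - 1 + 1 = n" using True by linarith
      ultimately show ?thesis using True by simp
     qed (use p in auto)
    qed
    show "(%n. real (K n) / real n * (1 / \<gamma> z)) \<longlonglongrightarrow> 0"
     using tendsto_mult_right[OF K(2), of "1 / \<gamma> z"] by simp
   qed
  qed
  show "AE z in Q. norm (if 1 <= K n & K n <= n - 1 then binom_tail (n - 1) (K n) (\<gamma> z) else 0) <= 1" for n
   using \<gamma> binom_tail_le_1 binom_tail_nonneg by (intro AE_I2) auto
 qed (auto simp del: One_nat_def)
 then show ?thesis unfolding \<gamma>_def by simp
qed

text \<open>By double counting the sum runs over the odds of the matches of each l. If l has K
  opposite units within \<delta>, all its matches are that close and, by the Lipschitz bound, have
  odds at least those of the opposite arm at the score of l, up to \<delta> / c^2. Otherwise the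
  loss is at most 1 / c, weighted by the probability of too few neighbours.\<close>

lemma cross_moment_bound:
 assumes K: "1 <= K" "K <= n - 1" and \<delta>: "0 < \<delta>"
 shows "odds_sq - \<delta> / c\<^sup>2 - 1 / c * (LINT z|Q. binom_tail (n - 1) K (grp (~ t z) {v. \<bar>v - e z\<bar> < \<delta>})) <=
  (\<integral>x. (\<Sum>i<n. real (count n K x i) / real K * odds (t (x i)) (e (x i))) / real n \<partial>sample n)"
proof -
 interpret P: prob_space "sample n" by (rule prob_space_sample)
 have n: "0 < real n" "0 < real K" using K by auto
 have te: "(%x. t (x i)) \<in> measurable (sample n) (count_space UNIV)" "(%x. e (x i)) \<in> borel_measurable (sample n)"
  if "i < n" for i
  using measurable_compose[OF sample_component[OF that] t_measurable]
   measurable_compose[OF sample_component[OF that] e_measurable] by simp_all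
 have cnt: "(%x. real (count n K x i)) \<in> borel_measurable (sample n)" for i
  using measurable_compose[OF count_measurable measurable_count_space] by simp
 define few where "few l x = (indicator {x. card {k \<in> {..<n} - {l}. t (x k) = (~ t (x l)) & \<bar>e (x k) - e (x l)\<bar> < \<delta>} < K} x :: real)" for l x
 have few_meas: "few l \<in> borel_measurable (sample n)" if l: "l < n" for l
 proof -
  have P: "Measurable.pred (sample n) (%x. t (x k) = (~ t (x l)) & \<bar>e (x k) - e (x l)\<bar> < \<delta>)" if "k < n" for k
  proof -
   note [measurable] = te[OF that] te[OF l]
   have "Measurable.pred (sample n) (%x. t (x k) = (~ t (x l)))"
    by (intro closer_measurable(2)[where d="%x. x k"] sample_component that l)
   moreover have "Measurable.pred (sample n) (%x. \<bar>e (x k) - e (x l)\<bar> < \<delta>)"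
    by (intro borel_measurable_pred_less borel_measurable_abs borel_measurable_diff te that l) auto
   ultimately show ?thesis by (rule pred_intros_logic)
  qed
  have eq: "card {k \<in> {..<n} - {l}. t (x k) = (~ t (x l)) & \<bar>e (x k) - e (x l)\<bar> < \<delta>} =
   (\<Sum>k\<in>{..<n} - {l}. if t (x k) = (~ t (x l)) & \<bar>e (x k) - e (x l)\<bar> < \<delta> then 1 else 0)" for x
   unfolding sum.If_cases[OF finite_Diff[OF finite_lessThan]]
   by (simp, intro arg_cong[where f=card]) blast
  have [measurable]: "(%x. card {k \<in> {..<n} - {l}. t (x k) = (~ t (x l)) & \<bar>e (x k) - e (x l)\<bar> < \<delta>}) \<in> measurable (sample n) (count_space UNIV)"
   unfolding eq using P by (intro measurable_sum_nat measurable_If) auto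
  show ?thesis unfolding few_def[abs_def] indicator_def mem_Collect_eq of_bool_def by measurable
 qed
 have few_int: "integrable (sample n) (few l)" if "l < n" for l
  using few_meas[OF that] by (intro count_bounded_integrable[where B=1]) (auto simp: few_def indicator_def)
 have few_exp: "(\<integral>x. few l x \<partial>sample n) = (LINT z|Q. binom_tail (n - 1) K (grp (~ t z) {v. \<bar>v - e z\<bar> < \<delta>}))" if l: "l < n" for l
 proof -
  have \<gamma>_eq: "grp (~ t z) {v. \<bar>v - e z\<bar> < \<delta>} = ball_mass (~ t z) (e z + \<delta>) (e z)" for z
   using \<delta> by (simp add: ball_mass_def)
  have bm: "(%z. binom_tail (n - 1) K (grp (~ t z) {v. \<bar>v - e z\<bar> < \<delta>})) \<in> borel_measurable Q"
   unfolding binom_tail_def \<gamma>_eq by measurable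
  have "ennreal (\<integral>x. few l x \<partial>sample n) = (\<integral>\<^sup>+ x. ennreal (few l x) \<partial>sample n)"
   by (intro nn_integral_eq_integral[symmetric] few_int l) (simp add: few_def)
  also have "... = (\<integral>\<^sup>+ z. ennreal (binom_tail (n - 1) K (grp (~ t z) {v. \<bar>v - e z\<bar> < \<delta>})) \<partial>Q)"
   unfolding few_neighbours_bound[OF l K, of \<delta>, symmetric] few_def
   by (intro nn_integral_cong) (simp add: indicator_def)
  also have "... = ennreal (LINT z|Q. binom_tail (n - 1) K (grp (~ t z) {v. \<bar>v - e z\<bar> < \<delta>}))"
  proof (rule nn_integral_eq_integral)
   show "integrable Q (%z. binom_tail (n - 1) K (grp (~ t z) {v. \<bar>v - e z\<bar> < \<delta>}))"
    by (rule integrable_const_bound[where B=1])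
     (use bm K in \<open>auto simp: binom_tail_nonneg intro!: binom_tail_le_1\<close>)
  qed (simp add: binom_tail_nonneg)
  finally show ?thesis
  proof (subst (asm) ennreal_inj)
   show "0 <= (\<integral>x. few l x \<partial>sample n)"
    by (intro Bochner_Integration.integral_nonneg) (simp add: few_def)
   show "0 <= (LINT z|Q. binom_tail (n - 1) K (grp (~ t z) {v. \<bar>v - e z\<bar> < \<delta>}))"
    by (intro Bochner_Integration.integral_nonneg) (simp add: binom_tail_nonneg)
  qed
 qed
 \<comment> \<open>The matches of l lie in the opposite arm, so this is the value their odds would
   take at the score of l itself. Its mean is \<open>odds_sq\<close> by
   \<open>integral_odds_opposite\<close>.\<close>
 define w where "w z = odds (~ t z) (e z)" for z
 have w_meas [measurable]: "w \<in> borel_measurable Q" unfolding w_def[abs_def] by measurable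
 have w_int: "integrable (sample n) (%x. w (x l))" if "l < n" for l
  using measurable_compose[OF sample_component[OF that] w_meas] odds_nonneg odds_le
  by (intro count_bounded_integrable[where B="1 / c"]) (auto simp: w_def)
 have lower: "w (x l) - \<delta> / c\<^sup>2 - 1 / c * few l x <= (\<Sum>i\<in>matches n K x l. odds (t (x i)) (e (x i))) / real K"
  for x l
 proof (cases "card {k \<in> {..<n} - {l}. t (x k) = (~ t (x l)) & \<bar>e (x k) - e (x l)\<bar> < \<delta>} < K")
  case True
  have "0 <= (\<Sum>i\<in>matches n K x l. odds (t (x i)) (e (x i))) / real K"
   by (intro divide_nonneg_nonneg sum_nonneg odds_nonneg) auto
  moreover have "w (x l) <= 1 / c" unfolding w_def by (rule odds_le)
  moreover have "0 <= \<delta> / c\<^sup>2" using \<delta> by simp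
  ultimately show ?thesis using True by (simp add: few_def)
 next
  case False
  then have close: "K <= card {k \<in> {..<n} - {l}. t (x k) = (~ t (x l)) & \<bar>e (x k) - e (x l)\<bar> < \<delta>}" by simp
  have "w (x l) - \<delta> / c\<^sup>2 <= odds (t (x i)) (e (x i))" if i: "i \<in> matches n K x l" for i
  proof -
   have "\<bar>odds (~ t (x l)) (e (x l)) - odds (~ t (x l)) (e (x i))\<bar> <= \<bar>e (x l) - e (x i)\<bar> / c\<^sup>2"
    by (rule odds_lipschitz)
   also have "... <= \<delta> / c\<^sup>2"
    using match_set_close(2)[OF close i] by (intro divide_right_mono) auto
   finally have "w (x l) - \<delta> / c\<^sup>2 <= odds (~ t (x l)) (e (x i))"
    unfolding w_def by linarith
   moreover have "t (x i) = (~ t (x l))" using match_setD(2)[OF i] by simp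
   ultimately show ?thesis by simp
  qed
  then have "(\<Sum>i\<in>matches n K x l. w (x l) - \<delta> / c\<^sup>2) <= (\<Sum>i\<in>matches n K x l. odds (t (x i)) (e (x i)))"
   by (rule sum_mono)
  then have "real K * (w (x l) - \<delta> / c\<^sup>2) <= (\<Sum>i\<in>matches n K x l. odds (t (x i)) (e (x i)))"
   using match_set_close(1)[OF close] by simp
  then have "w (x l) - \<delta> / c\<^sup>2 <= (\<Sum>i\<in>matches n K x l. odds (t (x i)) (e (x i))) / real K"
   using n by (simp add: pos_le_divide_eq mult.commute)
  then show ?thesis using False by (simp add: few_def)
 qed
 have total: "(\<Sum>i<n. real (count n K x i) / real K * odds (t (x i)) (e (x i))) =
   (\<Sum>l<n. (\<Sum>i\<in>matches n K x l. odds (t (x i)) (e (x i))) / real K)" for x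
 proof -
  have "(\<Sum>i<n. real (count n K x i) / real K * odds (t (x i)) (e (x i))) =
   (\<Sum>i<n. real (count n K x i) * odds (t (x i)) (e (x i))) / real K"
   by (simp add: sum_divide_distrib)
  also have "... = (\<Sum>l<n. \<Sum>i\<in>matches n K x l. odds (t (x i)) (e (x i))) / real K"
   by (simp only: sum_match_count)
  finally show ?thesis by (simp add: sum_divide_distrib)
 qed
 let ?R = "%x. (\<Sum>i<n. real (count n K x i) / real K * odds (t (x i)) (e (x i))) / real n"
 let ?L = "%x. (\<Sum>l<n. w (x l) - \<delta> / c\<^sup>2 - 1 / c * few l x) / real n"
 have R_int: "integrable (sample n) ?R"
 proof (rule count_bounded_integrable)
  show "?R \<in> borel_measurable (sample n)"
   using te cnt by (intro borel_measurable_divide borel_measurable_sum borel_measurable_times odds_measurable) auto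
  show "\<bar>?R x\<bar> <= (\<Sum>i<n. real n / real K * (1 / c)) / real n" for x
  proof -
   have "\<bar>\<Sum>i<n. real (count n K x i) / real K * odds (t (x i)) (e (x i))\<bar> <= (\<Sum>i<n. real n / real K * (1 / c))"
   proof (intro order_trans[OF sum_abs] sum_mono)
    fix i
    have "real (count n K x i) / real K * odds (t (x i)) (e (x i)) <= real n / real K * (1 / c)"
     using odds_nonneg odds_le match_count_le by (intro mult_mono divide_right_mono) auto
    then show "\<bar>real (count n K x i) / real K * odds (t (x i)) (e (x i))\<bar> <= real n / real K * (1 / c)"
     using odds_nonneg by (simp add: abs_mult)
   qed
   then show ?thesis unfolding abs_divide abs_of_nat by (rule divide_right_mono) simp
  qed
 qed
 have L_int: "integrable (sample n) (%x. w (x l) - \<delta> / c\<^sup>2 - 1 / c * few l x)" if "l < n" for l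
  using few_int[OF that] w_int[OF that] by auto
 have "(\<integral>x. ?L x \<partial>sample n) <= (\<integral>x. ?R x \<partial>sample n)"
 proof (rule integral_mono)
  show "integrable (sample n) ?L" using L_int by (intro integrable_divide Bochner_Integration.integrable_sum) auto
  show "?L x <= ?R x" for x
   unfolding total using lower n by (intro divide_right_mono sum_mono) auto
 qed (rule R_int)
 moreover have "(\<integral>x. ?L x \<partial>sample n) = odds_sq - \<delta> / c\<^sup>2 - 1 / c * (LINT z|Q. binom_tail (n - 1) K (grp (~ t z) {v. \<bar>v - e z\<bar> < \<delta>}))"
 proof -
  have "(\<integral>x. w (x l) - \<delta> / c\<^sup>2 - 1 / c * few l x \<partial>sample n) =
    odds_sq - \<delta> / c\<^sup>2 - 1 / c * (LINT z|Q. binom_tail (n - 1) K (grp (~ t z) {v. \<bar>v - e z\<bar> < \<delta>}))" if l: "l < n" for l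
  proof -
   have "(\<integral>x. w (x l) \<partial>sample n) = odds_sq"
    unfolding integral_sample_component[OF l w_meas] unfolding w_def by (rule integral_odds_opposite)
   then show ?thesis using few_int[OF l] w_int[OF l] few_exp[OF l] by (simp add: P.prob_space)
  qed
  then show ?thesis using L_int n by (simp add: Bochner_Integration.integral_sum)
 qed
 ultimately show ?thesis by simp
qed

text \<open>Expanding the square gives second moment minus twice the cross moment plus
  \<open>odds_sq\<close>. The upper bound \<open>odds_sq\<close> + \<epsilon> / 4 and the lower
  bound \<open>odds_sq\<close> - \<epsilon> / 4 leave at most 3 \<epsilon> / 4.\<close>

theorem match_weight_L2:
 fixes K :: "nat => nat"
 assumes K: "filterlim K at_top sequentially" "(%n. real (K n) / real n) \<longlonglongrightarrow> 0"
 shows "(%n. \<integral>x. (\<Sum>i<n. (real (count n (K n) x i) / real (K n) - odds (t (x i)) (e (x i)))\<^sup>2) / real n \<partial>sample n) \<longlonglongrightarrow> 0"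
proof (rule LIMSEQ_I)
 fix \<epsilon> :: real assume \<epsilon>: "0 < \<epsilon>"
 \<comment> \<open>The Lipschitz error \<delta> / c^2 is then \<epsilon> / 8; the other \<epsilon> /
   8 is reserved for units with too few neighbours.\<close>
 define \<delta> where "\<delta> = \<epsilon> / 8 * c\<^sup>2"
 have \<delta>: "0 < \<delta>" "\<delta> / c\<^sup>2 = \<epsilon> / 8" using \<epsilon> c_pos by (auto simp: \<delta>_def)
 have K1: "\<forall>\<^sub>F n in sequentially. 1 <= K n"
  using K(1) by (simp add: filterlim_at_top)
 have "\<forall>\<^sub>F n in sequentially. real (K n) / real n < 1 / 2"
  using order_tendstoD(2)[OF K(2), of "1 / 2"] by simp
 with eventually_ge_at_top[of 6] have K3: "\<forall>\<^sub>F n in sequentially. K n <= n - 1 & 1 <= n"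
 proof eventually_elim
  case (elim n)
  then have "2 * real (K n) < real n" by (simp add: field_simps)
  then show ?case using elim by linarith
 qed
 have "(%n. 1 / c * (LINT z|Q. (if 1 <= K n & K n <= n - 1 then binom_tail (n - 1) (K n) (grp (~ t z) {v. \<bar>v - e z\<bar> < \<delta>}) else 0))) \<longlonglongrightarrow> 1 / c * 0"
  by (intro tendsto_mult_left few_neighbours_limit K \<delta>(1))
 then have few: "\<forall>\<^sub>F n in sequentially. 1 / c * (LINT z|Q. (if 1 <= K n & K n <= n - 1 then binom_tail (n - 1) (K n) (grp (~ t z) {v. \<bar>v - e z\<bar> < \<delta>}) else 0)) < \<epsilon> / 8"
  using \<epsilon> by (intro order_tendstoD) auto
 have second: "\<forall>\<^sub>F n in sequentially. (\<integral>x. (\<Sum>i<n. (real (count n (K n) x i) / real (K n))\<^sup>2) / real n \<partial>sample n) <= odds_sq + \<epsilon> / 4"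
  using \<epsilon> by (intro limsup_second_moment K) auto
 have "\<forall>\<^sub>F n in sequentially. norm ((\<integral>x. (\<Sum>i<n. (real (count n (K n) x i) / real (K n) - odds (t (x i)) (e (x i)))\<^sup>2) / real n \<partial>sample n) - 0) < \<epsilon>"
  using second few K1 K3
 proof eventually_elim
  case (elim n)
  have n: "0 < real n" "0 < real (K n)" using elim by auto
  have te: "(%x. t (x i)) \<in> measurable (sample n) (count_space UNIV)" "(%x. e (x i)) \<in> borel_measurable (sample n)"
   if "i < n" for i
   using measurable_compose[OF sample_component[OF that] t_measurable]
    measurable_compose[OF sample_component[OF that] e_measurable] by simp_all
  have cnt: "(%x. real (count n (K n) x i)) \<in> borel_measurable (sample n)" for i
   using measurable_compose[OF count_measurable measurable_count_space] by simp
  define a where "a x i = real (count n (K n) x i) / real (K n)" for x i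
  define b where "b x i = odds (t (x i)) (e (x i))" for x :: "nat => 'a" and i
  have ab: "0 <= a x i" "a x i <= real n / real (K n)" "0 <= b x i" "b x i <= 1 / c" for x i
   using odds_nonneg odds_le match_count_le by (auto simp: a_def b_def intro!: divide_right_mono)
  have a_meas: "(%x. a x i) \<in> borel_measurable (sample n)" for i
   unfolding a_def using cnt by auto
  have b_meas: "(%x. b x i) \<in> borel_measurable (sample n)" if "i < n" for i
   unfolding b_def using te[OF that] by (intro odds_measurable)
  have int_aa: "integrable (sample n) (%x. (a x i)^2)" for i
   using a_meas[of i] ab by (intro count_bounded_integrable[where B="(real n / real (K n))^2"]) (auto intro!: power_mono)
  have int_ab: "integrable (sample n) (%x. a x i * b x i)" if "i < n" for i
  proof (rule count_bounded_integrable[where B="real n / real (K n) * (1 / c)"])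
   show "\<bar>a x i * b x i\<bar> <= real n / real (K n) * (1 / c)" for x
    using mult_mono[OF ab(2) ab(4) _ ab(3), of x i x i] ab(1,3)[of x i] by (simp add: abs_mult)
  qed (use a_meas[of i] b_meas[OF that] in measurable)
  have int_bb: "integrable (sample n) (%x. (b x i)^2)" if "i < n" for i
   using b_meas[OF that] ab by (intro count_bounded_integrable[where B="(1 / c)^2"]) (auto intro!: power_mono)
  have exp_bb: "(\<integral>x. (b x i)\<^sup>2 \<partial>sample n) = odds_sq" if "i < n" for i
   unfolding b_def odds_sq_def by (rule integral_sample_component[OF that]) measurable
  have "(\<integral>x. (\<Sum>i<n. (a x i - b x i)\<^sup>2) / real n \<partial>sample n) =
   (\<integral>x. (\<Sum>i<n. (a x i)\<^sup>2) / real n - 2 * ((\<Sum>i<n. a x i * b x i) / real n) + (\<Sum>i<n. (b x i)\<^sup>2) / real n \<partial>sample n)"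
   by (intro Bochner_Integration.integral_cong refl)
    (simp add: power2_diff sum.distrib sum_subtractf add_divide_distrib diff_divide_distrib sum_distrib_left mult.assoc)
  also have "... = (\<integral>x. (\<Sum>i<n. (a x i)\<^sup>2) / real n \<partial>sample n) - 2 * (\<integral>x. (\<Sum>i<n. a x i * b x i) / real n \<partial>sample n)
    + (\<integral>x. (\<Sum>i<n. (b x i)\<^sup>2) / real n \<partial>sample n)"
  proof -
   define A B C where "A x = (\<Sum>i<n. (a x i)\<^sup>2) / real n" and "B x = (\<Sum>i<n. a x i * b x i) / real n"
    and "C x = (\<Sum>i<n. (b x i)\<^sup>2) / real n" for x
   have "integrable (sample n) A" "integrable (sample n) B" "integrable (sample n) C"
    unfolding A_def B_def C_def using int_aa int_ab int_bb
    by (auto intro!: integrable_divide Bochner_Integration.integrable_sum)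
   then show ?thesis unfolding A_def[symmetric] B_def[symmetric] C_def[symmetric] by simp
  qed
  also have "(\<integral>x. (\<Sum>i<n. (b x i)\<^sup>2) / real n \<partial>sample n) = odds_sq"
   using int_bb exp_bb n by (simp add: Bochner_Integration.integral_sum)
  finally have eq: "(\<integral>x. (\<Sum>i<n. (a x i - b x i)\<^sup>2) / real n \<partial>sample n) =
   (\<integral>x. (\<Sum>i<n. (a x i)\<^sup>2) / real n \<partial>sample n) - 2 * (\<integral>x. (\<Sum>i<n. a x i * b x i) / real n \<partial>sample n) + odds_sq" .
  have "odds_sq - \<epsilon> / 4 <= (\<integral>x. (\<Sum>i<n. a x i * b x i) / real n \<partial>sample n)"
   using cross_moment_bound[of "K n" n \<delta>] elim \<delta> unfolding a_def b_def by auto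
  moreover have "(\<integral>x. (\<Sum>i<n. (a x i)\<^sup>2) / real n \<partial>sample n) <= odds_sq + \<epsilon> / 4"
   using elim unfolding a_def by simp
  moreover have "0 <= (\<integral>x. (\<Sum>i<n. (a x i - b x i)\<^sup>2) / real n \<partial>sample n)"
   by (intro Bochner_Integration.integral_nonneg divide_nonneg_nonneg sum_nonneg) auto
  ultimately show ?case using eq \<epsilon> unfolding a_def b_def by simp
 qed
 then show "\<exists>no. \<forall>n\<ge>no. norm ((\<integral>x. (\<Sum>i<n. (real (count n (K n) x i) / real (K n) - odds (t (x i)) (e (x i)))\<^sup>2) / real n \<partial>sample n) - 0) < \<epsilon>"
  by (simp add: eventually_sequentially)
qed

end

section \<open>Conditional probabilities, ignorability and weighting\<close>

lemma space_full [simp]: "space full_space = UNIV"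
 by (simp add: space_pair_measure)

lemma space_obs [simp]: "space obs_space = UNIV"
 by (simp add: space_pair_measure)

lemma cov_measurable [measurable]: "cov \<in> borel_measurable (full_space :: 'x::euclidean_space unit_data measure)"
 unfolding cov_def[abs_def] by measurable

lemma trt_measurable [measurable]: "trt \<in> measurable (full_space :: 'x::euclidean_space unit_data measure) (count_space UNIV)"
 unfolding trt_def[abs_def] by measurable

lemma pot_measurable [measurable]: "pot a \<in> borel_measurable (full_space :: 'x::euclidean_space unit_data measure)"
 unfolding pot_def[abs_def] by (cases a) simp_all

lemma obs_outcome_eq: "obs_outcome z = pot (trt z) z"
 by (simp add: obs_outcome_def pot_def)

lemma obs_outcome_measurable [measurable]:
 "obs_outcome \<in> borel_measurable (full_space :: 'x::euclidean_space unit_data measure)"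
 unfolding obs_outcome_def[abs_def] by measurable

definition prop_of :: "('x => real) => bool => 'x => real" where
 "prop_of s a x = (if a then s x else 1 - s x)"

lemma ennreal_of_bool: "ennreal (of_bool b) = of_bool b"
 by (cases b) simp_all

lemma prop_of_measurable [measurable]: "s \<in> borel_measurable M ==> prop_of s a \<in> borel_measurable M"
 unfolding prop_of_def[abs_def] by (cases a) simp_all

abbreviation xyy_space :: "('x::euclidean_space \<times> real \<times> real) measure" where
 "xyy_space \<equiv> borel \<Otimes>\<^sub>M (borel \<Otimes>\<^sub>M borel)"

text \<open>\<open>ipw Q s\<close>: weighting by the indicator of the treatment arm \<open>a\<close> and by its propensity
 give the same law of \<open>(X, Y(0), Y(1))\<close>; for a law with score \<open>s\<close> this is equivalent to ignorability.\<close>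

definition ipw :: "'x::euclidean_space unit_data measure => ('x => real) => bool" where
 "ipw Q s \<longleftrightarrow> (\<forall>a.
   distr (density Q (%z. of_bool (trt z = a))) xyy_space (%z. (cov z, pot False z, pot True z)) =
   distr (density Q (%z. ennreal (prop_of s a (cov z)))) xyy_space (%z. (cov z, pot False z, pot True z)))"

lemma measure_eqI_rectangles:
 assumes M: "sets M = sets (A \<Otimes>\<^sub>M B)" and N: "sets N = sets (A \<Otimes>\<^sub>M B)" and fin: "emeasure M (space A \<times> space B) ~= \<infinity>"
  and eq: "!!C D. C \<in> sets A ==> D \<in> sets B ==> emeasure M (C \<times> D) = emeasure N (C \<times> D)"
 shows "M = N"
proof (rule measure_eqI_generator_eq)
 let ?G = "{a \<times> b | a b. a \<in> sets A & b \<in> sets B}"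
 show "Int_stable ?G" by (rule Int_stable_pair_measure_generator)
 show "?G \<subseteq> Pow (space A \<times> space B)" by (rule pair_measure_closed)
 show "sets M = sigma_sets (space A \<times> space B) ?G" "sets N = sigma_sets (space A \<times> space B) ?G"
  unfolding M N by (rule sets_pair_measure)+
 show "range (%_::nat. space A \<times> space B) \<subseteq> ?G" by blast
 show "(\<Union>_::nat. space A \<times> space B) = space A \<times> space B" by simp
 show "emeasure M (space A \<times> space B) ~= \<infinity>" for i :: nat
  by (rule fin)
 fix X assume "X \<in> ?G"
 then obtain a b where "a \<in> sets A" "b \<in> sets B" "X = a \<times> b" by blast
 then show "emeasure M X = emeasure N X" using eq by simp
qed

text \<open>Test the inequality on the set where it fails.\<close>

lemma (in prob_space) AE_le_version:
 fixes F G :: "'b::topological_space => real"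
 assumes [measurable]: "X \<in> borel_measurable M" "F \<in> borel_measurable borel" "G \<in> borel_measurable borel"
  and int: "integrable M (%z. F (X z))" "integrable M (%z. G (X z))"
  and le: "!!C. C \<in> sets borel ==> (LINT z|M. indicator C (X z) * F (X z)) <= (LINT z|M. indicator C (X z) * G (X z))"
 shows "AE z in M. F (X z) <= G (X z)"
proof -
 define C where "C = {x. G x < F x}"
 have "{x \<in> space borel. G x < F x} \<in> sets borel" by measurable
 then have C [measurable]: "C \<in> sets borel" by (simp add: C_def)
 have iF: "integrable M (%z. indicator C (X z) * F (X z))"
  by (rule Bochner_Integration.integrable_bound[OF int(1)]) (auto simp: indicator_def)
 have iG: "integrable M (%z. indicator C (X z) * G (X z))"
  by (rule Bochner_Integration.integrable_bound[OF int(2)]) (auto simp: indicator_def)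
 have nn: "0 <= indicator C (X z) * F (X z) - indicator C (X z) * G (X z)" for z
  by (auto simp: C_def indicator_def)
 have "(LINT z|M. indicator C (X z) * F (X z) - indicator C (X z) * G (X z)) = 0"
 proof (rule antisym)
  show "(LINT z|M. indicator C (X z) * F (X z) - indicator C (X z) * G (X z)) <= 0"
   using le[OF C] iF iG by simp
  show "0 <= (LINT z|M. indicator C (X z) * F (X z) - indicator C (X z) * G (X z))"
   by (rule Bochner_Integration.integral_nonneg) (rule nn)
 qed
 then have "AE z in M. indicator C (X z) * F (X z) - indicator C (X z) * G (X z) = 0"
  using integral_nonneg_eq_0_iff_AE[OF Bochner_Integration.integrable_diff[OF iF iG]] nn by simp
 then show ?thesis by eventually_elim (auto simp: C_def indicator_def split: if_splits)
qed

text \<open>A conditional expectation is a random variable on \<open>M\<close>; what is wanted is a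
  Borel function on the value space. It is the Radon-Nikodym derivative of the law of
  \<open>X\<close> restricted to \<open>S\<close> with respect to the law of \<open>X\<close>. The
  derivative is at most 1 only almost surely, so it is cut off at 1.\<close>

lemma (in prob_space) conditional_probability_version:
 fixes X :: "'a => 'b::topological_space"
 assumes [measurable]: "X \<in> borel_measurable M" "Measurable.pred M S"
 obtains F :: "'b => real" where "F \<in> borel_measurable borel" "!!x. 0 <= F x" "!!x. F x <= 1"
  "!!C. C \<in> sets borel ==> (LINT z|M. indicator C (X z) * F (X z)) = (LINT z|M. indicator C (X z) * of_bool (S z))"
proof -
 let ?M = "distr M borel X" and ?N = "distr (density M (%z. of_bool (S z))) borel X"
 interpret D: prob_space ?M by (rule prob_space_distr) measurable
 have N: "emeasure ?N C = (\<integral>\<^sup>+ z. of_bool (S z) * indicator C (X z) \<partial>M)" if [measurable]: "C \<in> sets borel" for C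
 proof -
  have "X -` C \<inter> space M \<in> sets M" by measurable
  then have "emeasure ?N C = (\<integral>\<^sup>+ z. of_bool (S z) * indicator (X -` C \<inter> space M) z \<partial>M)"
   by (subst emeasure_distr) (auto simp: emeasure_density)
  also have "... = (\<integral>\<^sup>+ z. of_bool (S z) * indicator C (X z) \<partial>M)"
   by (intro nn_integral_cong) (auto simp: indicator_def)
  finally show ?thesis .
 qed
 have NM: "emeasure ?N C <= emeasure ?M C" if [measurable]: "C \<in> sets borel" for C
 proof -
  have [measurable]: "X -` C \<inter> space M \<in> sets M" by measurable
  have "emeasure ?M C = (\<integral>\<^sup>+ z. indicator (X -` C \<inter> space M) z \<partial>M)"
   by (subst emeasure_distr) simp_all
  also have "... = (\<integral>\<^sup>+ z. indicator C (X z) \<partial>M)"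
   by (intro nn_integral_cong) (auto simp: indicator_def)
  finally show ?thesis unfolding N[OF that] by (simp add: nn_integral_mono of_bool_def)
 qed
 have fin: "finite_measure ?N"
 proof
  show "emeasure ?N (space ?N) ~= \<infinity>"
   using NM[of UNIV] D.emeasure_space_1 by (auto simp: top_unique)
 qed
 have ac: "absolutely_continuous ?M ?N"
  unfolding absolutely_continuous_def
 proof
  fix C assume "C \<in> null_sets ?M"
  then show "C \<in> null_sets ?N" using NM[of C] by (auto simp: null_sets_def)
 qed
 obtain D where D: "D \<in> borel_measurable ?M" "AE x in ?M. RN_deriv ?M ?N x = ennreal (D x)" "!!x. 0 <= D x"
  using D.real_RN_deriv[OF fin ac] by auto
 have [measurable]: "D \<in> borel_measurable borel" using D(1) by simp
 have dens: "density ?M (%x. ennreal (D x)) = ?N"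
 proof -
  have "density ?M (%x. ennreal (D x)) = density ?M (RN_deriv ?M ?N)"
   using D(2) by (intro density_cong) (auto elim: eventually_mono)
  then show ?thesis using D.density_RN_deriv[OF ac] by simp
 qed
 have Dint: "(\<integral>\<^sup>+ z. ennreal (indicator C (X z) * D (X z)) \<partial>M) = (\<integral>\<^sup>+ z. of_bool (S z) * indicator C (X z) \<partial>M)"
  if [measurable]: "C \<in> sets borel" for C
 proof -
  have "(\<integral>\<^sup>+ z. ennreal (indicator C (X z) * D (X z)) \<partial>M) = (\<integral>\<^sup>+ x. ennreal (D x) * indicator C x \<partial>?M)"
   by (subst nn_integral_distr) (auto intro!: nn_integral_cong simp: indicator_def)
  also have "... = emeasure (density ?M (%x. ennreal (D x))) C"
   by (simp add: emeasure_density)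
  finally show ?thesis unfolding dens N[OF that] .
 qed
 have Dintegrable: "integrable M (%z. D (X z))"
 proof (rule integrableI_nonneg)
  have "(\<integral>\<^sup>+ z. ennreal (D (X z)) \<partial>M) = (\<integral>\<^sup>+ z. of_bool (S z) \<partial>M)"
   using Dint[of UNIV] by simp
  also have "... <= (\<integral>\<^sup>+ z. 1 \<partial>M)"
   by (intro nn_integral_mono) simp
  also have "... < \<infinity>" using emeasure_space_1 by simp
  finally show "(\<integral>\<^sup>+ z. ennreal (D (X z)) \<partial>M) < \<infinity>" .
 qed (use D in auto)
 have version: "(LINT z|M. indicator C (X z) * D (X z)) = (LINT z|M. indicator C (X z) * of_bool (S z))"
  if C [measurable]: "C \<in> sets borel" for C
 proof -
  have intC: "integrable M (%z. indicator C (X z) * D (X z))"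
   by (rule Bochner_Integration.integrable_bound[OF Dintegrable]) (use D in \<open>auto simp: indicator_def\<close>)
  have "ennreal (LINT z|M. indicator C (X z) * of_bool (S z)) = (\<integral>\<^sup>+ z. ennreal (indicator C (X z) * of_bool (S z)) \<partial>M)"
   by (intro nn_integral_eq_integral[symmetric] integrable_const_bound[where B=1]) (auto simp: indicator_def of_bool_def)
  also have "... = (\<integral>\<^sup>+ z. of_bool (S z) * indicator C (X z) \<partial>M)"
   by (intro nn_integral_cong) (auto simp: indicator_def of_bool_def)
  also have "... = (\<integral>\<^sup>+ z. ennreal (indicator C (X z) * D (X z)) \<partial>M)"
   by (rule Dint[symmetric]) simp
  also have "... = ennreal (LINT z|M. indicator C (X z) * D (X z))"
   using D by (intro nn_integral_eq_integral intC) auto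
  finally show ?thesis
   using D by (subst (asm) ennreal_inj) (auto intro!: Bochner_Integration.integral_nonneg)
 qed
 have "AE z in M. D (X z) <= 1"
 proof (rule AE_le_version[where F=D and G="%_. 1" and X=X])
  fix C :: "'b set" assume [measurable]: "C \<in> sets borel"
  have "(LINT z|M. indicator C (X z) * of_bool (S z)) <= (\<integral>z. indicator C (X z) * 1 \<partial>M :: real)"
   by (intro integral_mono integrable_const_bound[where B=1]) (auto simp: indicator_def of_bool_def)
  then show "(LINT z|M. indicator C (X z) * D (X z)) <= (LINT z|M. indicator C (X z) * 1)"
   using version[of C] by simp
 qed (use Dintegrable in auto)
 then have eq: "AE z in M. min 1 (D (X z)) = D (X z)" by eventually_elim simp
 show ?thesis
 proof (rule that[of "%x. min 1 (D x)"])
  fix C :: "'b set" assume [measurable]: "C \<in> sets borel"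
  have "(LINT z|M. indicator C (X z) * min 1 (D (X z))) = (LINT z|M. indicator C (X z) * D (X z))"
   using eq by (intro integral_cong_AE) auto
  also have "... = (LINT z|M. indicator C (X z) * of_bool (S z))" by (rule version) simp
  finally show "(LINT z|M. indicator C (X z) * min 1 (D (X z))) = (LINT z|M. indicator C (X z) * of_bool (S z))" .
 qed (use D in auto)
qed

locale unit_law = prob_space Q for Q :: "'x::euclidean_space unit_data measure" +
 assumes sets_Q [measurable_cong]: "sets Q = sets full_space"
begin

lemma space_Q [simp]: "space Q = UNIV"
 using sets_eq_imp_space_eq[OF sets_Q] by simp

lemma ipw_nn_integral:
 assumes "ipw Q s" and [measurable]: "s \<in> borel_measurable borel"
  and [measurable]: "h \<in> borel_measurable xyy_space"
 shows "(\<integral>\<^sup>+ z. of_bool (trt z = a) * h (cov z, pot False z, pot True z) \<partial>Q) =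
  (\<integral>\<^sup>+ z. ennreal (prop_of s a (cov z)) * h (cov z, pot False z, pot True z) \<partial>Q)"
proof -
 have "(\<integral>\<^sup>+ y. h y \<partial>distr (density Q (%z. of_bool (trt z = a))) xyy_space (%z. (cov z, pot False z, pot True z))) =
  (\<integral>\<^sup>+ y. h y \<partial>distr (density Q (%z. ennreal (prop_of s a (cov z)))) xyy_space (%z. (cov z, pot False z, pot True z)))"
  using assms(1) unfolding ipw_def by simp
 then show ?thesis
  by (subst (asm) (1 2) nn_integral_distr, simp, simp, simp, simp, subst (asm) (1 2) nn_integral_density) (simp_all add: of_bool_def)
qed

lemma ipw_integral:
 fixes h :: "'x => real => real => real"
 assumes "ipw Q s" and [measurable]: "s \<in> borel_measurable borel" and s: "!!x. 0 <= s x" "!!x. s x <= 1"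
  and [measurable]: "(%(x, y0, y1). h x y0 y1) \<in> borel_measurable xyy_space"
 shows "(LINT z|Q. of_bool (trt z = a) * h (cov z) (pot False z) (pot True z)) =
   (LINT z|Q. prop_of s a (cov z) * h (cov z) (pot False z) (pot True z))"
  and "integrable Q (%z. of_bool (trt z = a) * h (cov z) (pot False z) (pot True z)) \<longleftrightarrow>
   integrable Q (%z. prop_of s a (cov z) * h (cov z) (pot False z) (pot True z))"
proof -
 let ?H = "%(x, y0, y1). h x y0 y1"
 let ?M = "distr (density Q (%z. ennreal (of_bool (trt z = a)))) xyy_space (%z. (cov z, pot False z, pot True z))"
 let ?N = "distr (density Q (%z. ennreal (prop_of s a (cov z)))) xyy_space (%z. (cov z, pot False z, pot True z))"
 have eq: "?M = ?N" using assms(1) unfolding ipw_def by (simp add: ennreal_of_bool)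
 have nn: "0 <= prop_of s a x" for x using s by (simp add: prop_of_def)
 have [measurable]: "(%z. h (cov z) (pot False z) (pot True z)) \<in> borel_measurable Q"
  using measurable_compose[OF _ assms(5), of "%z. (cov z, pot False z, pot True z)" Q] by simp
 have "(\<integral>y. ?H y \<partial>?M) = (LINT z|Q. of_bool (trt z = a) * h (cov z) (pot False z) (pot True z))"
  by (subst integral_distr, simp, simp, subst integral_density) auto
 moreover have "(\<integral>y. ?H y \<partial>?N) = (LINT z|Q. prop_of s a (cov z) * h (cov z) (pot False z) (pot True z))"
  by (subst integral_distr, simp, simp, subst integral_density) (auto simp: nn)
 ultimately show "(LINT z|Q. of_bool (trt z = a) * h (cov z) (pot False z) (pot True z)) =
   (LINT z|Q. prop_of s a (cov z) * h (cov z) (pot False z) (pot True z))" using eq by simp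
 have "integrable ?M ?H \<longleftrightarrow> integrable Q (%z. of_bool (trt z = a) * h (cov z) (pot False z) (pot True z))"
  by (subst integrable_distr_eq, simp, simp, subst integrable_density) auto
 moreover have "integrable ?N ?H \<longleftrightarrow> integrable Q (%z. prop_of s a (cov z) * h (cov z) (pot False z) (pot True z))"
  by (subst integrable_distr_eq, simp, simp, subst integrable_density) (auto simp: nn)
 ultimately show "integrable Q (%z. of_bool (trt z = a) * h (cov z) (pot False z) (pot True z)) \<longleftrightarrow>
   integrable Q (%z. prop_of s a (cov z) * h (cov z) (pot False z) (pot True z))" using eq by simp
qed

end

lemma subalgebra_vimage:
 assumes "U \<in> borel_measurable Q"
 shows "subalgebra Q (vimage_algebra (space Q) U borel)"
 unfolding subalgebra_def using assms by (auto simp: sets_vimage_algebra2 dest: measurable_sets)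

context prob_space
begin

lemma cexp_subalgebra:
 assumes "U \<in> borel_measurable M"
 shows "sigma_finite_subalgebra M (vimage_algebra (space M) U borel)"
proof -
 interpret finite_measure_subalgebra M "vimage_algebra (space M) U borel"
  using subalgebra_vimage[OF assms] by unfold_locales
 show ?thesis by unfold_locales
qed

lemma vimage_borel_measurable [intro]:
 assumes "U \<in> borel_measurable M" "k \<in> borel_measurable borel"
 shows "(%z. k (U z)) \<in> borel_measurable (vimage_algebra (space M) U borel)"
 using assms by (intro measurable_compose[OF measurable_vimage_algebra1]) auto

lemma cexp_integral:
 assumes U: "U \<in> borel_measurable M" and "k \<in> borel_measurable borel" "f \<in> borel_measurable M"
  and "integrable M (%z. k (U z) * f z)"
 shows "integrable M (%z. k (U z) * cexp M U f z)" "(LINT z|M. k (U z) * cexp M U f z) = (LINT z|M. k (U z) * f z)"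
proof -
 interpret sigma_finite_subalgebra M "vimage_algebra (space M) U borel"
  using U by (rule cexp_subalgebra)
 show "integrable M (%z. k (U z) * cexp M U f z)" "(LINT z|M. k (U z) * cexp M U f z) = (LINT z|M. k (U z) * f z)"
  unfolding cexp_def using real_cond_exp_intg[OF assms(4) vimage_borel_measurable[OF U assms(2)] assms(3)] .
qed

lemma cexp_measurable [measurable]: "U \<in> borel_measurable M ==> cexp M U f \<in> borel_measurable M"
proof -
 assume U: "U \<in> borel_measurable M"
 interpret sigma_finite_subalgebra M "vimage_algebra (space M) U borel"
  using U by (rule cexp_subalgebra)
 show ?thesis unfolding cexp_def by simp
qed

lemma cexp_charact:
 assumes U: "U \<in> borel_measurable M" and f: "integrable M f" and g: "integrable M g"
  and gm: "g \<in> borel_measurable (vimage_algebra (space M) U borel)"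
  and eq: "!!S. S \<in> sets borel ==> (LINT z|M. indicator S (U z) * f z) = (LINT z|M. indicator S (U z) * g z)"
 shows "AE z in M. cexp M U f z = g z"
proof -
 interpret sigma_finite_subalgebra M "vimage_algebra (space M) U borel"
  using U by (rule cexp_subalgebra)
 show ?thesis unfolding cexp_def
 proof (rule real_cond_exp_charact[OF _ f g gm])
  fix A assume "A \<in> sets (vimage_algebra (space M) U borel)"
  then obtain S where S: "S \<in> sets borel" "A = U -` S \<inter> space M"
   by (auto simp: sets_vimage_algebra2)
  have *: "(\<integral>z\<in>A. k z \<partial>M) = (LINT z|M. indicator S (U z) * k z)" for k :: "'a => real"
   unfolding set_lebesgue_integral_def S by (intro Bochner_Integration.integral_cong) (auto simp: indicator_def)
  show "(\<integral>z\<in>A. f z \<partial>M) = (\<integral>z\<in>A. g z \<partial>M)"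
   unfolding * using eq[OF S(1)] .
 qed
qed

end

context unit_law
begin

lemma cprob_integral:
 assumes [measurable]: "U \<in> borel_measurable Q" "k \<in> borel_measurable borel" "Measurable.pred Q S"
  and k: "!!x. \<bar>k x\<bar> <= B"
 shows "(LINT z|Q. k (U z) * cprob Q U S z) = (LINT z|Q. k (U z) * of_bool (S z))"
  and "integrable Q (%z. k (U z) * cprob Q U S z)"
proof -
 have "integrable Q (%z. k (U z) * of_bool (S z))"
  by (rule integrable_const_bound[where B=B]) (use k order_trans[OF abs_ge_zero k] in \<open>auto simp: abs_mult of_bool_def\<close>)
 then show "(LINT z|Q. k (U z) * cprob Q U S z) = (LINT z|Q. k (U z) * of_bool (S z))"
   "integrable Q (%z. k (U z) * cprob Q U S z)"
  unfolding cprob_def by (intro cexp_integral; simp)+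
qed

lemma cprob_charact:
 assumes [measurable]: "U \<in> borel_measurable Q" "Measurable.pred Q S" and "integrable Q g"
  and "g \<in> borel_measurable (vimage_algebra (space Q) U borel)"
  and "!!C. C \<in> sets borel ==> (LINT z|Q. indicator C (U z) * of_bool (S z)) = (LINT z|Q. indicator C (U z) * g z)"
 shows "AE z in Q. cprob Q U S z = g z"
 unfolding cprob_def
proof (rule cexp_charact)
 show "integrable Q (%z. of_bool (S z) :: real)"
  by (rule integrable_const_bound[where B=1]) (auto simp: of_bool_def)
qed (use assms in auto)

lemma cprob_arm:
 assumes [measurable]: "s \<in> borel_measurable borel" and s: "AE z in Q. s (cov z) = cprob Q cov trt z"
  and b: "!!x. 0 <= s x" "!!x. s x <= 1"
 shows "AE z in Q. cprob Q cov (%z. trt z = a) z = prop_of s a (cov z)"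
proof (rule cprob_charact)
 have int: "integrable Q (%z. s (cov z))"
  by (rule integrable_const_bound[where B=1]) (use b in auto)
 then show "integrable Q (%z. prop_of s a (cov z))" by (cases a) (simp_all add: prop_of_def)
 show "(%z. prop_of s a (cov z)) \<in> borel_measurable (vimage_algebra (space Q) cov borel)"
  by (intro vimage_borel_measurable) measurable
 fix C :: "'x set" assume [measurable]: "C \<in> sets borel"
 have T: "(LINT z|Q. indicator C (cov z) * of_bool (trt z)) = (LINT z|Q. indicator C (cov z) * s (cov z))"
 proof -
  have "(LINT z|Q. indicator C (cov z) * of_bool (trt z)) = (LINT z|Q. indicator C (cov z) * cprob Q cov trt z)"
   by (rule cprob_integral(1)[where B=1, symmetric]) (auto simp: indicator_def)
  also have "... = (LINT z|Q. indicator C (cov z) * s (cov z))"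
   using s by (intro integral_cong_AE) (auto simp: cprob_def)
  finally show ?thesis .
 qed
 have intC: "integrable Q (%z. indicator C (cov z) * of_bool (trt z) :: real)" "integrable Q (%z. indicator C (cov z) :: real)"
  "integrable Q (%z. indicator C (cov z) * s (cov z))"
  by (rule integrable_const_bound[where B=1]; use b in \<open>auto simp: indicator_def of_bool_def\<close>)+
 show "(LINT z|Q. indicator C (cov z) * of_bool (trt z = a)) = (LINT z|Q. indicator C (cov z) * prop_of s a (cov z))"
 proof (cases a)
  case True
  then show ?thesis using T by (simp add: prop_of_def)
 next
  case False
  have "(LINT z|Q. indicator C (cov z) * of_bool (trt z = a)) = (\<integral>z. indicator C (cov z) - indicator C (cov z) * of_bool (trt z) \<partial>Q :: real)"
   using False by (intro Bochner_Integration.integral_cong) auto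
  also have "... = (LINT z|Q. indicator C (cov z) - indicator C (cov z) * s (cov z))"
   using T intC by simp
  also have "... = (LINT z|Q. indicator C (cov z) * prop_of s a (cov z))"
   using False by (intro Bochner_Integration.integral_cong) (auto simp: prop_of_def algebra_simps)
  finally show ?thesis .
 qed
qed measurable

text \<open>On a rectangle C x S both measures agree: conditioning on X splits the indicators of A =
  a and of S into a product of conditional probabilities, the first is the score, and the second is
  undone again. Finite measures are determined by rectangles.\<close>

lemma ignorability_imp_ipw:
 assumes ign: "ignorability Q" and [measurable]: "s \<in> borel_measurable borel"
  and s: "AE z in Q. s (cov z) = cprob Q cov trt z" and b: "!!x. 0 <= s x" "!!x. s x <= 1"
 shows "ipw Q s"
 unfolding ipw_def
proof
 fix a
 let ?E = "borel \<Otimes>\<^sub>M (borel \<Otimes>\<^sub>M borel) :: ('x \<times> real \<times> real) measure"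
 let ?Y = "%z. (pot False z, pot True z)"
 let ?M = "distr (density Q (%z. of_bool (trt z = a))) ?E (%z. (cov z, ?Y z))"
 let ?N = "distr (density Q (%z. ennreal (prop_of s a (cov z)))) ?E (%z. (cov z, ?Y z))"
 have p: "0 <= prop_of s a x" "prop_of s a x <= 1" for x using b by (auto simp: prop_of_def)
 have Ya: "(%z. (cov z, ?Y z)) \<in> measurable Q ?E" by measurable
 have Yb [measurable]: "?Y \<in> measurable Q (borel \<Otimes>\<^sub>M borel)" by measurable
 have emM: "emeasure ?M (C \<times> S) = ennreal (LINT z|Q. of_bool (trt z = a) * (indicator C (cov z) * indicator S (?Y z)))"
  and emN: "emeasure ?N (C \<times> S) = ennreal (LINT z|Q. prop_of s a (cov z) * (indicator C (cov z) * indicator S (?Y z)))"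
  if [measurable]: "C \<in> sets borel" "S \<in> sets (borel \<Otimes>\<^sub>M borel)" for C S
 proof -
  have CS: "C \<times> S \<in> sets ?E" by measurable
  have pre [measurable]: "(%z. (cov z, ?Y z)) -` (C \<times> S) \<in> sets Q"
   using measurable_sets[OF Ya CS] by simp
  have "emeasure ?M (C \<times> S) = (\<integral>\<^sup>+ z. of_bool (trt z = a) * indicator ((%z. (cov z, ?Y z)) -` (C \<times> S)) z \<partial>Q)"
   using CS Ya by (subst emeasure_distr) (auto simp: emeasure_density)
  also have "... = (\<integral>\<^sup>+ z. ennreal (of_bool (trt z = a) * (indicator C (cov z) * indicator S (?Y z))) \<partial>Q)"
   by (intro nn_integral_cong) (auto simp: indicator_def)
  also have "... = ennreal (LINT z|Q. of_bool (trt z = a) * (indicator C (cov z) * indicator S (?Y z)))"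
   by (intro nn_integral_eq_integral integrable_const_bound[where B=1]) (auto simp: indicator_def)
  finally show "emeasure ?M (C \<times> S) = ennreal (LINT z|Q. of_bool (trt z = a) * (indicator C (cov z) * indicator S (?Y z)))" .
  have "emeasure ?N (C \<times> S) = (\<integral>\<^sup>+ z. ennreal (prop_of s a (cov z)) * indicator ((%z. (cov z, ?Y z)) -` (C \<times> S)) z \<partial>Q)"
   using CS Ya by (subst emeasure_distr) (auto simp: emeasure_density)
  also have "... = (\<integral>\<^sup>+ z. ennreal (prop_of s a (cov z) * (indicator C (cov z) * indicator S (?Y z))) \<partial>Q)"
   by (intro nn_integral_cong) (auto simp: indicator_def)
  also have "... = ennreal (LINT z|Q. prop_of s a (cov z) * (indicator C (cov z) * indicator S (?Y z)))"
   using p by (intro nn_integral_eq_integral integrable_const_bound[where B=1]) (auto simp: indicator_def)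
  finally show "emeasure ?N (C \<times> S) = ennreal (LINT z|Q. prop_of s a (cov z) * (indicator C (cov z) * indicator S (?Y z)))" .
 qed
 have rect: "(LINT z|Q. of_bool (trt z = a) * (indicator C (cov z) * indicator S (?Y z))) =
   (LINT z|Q. prop_of s a (cov z) * (indicator C (cov z) * indicator S (?Y z)))"
  if [measurable]: "C \<in> sets borel" "S \<in> sets (borel \<Otimes>\<^sub>M borel)" for C S
 proof -
  have [measurable]: "Measurable.pred Q (%z. ?Y z \<in> S)" by measurable
  have "(LINT z|Q. of_bool (trt z = a) * (indicator C (cov z) * indicator S (?Y z))) =
   (\<integral>z. indicator C (cov z) * of_bool (trt z = a & ?Y z \<in> S) \<partial>Q :: real)"
   by (intro Bochner_Integration.integral_cong) (auto simp: indicator_def)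
  also have "... = (LINT z|Q. indicator C (cov z) * cprob Q cov (%z. trt z = a & ?Y z \<in> S) z)"
   by (rule cprob_integral(1)[where B=1, symmetric]) (auto simp: indicator_def)
  also have "... = (LINT z|Q. (indicator C (cov z) * prop_of s a (cov z)) * cprob Q cov (%z. ?Y z \<in> S) z)"
  proof (rule integral_cong_AE)
   show "AE z in Q. indicator C (cov z) * cprob Q cov (%z. trt z = a & ?Y z \<in> S) z =
     indicator C (cov z) * prop_of s a (cov z) * cprob Q cov (%z. ?Y z \<in> S) z"
    using ign[unfolded ignorability_def, rule_format, OF that(2), of a] cprob_arm[OF assms(2) s b, of a]
    by eventually_elim simp
  qed (simp_all add: cprob_def)
  also have "... = (LINT z|Q. (indicator C (cov z) * prop_of s a (cov z)) * of_bool (?Y z \<in> S))"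
   using p by (intro cprob_integral(1)[where k="%x. indicator C x * prop_of s a x" and B=1]) (auto simp: indicator_def)
  also have "... = (LINT z|Q. prop_of s a (cov z) * (indicator C (cov z) * indicator S (?Y z)))"
   by (intro Bochner_Integration.integral_cong) (auto simp: indicator_def)
  finally show ?thesis .
 qed
 show "?M = ?N"
 proof (rule measure_eqI_rectangles)
  show "emeasure ?M (space borel \<times> space (borel \<Otimes>\<^sub>M borel)) ~= \<infinity>"
   unfolding emM[OF sets.top sets.top] by simp
  show "emeasure ?M (C \<times> S) = emeasure ?N (C \<times> S)" if "C \<in> sets borel" "S \<in> sets (borel \<Otimes>\<^sub>M borel)" for C S
   unfolding emM[OF that] emN[OF that] rect[OF that] ..
 qed (rule sets_distr)+
qed

text \<open>The converse of \<open>ignorability_imp_ipw\<close>. It certifies that constructed laws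
  belong to the model by comparing integrals, without computing conditional probabilities under
  them.\<close>

lemma ipw_imp_assumption1:
 assumes ipw: "ipw Q s" and [measurable]: "s \<in> borel_measurable borel" and c: "0 < c" "!!x. c <= s x" "!!x. s x <= 1 - c"
 shows "assumption1 Q" "AE z in Q. cprob Q cov trt z = s (cov z)"
proof -
 have b: "0 <= s x" "s x <= 1" for x using c(1) c(2,3)[of x] by auto
 have p: "0 <= prop_of s a x" "prop_of s a x <= 1" for a x using b by (auto simp: prop_of_def)
 have arm: "AE z in Q. cprob Q cov (%z. trt z = a) z = prop_of s a (cov z)" for a
 proof (rule cprob_charact)
  show "integrable Q (%z. prop_of s a (cov z))"
   by (rule integrable_const_bound[where B=1]) (use p in auto)
  show "(%z. prop_of s a (cov z)) \<in> borel_measurable (vimage_algebra (space Q) cov borel)"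
   by (intro vimage_borel_measurable) measurable
  fix C :: "'x set" assume [measurable]: "C \<in> sets borel"
  show "(LINT z|Q. indicator C (cov z) * of_bool (trt z = a)) = (LINT z|Q. indicator C (cov z) * prop_of s a (cov z))"
   using ipw_integral(1)[OF ipw _ b, of "%x _ _. indicator C x" a] by (simp add: mult.commute)
 qed measurable
 from arm[of True] show T: "AE z in Q. cprob Q cov trt z = s (cov z)" by (simp add: prop_of_def)
 have "c <= 1 - c" using c(2,3) order_trans by blast
 moreover have "1 - c < 1" using c by simp
 moreover have "AE z in Q. c <= cprob Q cov trt z & cprob Q cov trt z <= 1 - c"
  using T by eventually_elim (use c in simp)
 ultimately have "overlap Q"
  unfolding overlap_def using c(1) by blast
 moreover have "ignorability Q"
  unfolding ignorability_def
 proof (intro allI ballI)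
  fix a and S :: "(real \<times> real) set" assume S [measurable]: "S \<in> sets (borel \<Otimes>\<^sub>M borel)"
  let ?Y = "%z. (pot False z, pot True z)"
  have [measurable]: "Measurable.pred Q (%z. ?Y z \<in> S)" by measurable
  have "AE z in Q. cprob Q cov (%z. trt z = a & ?Y z \<in> S) z = prop_of s a (cov z) * cprob Q cov (%z. ?Y z \<in> S) z"
  proof (rule cprob_charact)
   show "integrable Q (%z. prop_of s a (cov z) * cprob Q cov (%z. ?Y z \<in> S) z)"
    using p by (intro cprob_integral(2)[where B=1]) auto
   interpret sigma_finite_subalgebra Q "vimage_algebra (space Q) cov borel"
    by (rule cexp_subalgebra) measurable
   have "(%z. prop_of s a (cov z)) \<in> borel_measurable (vimage_algebra (space Q) cov borel)"
    by (intro vimage_borel_measurable) measurable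
   then show "(%z. prop_of s a (cov z) * cprob Q cov (%z. ?Y z \<in> S) z) \<in> borel_measurable (vimage_algebra (space Q) cov borel)"
    unfolding cprob_def cexp_def by measurable
   fix C :: "'x set" assume C [measurable]: "C \<in> sets borel"
   have "(LINT z|Q. indicator C (cov z) * of_bool (trt z = a & ?Y z \<in> S)) =
    (\<integral>z. of_bool (trt z = a) * (indicator C (cov z) * indicator S (?Y z)) \<partial>Q :: real)"
    by (intro Bochner_Integration.integral_cong) (auto simp: indicator_def)
   also have "... = (LINT z|Q. prop_of s a (cov z) * (indicator C (cov z) * indicator S (?Y z)))"
    using ipw_integral(1)[OF ipw _ b, of "%x y0 y1. indicator C x * indicator S (y0, y1)" a] by simp
   also have "... = (LINT z|Q. (indicator C (cov z) * prop_of s a (cov z)) * of_bool (?Y z \<in> S))"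
    by (intro Bochner_Integration.integral_cong) (auto simp: indicator_def)
   also have "... = (LINT z|Q. (indicator C (cov z) * prop_of s a (cov z)) * cprob Q cov (%z. ?Y z \<in> S) z)"
    using p by (intro cprob_integral(1)[where k="%x. indicator C x * prop_of s a x" and B=1, symmetric]) (auto simp: indicator_def)
   finally show "(LINT z|Q. indicator C (cov z) * of_bool (trt z = a & ?Y z \<in> S)) =
     (LINT z|Q. indicator C (cov z) * (prop_of s a (cov z) * cprob Q cov (%z. ?Y z \<in> S) z))"
    by (simp add: mult.assoc)
  qed measurable
  then show "AE z in Q. cprob Q cov (%z. trt z = a & ?Y z \<in> S) z =
     cprob Q cov (%z. trt z = a) z * cprob Q cov (%z. ?Y z \<in> S) z"
   using arm[of a] by eventually_elim simp
 qed
 ultimately show "assumption1 Q" by (simp add: assumption1_def)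
qed

text \<open>An arbitrary law of the model comes without a score function. A version of its
  conditional treatment probability is clipped so that overlap holds at every point rather than
  almost surely.\<close>

lemma assumption1_obtains_score:
 assumes "assumption1 Q"
 obtains s c where "s \<in> borel_measurable borel" "0 < c" "!!x. c <= s x" "!!x. s x <= 1 - c"
  "AE z in Q. s (cov z) = cprob Q cov trt z" "ipw Q s"
proof -
 obtain c0 c1 where c: "0 < c0" "c0 <= c1" "c1 < 1" "AE z in Q. c0 <= cprob Q cov trt z & cprob Q cov trt z <= c1"
  using assms by (auto simp: assumption1_def overlap_def)
 have cm: "cov \<in> borel_measurable Q" and pm: "Measurable.pred Q trt" by measurable
 have "\<exists>D :: 'x => real. D \<in> borel_measurable borel & (\<forall>x. 0 <= D x & D x <= 1) & (\<forall>C \<in> sets borel.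
   (LINT z|Q. indicator C (cov z) * D (cov z)) = (LINT z|Q. indicator C (cov z) * of_bool (trt z)))"
 proof (rule conditional_probability_version[OF cm pm])
  fix D :: "'x => real"
  assume D: "D \<in> borel_measurable borel" "!!x. 0 <= D x" "!!x. D x <= 1"
   "!!C. C \<in> sets borel ==> (LINT z|Q. indicator C (cov z) * D (cov z)) = (LINT z|Q. indicator C (cov z) * of_bool (trt z))"
  show ?thesis by (intro exI[of _ D] conjI allI ballI D)
 qed
 then obtain D :: "'x => real" where D0: "D \<in> borel_measurable borel & (\<forall>x. 0 <= D x & D x <= 1) & (\<forall>C \<in> sets borel.
   (LINT z|Q. indicator C (cov z) * D (cov z)) = (LINT z|Q. indicator C (cov z) * of_bool (trt z)))" ..
 have D: "D \<in> borel_measurable borel" "0 <= D x" "D x <= 1"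
  "C \<in> sets borel ==> (LINT z|Q. indicator C (cov z) * D (cov z)) = (LINT z|Q. indicator C (cov z) * of_bool (trt z))" for x C
  using D0 by simp_all
 note [measurable] = D(1)
 have Dint: "integrable Q (%z. D (cov z))"
  by (rule integrable_const_bound[where B=1]) (use D in auto)
 have cp: "AE z in Q. cprob Q cov trt z = D (cov z)"
 proof (rule cprob_charact[OF cm pm Dint])
  show "(%z. D (cov z)) \<in> borel_measurable (vimage_algebra (space Q) cov borel)"
   by (intro vimage_borel_measurable) measurable
  fix C :: "'x set" assume "C \<in> sets borel"
  then show "(LINT z|Q. indicator C (cov z) * of_bool (trt z)) = (LINT z|Q. indicator C (cov z) * D (cov z))"
   by (rule D(4)[symmetric])
 qed
 define c where "c = min c0 (1 - c1)"
 define s where "s x = max c (min (1 - c) (D x))" for x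
 have c': "0 < c" "c <= 1 - c" "c <= c0" "c1 <= 1 - c" using c by (auto simp: c_def min_def)
 have sm: "s \<in> borel_measurable borel" unfolding s_def[abs_def] by measurable
 have sb: "c <= s x" "s x <= 1 - c" for x using c' by (auto simp: s_def)
 have sAE: "AE z in Q. s (cov z) = cprob Q cov trt z"
  using cp c(4) by eventually_elim (use c' in \<open>auto simp: s_def\<close>)
 have sb': "0 <= s x" "s x <= 1" for x using sb[of x] c' by linarith+
 have "ipw Q s"
  using assms by (intro ignorability_imp_ipw sm sAE sb') (simp add: assumption1_def)
 then show ?thesis using that[OF sm c'(1) sb sAE] by blast
qed

end

section \<open>Limit theorems for sums with a small perturbation\<close>

lemma real_distribution_centered_normal: "real_distribution (centered_normal v)"
proof -
 interpret S: real_distribution std_normal_distribution by (rule real_dist_normal_dist)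
 show ?thesis
  unfolding centered_normal_def by (intro prob_space.real_distribution_distr S.prob_space_axioms) measurable
qed

lemma char_scale:
 assumes "X \<in> borel_measurable M"
 shows "char (distr M borel (%\<omega>. a * X \<omega>)) t = char (distr M borel X) (t * a)"
 unfolding char_def using assms by (simp add: integral_distr mult.assoc)

text \<open>A form of Slutsky's theorem. The characteristic functions of S + D and S differ at t by
  at most |t| E |D|, which is at most |t| times the root of the second moment of D.\<close>

lemma (in prob_space) weak_conv_add_L2_null:
 fixes S D :: "nat => 'a => real"
 assumes S [measurable]: "!!n. S n \<in> borel_measurable M" and D [measurable]: "!!n. D n \<in> borel_measurable M"
  and \<mu>: "real_distribution \<mu>" and conv: "weak_conv_m (%n. distr M borel (S n)) \<mu>"
  and int: "!!n. integrable M (%\<omega>. (D n \<omega>)^2)" and null: "(%n. expectation (%\<omega>. (D n \<omega>)^2)) \<longlonglongrightarrow> 0"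
 shows "weak_conv_m (%n. distr M borel (%\<omega>. S n \<omega> + D n \<omega>)) \<mu>"
proof (rule levy_continuity)
 show "real_distribution (distr M borel (%\<omega>. S n \<omega> + D n \<omega>))" for n
  by (rule real_distribution_distr) measurable
 fix t
 have abs_D: "integrable M (%\<omega>. \<bar>D n \<omega>\<bar>)" for n
  by (rule square_integrable_imp_integrable) (use int in auto)
 have E_abs: "expectation (%\<omega>. \<bar>D n \<omega>\<bar>) <= sqrt (expectation (%\<omega>. (D n \<omega>)^2))" for n
 proof (rule real_le_rsqrt)
  have "0 <= variance (%\<omega>. \<bar>D n \<omega>\<bar>)" by (rule variance_positive)
  also have "... = expectation (%\<omega>. (\<bar>D n \<omega>\<bar>)^2) - (expectation (%\<omega>. \<bar>D n \<omega>\<bar>))^2"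
   using abs_D int by (intro variance_eq) auto
  finally show "(expectation (%\<omega>. \<bar>D n \<omega>\<bar>))^2 <= expectation (%\<omega>. (D n \<omega>)^2)" by simp
 qed
 have bound: "norm (char (distr M borel (%\<omega>. S n \<omega> + D n \<omega>)) t - char (distr M borel (S n)) t) <=
   \<bar>t\<bar> * sqrt (expectation (%\<omega>. (D n \<omega>)^2))" for n
 proof -
  have i: "integrable M (%\<omega>. iexp (t * (S n \<omega> + D n \<omega>)))" "integrable M (%\<omega>. iexp (t * S n \<omega>))"
   by (rule integrable_const_bound[where B=1]; simp)+
  have "char (distr M borel (%\<omega>. S n \<omega> + D n \<omega>)) t - char (distr M borel (S n)) t =
   (\<integral>\<omega>. iexp (t * (S n \<omega> + D n \<omega>)) - iexp (t * S n \<omega>) \<partial>M)"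
   unfolding char_def using i by (simp add: integral_distr)
  also have "norm ... <= (\<integral>\<omega>. \<bar>t\<bar> * \<bar>D n \<omega>\<bar> \<partial>M)"
  proof (intro order_trans[OF integral_norm_bound] integral_mono)
   fix \<omega>
   have "iexp (t * (S n \<omega> + D n \<omega>)) - iexp (t * S n \<omega>) = iexp (t * S n \<omega>) * (iexp (t * D n \<omega>) - 1)"
   proof -
    have "iexp (t * (S n \<omega> + D n \<omega>)) = iexp (t * S n \<omega>) * iexp (t * D n \<omega>)"
     by (simp add: distrib_left exp_add)
    then show ?thesis by (simp add: right_diff_distrib)
   qed
   also have "norm ... = norm (iexp (t * D n \<omega>) - 1)" by (simp only: norm_mult norm_exp_i_times mult_1)
   also have "... <= \<bar>t * D n \<omega>\<bar>" using iexp_approx1[of "t * D n \<omega>" 0] by simp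
   finally show "norm (iexp (t * (S n \<omega> + D n \<omega>)) - iexp (t * S n \<omega>)) <= \<bar>t\<bar> * \<bar>D n \<omega>\<bar>"
    by (simp add: abs_mult)
  qed (use i abs_D in auto)
  also have "... <= \<bar>t\<bar> * sqrt (expectation (%\<omega>. (D n \<omega>)^2))"
   using E_abs[of n] by (simp add: mult_left_mono)
  finally show ?thesis .
 qed
 have lim: "(%n. \<bar>t\<bar> * sqrt (expectation (%\<omega>. (D n \<omega>)^2))) \<longlonglongrightarrow> 0"
  using tendsto_mult_left[OF tendsto_real_sqrt[OF null], of "\<bar>t\<bar>"] by simp
 have "(%n. char (distr M borel (%\<omega>. S n \<omega> + D n \<omega>)) t - char (distr M borel (S n)) t) \<longlonglongrightarrow> 0"
  by (rule Lim_null_comparison[OF _ lim]) (use bound in simp)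
 moreover have "(%n. char (distr M borel (S n)) t) \<longlonglongrightarrow> char \<mu> t"
  by (intro levy_continuity1 \<mu> conv real_distribution_distr) measurable
 ultimately have "(%n. (char (distr M borel (%\<omega>. S n \<omega> + D n \<omega>)) t - char (distr M borel (S n)) t) +
   char (distr M borel (S n)) t) \<longlonglongrightarrow> 0 + char \<mu> t"
  by (rule tendsto_add)
 then show "(%n. char (distr M borel (%\<omega>. S n \<omega> + D n \<omega>)) t) \<longlonglongrightarrow> char \<mu> t" by simp
qed (fact \<mu>)

text \<open>For v > 0 the standardized limit theorem is transferred by evaluating characteristic
  functions at t * sqrt v. For v = 0 all summands vanish almost surely and the limit is the point
  mass at 0.\<close>

lemma (in prob_space) iid_sum_weak_conv:
 fixes X :: "nat => 'a => real"
 assumes ind: "indep_vars (%_. borel) X UNIV" and dist: "!!n. distr M borel (X n) = \<mu>"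
  and int: "!!n. integrable M (%\<omega>. (X n \<omega>)^2)"
  and mean: "!!n. expectation (X n) = 0" and var: "!!n. expectation (%\<omega>. (X n \<omega>)^2) = v"
 shows "weak_conv_m (%n. distr M borel (%\<omega>. (\<Sum>i<n. X i \<omega>) / sqrt (real n))) (centered_normal v)"
proof -
 have X [measurable]: "random_variable borel (X n)" for n
  using ind unfolding indep_vars_def2 by simp
 have v: "0 <= v" using var[of 0] by (metis Bochner_Integration.integral_nonneg zero_le_power2)
 show ?thesis
 proof (rule levy_continuity)
  show "real_distribution (distr M borel (%\<omega>. (\<Sum>i<n. X i \<omega>) / sqrt (real n)))" for n
   by (rule real_distribution_distr) measurable
  fix t
  have char_lim: "char (centered_normal v) t = char std_normal_distribution (t * sqrt v)"
  proof -
   have "distr std_normal_distribution borel (%x. x) = std_normal_distribution"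
    by (rule distr_id2) simp
   then show ?thesis unfolding centered_normal_def by (subst char_scale) auto
  qed
  show "(%n. char (distr M borel (%\<omega>. (\<Sum>i<n. X i \<omega>) / sqrt (real n))) t) \<longlonglongrightarrow> char (centered_normal v) t"
  proof (cases "v = 0")
   case True
   have "AE \<omega> in M. X i \<omega> = 0" for i
   proof -
    have "AE \<omega> in M. (X i \<omega>)\<^sup>2 = 0"
     using integral_nonneg_eq_0_iff_AE[OF int[of i]] var[of i] True by simp
    then show ?thesis by eventually_elim simp
   qed
   then have AE0: "AE \<omega> in M. \<forall>i. X i \<omega> = 0" by (simp add: AE_all_countable)
   have "char (distr M borel (%\<omega>. (\<Sum>i<n. X i \<omega>) / sqrt (real n))) t = (\<integral>\<omega>. 1 \<partial>M)" for n
    unfolding char_def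
   proof (subst integral_distr)
    show "(\<integral>\<omega>. iexp (t * ((\<Sum>i<n. X i \<omega>) / sqrt (real n))) \<partial>M) = (\<integral>\<omega>. 1 \<partial>M)"
     by (rule integral_cong_AE) (use AE0 in \<open>auto elim!: eventually_mono\<close>)
   qed auto
   moreover have "char (centered_normal v) t = 1" unfolding char_lim using True by (simp add: char_std_normal_distribution)
   ultimately show ?thesis by (simp add: prob_space)
  next
   case False
   then have vpos: "0 < v" using v by simp
   have "weak_conv_m (%n. distr M borel (%x. (\<Sum>i<n. X i x) / sqrt (real n * (sqrt v)^2))) std_normal_distribution"
   proof (rule central_limit_theorem_zero_mean[OF ind mean _ int _ dist])
    show "variance (X n) = (sqrt v)^2" for n using mean var vpos by simp
   qed (use vpos in simp)
   then have "(%n. char (distr M borel (%x. (\<Sum>i<n. X i x) / sqrt (real n * (sqrt v)^2))) (t * sqrt v)) \<longlonglongrightarrow> char std_normal_distribution (t * sqrt v)"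
    by (intro levy_continuity1 real_dist_normal_dist real_distribution_distr) measurable
   moreover have "char (distr M borel (%x. (\<Sum>i<n. X i x) / sqrt (real n * (sqrt v)^2))) (t * sqrt v) =
     char (distr M borel (%\<omega>. (\<Sum>i<n. X i \<omega>) / sqrt (real n))) t" for n
   proof -
    have "(%\<omega>. sqrt v * ((\<Sum>i<n. X i \<omega>) / sqrt (real n * (sqrt v)^2))) = (%\<omega>. (\<Sum>i<n. X i \<omega>) / sqrt (real n))"
     using vpos by (simp add: real_sqrt_mult)
    then show ?thesis by (subst char_scale[symmetric]) auto
   qed
   ultimately show ?thesis using char_lim by simp
  qed
 qed (rule real_distribution_centered_normal)
qed

section \<open>The influence function and its moments\<close>

text \<open>The first identity is the defining property of the regression function. In the second,
  weighting replaces the indicator of the arm by the propensity, which is again a bounded function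
  of the covariates.\<close>

lemma residual_orthogonal:
 fixes Q :: "'x::euclidean_space unit_data measure"
 assumes "unit_law Q" "square_integrable_outcomes Q" and ipw: "ipw Q s" and s [measurable]: "s \<in> borel_measurable borel"
  and b: "!!x. 0 <= s x" "!!x. s x <= 1"
  and m [measurable]: "\<mu> \<in> borel_measurable borel" and cm: "AE z in Q. \<mu> (cov z) = cexp Q cov (pot a) z"
  and \<phi> [measurable]: "\<phi> \<in> borel_measurable borel" and \<phi>b: "!!x. \<bar>\<phi> x\<bar> <= C"
 shows "(LINT z|Q. \<phi> (cov z) * (pot a z - \<mu> (cov z))) = 0"
  and "(LINT z|Q. of_bool (trt z = a) * (\<phi> (cov z) * (pot a z - \<mu> (cov z)))) = 0"
proof -
 interpret unit_law Q by fact
 have int: "integrable Q (pot a)"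
 proof (rule square_integrable_imp_integrable)
  show "integrable Q (%z. (pot a z)^2)"
   using assms(2) unfolding square_integrable_outcomes_def by blast
 qed measurable
 have zero: "(LINT z|Q. \<phi> (cov z) * (pot a z - \<mu> (cov z))) = 0"
  if [measurable]: "\<phi> \<in> borel_measurable borel" and \<phi>b: "!!x. \<bar>\<phi> x\<bar> <= C" for \<phi>
 proof -
  have i: "integrable Q (%z. \<phi> (cov z) * pot a z)"
  proof (rule Bochner_Integration.integrable_bound[OF integrable_mult_right[OF int, of C]])
   show "AE z in Q. norm (\<phi> (cov z) * pot a z) <= norm (C * pot a z)"
   proof (intro AE_I2)
    fix z
    have "\<bar>\<phi> (cov z)\<bar> <= \<bar>C\<bar>" using \<phi>b[of "cov z"] by linarith
    then show "norm (\<phi> (cov z) * pot a z) <= norm (C * pot a z)"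
     by (simp add: abs_mult mult_right_mono)
   qed
  qed measurable
  have c: "integrable Q (%z. \<phi> (cov z) * cexp Q cov (pot a) z)"
    "(LINT z|Q. \<phi> (cov z) * cexp Q cov (pot a) z) = (LINT z|Q. \<phi> (cov z) * pot a z)"
   using cexp_integral[where U=cov and k=\<phi> and f="pot a", OF _ _ _ i] by simp_all
  have eq: "AE z in Q. \<phi> (cov z) * cexp Q cov (pot a) z = \<phi> (cov z) * \<mu> (cov z)"
   using cm by eventually_elim simp
  have i2: "integrable Q (%z. \<phi> (cov z) * \<mu> (cov z))"
   by (rule integrable_cong_AE[THEN iffD1, OF _ _ eq c(1)]) measurable
  have "(LINT z|Q. \<phi> (cov z) * \<mu> (cov z)) = (LINT z|Q. \<phi> (cov z) * pot a z)"
   using c(2) integral_cong_AE[OF _ _ eq] by simp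
  then show ?thesis using i i2 by (simp add: right_diff_distrib)
 qed
 show "(LINT z|Q. \<phi> (cov z) * (pot a z - \<mu> (cov z))) = 0" by (rule zero[OF \<phi> \<phi>b])
 have h: "(%(x, y0, y1). \<phi> x * ((if a then y1 else y0) - \<mu> x)) \<in> borel_measurable xyy_space"
  by (cases a) simp_all
 have pa: "pot a z = (if a then pot True z else pot False z)" for z by (cases a) auto
 have "(LINT z|Q. of_bool (trt z = a) * (\<phi> (cov z) * (pot a z - \<mu> (cov z)))) =
   (LINT z|Q. (prop_of s a (cov z) * \<phi> (cov z)) * (pot a z - \<mu> (cov z)))"
  using ipw_integral(1)[OF ipw s b h, of a] unfolding pa by (simp add: mult.assoc)
 also have "... = 0"
 proof (rule zero[of "%x. prop_of s a x * \<phi> x"])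
  have "\<bar>prop_of s a x\<bar> * \<bar>\<phi> x\<bar> <= 1 * C" for x
   using b[of x] \<phi>b[of x] by (intro mult_mono) (auto simp: prop_of_def)
  then show "\<bar>prop_of s a x * \<phi> x\<bar> <= C" for x by (simp add: abs_mult)
 qed measurable
 finally show "(LINT z|Q. of_bool (trt z = a) * (\<phi> (cov z) * (pot a z - \<mu> (cov z)))) = 0" .
qed

locale regression_setting = unit_law Q for Q :: "'x::euclidean_space unit_data measure" +
 fixes s :: "'x => real" and m :: "bool => 'x => real" and c B :: real
 assumes outcomes: "square_integrable_outcomes Q"
  and s_measurable [measurable]: "s \<in> borel_measurable borel" and m_measurable [measurable]: "!!a. m a \<in> borel_measurable borel"
  and c_pos: "0 < c" and s_bounds: "!!x. c <= s x" "!!x. s x <= 1 - c"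
  and s_ipw: "ipw Q s"
  and m_correct: "!!a. AE z in Q. m a (cov z) = cexp Q cov (pot a) z"
  and resid_bound: "!!a. AE z in Q. \<bar>resid m a z\<bar> <= B"
begin

text \<open>The efficient influence function of the average treatment effect at an observation (x,
  a, y). Below, \<open>base\<close> is its part depending on the covariates alone and
  \<open>wresid\<close> the part that is centred given covariates and treatment.\<close>

definition eff :: "'x => bool => real => real" where
 "eff x a y = m True x - m False x - ate Q + (if a then 1 else - 1) * (y - m a x) / prop_of s a x"

definition infl :: "'x unit_data => real" where
 "infl z = eff (cov z) (trt z) (pot (trt z) z)"

definition base :: "'x => real" where
 "base x = m True x - m False x - ate Q"

definition wresid :: "bool => 'x unit_data => real" where
 "wresid a z = (if a then 1 else - 1) * resid m a z / prop_of s a (cov z)"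

lemma s_unit: "0 <= s x" "s x <= 1"
 using c_pos s_bounds[of x] by linarith+

lemma prop_bounds: "c <= prop_of s a x" "prop_of s a x <= 1"
 using s_bounds[of x] s_unit[of x] by (auto simp: prop_of_def)

lemma B_nonneg: "0 <= B"
proof -
 have "AE z in Q. 0 <= B" using resid_bound[of True] by eventually_elim linarith
 then show ?thesis by simp
qed

lemma resid_measurable [measurable]: "resid m a \<in> borel_measurable Q"
 unfolding resid_def[abs_def] by measurable

lemma base_measurable [measurable]: "base \<in> borel_measurable borel"
 unfolding base_def[abs_def] by measurable

lemma wresid_measurable [measurable]: "wresid a \<in> borel_measurable Q"
 unfolding wresid_def[abs_def] by measurable

lemma infl_eq: "infl z = base (cov z) + wresid (trt z) z"
 by (simp add: infl_def eff_def base_def wresid_def resid_def)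

lemma infl_measurable [measurable]: "infl \<in> borel_measurable Q"
proof -
 have eq: "infl = (%z. base (cov z) + (if trt z then wresid True z else wresid False z))"
  by (auto simp: infl_eq fun_eq_iff)
 show ?thesis unfolding eq by measurable
qed

lemma integrable_pot: "integrable Q (pot a)" "integrable Q (%z. (pot a z)^2)"
proof -
 show *: "integrable Q (%z. (pot a z)^2)"
  using outcomes unfolding square_integrable_outcomes_def by blast
 show "integrable Q (pot a)"
  by (rule square_integrable_imp_integrable[OF _ *]) measurable
qed

lemma wresid_AE: "AE z in Q. \<bar>wresid a z\<bar> <= B / c"
 using resid_bound[of a]
proof eventually_elim
 case (elim z)
 have "\<bar>wresid a z\<bar> = \<bar>resid m a z\<bar> / prop_of s a (cov z)"
  using prop_bounds[of a "cov z"] c_pos by (simp add: wresid_def abs_mult)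
 also have "... <= B / c"
  using elim prop_bounds[of a "cov z"] c_pos B_nonneg by (intro frac_le) auto
 finally show ?case .
qed

lemma integrable_m_sq: "integrable Q (%z. (m a (cov z))^2)"
proof (rule Bochner_Integration.integrable_bound[where f="%z. 2 * (pot a z)^2 + 2 * B\<^sup>2"])
 show "integrable Q (%z. 2 * (pot a z)^2 + 2 * B\<^sup>2)" using integrable_pot(2) by simp
 show "AE z in Q. norm ((m a (cov z))^2) <= norm (2 * (pot a z)^2 + 2 * B\<^sup>2)"
  using resid_bound[of a]
 proof eventually_elim
  case (elim z)
  have "(m a (cov z))^2 <= 2 * (pot a z)^2 + 2 * (resid m a z)^2"
  proof -
   have "(m a (cov z))^2 = 2 * (pot a z)^2 + 2 * (resid m a z)^2 - (pot a z + resid m a z)^2"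
    by (simp add: resid_def power2_eq_square algebra_simps)
   then show ?thesis using zero_le_power2[of "pot a z + resid m a z"] by linarith
  qed
  moreover have "(resid m a z)^2 <= B\<^sup>2" using elim B_nonneg by (simp add: abs_le_square_iff[symmetric])
  ultimately show ?case by simp
 qed
qed measurable

lemma integrable_m: "integrable Q (%z. m a (cov z))"
 by (rule square_integrable_imp_integrable) (use integrable_m_sq in auto)

lemma integrable_base_sq: "integrable Q (%z. (base (cov z))^2)"
proof (rule Bochner_Integration.integrable_bound[where f="%z. 3 * (m True (cov z))^2 + 3 * (m False (cov z))^2 + 3 * (ate Q)^2"])
 show "integrable Q (%z. 3 * (m True (cov z))^2 + 3 * (m False (cov z))^2 + 3 * (ate Q)^2)"
  using integrable_m_sq by simp
 have "(x - y - w)^2 <= 3 * x\<^sup>2 + 3 * y\<^sup>2 + 3 * w\<^sup>2" for x y w :: real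
 proof -
  have "0 <= (x + y)^2 + (x + w)^2 + (y - w)^2" by simp
  then show ?thesis by (simp add: power2_eq_square algebra_simps)
 qed
 then show "AE z in Q. norm ((base (cov z))^2) <= norm (3 * (m True (cov z))^2 + 3 * (m False (cov z))^2 + 3 * (ate Q)^2)"
  by (simp add: base_def)
qed measurable

lemma integrable_base: "integrable Q (%z. base (cov z))"
 by (rule square_integrable_imp_integrable) (use integrable_base_sq in auto)

lemma orthogonal:
 assumes "\<phi> \<in> borel_measurable borel" "!!x. \<bar>\<phi> x\<bar> <= C"
 shows "(LINT z|Q. \<phi> (cov z) * resid m a z) = 0"
  and "(LINT z|Q. of_bool (trt z = a) * (\<phi> (cov z) * resid m a z)) = 0"
 unfolding resid_def
 using residual_orthogonal[OF unit_law_axioms outcomes s_ipw s_measurable s_unit m_measurable m_correct assms] by auto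

lemma base_mean: "(LINT z|Q. base (cov z)) = 0"
proof -
 have r: "integrable Q (resid m a)" for a
  unfolding resid_def[abs_def] using integrable_pot(1) integrable_m by simp
 have "(LINT z|Q. m a (cov z)) = (LINT z|Q. pot a z)" for a
  using orthogonal(1)[of "%_. 1" 1 a] integrable_pot(1) integrable_m by (simp add: resid_def)
 then have "(LINT z|Q. m True (cov z) - m False (cov z)) = ate Q"
  unfolding ate_def using integrable_pot(1) integrable_m by simp
 then show ?thesis
  unfolding base_def using integrable_m prob_space by simp
qed

lemma obs_resid_orthogonal:
 assumes [measurable]: "\<phi> \<in> borel_measurable (borel \<Otimes>\<^sub>M count_space UNIV)" and b: "!!x a. \<bar>\<phi> (x, a)\<bar> <= C"
 shows "(LINT z|Q. \<phi> (cov z, trt z) * resid m (trt z) z) = 0"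
  and "integrable Q (%z. \<phi> (cov z, trt z) * resid m (trt z) z)"
proof -
 have i: "integrable Q (%z. of_bool (trt z = a) * (\<phi> (cov z, a) * resid m a z))" for a
 proof (rule integrable_const_bound[where B="C * B"])
  show "AE z in Q. norm (of_bool (trt z = a) * (\<phi> (cov z, a) * resid m a z)) <= C * B"
   using resid_bound[of a]
  proof eventually_elim
   case (elim z)
   have "\<bar>\<phi> (cov z, a)\<bar> * \<bar>resid m a z\<bar> <= C * B"
    using elim b[of "cov z" a] B_nonneg by (intro mult_mono) auto
   moreover have "0 <= C * B" using b[of undefined True] B_nonneg by (intro mult_nonneg_nonneg) auto
   ultimately show ?case by (simp add: abs_mult of_bool_def)
  qed
 qed measurable
 have eq: "\<phi> (cov z, trt z) * resid m (trt z) z =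
   of_bool (trt z = True) * (\<phi> (cov z, True) * resid m True z) + of_bool (trt z = False) * (\<phi> (cov z, False) * resid m False z)" for z
  by (cases "trt z") auto
 have o: "(LINT z|Q. of_bool (trt z = a) * (\<phi> (cov z, a) * resid m a z)) = 0" for a
  by (rule orthogonal(2)[where C=C]) (use b in auto)
 show "integrable Q (%z. \<phi> (cov z, trt z) * resid m (trt z) z)"
  unfolding eq by (intro Bochner_Integration.integrable_add i)
 show "(LINT z|Q. \<phi> (cov z, trt z) * resid m (trt z) z) = 0"
  unfolding eq Bochner_Integration.integral_add[OF i i] o by simp
qed

lemma integrable_wresid_sq: "integrable Q (%z. (wresid a z)^2)" "integrable Q (%z. (wresid (trt z) z)^2)"
proof -
 have sq: "AE z in Q. (wresid a z)\<^sup>2 <= (B / c)^2" for a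
  using wresid_AE[of a] by eventually_elim (use B_nonneg c_pos in \<open>simp add: abs_le_square_iff[symmetric]\<close>)
 show "integrable Q (%z. (wresid a z)^2)"
  by (rule integrable_const_bound[where B="(B / c)^2"]) (use sq in auto)
 have eq: "(wresid (trt z) z)^2 = (if trt z then (wresid True z)\<^sup>2 else (wresid False z)\<^sup>2)" for z by simp
 show "integrable Q (%z. (wresid (trt z) z)^2)"
  unfolding eq
 proof (rule integrable_const_bound[where B="(B / c)^2"])
  show "AE z in Q. norm (if trt z then (wresid True z)\<^sup>2 else (wresid False z)\<^sup>2) <= (B / c)^2"
   using sq[of True] sq[of False] by eventually_elim auto
 qed measurable
qed

text \<open>Weighting turns the indicator of the arm into one factor of the propensity, which
  cancels one of the two in the denominator.\<close>

lemma wresid_second_moment: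
 "(LINT z|Q. of_bool (trt z = a) * (wresid a z)^2) = (LINT z|Q. (resid m a z)^2 / prop_of s a (cov z))"
proof -
 have h: "(%(x, y0, y1). (((if a then 1 else - 1) * ((if a then y1 else y0) - m a x) / prop_of s a x)^2)) \<in> borel_measurable xyy_space"
  by (cases a) simp_all
 have pa: "pot a z = (if a then pot True z else pot False z)" for z by (cases a) auto
 have "(LINT z|Q. of_bool (trt z = a) * (wresid a z)^2) = (LINT z|Q. prop_of s a (cov z) * (wresid a z)^2)"
  using ipw_integral(1)[OF s_ipw s_measurable s_unit h, of a] unfolding wresid_def resid_def pa by simp
 also have "... = (LINT z|Q. (resid m a z)^2 / prop_of s a (cov z))"
 proof (rule Bochner_Integration.integral_cong[OF refl])
  fix z
  have "prop_of s a (cov z) ~= 0" using prop_bounds[of a "cov z"] c_pos by linarith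
  then show "prop_of s a (cov z) * (wresid a z)^2 = (resid m a z)^2 / prop_of s a (cov z)"
   by (simp add: wresid_def power2_eq_square)
 qed
 finally show ?thesis .
qed

lemma resid_var: 
 "integrable Q (%z. cvar Q cov (pot a) z / prop_of s a (cov z))"
 "(LINT z|Q. cvar Q cov (pot a) z / prop_of s a (cov z)) = (LINT z|Q. (resid m a z)^2 / prop_of s a (cov z))"
proof -
 let ?f = "%z. (pot a z - cexp Q cov (pot a) z)^2"
 have fm: "?f \<in> borel_measurable Q" by measurable
 have eq: "AE z in Q. ?f z = (resid m a z)^2"
  using m_correct[of a] by eventually_elim (simp add: resid_def)
 have i: "integrable Q (%z. 1 / prop_of s a (cov z) * ?f z)"
 proof (rule integrable_const_bound[where B="1 / c * B\<^sup>2"])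
  show "AE z in Q. norm (1 / prop_of s a (cov z) * ?f z) <= 1 / c * B\<^sup>2"
   using eq resid_bound[of a]
  proof eventually_elim
   case (elim z)
   have "1 / prop_of s a (cov z) * (resid m a z)^2 <= 1 / c * B\<^sup>2"
    using prop_bounds[of a "cov z"] c_pos elim B_nonneg
    by (intro mult_mono) (auto simp: frac_le abs_le_square_iff[symmetric])
   then show ?case using elim prop_bounds[of a "cov z"] c_pos by simp
  qed
 qed (use fm in measurable)
 have k: "(%x. 1 / prop_of s a x) \<in> borel_measurable borel" by measurable
 note ci = cexp_integral[where U=cov and k="%x. 1 / prop_of s a x", OF _ k fm i, simplified]
 show "integrable Q (%z. cvar Q cov (pot a) z / prop_of s a (cov z))"
  unfolding cvar_def using ci(1) by simp
 have "(LINT z|Q. cvar Q cov (pot a) z / prop_of s a (cov z)) = (LINT z|Q. ?f z / prop_of s a (cov z))"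
  unfolding cvar_def using ci(2) by simp
 also have "... = (LINT z|Q. (resid m a z)^2 / prop_of s a (cov z))"
 proof (rule integral_cong_AE)
  show "AE z in Q. ?f z / prop_of s a (cov z) = (resid m a z)^2 / prop_of s a (cov z)"
   using eq by eventually_elim simp
 qed (use fm in measurable)
 finally show "(LINT z|Q. cvar Q cov (pot a) z / prop_of s a (cov z)) = (LINT z|Q. (resid m a z)^2 / prop_of s a (cov z))" .
qed

end

context regression_setting
begin

lemma wresid_obs_AE: "AE z in Q. \<bar>wresid (trt z) z\<bar> <= B / c"
 using wresid_AE[of True] wresid_AE[of False]
proof eventually_elim
 case (elim z)
 then show ?case by (cases "trt z") auto
qed

lemma wresid_obs_measurable [measurable]: "(%z. wresid (trt z) z) \<in> borel_measurable Q"
proof -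
 have eq: "(%z. wresid (trt z) z) = (%z. if trt z then wresid True z else wresid False z)" by (auto simp: fun_eq_iff)
 show ?thesis unfolding eq by measurable
qed

lemma resid_obs_measurable [measurable]: "(%z. resid m (trt z) z) \<in> borel_measurable Q"
proof -
 have eq: "(%z. resid m (trt z) z) = (%z. if trt z then resid m True z else resid m False z)" by (auto simp: fun_eq_iff)
 show ?thesis unfolding eq by measurable
qed

text \<open>Extends orthogonality from bounded to square integrable functions of the covariates:
  truncate \<open>k\<close> at level i and use dominated convergence with the bound |k| B /
  c.\<close>

lemma wresid_orthogonal:
 assumes k [measurable]: "k \<in> borel_measurable borel" and int: "integrable Q (%z. (k (cov z))^2)"
 shows "integrable Q (%z. k (cov z) * wresid (trt z) z)" "(LINT z|Q. k (cov z) * wresid (trt z) z) = 0"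
proof -
 have k1: "integrable Q (%z. k (cov z))"
  by (rule square_integrable_imp_integrable[OF _ int]) measurable
 have w: "integrable Q (%z. \<bar>k (cov z)\<bar> * (B / c))" using k1 by simp
 have le: "AE z in Q. \<bar>k (cov z) * wresid (trt z) z\<bar> <= \<bar>k (cov z)\<bar> * (B / c)"
  using wresid_obs_AE by eventually_elim (simp add: abs_mult mult_left_mono del: times_divide_eq_right)
 show "integrable Q (%z. k (cov z) * wresid (trt z) z)"
 proof (rule Bochner_Integration.integrable_bound[OF w])
  show "AE z in Q. norm (k (cov z) * wresid (trt z) z) <= norm (\<bar>k (cov z)\<bar> * (B / c))"
   using le unfolding real_norm_def by eventually_elim (rule order_trans[OF _ abs_ge_self])
 qed measurable
 define kc where "kc i x = max (- real i) (min (real i) (k x))" for i x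
 have [measurable]: "kc i \<in> borel_measurable borel" for i unfolding kc_def[abs_def] by measurable
 have kc_le: "\<bar>kc i x\<bar> <= real i" "\<bar>kc i x\<bar> <= \<bar>k x\<bar>" for i x by (auto simp: kc_def)
 have z: "(LINT z|Q. kc i (cov z) * wresid (trt z) z) = 0" for i
 proof -
  have eq: "kc i (cov z) * wresid (trt z) z =
   (%(x, a). kc i x * (if a then 1 else - 1) / (if a then prop_of s True x else prop_of s False x)) (cov z, trt z) * resid m (trt z) z" for z
   by (simp add: wresid_def)
  show ?thesis unfolding eq
  proof (rule obs_resid_orthogonal(1)[where C="real i / c"])
   show "\<bar>(%(x, a). kc i x * (if a then 1 else - 1) / (if a then prop_of s True x else prop_of s False x)) (x, a)\<bar> <= real i / c" for x a
   proof -
    have "\<bar>(%(x, a). kc i x * (if a then 1 else - 1) / (if a then prop_of s True x else prop_of s False x)) (x, a)\<bar> = \<bar>kc i x\<bar> / prop_of s a x"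
     using prop_bounds[of a x] c_pos by (auto simp: abs_mult)
    also have "... <= real i / c"
     using kc_le(1)[of i x] prop_bounds[of a x] c_pos by (intro frac_le) auto
    finally show ?thesis .
   qed
  qed measurable
 qed
 have "(%i. \<integral>z. kc i (cov z) * wresid (trt z) z \<partial>Q) \<longlonglongrightarrow> (LINT z|Q. k (cov z) * wresid (trt z) z)"
 proof (rule integral_dominated_convergence[OF _ _ w])
  show "AE z in Q. (%i. kc i (cov z) * wresid (trt z) z) \<longlonglongrightarrow> k (cov z) * wresid (trt z) z"
  proof (intro AE_I2 tendsto_mult_right)
   fix z
   obtain N where N: "\<bar>k (cov z)\<bar> <= real N" using real_arch_simple by blast
   have "\<forall>\<^sub>F i in sequentially. kc i (cov z) = k (cov z)"
    using eventually_ge_at_top[of N]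
   proof eventually_elim
    case (elim i)
    then have "\<bar>k (cov z)\<bar> <= real i" using N by linarith
    then show ?case by (auto simp: kc_def)
   qed
   then show "(%i. kc i (cov z)) \<longlonglongrightarrow> k (cov z)" by (rule tendsto_eventually)
  qed
  show "AE z in Q. norm (kc i (cov z) * wresid (trt z) z) <= \<bar>k (cov z)\<bar> * (B / c)" for i
   using wresid_obs_AE
  proof eventually_elim
   case (elim z)
   have "\<bar>kc i (cov z)\<bar> * \<bar>wresid (trt z) z\<bar> <= \<bar>k (cov z)\<bar> * (B / c)"
    using elim kc_le(2)[of i "cov z"] by (intro mult_mono) auto
   then show ?case by (simp add: abs_mult)
  qed
 qed measurable
 from LIMSEQ_unique[OF this[unfolded z] tendsto_const]
 show "(LINT z|Q. k (cov z) * wresid (trt z) z) = 0" .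
qed

definition noise_var :: real where
 "noise_var = (LINT z|Q. (wresid (trt z) z)^2)"

lemma noise_var_eq:
 "noise_var = (LINT z|Q. cvar Q cov (pot False) z / prop_of s False (cov z) + cvar Q cov (pot True) z / prop_of s True (cov z))"
proof -
 have i: "integrable Q (%z. of_bool (trt z = a) * (wresid a z)^2)" for a
  by (rule Bochner_Integration.integrable_bound[OF integrable_wresid_sq(1)[of a]]) auto
 have "noise_var = (LINT z|Q. of_bool (trt z = False) * (wresid False z)^2 + of_bool (trt z = True) * (wresid True z)^2)"
  unfolding noise_var_def by (intro Bochner_Integration.integral_cong) auto
 also have "... = (LINT z|Q. of_bool (trt z = False) * (wresid False z)^2) + (LINT z|Q. of_bool (trt z = True) * (wresid True z)^2)"
  by (rule Bochner_Integration.integral_add[OF i i])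
 also have "... = (LINT z|Q. cvar Q cov (pot False) z / prop_of s False (cov z)) + (LINT z|Q. cvar Q cov (pot True) z / prop_of s True (cov z))"
  unfolding wresid_second_moment resid_var(2) ..
 also have "... = (LINT z|Q. cvar Q cov (pot False) z / prop_of s False (cov z) + cvar Q cov (pot True) z / prop_of s True (cov z))"
  by (rule Bochner_Integration.integral_add[OF resid_var(1) resid_var(1), symmetric])
 finally show ?thesis .
qed

text \<open>The functions k(X) + \<open>wresid\<close> are the scores of the tilted submodels built
  later. Their products with \<open>infl\<close> and their squares have no cross terms by
  \<open>wresid_orthogonal\<close>, so only covariate moments and \<open>noise_var\<close>
  remain.\<close>

lemma eff_inner:
 assumes k [measurable]: "k \<in> borel_measurable borel" and int: "integrable Q (%z. (k (cov z))^2)"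
 shows "integrable Q (%z. (k (cov z) + wresid (trt z) z)^2)"
  "(LINT z|Q. infl z * (k (cov z) + wresid (trt z) z)) = (LINT z|Q. base (cov z) * k (cov z)) + noise_var"
  "integrable Q (%z. infl z * (k (cov z) + wresid (trt z) z))"
  "(LINT z|Q. (k (cov z) + wresid (trt z) z)^2) = (LINT z|Q. (k (cov z))^2) + noise_var"
proof -
 note o1 = wresid_orthogonal[OF k int] and o2 = wresid_orthogonal[OF base_measurable integrable_base_sq]
 have bk: "integrable Q (%z. base (cov z) * k (cov z))"
 proof (rule Bochner_Integration.integrable_bound[OF Bochner_Integration.integrable_add[OF integrable_base_sq int]])
  have "\<bar>x * y\<bar> <= x\<^sup>2 + y\<^sup>2" for x y :: real
  proof -
   have "2 * \<bar>x\<bar> * \<bar>y\<bar> <= x\<^sup>2 + y\<^sup>2"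
    using zero_le_power2[of "\<bar>x\<bar> - \<bar>y\<bar>"] by (simp add: power2_diff)
   moreover have "0 <= \<bar>x\<bar> * \<bar>y\<bar>" by simp
   ultimately show ?thesis unfolding abs_mult by linarith
  qed
  then show "AE z in Q. norm (base (cov z) * k (cov z)) <= norm ((base (cov z))^2 + (k (cov z))^2)"
   unfolding real_norm_def by (intro AE_I2 order_trans[OF _ abs_ge_self])
 qed measurable
 have eq1: "(k (cov z) + wresid (trt z) z)^2 = (k (cov z))^2 + (2 * (k (cov z) * wresid (trt z) z) + (wresid (trt z) z)^2)" for z
  by (simp add: power2_eq_square algebra_simps)
 show "integrable Q (%z. (k (cov z) + wresid (trt z) z)^2)"
  unfolding eq1 using int o1(1) integrable_wresid_sq(2) by simp
 show "(LINT z|Q. (k (cov z) + wresid (trt z) z)^2) = (LINT z|Q. (k (cov z))^2) + noise_var"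
  unfolding eq1 noise_var_def using int o1 integrable_wresid_sq(2) by simp
 have eq2: "infl z * (k (cov z) + wresid (trt z) z) = base (cov z) * k (cov z) + (base (cov z) * wresid (trt z) z + (k (cov z) * wresid (trt z) z + (wresid (trt z) z)^2))" for z
  by (simp add: infl_eq power2_eq_square algebra_simps)
 show "integrable Q (%z. infl z * (k (cov z) + wresid (trt z) z))"
  unfolding eq2 using bk o1(1) o2(1) integrable_wresid_sq(2) by simp
 show "(LINT z|Q. infl z * (k (cov z) + wresid (trt z) z)) = (LINT z|Q. base (cov z) * k (cov z)) + noise_var"
  unfolding eq2 noise_var_def using bk o1 o2 integrable_wresid_sq(2) by simp
qed

lemma infl_moments:
 "integrable Q (%z. (infl z)^2)" "(LINT z|Q. (infl z)^2) = (LINT z|Q. (base (cov z))^2) + noise_var"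
 "integrable Q infl" "(LINT z|Q. infl z) = 0"
proof -
 show sq: "integrable Q (%z. (infl z)^2)" and "(LINT z|Q. (infl z)^2) = (LINT z|Q. (base (cov z))^2) + noise_var"
  using eff_inner(1,4)[OF base_measurable integrable_base_sq] by (simp_all add: infl_eq)
 show "integrable Q infl" by (rule square_integrable_imp_integrable[OF _ sq]) measurable
 have "integrable Q (%z. wresid (trt z) z)" "(LINT z|Q. wresid (trt z) z) = 0"
  using wresid_orthogonal[of "%_. 1"] by simp_all
 then show "(LINT z|Q. infl z) = 0"
  unfolding infl_eq using integrable_base base_mean by simp
qed

section \<open>Asymptotic normality of the matching estimator\<close>

text \<open>The signed residual, set to 0 on the null set where it exceeds \<open>B\<close>. Being
  bounded everywhere, it gives bounded statistics on the product space, where integrability is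
  immediate.\<close>

definition noise :: "'x unit_data => real" where
 "noise z = (if \<bar>resid m (trt z) z\<bar> <= B then (if trt z then 1 else - 1) * resid m (trt z) z else 0)"

lemma noise_measurable [measurable]: "noise \<in> borel_measurable Q"
 unfolding noise_def[abs_def] by measurable

lemma noise_bound: "\<bar>noise z\<bar> <= B"
 using B_nonneg by (auto simp: noise_def)

lemma noise_AE: "AE z in Q. noise z = (if trt z then 1 else - 1) * resid m (trt z) z"
 using resid_bound[of True] resid_bound[of False]
proof eventually_elim
 case (elim z)
 then show ?case by (cases "trt z") (auto simp: noise_def)
qed

lemma noise_orthogonal:
 assumes [measurable]: "\<phi> \<in> borel_measurable (borel \<Otimes>\<^sub>M count_space UNIV)" and b: "!!x a. \<bar>\<phi> (x, a)\<bar> <= C"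
 shows "(LINT z|Q. noise z * \<phi> (cov z, trt z)) = 0"
proof -
 have "(LINT z|Q. noise z * \<phi> (cov z, trt z)) =
   (LINT z|Q. (%(x, a). (if a then 1 else - 1) * \<phi> (x, a)) (cov z, trt z) * resid m (trt z) z)"
 proof (rule integral_cong_AE)
  show "AE z in Q. noise z * \<phi> (cov z, trt z) = (%(x, a). (if a then 1 else - 1) * \<phi> (x, a)) (cov z, trt z) * resid m (trt z) z"
   using noise_AE by eventually_elim simp
 qed measurable
 also have "... = 0"
  by (rule obs_resid_orthogonal(1)[where C=C]) (use b in \<open>auto simp: abs_mult\<close>)
 finally show ?thesis .
qed

text \<open>Since 1 / prop = 1 + odds, the weight 1 + M / K is the inverse propensity plus the
  deviation of M / K from the odds. The first part completes the influence function and the second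
  is the remainder.\<close>

lemma amw_expansion:
 assumes s_eq: "!!x. s x = max c (min (1 - c) (s0 x))" and mp: "matching_population Q trt (%z. s0 (cov z)) c f lo hi"
 shows "sqrt (real n) * (amw s0 m n K z - ate Q) = (\<Sum>i<n. infl (z i)) / sqrt (real n) +
  (\<Sum>i<n. (if trt (z i) then 1 else - 1) * resid m (trt (z i)) (z i) *
   (real (match_count n K (%j. trt (z j)) (%j. s0 (cov (z j))) i) / real K -
    matching_population.odds c (trt (z i)) (s0 (cov (z i))))) / sqrt (real n)"
proof (cases "n = 0")
 case False
 interpret mp: matching_population Q trt "%z. s0 (cov z)" c f lo hi by fact
 define w where "w i = real (match_count n K (%j. trt (z j)) (%j. s0 (cov (z j))) i) / real K" for i
 define r where "r i = (if trt (z i) then 1 else - 1) * resid m (trt (z i)) (z i)" for i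
 have odds: "mp.odds a (s0 x) = 1 / prop_of s a x - 1" for a x
  by (simp add: mp.odds_def mp.pr_def prop_of_def s_eq)
 have "amw s0 m n K z - ate Q = (\<Sum>i<n. base (cov (z i)) + r i * (1 + w i)) / real n"
 proof -
  have 1: "of_bool (trt (z i)) * (1 + w i) * resid m True (z i) - (1 - of_bool (trt (z i))) * (1 + w i) * resid m False (z i) = r i * (1 + w i)" for i
   by (cases "trt (z i)") (auto simp: r_def)
  have "amw s0 m n K z = (\<Sum>i<n. m True (cov (z i)) - m False (cov (z i))) / real n + (\<Sum>i<n. r i * (1 + w i)) / real n"
   unfolding amw_def Let_def w_def[symmetric] 1 by simp
  moreover have "ate Q = (\<Sum>i<n. ate Q) / real n" using False by simp
  ultimately show ?thesis
   by (simp add: base_def sum.distrib sum_subtractf add_divide_distrib diff_divide_distrib)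
 qed
 also have "(\<Sum>i<n. base (cov (z i)) + r i * (1 + w i)) = (\<Sum>i<n. infl (z i) + r i * (w i - mp.odds (trt (z i)) (s0 (cov (z i)))))"
  by (intro sum.cong refl) (simp add: infl_eq wresid_def odds r_def algebra_simps)
 finally have "sqrt (real n) * (amw s0 m n K z - ate Q) =
   sqrt (real n) * ((\<Sum>i<n. infl (z i) + r i * (w i - mp.odds (trt (z i)) (s0 (cov (z i))))) / real n)" by simp
 also have "... = (\<Sum>i<n. infl (z i) + r i * (w i - mp.odds (trt (z i)) (s0 (cov (z i))))) / sqrt (real n)"
  using False by (simp add: field_simps flip: real_sqrt_mult)
 finally show ?thesis
  unfolding sum.distrib add_divide_distrib w_def r_def .
qed simp

text \<open>The weights \<Delta> are functions of all covariates and treatments but of no outcome.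
  For i different from j, integrating out unit i therefore annihilates the product of the two terms,
  and only the diagonal, bounded by B^2 \<Delta>^2, survives.\<close>

lemma weighted_noise_L2:
 fixes n K :: nat and s0 :: "'x => real"
 assumes mp: "matching_population Q trt (%z. s0 (cov z)) c f lo hi" and [measurable]: "s0 \<in> borel_measurable borel"
 defines "\<Delta> \<equiv> %x i. real (match_count n K (%j. trt (x j)) (%j. s0 (cov (x j))) i) / real K -
    matching_population.odds c (trt (x i)) (s0 (cov (x i)))"
 shows "(\<integral>x. ((\<Sum>i<n. noise (x i) * \<Delta> x i) / sqrt (real n))\<^sup>2 \<partial>(\<Pi>\<^sub>M k\<in>{..<n}. Q)) <=
   B\<^sup>2 * (\<integral>x. (\<Sum>i<n. (\<Delta> x i)\<^sup>2) / real n \<partial>(\<Pi>\<^sub>M k\<in>{..<n}. Q))"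
  and "(%x. (\<Sum>i<n. noise (x i) * \<Delta> x i) / sqrt (real n)) \<in> borel_measurable (\<Pi>\<^sub>M k\<in>{..<n}. Q)"
  and "\<exists>C. \<forall>x. \<bar>(\<Sum>i<n. noise (x i) * \<Delta> x i) / sqrt (real n)\<bar> <= C"
proof -
 interpret mp: matching_population Q trt "%z. s0 (cov z)" c f lo hi by fact
 interpret P: prob_space "mp.sample n" by (rule mp.prob_space_sample)
 interpret PS: product_sigma_finite "%_. Q" ..
 let ?M = "mp.sample n"
 define C where "C = \<bar>real n / real K\<bar> + 1 / c"
 have C: "\<bar>\<Delta> x i\<bar> <= C" for x i
 proof -
  have "real (match_count n K (%j. trt (x j)) (%j. s0 (cov (x j))) i) / real K <= real n / real K"
   by (intro divide_right_mono) (simp_all add: match_count_le)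
  moreover have "0 <= real (match_count n K (%j. trt (x j)) (%j. s0 (cov (x j))) i) / real K" by simp
  moreover have "0 <= mp.odds (trt (x i)) (s0 (cov (x i)))" "mp.odds (trt (x i)) (s0 (cov (x i))) <= 1 / c"
   by (rule mp.odds_nonneg mp.odds_le)+
  ultimately show ?thesis unfolding \<Delta>_def C_def by linarith
 qed
 have C0: "0 <= C" using C order_trans[OF abs_ge_zero] by blast
 have comp: "(%x. g (x i)) \<in> borel_measurable ?M" if "i < n" "g \<in> borel_measurable Q" for g :: "_ => real" and i
  using measurable_compose[OF mp.sample_component[OF that(1)] that(2)] .
 have \<Delta>_meas: "(%x. \<Delta> x i) \<in> borel_measurable ?M" if "i < n" for i
 proof -
  have "(%x. real (match_count n K (%j. trt (x j)) (%j. s0 (cov (x j))) i)) \<in> borel_measurable ?M"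
   using measurable_compose[OF mp.count_measurable measurable_count_space] by simp
  moreover have "(%x. mp.odds (trt (x i)) (s0 (cov (x i)))) \<in> borel_measurable ?M"
   by (rule comp[OF that]) measurable
  ultimately show ?thesis unfolding \<Delta>_def by measurable
 qed
 have term_meas: "(%x. noise (x i) * \<Delta> x i) \<in> borel_measurable ?M" if "i < n" for i
  using comp[OF that noise_measurable] \<Delta>_meas[OF that] by measurable
 show meas: "(%x. (\<Sum>i<n. noise (x i) * \<Delta> x i) / sqrt (real n)) \<in> borel_measurable ?M"
  by (intro borel_measurable_divide borel_measurable_sum term_meas) auto
 have term_bd: "\<bar>noise (x i) * \<Delta> x i\<bar> <= B * C" for x i
  unfolding abs_mult by (intro mult_mono noise_bound C B_nonneg) auto
 show "\<exists>C. \<forall>x. \<bar>(\<Sum>i<n. noise (x i) * \<Delta> x i) / sqrt (real n)\<bar> <= C"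
 proof (intro exI allI)
  fix x
  have "\<bar>\<Sum>i<n. noise (x i) * \<Delta> x i\<bar> <= (\<Sum>i<n. B * C)"
   by (intro order_trans[OF sum_abs] sum_mono term_bd)
  then show "\<bar>(\<Sum>i<n. noise (x i) * \<Delta> x i) / sqrt (real n)\<bar> <= (\<Sum>i<n. B * C) / \<bar>sqrt (real n)\<bar>"
   unfolding abs_divide by (rule divide_right_mono) simp
 qed
 have int2: "integrable ?M (%x. (noise (x i) * \<Delta> x i) * (noise (x j) * \<Delta> x j))" if "i < n" "j < n" for i j
 proof (rule P.integrable_const_bound[where B="(B * C) * (B * C)"])
  show "AE x in ?M. norm ((noise (x i) * \<Delta> x i) * (noise (x j) * \<Delta> x j)) <= (B * C) * (B * C)"
   unfolding real_norm_def abs_mult[of "noise _ * \<Delta> _ _"]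
   using B_nonneg C0 by (intro AE_I2 mult_mono term_bd) auto
 qed (use term_meas[OF that(1)] term_meas[OF that(2)] in measurable)
 have cross: "(\<integral>x. (noise (x i) * \<Delta> x i) * (noise (x j) * \<Delta> x j) \<partial>?M) = 0" if ij: "i < n" "j < n" "i ~= j" for i j
 proof -
  let ?J = "{..<n} - {i}"
  have I: "{..<n} = insert i ?J" using ij by auto
  define G where "G x = \<Delta> x i * (noise (x j) * \<Delta> x j)" for x
  have G_meas: "G \<in> borel_measurable ?M"
   unfolding G_def using \<Delta>_meas[OF ij(1)] term_meas[OF ij(2)] by measurable
  have G_bd: "\<bar>G x\<bar> <= C * (B * C)" for x
   unfolding G_def abs_mult[of "\<Delta> _ _"] by (intro mult_mono C term_bd) (use C0 in auto)
  have "(\<integral>x. (noise (x i) * \<Delta> x i) * (noise (x j) * \<Delta> x j) \<partial>?M) = (\<integral>x. noise (x i) * G x \<partial>(\<Pi>\<^sub>M k\<in>insert i ?J. Q))"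
   unfolding I[symmetric] G_def by (simp only: mult.assoc)
  also have "... = (\<integral>x. (LINT z|Q. noise ((x(i := z)) i) * G (x(i := z))) \<partial>(\<Pi>\<^sub>M k\<in>?J. Q))"
  proof (rule PS.product_integral_insert)
   show "integrable (\<Pi>\<^sub>M k\<in>insert i ?J. Q) (%x. noise (x i) * G x)"
    using int2[OF ij(1,2)] unfolding I[symmetric] G_def by (simp only: mult.assoc)
  qed auto
  also have "... = (\<integral>x. 0 \<partial>(\<Pi>\<^sub>M k\<in>?J. Q))"
  proof (intro Bochner_Integration.integral_cong refl)
   fix x assume x: "x \<in> space (\<Pi>\<^sub>M k\<in>?J. Q)"
   \<comment> \<open>\<open>G\<close> sees unit i only through its covariates and treatment; the
     zeros are placeholders for its outcomes. This exhibits \<open>G\<close> as a function to which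
     \<open>noise_orthogonal\<close> applies.\<close>
   define \<phi> where "\<phi> y = G (x(i := (fst y, snd y, 0, 0)))" for y :: "'x \<times> bool"
   have "G (x(i := z)) = \<phi> (cov z, trt z)" for z
   proof -
    let ?z = "(cov z, trt z, 0, 0) :: 'x unit_data"
    have "cov ?z = cov z" "trt ?z = trt z" by (simp_all add: cov_def trt_def)
    then have "trt ((x(i := z)) k) = trt ((x(i := ?z)) k)" "s0 (cov ((x(i := z)) k)) = s0 (cov ((x(i := ?z)) k))" for k
     by simp_all
    then have "(%k. trt ((x(i := z)) k)) = (%k. trt ((x(i := ?z)) k))"
     "(%k. s0 (cov ((x(i := z)) k))) = (%k. s0 (cov ((x(i := ?z)) k)))" by blast+
    then have "\<Delta> (x(i := z)) k = \<Delta> (x(i := ?z)) k" for k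
     unfolding \<Delta>_def by metis
    then show ?thesis using ij unfolding \<phi>_def G_def by simp
   qed
   moreover have "\<phi> \<in> borel_measurable (borel \<Otimes>\<^sub>M count_space UNIV)"
    unfolding \<phi>_def
   proof (rule measurable_compose[OF _ G_meas])
    have "(%y. x(i := (fst y, snd y, 0, 0))) \<in> measurable ((borel :: 'x measure) \<Otimes>\<^sub>M count_space UNIV) (\<Pi>\<^sub>M k\<in>insert i ?J. Q)"
     by (rule measurable_fun_upd[where J="?J"]) (use x in measurable)
    then show "(%y. x(i := (fst y, snd y, 0, 0))) \<in> measurable ((borel :: 'x measure) \<Otimes>\<^sub>M count_space UNIV) ?M"
     unfolding I[symmetric] .
   qed
   ultimately show "(LINT z|Q. noise ((x(i := z)) i) * G (x(i := z))) = 0"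
    using noise_orthogonal[of \<phi> "C * (B * C)"] G_bd by (simp add: \<phi>_def)
  qed
  finally show ?thesis by simp
 qed
 have diag: "(\<integral>x. (noise (x i) * \<Delta> x i) * (noise (x i) * \<Delta> x i) \<partial>?M) <= B\<^sup>2 * (\<integral>x. (\<Delta> x i)\<^sup>2 \<partial>?M)"
  and \<Delta>_int: "integrable ?M (%x. (\<Delta> x i)^2)" if i: "i < n" for i
 proof -
  show ii: "integrable ?M (%x. (\<Delta> x i)^2)"
  proof (rule P.integrable_const_bound[where B="C\<^sup>2"])
   show "AE x in ?M. norm ((\<Delta> x i)^2) <= C\<^sup>2"
    using C C0 by (simp add: abs_le_square_iff[symmetric])
  qed (use \<Delta>_meas[OF i] in measurable)
  have "(\<integral>x. (noise (x i) * \<Delta> x i) * (noise (x i) * \<Delta> x i) \<partial>?M) <= (\<integral>x. B\<^sup>2 * (\<Delta> x i)^2 \<partial>?M)"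
  proof (rule integral_mono[OF int2[OF i i]])
   show "integrable ?M (%x. B\<^sup>2 * (\<Delta> x i)^2)" using ii by simp
   show "(noise (x i) * \<Delta> x i) * (noise (x i) * \<Delta> x i) <= B\<^sup>2 * (\<Delta> x i)^2" for x
   proof -
    have "(noise (x i))^2 <= B\<^sup>2" using noise_bound[of "x i"] B_nonneg by (simp add: abs_le_square_iff[symmetric])
    then have "(noise (x i))^2 * (\<Delta> x i)^2 <= B\<^sup>2 * (\<Delta> x i)^2" by (intro mult_right_mono) auto
    then show ?thesis by (simp add: power2_eq_square mult_ac)
   qed
  qed
  then show "(\<integral>x. (noise (x i) * \<Delta> x i) * (noise (x i) * \<Delta> x i) \<partial>?M) <= B\<^sup>2 * (\<integral>x. (\<Delta> x i)\<^sup>2 \<partial>?M)" by simp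
 qed
 have "(\<integral>x. ((\<Sum>i<n. noise (x i) * \<Delta> x i) / sqrt (real n))\<^sup>2 \<partial>?M) =
   (\<integral>x. (\<Sum>i<n. \<Sum>j<n. (noise (x i) * \<Delta> x i) * (noise (x j) * \<Delta> x j)) / real n \<partial>?M)"
  by (intro Bochner_Integration.integral_cong refl) (simp add: power_divide, simp add: power2_eq_square sum_product)
 also have "... = (\<Sum>i<n. \<Sum>j<n. (\<integral>x. (noise (x i) * \<Delta> x i) * (noise (x j) * \<Delta> x j) \<partial>?M)) / real n"
  by (subst integral_divide_zero, subst Bochner_Integration.integral_sum)
    (auto intro!: Bochner_Integration.integrable_sum int2 sum.cong Bochner_Integration.integral_sum)
 also have "... = (\<Sum>i<n. (\<integral>x. (noise (x i) * \<Delta> x i) * (noise (x i) * \<Delta> x i) \<partial>?M)) / real n"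
 proof -
  have "(\<Sum>j<n. (\<integral>x. (noise (x i) * \<Delta> x i) * (noise (x j) * \<Delta> x j) \<partial>?M)) = (\<integral>x. (noise (x i) * \<Delta> x i) * (noise (x i) * \<Delta> x i) \<partial>?M)"
   if i: "i < n" for i
  proof -
   have "(\<Sum>j\<in>{..<n} - {i}. (\<integral>x. (noise (x i) * \<Delta> x i) * (noise (x j) * \<Delta> x j) \<partial>?M)) = 0"
    by (intro sum.neutral ballI cross) (use i in auto)
   then show ?thesis using i by (subst sum.remove[of _ i]) auto
  qed
  then show ?thesis by simp
 qed
 also have "... <= (\<Sum>i<n. B\<^sup>2 * (\<integral>x. (\<Delta> x i)\<^sup>2 \<partial>?M)) / real n"
  by (intro divide_right_mono sum_mono diag) auto
 also have "... = B\<^sup>2 * (\<integral>x. (\<Sum>i<n. (\<Delta> x i)\<^sup>2) / real n \<partial>?M)"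
  using \<Delta>_int by (simp add: sum_distrib_left Bochner_Integration.integral_sum)
 finally show "(\<integral>x. ((\<Sum>i<n. noise (x i) * \<Delta> x i) / sqrt (real n))\<^sup>2 \<partial>?M) <=
   B\<^sup>2 * (\<integral>x. (\<Sum>i<n. (\<Delta> x i)\<^sup>2) / real n \<partial>?M)" .
qed

theorem amw_weak_conv:
 fixes Z :: "nat => 'w => 'x unit_data" and K :: "nat => nat"
 assumes \<Omega>: "prob_space \<Omega>" and ind: "prob_space.indep_vars \<Omega> (%_. full_space) Z UNIV"
  and dist: "!!i. distr \<Omega> full_space (Z i) = Q"
  and s_eq: "!!x. s x = max c (min (1 - c) (s0 x))" and s0 [measurable]: "s0 \<in> borel_measurable borel"
  and mp: "matching_population Q trt (%z. s0 (cov z)) c f lo hi"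
  and K: "filterlim K at_top sequentially" "(%n. real (K n) / real n) \<longlonglongrightarrow> 0"
 shows "weak_conv_m (%n. distr \<Omega> borel (%\<omega>. sqrt (real n) * (amw s0 m n (K n) (%i. Z i \<omega>) - ate Q)))
   (centered_normal (LINT z|Q. (infl z)^2))"
proof -
 interpret \<Omega>: prob_space \<Omega> by fact
 interpret mp: matching_population Q trt "%z. s0 (cov z)" c f lo hi by fact
 have Zm: "Z i \<in> measurable \<Omega> full_space" for i
  using ind unfolding \<Omega>.indep_vars_def2 by simp
 then have ZQ [measurable]: "Z i \<in> measurable \<Omega> Q" for i
  using measurable_cong_sets[OF refl sets_Q] by blast
 \<comment> \<open>Points of the product space are functions restricted to the index set, hence the
   restricted sample.\<close>
 have sample: "distr \<Omega> (\<Pi>\<^sub>M k\<in>{..<n}. Q) (%\<omega>. \<lambda>i\<in>{..<n}. Z i \<omega>) = (\<Pi>\<^sub>M k\<in>{..<n}. Q)" if n: "0 < n" for n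
 proof -
  have "\<Omega>.indep_vars (%_. full_space) Z {..<n}" by (rule \<Omega>.indep_vars_subset[OF ind]) simp
  then have "distr \<Omega> (\<Pi>\<^sub>M k\<in>{..<n}. full_space) (%\<omega>. \<lambda>i\<in>{..<n}. Z i \<omega>) = (\<Pi>\<^sub>M k\<in>{..<n}. distr \<Omega> full_space (Z k))"
   using n Zm by (subst (asm) \<Omega>.indep_vars_iff_distr_eq_PiM') auto
  moreover have "sets (\<Pi>\<^sub>M k\<in>{..<n}. Q) = sets (\<Pi>\<^sub>M k\<in>{..<n}. full_space :: 'x unit_data measure)"
   by (intro sets_PiM_cong refl sets_Q)
  ultimately show ?thesis
   by (subst distr_cong[OF refl _ refl, of _ "\<Pi>\<^sub>M k\<in>{..<n}. full_space"]) (simp_all add: dist)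
 qed
 define \<Delta> where "\<Delta> n x i = real (match_count n (K n) (%j. trt (x j)) (%j. s0 (cov (x j))) i) / real (K n) -
    mp.odds (trt (x i)) (s0 (cov (x i)))" for n x i
 define W where "W n x = (\<Sum>i<n. noise (x i) * \<Delta> n x i) / sqrt (real n)" for n x
 have W_meas: "W n \<in> borel_measurable (\<Pi>\<^sub>M k\<in>{..<n}. Q)" for n
  using weighted_noise_L2(2)[OF mp s0, where n=n and K="K n"] unfolding W_def[abs_def] \<Delta>_def .
 have W_bd: "\<exists>C. \<forall>x. \<bar>W n x\<bar> <= C" for n
  using weighted_noise_L2(3)[OF mp s0, where n=n and K="K n"] unfolding W_def[abs_def] \<Delta>_def .
 have W_L2: "(\<integral>x. (W n x)\<^sup>2 \<partial>(\<Pi>\<^sub>M k\<in>{..<n}. Q)) <= B\<^sup>2 * (\<integral>x. (\<Sum>i<n. (\<Delta> n x i)\<^sup>2) / real n \<partial>(\<Pi>\<^sub>M k\<in>{..<n}. Q))" for n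
  using weighted_noise_L2(1)[OF mp s0, where n=n and K="K n"] unfolding W_def[abs_def] \<Delta>_def .
 have restr_meas: "(%\<omega>. \<lambda>i\<in>{..<n}. Z i \<omega>) \<in> measurable \<Omega> (\<Pi>\<^sub>M k\<in>{..<n}. Q)" for n
  by (intro measurable_restrict ZQ)
 \<comment> \<open>The statistic reads the first n units only, so results on the product space carry
   over to the sequence.\<close>
 have W_restr: "W n (\<lambda>i\<in>{..<n}. Z i \<omega>) = W n (%i. Z i \<omega>)" for n \<omega>
 proof -
  have "match_count n (K n) (%j. trt ((\<lambda>i\<in>{..<n}. Z i \<omega>) j)) (%j. s0 (cov ((\<lambda>i\<in>{..<n}. Z i \<omega>) j))) i =
    match_count n (K n) (%j. trt (Z j \<omega>)) (%j. s0 (cov (Z j \<omega>))) i" for i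
   by (rule match_count_cong) auto
  then show ?thesis unfolding W_def \<Delta>_def by (intro arg_cong2[where f="(/)"] sum.cong refl) auto
 qed
 define D where "D n \<omega> = W n (%i. Z i \<omega>)" for n \<omega>
 have D_eq: "D n = (%\<omega>. W n (\<lambda>i\<in>{..<n}. Z i \<omega>))" for n
  by (simp add: D_def W_restr fun_eq_iff)
 have D_meas: "D n \<in> borel_measurable \<Omega>" for n
  unfolding D_eq by (rule measurable_compose[OF restr_meas W_meas])
 have D_int: "integrable \<Omega> (%\<omega>. (D n \<omega>)^2)" for n
 proof -
  obtain C where C: "!!x. \<bar>W n x\<bar> <= C" using W_bd by blast
  then have "0 <= C" using order_trans[OF abs_ge_zero] by blast
  then show ?thesis
  proof (intro \<Omega>.integrable_const_bound[where B="C\<^sup>2"])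
   show "AE \<omega> in \<Omega>. norm ((D n \<omega>)^2) <= C\<^sup>2"
    using C \<open>0 <= C\<close> by (auto simp: D_def abs_le_square_iff[symmetric])
  qed (use D_meas[of n] in measurable)
 qed
 have D_null: "(%n. \<Omega>.expectation (%\<omega>. (D n \<omega>)^2)) \<longlonglongrightarrow> 0"
 proof (rule tendsto_sandwich[OF _ _ tendsto_const])
  show "\<forall>\<^sub>F n in sequentially. 0 <= \<Omega>.expectation (%\<omega>. (D n \<omega>)^2)" by simp
  show "(%n. B\<^sup>2 * (\<integral>x. (\<Sum>i<n. (\<Delta> n x i)\<^sup>2) / real n \<partial>(\<Pi>\<^sub>M k\<in>{..<n}. Q))) \<longlonglongrightarrow> 0"
   using tendsto_mult_left[OF mp.match_weight_L2[OF K], of "B\<^sup>2"] unfolding \<Delta>_def by simp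
  show "\<forall>\<^sub>F n in sequentially. \<Omega>.expectation (%\<omega>. (D n \<omega>)^2) <= B\<^sup>2 * (\<integral>x. (\<Sum>i<n. (\<Delta> n x i)\<^sup>2) / real n \<partial>(\<Pi>\<^sub>M k\<in>{..<n}. Q))"
   using eventually_gt_at_top[of 0]
  proof eventually_elim
   case (elim n)
   have "(\<integral>x. (W n x)\<^sup>2 \<partial>(\<Pi>\<^sub>M k\<in>{..<n}. Q)) = (\<integral>x. (W n x)\<^sup>2 \<partial>distr \<Omega> (\<Pi>\<^sub>M k\<in>{..<n}. Q) (%\<omega>. \<lambda>i\<in>{..<n}. Z i \<omega>))"
    unfolding sample[OF elim] ..
   also have "... = \<Omega>.expectation (%\<omega>. (D n \<omega>)^2)"
    unfolding D_eq by (rule integral_distr[OF restr_meas]) (use W_meas[of n] in measurable)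
   finally show ?case using W_L2[of n] by simp
  qed
 qed
 have S_ind: "\<Omega>.indep_vars (%_. borel) (%i \<omega>. infl (Z i \<omega>)) UNIV"
 proof (rule \<Omega>.indep_vars_compose2[OF ind])
  show "infl \<in> measurable full_space borel"
   using infl_measurable measurable_cong_sets[OF sets_Q refl] by blast
 qed
 have Q_distr: "distr \<Omega> Q (Z i) = Q" for i
  using dist[of i] distr_cong[OF refl sets_Q refl, of \<Omega> "Z i"] by metis
 have inflZ: "\<Omega>.expectation (%\<omega>. g (infl (Z i \<omega>))) = (LINT z|Q. g (infl z))" if [measurable]: "g \<in> borel_measurable borel" for g :: "real => real" and i
  by (subst (2) Q_distr[of i, symmetric], subst integral_distr) auto
 have "weak_conv_m (%n. distr \<Omega> borel (%\<omega>. (\<Sum>i<n. infl (Z i \<omega>)) / sqrt (real n))) (centered_normal (LINT z|Q. (infl z)^2))"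
 proof (rule \<Omega>.iid_sum_weak_conv[OF S_ind])
  show "distr \<Omega> borel (%\<omega>. infl (Z n \<omega>)) = distr Q borel infl" for n
   by (subst (2) Q_distr[of n, symmetric], subst distr_distr) (auto simp: comp_def)
  show "integrable \<Omega> (%\<omega>. (infl (Z n \<omega>))^2)" for n
   using integrable_distr[OF ZQ[of n], of "%z. (infl z)^2"] infl_moments(1) Q_distr[of n] by simp
  show "\<Omega>.expectation (%\<omega>. infl (Z n \<omega>)) = 0" for n
   using inflZ[of "%x. x" n] infl_moments(4) by simp
  show "\<Omega>.expectation (%\<omega>. (infl (Z n \<omega>))^2) = (LINT z|Q. (infl z)^2)" for n
   using inflZ[of "%x. x\<^sup>2" n] by simp
 qed
 then have conv: "weak_conv_m (%n. distr \<Omega> borel (%\<omega>. (\<Sum>i<n. infl (Z i \<omega>)) / sqrt (real n) + D n \<omega>)) (centered_normal (LINT z|Q. (infl z)^2))"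
  by (intro \<Omega>.weak_conv_add_L2_null D_int D_null D_meas real_distribution_centered_normal) measurable
 have noiseZ: "AE \<omega> in \<Omega>. \<forall>i. noise (Z i \<omega>) = (if trt (Z i \<omega>) then 1 else - 1) * resid m (trt (Z i \<omega>)) (Z i \<omega>)"
  unfolding AE_all_countable
 proof
  fix i
  have "AE z in distr \<Omega> Q (Z i). noise z = (if trt z then 1 else - 1) * resid m (trt z) z"
   unfolding Q_distr by (rule noise_AE)
  then show "AE \<omega> in \<Omega>. noise (Z i \<omega>) = (if trt (Z i \<omega>) then 1 else - 1) * resid m (trt (Z i \<omega>)) (Z i \<omega>)"
   by (rule AE_distrD[OF ZQ])
 qed
 have "distr \<Omega> borel (%\<omega>. (\<Sum>i<n. infl (Z i \<omega>)) / sqrt (real n) + D n \<omega>) =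
  distr \<Omega> borel (%\<omega>. sqrt (real n) * (amw s0 m n (K n) (%i. Z i \<omega>) - ate Q))" for n
 proof -
  define L where "L \<omega> = (\<Sum>i<n. infl (Z i \<omega>)) / sqrt (real n) + (\<Sum>i<n. (if trt (Z i \<omega>) then 1 else - 1) * resid m (trt (Z i \<omega>)) (Z i \<omega>) * \<Delta> n (%i. Z i \<omega>) i) / sqrt (real n)" for \<omega>
  have L_eq: "L = (%\<omega>. sqrt (real n) * (amw s0 m n (K n) (%i. Z i \<omega>) - ate Q))"
   unfolding L_def \<Delta>_def fun_eq_iff using amw_expansion[OF s_eq mp] by simp
  have \<Delta>Z: "(%\<omega>. \<Delta> n (%i. Z i \<omega>) i) \<in> borel_measurable \<Omega>" if i: "i < n" for i
  proof -
   have "(%\<omega>. real (match_count n (K n) (%j. trt ((\<lambda>i\<in>{..<n}. Z i \<omega>) j)) (%j. s0 (cov ((\<lambda>i\<in>{..<n}. Z i \<omega>) j))) i)) \<in> borel_measurable \<Omega>"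
   proof (rule measurable_compose[OF restr_meas])
    show "(%x. real (mp.count n (K n) x i)) \<in> borel_measurable (mp.sample n)"
     using measurable_compose[OF mp.count_measurable measurable_count_space] by simp
   qed
   moreover have "match_count n (K n) (%j. trt ((\<lambda>i\<in>{..<n}. Z i \<omega>) j)) (%j. s0 (cov ((\<lambda>i\<in>{..<n}. Z i \<omega>) j))) i =
     match_count n (K n) (%j. trt (Z j \<omega>)) (%j. s0 (cov (Z j \<omega>))) i" for \<omega>
    by (rule match_count_cong) auto
   ultimately have [measurable]: "(%\<omega>. real (match_count n (K n) (%j. trt (Z j \<omega>)) (%j. s0 (cov (Z j \<omega>))) i)) \<in> borel_measurable \<Omega>"
    by simp
   show ?thesis unfolding \<Delta>_def by measurable
  qed
  have rZ: "(%\<omega>. resid m (trt (Z i \<omega>)) (Z i \<omega>)) \<in> borel_measurable \<Omega>" for i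
   by (rule measurable_compose[OF ZQ resid_obs_measurable])
  have tZ: "(%\<omega>. (if trt (Z i \<omega>) then 1 else - 1) * resid m (trt (Z i \<omega>)) (Z i \<omega>) * \<Delta> n (%i. Z i \<omega>) i) \<in> borel_measurable \<Omega>"
   if i: "i < n" for i
  proof -
   have [measurable]: "Measurable.pred \<Omega> (%\<omega>. trt (Z i \<omega>))"
    by (rule measurable_compose[OF Zm trt_measurable])
   note [measurable] = rZ[of i] \<Delta>Z[OF i]
   show ?thesis by (intro borel_measurable_times rZ \<Delta>Z[OF i]) measurable
  qed
  have "(%\<omega>. (\<Sum>i<n. infl (Z i \<omega>)) / sqrt (real n)) \<in> borel_measurable \<Omega>" by measurable
  moreover have "(%\<omega>. (\<Sum>i<n. (if trt (Z i \<omega>) then 1 else - 1) * resid m (trt (Z i \<omega>)) (Z i \<omega>) * \<Delta> n (%i. Z i \<omega>) i) / sqrt (real n)) \<in> borel_measurable \<Omega>"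
   by (intro borel_measurable_divide borel_measurable_sum tZ) auto
  ultimately have L_meas: "L \<in> borel_measurable \<Omega>"
   unfolding L_def[abs_def] by (rule borel_measurable_add)
  have "AE \<omega> in \<Omega>. (\<Sum>i<n. infl (Z i \<omega>)) / sqrt (real n) + D n \<omega> = L \<omega>"
   using noiseZ by eventually_elim (simp add: D_def W_def L_def)
  then show ?thesis
   unfolding L_eq[symmetric] using D_meas[of n] L_meas by (intro distr_cong_AE) auto
 qed
 then show ?thesis using conv by simp
qed

end

section \<open>Differentiability in quadratic mean\<close>

lemma abs_mult_le_sum_squares: "\<bar>x * y\<bar> <= x\<^sup>2 + y\<^sup>2" for x y :: real
proof -
 have "2 * \<bar>x\<bar> * \<bar>y\<bar> <= x\<^sup>2 + y\<^sup>2"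
  using zero_le_power2[of "\<bar>x\<bar> - \<bar>y\<bar>"] by (simp add: power2_diff)
 moreover have "0 <= \<bar>x\<bar> * \<bar>y\<bar>" by simp
 ultimately show ?thesis unfolding abs_mult by linarith
qed

lemma sum_square_le: "(x + y)^2 <= 2 * x\<^sup>2 + 2 * y\<^sup>2" for x y :: real
 using zero_le_power2[of "x - y"] by (simp add: power2_eq_square algebra_simps)

lemma integrable_mult_square:
 fixes f g :: "'a => real"
 assumes [measurable]: "f \<in> borel_measurable M" "g \<in> borel_measurable M"
  and i: "integrable M (%x. (f x)^2)" "integrable M (%x. (g x)^2)"
 shows "integrable M (%x. f x * g x)"
proof (rule Bochner_Integration.integrable_bound[OF Bochner_Integration.integrable_add[OF i]])
 show "AE x in M. norm (f x * g x) <= norm ((f x)^2 + (g x)^2)"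
  unfolding real_norm_def by (intro AE_I2 order_trans[OF abs_mult_le_sum_squares abs_ge_self])
qed measurable

lemma integrable_add_square:
 fixes f g :: "'a => real"
 assumes [measurable]: "f \<in> borel_measurable M" "g \<in> borel_measurable M"
  and i: "integrable M (%x. (f x)^2)" "integrable M (%x. (g x)^2)"
 shows "integrable M (%x. (f x + g x)^2)"
proof -
 have "(f x + g x)^2 = (f x)^2 + (g x)^2 + 2 * (f x * g x)" for x by (simp add: power2_sum)
 then show ?thesis using i integrable_mult_square[OF assms] by simp
qed

lemma Cauchy_Schwarz_integral:
 fixes f g :: "'a => real"
 assumes [measurable]: "f \<in> borel_measurable M" "g \<in> borel_measurable M"
  and i: "integrable M (%x. (f x)^2)" "integrable M (%x. (g x)^2)"
 shows "(LINT x|M. f x * g x)^2 <= (LINT x|M. (f x)^2) * (LINT x|M. (g x)^2)"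
proof -
 define A B C where "A = (LINT x|M. (f x)^2)" and "B = (LINT x|M. f x * g x)" and "C = (LINT x|M. (g x)^2)"
 have fg: "integrable M (%x. f x * g x)" by (rule integrable_mult_square[OF assms])
 have q: "0 <= A + 2 * l * B + l\<^sup>2 * C" for l
 proof -
  have "0 <= (LINT x|M. (f x + l * g x)^2)" by simp
  also have "... = (LINT x|M. (f x)^2 + (2 * l) * (f x * g x) + l\<^sup>2 * (g x)^2)"
   by (intro Bochner_Integration.integral_cong) (auto simp: power2_eq_square algebra_simps)
  also have "... = A + 2 * l * B + l\<^sup>2 * C"
   unfolding A_def B_def C_def using i fg by simp
  finally show ?thesis .
 qed
 have "B\<^sup>2 <= A * C"
 proof (cases "C = 0")
  case True
  have "B = 0"
  proof (rule ccontr)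
   assume "B ~= 0"
   \<comment> \<open>With C = 0 the quadratic in l is affine; this l sends it to -1, contradicting
     nonnegativity. For C > 0 the minimizer l = - B / C is used.\<close>
   then have "A + 2 * (- (A + 1) / (2 * B)) * B + (- (A + 1) / (2 * B))^2 * C = - 1"
    using True by (simp add: field_simps)
   with q[of "- (A + 1) / (2 * B)"] show False by linarith
  qed
  then show ?thesis using True by simp
 next
  case False
  moreover have "0 <= C" by (simp add: C_def)
  ultimately have C: "0 < C" by simp
  have "A + 2 * (- B / C) * B + (- B / C)^2 * C = A - B\<^sup>2 / C"
   using C by (simp add: power2_eq_square field_simps)
  with q[of "- B / C"] have "B\<^sup>2 / C <= A" by linarith
  then show ?thesis using C by (simp add: pos_divide_le_eq)
 qed
 then show ?thesis by (simp add: A_def B_def C_def)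
qed

lemma abs_integral_mult_le:
 fixes f g :: "'a => real"
 assumes "f \<in> borel_measurable M" "g \<in> borel_measurable M"
  and "integrable M (%x. (f x)^2)" "integrable M (%x. (g x)^2)"
 shows "\<bar>\<integral>x. f x * g x \<partial>M\<bar> <= sqrt (LINT x|M. (f x)^2) * sqrt (LINT x|M. (g x)^2)"
proof -
 have "\<bar>\<integral>x. f x * g x \<partial>M\<bar> = sqrt ((LINT x|M. f x * g x)^2)" by simp
 also have "... <= sqrt ((LINT x|M. (f x)^2) * (LINT x|M. (g x)^2))"
  using Cauchy_Schwarz_integral[OF assms] by (rule real_sqrt_le_mono)
 finally show ?thesis by (simp add: real_sqrt_mult)
qed

text \<open>Sequences t n tending to 0 replace the continuous parameter because a subsequence must
  be taken later, along which the propensity scores converge almost everywhere.\<close>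

locale dqm_sequence =
 fixes \<nu> :: "'y measure" and p :: "nat => 'y => real" and p0 g :: "'y => real" and t :: "nat => real"
 assumes p_measurable [measurable]: "!!n. p n \<in> borel_measurable \<nu>" and p0_measurable [measurable]: "p0 \<in> borel_measurable \<nu>"
  and g_measurable [measurable]: "g \<in> borel_measurable \<nu>"
  and p_nonneg: "!!n y. 0 <= p n y" and p0_nonneg: "!!y. 0 <= p0 y"
  and p_integrable: "!!n. integrable \<nu> (p n)" and p0_integrable: "integrable \<nu> p0"
  and p_total: "!!n. (LINT y|\<nu>. p n y) = 1" and p0_total: "(LINT y|\<nu>. p0 y) = 1"
  and g_integrable: "integrable \<nu> (%y. (g y)^2 * p0 y)"
  and t_nz: "!!n. t n ~= 0" and t_null: "t \<longlonglongrightarrow> 0"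
  and dqm: "(%n. \<integral>\<^sup>+ y. ennreal (((sqrt (p n y) - sqrt (p0 y)) / t n - g y * sqrt (p0 y) / 2)^2) \<partial>\<nu>) \<longlonglongrightarrow> 0"
begin

definition root_diff :: "nat => 'y => real" where "root_diff n y = sqrt (p n y) - sqrt (p0 y)"
definition rem :: "nat => 'y => real" where "rem n y = root_diff n y / t n - g y * sqrt (p0 y) / 2"

lemma measurables [measurable]: "root_diff n \<in> borel_measurable \<nu>" "rem n \<in> borel_measurable \<nu>"
 unfolding root_diff_def[abs_def] rem_def[abs_def] by measurable

lemma sqrt_sq: "(sqrt (p n y))^2 = p n y" "(sqrt (p0 y))^2 = p0 y"
 using p_nonneg p0_nonneg by simp_all

lemma g_root_integrable: "integrable \<nu> (%y. (g y * sqrt (p0 y))^2)"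
 using g_integrable by (simp add: power_mult_distrib p0_nonneg)

lemma root_integrable: "integrable \<nu> (%y. (sqrt (p n y))^2)" "integrable \<nu> (%y. (sqrt (p0 y))^2)"
 unfolding sqrt_sq using p_integrable p0_integrable by simp_all

lemma root_diff_integrable: "integrable \<nu> (%y. (root_diff n y)^2)"
 using integrable_add_square[of "%y. sqrt (p n y)" \<nu> "%y. - sqrt (p0 y)"] root_integrable
 by (simp add: root_diff_def)

lemma rem_integrable: "integrable \<nu> (%y. (rem n y)^2)"
proof -
 have "integrable \<nu> (%y. (root_diff n y / t n)^2)" "integrable \<nu> (%y. (- (g y * sqrt (p0 y) / 2))^2)"
  using root_diff_integrable g_root_integrable by (simp_all add: power_divide)
 from integrable_add_square[OF _ _ this] show ?thesis by (simp add: rem_def)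
qed

lemma rem_null: "(%n. \<integral>y. (rem n y)\<^sup>2 \<partial>\<nu>) \<longlonglongrightarrow> 0"
proof -
 have "(\<integral>\<^sup>+ y. ennreal (((sqrt (p n y) - sqrt (p0 y)) / t n - g y * sqrt (p0 y) / 2)^2) \<partial>\<nu>) = ennreal (LINT y|\<nu>. (rem n y)\<^sup>2)" for n
  unfolding rem_def[symmetric] root_diff_def[symmetric] by (rule nn_integral_eq_integral[OF rem_integrable]) simp
 then have "(%n. ennreal (LINT y|\<nu>. (rem n y)\<^sup>2)) \<longlonglongrightarrow> ennreal 0" using dqm by simp
 then show ?thesis by (rule tendsto_ennrealD) simp_all
qed

lemma root_diff_eq: "root_diff n y = t n * (rem n y + g y * sqrt (p0 y) / 2)"
 using t_nz[of n] by (simp add: rem_def field_simps)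

text \<open>The contribution of \<open>S\<close> to the squared Hellinger distance, up to
  normalization. It is O(t^2) on the whole space and o(t^2) on sets that eventually leave every
  point of positive density.\<close>

definition h :: "nat => 'y set => real" where
 "h n S = (LINT y|\<nu>. indicator S y * (root_diff n y)^2)"

lemma indicator_integrable:
 assumes "integrable \<nu> f" "S \<in> sets \<nu>" shows "integrable \<nu> (%y. indicator S y * f y :: real)"
 using integrable_real_mult_indicator[OF assms(2,1)] by (simp add: mult.commute)

lemma h_le:
 assumes [measurable]: "S \<in> sets \<nu>"
 shows "h n S <= (t n)^2 * (2 * (LINT y|\<nu>. (rem n y)\<^sup>2) + (LINT y|\<nu>. indicator S y * ((g y)^2 * p0 y)))"
proof -
 have i: "integrable \<nu> (%y. indicator S y * ((g y)^2 * p0 y))"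
  by (rule indicator_integrable[OF g_integrable assms])
 have "h n S <= (LINT y|\<nu>. (t n)\<^sup>2 * (2 * (rem n y)^2 + indicator S y * ((g y)^2 * p0 y)))"
  unfolding h_def
 proof (rule integral_mono)
  show "integrable \<nu> (%y. indicator S y * (root_diff n y)^2)" by (rule indicator_integrable[OF root_diff_integrable assms])
  show "integrable \<nu> (%y. (t n)^2 * (2 * (rem n y)^2 + indicator S y * ((g y)^2 * p0 y)))"
   using i rem_integrable by simp
  show "indicator S y * (root_diff n y)^2 <= (t n)^2 * (2 * (rem n y)^2 + indicator S y * ((g y)^2 * p0 y))" for y
  proof (cases "y \<in> S")
   case True
   have "(rem n y + g y * sqrt (p0 y) / 2)^2 <= 2 * (rem n y)^2 + 2 * (g y * sqrt (p0 y) / 2)^2"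
    by (rule sum_square_le)
   also have "2 * (g y * sqrt (p0 y) / 2)^2 = (g y)^2 * p0 y / 2"
    by (simp add: power_divide power_mult_distrib p0_nonneg)
   also have "... <= (g y)^2 * p0 y" using p0_nonneg[of y] by simp
   finally have "(rem n y + g y * sqrt (p0 y) / 2)^2 <= 2 * (rem n y)^2 + (g y)^2 * p0 y" by simp
   then show ?thesis using True unfolding root_diff_eq power_mult_distrib by (simp add: mult_left_mono)
  qed simp
 qed
 also have "... = (t n)^2 * (2 * (LINT y|\<nu>. (rem n y)\<^sup>2) + (LINT y|\<nu>. indicator S y * ((g y)^2 * p0 y)))"
  using i rem_integrable by simp
 finally show ?thesis .
qed

lemma h_nonneg: "0 <= h n S"
 unfolding h_def by simp

lemma h_mono: "S \<subseteq> S' ==> S \<in> sets \<nu> ==> S' \<in> sets \<nu> ==> h n S <= h n S'"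
 unfolding h_def
 by (intro integral_mono indicator_integrable root_diff_integrable) (auto simp: indicator_def)

text \<open>Up to a vanishing remainder, \<open>h\<close> divided by t^2 is bounded by the integral
  of g^2 p0 over the sets, which tends to 0 by dominated convergence.\<close>

lemma h_null:
 assumes [measurable]: "!!n. S n \<in> sets \<nu>" and S: "AE y in \<nu>. p0 y > 0 --> (\<forall>\<^sub>F n in sequentially. y \<notin> S n)"
 shows "(%n. h n (S n) / (t n)^2) \<longlonglongrightarrow> 0"
proof -
 have lim: "(%n. \<integral>y. indicator (S n) y * ((g y)^2 * p0 y) \<partial>\<nu>) \<longlonglongrightarrow> (LINT y|\<nu>. 0)"
 proof (rule integral_dominated_convergence[OF _ _ g_integrable])
  show "AE y in \<nu>. (%n. indicator (S n) y * ((g y)^2 * p0 y)) \<longlonglongrightarrow> 0"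
   using S
  proof eventually_elim
   case (elim y)
   show ?case
   proof (cases "p0 y > 0")
    case True
    then have "\<forall>\<^sub>F n in sequentially. indicator (S n) y * ((g y)^2 * p0 y) = 0"
     using elim by (auto elim!: eventually_mono)
    then show ?thesis by (rule tendsto_eventually)
   next
    case False
    then have "p0 y = 0" using p0_nonneg[of y] by linarith
    then show ?thesis by simp
   qed
  qed
  show "AE y in \<nu>. norm (indicator (S n) y * ((g y)^2 * p0 y)) <= (g y)^2 * p0 y" for n
   using p0_nonneg by (auto simp: indicator_def)
 qed measurable
 have "(%n. 2 * (LINT y|\<nu>. (rem n y)\<^sup>2) + (LINT y|\<nu>. indicator (S n) y * ((g y)^2 * p0 y))) \<longlonglongrightarrow> 2 * 0 + 0"
  using lim by (intro tendsto_intros rem_null) simp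
 then have lim0: "(%n. 2 * (LINT y|\<nu>. (rem n y)\<^sup>2) + (LINT y|\<nu>. indicator (S n) y * ((g y)^2 * p0 y))) \<longlonglongrightarrow> 0"
  by simp
 have "h n (S n) / (t n)^2 <= 2 * (LINT y|\<nu>. (rem n y)\<^sup>2) + (LINT y|\<nu>. indicator (S n) y * ((g y)^2 * p0 y))" for n
  using h_le[of "S n" n] t_nz[of n] by (simp add: pos_divide_le_eq mult.commute)
 then show ?thesis
  by (intro Lim_null_comparison[OF _ lim0] always_eventually allI) (simp add: h_nonneg)
qed

lemma h_bounded: "\<exists>C. \<forall>n. h n (space \<nu>) <= C * (t n)^2"
proof -
 obtain R where R: "!!n. \<bar>\<integral>y. (rem n y)\<^sup>2 \<partial>\<nu>\<bar> <= R"
  using convergent_imp_Bseq[OF convergentI[OF rem_null]] unfolding Bseq_def by auto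
 show ?thesis
 proof (intro exI allI)
  fix n
  have "h n (space \<nu>) <= (t n)^2 * (2 * (LINT y|\<nu>. (rem n y)\<^sup>2) + (LINT y|\<nu>. indicator (space \<nu>) y * ((g y)^2 * p0 y)))"
   by (rule h_le) simp
  also have "... <= (t n)^2 * (2 * R + (LINT y|\<nu>. indicator (space \<nu>) y * ((g y)^2 * p0 y)))"
   using R[of n] by (intro mult_left_mono) auto
  finally show "h n (space \<nu>) <= (2 * R + (LINT y|\<nu>. indicator (space \<nu>) y * ((g y)^2 * p0 y))) * (t n)^2"
   by (simp add: mult.commute)
 qed
qed

lemma root_diff_null: "(%n. \<integral>y. (root_diff n y)\<^sup>2 \<partial>\<nu>) \<longlonglongrightarrow> 0"
proof -
 have eq: "(LINT y|\<nu>. (root_diff n y)\<^sup>2) = h n (space \<nu>)" for n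
  unfolding h_def by (intro Bochner_Integration.integral_cong) auto
 obtain C where C: "!!n. h n (space \<nu>) <= C * (t n)^2" using h_bounded by blast
 have "(%n. C * (t n)^2) \<longlonglongrightarrow> C * 0\<^sup>2" by (intro tendsto_intros t_null)
 then have lim0: "(%n. C * (t n)^2) \<longlonglongrightarrow> 0" by simp
 show ?thesis unfolding eq
  by (intro Lim_null_comparison[OF _ lim0] always_eventually allI) (simp add: h_nonneg C)
qed

lemma p_diff_eq: "p n y - p0 y = root_diff n y * (sqrt (p n y) + sqrt (p0 y))"
 using p_nonneg[of n y] p0_nonneg[of y] by (simp add: root_diff_def algebra_simps)

lemma L1_null: "(%n. \<integral>y. \<bar>p n y - p0 y\<bar> \<partial>\<nu>) \<longlonglongrightarrow> 0"
proof (rule tendsto_sandwich[OF _ _ tendsto_const])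
 show "\<forall>\<^sub>F n in sequentially. 0 <= (LINT y|\<nu>. \<bar>p n y - p0 y\<bar>)" by simp
 show "(%n. sqrt (LINT y|\<nu>. (root_diff n y)\<^sup>2) * sqrt 4) \<longlonglongrightarrow> 0"
  using tendsto_mult_right[OF tendsto_real_sqrt[OF root_diff_null], of "sqrt 4"] by simp
 show "\<forall>\<^sub>F n in sequentially. (LINT y|\<nu>. \<bar>p n y - p0 y\<bar>) <= sqrt (LINT y|\<nu>. (root_diff n y)\<^sup>2) * sqrt 4"
 proof (intro always_eventually allI)
  fix n
  have i: "integrable \<nu> (%y. (sqrt (p n y) + sqrt (p0 y))^2)"
   by (rule integrable_add_square[OF _ _ root_integrable]) measurable
  have le4: "(LINT y|\<nu>. (sqrt (p n y) + sqrt (p0 y))\<^sup>2) <= 4"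
  proof -
   have "(LINT y|\<nu>. (sqrt (p n y) + sqrt (p0 y))\<^sup>2) <= (LINT y|\<nu>. 2 * p n y + 2 * p0 y)"
    using sum_square_le[of "sqrt (p n y)" "sqrt (p0 y)" for y]
    by (intro integral_mono i) (simp_all add: p_integrable p0_integrable sqrt_sq)
   then show ?thesis using p_integrable p0_integrable by (simp add: p_total p0_total)
  qed
  have "(LINT y|\<nu>. \<bar>p n y - p0 y\<bar>) = (LINT y|\<nu>. \<bar>root_diff n y\<bar> * (sqrt (p n y) + sqrt (p0 y)))"
   unfolding p_diff_eq abs_mult using p_nonneg p0_nonneg by (intro Bochner_Integration.integral_cong) auto
  also have "... <= \<bar>\<integral>y. \<bar>root_diff n y\<bar> * (sqrt (p n y) + sqrt (p0 y)) \<partial>\<nu>\<bar>" by simp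
  also have "... <= sqrt (LINT y|\<nu>. \<bar>root_diff n y\<bar>\<^sup>2) * sqrt (LINT y|\<nu>. (sqrt (p n y) + sqrt (p0 y))\<^sup>2)"
   using root_diff_integrable i by (intro abs_integral_mult_le) auto
  also have "... <= sqrt (LINT y|\<nu>. (root_diff n y)\<^sup>2) * sqrt 4"
   using le4 by (intro mult_mono real_sqrt_le_mono) auto
  finally show "(LINT y|\<nu>. \<bar>p n y - p0 y\<bar>) <= sqrt (LINT y|\<nu>. (root_diff n y)\<^sup>2) * sqrt 4" .
 qed
qed

lemma p_le: "p n y <= 2 * p0 y + 2 * (root_diff n y)^2"
 using sum_square_le[of "sqrt (p0 y)" "root_diff n y"] p_nonneg[of n y] p0_nonneg[of y] by (simp add: root_diff_def)

text \<open>Expresses one root density as the other plus their difference and squares. Smallness of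
  a set is thereby transferred between the two laws at the price of \<open>h\<close>.\<close>

lemma mass_le:
 assumes [measurable]: "S \<in> sets \<nu>"
 shows "(LINT y|\<nu>. indicator S y * p n y) <= 2 * (LINT y|\<nu>. indicator S y * p0 y) + 2 * h n S"
  and "(LINT y|\<nu>. indicator S y * p0 y) <= 2 * (LINT y|\<nu>. indicator S y * p n y) + 2 * h n S"
proof -
 note i = indicator_integrable[OF p_integrable assms] indicator_integrable[OF p0_integrable assms]
  indicator_integrable[OF root_diff_integrable assms]
 have 2: "p0 y <= 2 * p n y + 2 * (root_diff n y)^2" for y
  using sum_square_le[of "sqrt (p n y)" "- root_diff n y"] p_nonneg[of n y] p0_nonneg[of y]
  by (simp add: root_diff_def power2_commute)
 have "(LINT y|\<nu>. indicator S y * p n y) <= (LINT y|\<nu>. 2 * (indicator S y * p0 y) + 2 * (indicator S y * (root_diff n y)^2))"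
  using i p_le by (intro integral_mono) (auto simp: indicator_def)
 then show "(LINT y|\<nu>. indicator S y * p n y) <= 2 * (LINT y|\<nu>. indicator S y * p0 y) + 2 * h n S"
  unfolding h_def using i by simp
 have "(LINT y|\<nu>. indicator S y * p0 y) <= (LINT y|\<nu>. 2 * (indicator S y * p n y) + 2 * (indicator S y * (root_diff n y)^2))"
  using i 2 by (intro integral_mono) (auto simp: indicator_def)
 then show "(LINT y|\<nu>. indicator S y * p0 y) <= 2 * (LINT y|\<nu>. indicator S y * p n y) + 2 * h n S"
  unfolding h_def using i by simp
qed

text \<open>Factor p n - p0 as a difference times a sum of roots. The remainder of the root
  expansion vanishes by Cauchy-Schwarz, since \<xi> has bounded second moments under both laws. What
  is left is the limit term and the product \<open>u\<close> of \<xi>, the root difference and g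
  sqrt p0. The dominating \<open>D\<close> is controlled under p0 alone, so \<open>u\<close> has to
  be split according to the size of \<open>D\<close>.\<close>

theorem expectation_derivative:
 fixes \<xi> :: "nat => 'y => real"
 assumes [measurable]: "!!n. \<xi> n \<in> borel_measurable \<nu>" "D \<in> borel_measurable \<nu>" "\<phi> \<in> borel_measurable \<nu>"
  and inn: "!!n. integrable \<nu> (%y. (\<xi> n y)^2 * p n y)" and bd: "!!n. (LINT y|\<nu>. (\<xi> n y)\<^sup>2 * p n y) <= C"
  and D: "integrable \<nu> (%y. (D y)^2 * p0 y)" and \<xi>D: "!!n y. \<bar>\<xi> n y\<bar> <= D y"
  and conv: "AE y in \<nu>. p0 y > 0 --> (%n. \<xi> n y) \<longlonglongrightarrow> \<phi> y"
 shows "(%n. ((LINT y|\<nu>. \<xi> n y * p n y) - (LINT y|\<nu>. \<xi> n y * p0 y)) / t n) \<longlonglongrightarrow> (LINT y|\<nu>. \<phi> y * g y * p0 y)"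
proof -
 have D0: "0 <= D y" for y using \<xi>D[of undefined y] by linarith
 have D_root: "integrable \<nu> (%y. (D y * sqrt (p0 y))^2)"
  using D by (simp add: power_mult_distrib p0_nonneg)
 have \<xi>n_root: "integrable \<nu> (%y. (\<xi> n y * sqrt (p n y))^2)" for n
  using inn by (simp add: power_mult_distrib p_nonneg)
 have \<xi>_le: "(\<xi> n y * sqrt (p0 y))^2 <= (D y * sqrt (p0 y))^2" for n y
  using mult_right_mono[OF \<xi>D[of n y], of "sqrt (p0 y)"] p0_nonneg[of y] D0[of y]
  by (simp add: abs_le_square_iff[symmetric] abs_mult)
 have \<xi>0_root: "integrable \<nu> (%y. (\<xi> n y * sqrt (p0 y))^2)" for n
  by (rule Bochner_Integration.integrable_bound[OF D_root]) (use \<xi>_le in auto)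
 define C0 where "C0 = (LINT y|\<nu>. (D y * sqrt (p0 y))\<^sup>2)"
 define s where "s n y = \<xi> n y * (sqrt (p n y) + sqrt (p0 y))" for n y
 have [measurable]: "s n \<in> borel_measurable \<nu>" for n unfolding s_def[abs_def] by measurable
 have s_eq: "s n = (%y. \<xi> n y * sqrt (p n y) + \<xi> n y * sqrt (p0 y))" for n
  by (simp add: s_def fun_eq_iff distrib_left)
 have s_int: "integrable \<nu> (%y. (s n y)^2)" for n
  unfolding s_eq by (rule integrable_add_square[OF _ _ \<xi>n_root \<xi>0_root]) measurable
 have s_bd: "(LINT y|\<nu>. (s n y)\<^sup>2) <= 2 * C + 2 * C0" for n
 proof -
  have "(LINT y|\<nu>. (s n y)\<^sup>2) <= (LINT y|\<nu>. 2 * (\<xi> n y * sqrt (p n y))^2 + 2 * (D y * sqrt (p0 y))^2)"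
  proof (rule integral_mono[OF s_int])
   show "(s n y)^2 <= 2 * (\<xi> n y * sqrt (p n y))^2 + 2 * (D y * sqrt (p0 y))^2" for y
    using sum_square_le[of "\<xi> n y * sqrt (p n y)" "\<xi> n y * sqrt (p0 y)"] \<xi>_le[of n y] unfolding s_eq by linarith
  qed (use \<xi>n_root D_root in simp)
  also have "... = 2 * (LINT y|\<nu>. (\<xi> n y)\<^sup>2 * p n y) + 2 * C0"
   using \<xi>n_root[of n] D_root by (simp add: C0_def power_mult_distrib p_nonneg)
  finally show ?thesis using bd[of n] by linarith
 qed
 have CC: "0 <= 2 * C + 2 * C0" using order_trans[OF _ s_bd[of 0]] by simp
 have i1: "integrable \<nu> (%y. \<xi> n y * p n y)" for n
 proof -
  have "integrable \<nu> (%y. (\<xi> n y * sqrt (p n y)) * sqrt (p n y))"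
   by (rule integrable_mult_square[OF _ _ \<xi>n_root root_integrable(1)]) measurable
  then show ?thesis by (simp add: mult.assoc p_nonneg)
 qed
 have i2: "integrable \<nu> (%y. \<xi> n y * p0 y)" for n
 proof -
  have "integrable \<nu> (%y. (\<xi> n y * sqrt (p0 y)) * sqrt (p0 y))"
   by (rule integrable_mult_square[OF _ _ \<xi>0_root root_integrable(2)]) measurable
  then show ?thesis by (simp add: mult.assoc p0_nonneg)
 qed
 have i3: "integrable \<nu> (%y. s n y * rem n y)" for n
  by (rule integrable_mult_square[OF _ _ s_int rem_integrable]) measurable
 have i4: "integrable \<nu> (%y. s n y * (g y * sqrt (p0 y)))" for n
  by (rule integrable_mult_square[OF _ _ s_int g_root_integrable]) measurable
 have i5: "integrable \<nu> (%y. \<xi> n y * g y * p0 y)" for n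
 proof -
  have "integrable \<nu> (%y. (\<xi> n y * sqrt (p0 y)) * (g y * sqrt (p0 y)))"
   by (rule integrable_mult_square[OF _ _ \<xi>0_root g_root_integrable]) measurable
  moreover have "(\<xi> n y * sqrt (p0 y)) * (g y * sqrt (p0 y)) = \<xi> n y * g y * p0 y" for y
   using sqrt_sq(2)[of y] by (simp add: power2_eq_square mult_ac)
  ultimately show ?thesis by simp
 qed
 define u where "u n y = \<xi> n y * root_diff n y * (g y * sqrt (p0 y))" for n y
 have [measurable]: "u n \<in> borel_measurable \<nu>" for n unfolding u_def[abs_def] by measurable
 have s_split: "s n y * (g y * sqrt (p0 y)) = u n y + 2 * (\<xi> n y * g y * p0 y)" for n y
  using sqrt_sq(2)[of y] unfolding s_def u_def root_diff_def power2_eq_square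
  by (simp add: algebra_simps)
 have i6: "integrable \<nu> (u n)" for n
 proof -
  have "u n = (%y. s n y * (g y * sqrt (p0 y)) - 2 * (\<xi> n y * g y * p0 y))" using s_split by (simp add: fun_eq_iff)
  then show ?thesis using i4[of n] i5[of n] by simp
 qed
 have decomp: "((LINT y|\<nu>. \<xi> n y * p n y) - (LINT y|\<nu>. \<xi> n y * p0 y)) / t n =
   (LINT y|\<nu>. s n y * rem n y) + (1 / 2 * (LINT y|\<nu>. u n y) + (LINT y|\<nu>. \<xi> n y * g y * p0 y))" for n
 proof -
  have "(LINT y|\<nu>. \<xi> n y * p n y) - (LINT y|\<nu>. \<xi> n y * p0 y) = (LINT y|\<nu>. \<xi> n y * p n y - \<xi> n y * p0 y)"
   using i1 i2 by simp
  also have "... = (LINT y|\<nu>. t n * (s n y * rem n y + (1 / 2 * u n y + \<xi> n y * g y * p0 y)))"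
  proof (rule Bochner_Integration.integral_cong[OF refl])
   fix y
   have "\<xi> n y * p n y - \<xi> n y * p0 y = \<xi> n y * (p n y - p0 y)"
    by (rule right_diff_distrib[symmetric])
   also have "... = s n y * root_diff n y"
    unfolding p_diff_eq s_def by (simp only: mult_ac)
   also have "... = t n * (s n y * rem n y + 1 / 2 * (s n y * (g y * sqrt (p0 y))))"
    unfolding root_diff_eq by (simp add: algebra_simps)
   finally show "\<xi> n y * p n y - \<xi> n y * p0 y = t n * (s n y * rem n y + (1 / 2 * u n y + \<xi> n y * g y * p0 y))"
    unfolding s_split by simp
  qed
  also have "... = t n * ((LINT y|\<nu>. s n y * rem n y) + (1 / 2 * (LINT y|\<nu>. u n y) + (LINT y|\<nu>. \<xi> n y * g y * p0 y)))"
   using i3[of n] i5[of n] i6[of n] by simp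
  finally show ?thesis using t_nz[of n] by simp
 qed
 have l1: "(%n. \<integral>y. s n y * rem n y \<partial>\<nu>) \<longlonglongrightarrow> 0"
 proof (rule Lim_null_comparison)
  show "\<forall>\<^sub>F n in sequentially. norm (LINT y|\<nu>. s n y * rem n y) <= sqrt (2 * C + 2 * C0) * sqrt (LINT y|\<nu>. (rem n y)\<^sup>2)"
  proof (intro always_eventually allI)
   fix n
   have "\<bar>\<integral>y. s n y * rem n y \<partial>\<nu>\<bar> <= sqrt (LINT y|\<nu>. (s n y)\<^sup>2) * sqrt (LINT y|\<nu>. (rem n y)\<^sup>2)"
    by (rule abs_integral_mult_le[OF _ _ s_int rem_integrable]) measurable
   also have "... <= sqrt (2 * C + 2 * C0) * sqrt (LINT y|\<nu>. (rem n y)\<^sup>2)"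
    using s_bd[of n] by (intro mult_right_mono real_sqrt_le_mono) auto
   finally show "norm (LINT y|\<nu>. s n y * rem n y) <= sqrt (2 * C + 2 * C0) * sqrt (LINT y|\<nu>. (rem n y)\<^sup>2)" by simp
  qed
  show "(%n. sqrt (2 * C + 2 * C0) * sqrt (LINT y|\<nu>. (rem n y)\<^sup>2)) \<longlonglongrightarrow> 0"
   using tendsto_mult_left[OF tendsto_real_sqrt[OF rem_null], of "sqrt (2 * C + 2 * C0)"] by simp
 qed
 have l3: "(%n. \<integral>y. \<xi> n y * g y * p0 y \<partial>\<nu>) \<longlonglongrightarrow> (LINT y|\<nu>. \<phi> y * g y * p0 y)"
 proof (rule integral_dominated_convergence[where w="%y. (D y)^2 * p0 y + (g y)^2 * p0 y"])
  show "integrable \<nu> (%y. (D y)^2 * p0 y + (g y)^2 * p0 y)" using D g_integrable by simp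
  show "AE y in \<nu>. (%n. \<xi> n y * g y * p0 y) \<longlonglongrightarrow> \<phi> y * g y * p0 y"
   using conv
  proof eventually_elim
   case (elim y)
   show ?case
   proof (cases "p0 y > 0")
    case True
    then show ?thesis using elim by (intro tendsto_mult_right) auto
   next
    case False
    then have "p0 y = 0" using p0_nonneg[of y] by linarith
    then show ?thesis by simp
   qed
  qed
  show "AE y in \<nu>. norm (\<xi> n y * g y * p0 y) <= (D y)^2 * p0 y + (g y)^2 * p0 y" for n
  proof (intro AE_I2)
   fix y
   have "\<bar>\<xi> n y * g y\<bar> <= \<bar>D y * g y\<bar>"
    unfolding abs_mult using \<xi>D[of n y] D0[of y] by (intro mult_right_mono) auto
   also have "... <= (D y)^2 + (g y)^2" by (rule abs_mult_le_sum_squares)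
   finally have "\<bar>\<xi> n y * g y\<bar> * p0 y <= ((D y)^2 + (g y)^2) * p0 y"
    using p0_nonneg[of y] by (rule mult_right_mono)
   then show "norm (\<xi> n y * g y * p0 y) <= (D y)^2 * p0 y + (g y)^2 * p0 y"
    using p0_nonneg[of y] by (simp add: abs_mult distrib_right)
  qed
 qed measurable
 have l2: "(%n. \<integral>y. u n y \<partial>\<nu>) \<longlonglongrightarrow> 0"
 proof (rule LIMSEQ_I)
  fix \<epsilon> :: real assume \<epsilon>: "0 < \<epsilon>"
  \<comment> \<open>Where D <= k, \<xi> is bounded and the root difference is small in L2. Where D >
    k, \<xi> times the root difference is bounded by |s|, which is bounded in L2, and
    \<open>cut\<close> is small in L2 for large k.\<close>
  define cut where "cut k y = indicator {y. D y > real k} y * (g y * sqrt (p0 y))" for k y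
  have [measurable]: "cut k \<in> borel_measurable \<nu>" for k unfolding cut_def[abs_def] indicator_def mem_Collect_eq by measurable
  have cut_sq: "(cut k y)^2 <= (g y * sqrt (p0 y))^2" for k y by (auto simp: cut_def indicator_def)
  have cut_int: "integrable \<nu> (%y. (cut k y)^2)" for k
   by (rule Bochner_Integration.integrable_bound[OF g_root_integrable]) (use cut_sq in auto)
  have "(%k. \<integral>y. (cut k y)\<^sup>2 \<partial>\<nu>) \<longlonglongrightarrow> (LINT y|\<nu>. 0)"
  proof (rule integral_dominated_convergence[OF _ _ g_root_integrable])
   show "AE y in \<nu>. (%k. (cut k y)^2) \<longlonglongrightarrow> 0"
   proof (intro AE_I2 tendsto_eventually)
    fix y
    obtain N where N: "D y <= real N" using real_arch_simple by blast
    show "\<forall>\<^sub>F k in sequentially. (cut k y)\<^sup>2 = 0"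
     using eventually_ge_at_top[of N] by eventually_elim (use N in \<open>auto simp: cut_def indicator_def\<close>)
   qed
  qed (use cut_sq in auto)
  then have "(%k. sqrt (2 * C + 2 * C0) * sqrt (LINT y|\<nu>. (cut k y)\<^sup>2)) \<longlonglongrightarrow> sqrt (2 * C + 2 * C0) * sqrt 0"
   by (intro tendsto_intros) simp
  then have "\<forall>\<^sub>F k in sequentially. sqrt (2 * C + 2 * C0) * sqrt (LINT y|\<nu>. (cut k y)\<^sup>2) < \<epsilon> / 2"
   using \<epsilon> by (intro order_tendstoD) auto
  then obtain k where k: "sqrt (2 * C + 2 * C0) * sqrt (LINT y|\<nu>. (cut k y)\<^sup>2) < \<epsilon> / 2"
   by (auto simp: eventually_sequentially)
  define G where "G = sqrt (LINT y|\<nu>. (g y * sqrt (p0 y))\<^sup>2)"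
  have "(%n. real k * (sqrt (LINT y|\<nu>. (root_diff n y)\<^sup>2) * G)) \<longlonglongrightarrow> real k * (sqrt 0 * G)"
   by (intro tendsto_intros root_diff_null)
  then have "\<forall>\<^sub>F n in sequentially. real k * (sqrt (LINT y|\<nu>. (root_diff n y)\<^sup>2) * G) < \<epsilon> / 2"
   using \<epsilon> by (intro order_tendstoD) auto
  then have "\<forall>\<^sub>F n in sequentially. norm ((LINT y|\<nu>. u n y) - 0) < \<epsilon>"
  proof eventually_elim
   case (elim n)
   have ia: "integrable \<nu> (%y. \<bar>root_diff n y\<bar> * \<bar>g y * sqrt (p0 y)\<bar>)"
    using root_diff_integrable g_root_integrable by (intro integrable_mult_square) auto
   have ib: "integrable \<nu> (%y. \<bar>s n y\<bar> * \<bar>cut k y\<bar>)"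
    using s_int cut_int by (intro integrable_mult_square) auto
   have "\<bar>\<integral>y. u n y \<partial>\<nu>\<bar> <= (LINT y|\<nu>. \<bar>u n y\<bar>)" by (rule integral_abs_bound)
   also have "... <= (LINT y|\<nu>. real k * (\<bar>root_diff n y\<bar> * \<bar>g y * sqrt (p0 y)\<bar>) + \<bar>s n y\<bar> * \<bar>cut k y\<bar>)"
   proof (rule integral_mono)
    show "integrable \<nu> (%y. \<bar>u n y\<bar>)" using i6 by simp
    show "integrable \<nu> (%y. real k * (\<bar>root_diff n y\<bar> * \<bar>g y * sqrt (p0 y)\<bar>) + \<bar>s n y\<bar> * \<bar>cut k y\<bar>)"
     using ia ib by simp
    fix y
    show "\<bar>u n y\<bar> <= real k * (\<bar>root_diff n y\<bar> * \<bar>g y * sqrt (p0 y)\<bar>) + \<bar>s n y\<bar> * \<bar>cut k y\<bar>"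
    proof (cases "D y <= real k")
     case True
     have "\<bar>u n y\<bar> = \<bar>\<xi> n y\<bar> * (\<bar>root_diff n y\<bar> * \<bar>g y * sqrt (p0 y)\<bar>)" by (simp add: u_def abs_mult mult.assoc)
     also have "... <= real k * (\<bar>root_diff n y\<bar> * \<bar>g y * sqrt (p0 y)\<bar>)"
      using \<xi>D[of n y] True by (intro mult_right_mono) auto
     finally show ?thesis by (rule order_trans) simp
    next
     case False
     then have c: "cut k y = g y * sqrt (p0 y)" by (simp add: cut_def)
     have "\<bar>root_diff n y\<bar> <= sqrt (p n y) + sqrt (p0 y)"
      using p_nonneg[of n y] p0_nonneg[of y] unfolding root_diff_def abs_le_iff by (simp add: add_increasing)
     then have "\<bar>\<xi> n y\<bar> * \<bar>root_diff n y\<bar> <= \<bar>\<xi> n y\<bar> * (sqrt (p n y) + sqrt (p0 y))" by (intro mult_left_mono) auto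
     also have "... = \<bar>s n y\<bar>"
      using p_nonneg[of n y] p0_nonneg[of y] by (simp add: s_def abs_mult)
     finally have "\<bar>u n y\<bar> <= \<bar>s n y\<bar> * \<bar>cut k y\<bar>"
      unfolding u_def c abs_mult[of "_ * _" "_ * _"] abs_mult[of "\<xi> n y"] by (intro mult_right_mono) auto
     then show ?thesis by (rule order_trans) simp
    qed
   qed
   also have "... = real k * (LINT y|\<nu>. \<bar>root_diff n y\<bar> * \<bar>g y * sqrt (p0 y)\<bar>) + (LINT y|\<nu>. \<bar>s n y\<bar> * \<bar>cut k y\<bar>)"
    using ia ib by simp
   also have "... <= real k * (sqrt (LINT y|\<nu>. (root_diff n y)\<^sup>2) * G) + sqrt (2 * C + 2 * C0) * sqrt (LINT y|\<nu>. (cut k y)\<^sup>2)"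
   proof (intro add_mono mult_left_mono)
    have "(LINT y|\<nu>. \<bar>root_diff n y\<bar> * \<bar>g y * sqrt (p0 y)\<bar>) <= sqrt (LINT y|\<nu>. \<bar>root_diff n y\<bar>\<^sup>2) * sqrt (LINT y|\<nu>. \<bar>g y * sqrt (p0 y)\<bar>\<^sup>2)"
     using root_diff_integrable g_root_integrable by (intro order_trans[OF abs_ge_self abs_integral_mult_le]) auto
    then show "(LINT y|\<nu>. \<bar>root_diff n y\<bar> * \<bar>g y * sqrt (p0 y)\<bar>) <= sqrt (LINT y|\<nu>. (root_diff n y)\<^sup>2) * G"
     by (simp only: G_def power2_abs)
    have "(LINT y|\<nu>. \<bar>s n y\<bar> * \<bar>cut k y\<bar>) <= sqrt (LINT y|\<nu>. \<bar>s n y\<bar>\<^sup>2) * sqrt (LINT y|\<nu>. \<bar>cut k y\<bar>\<^sup>2)"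
     using s_int cut_int by (intro order_trans[OF abs_ge_self abs_integral_mult_le]) auto
    also have "... <= sqrt (2 * C + 2 * C0) * sqrt (LINT y|\<nu>. \<bar>cut k y\<bar>\<^sup>2)"
     using s_bd[of n] by (intro mult_right_mono real_sqrt_le_mono) auto
    finally show "(LINT y|\<nu>. \<bar>s n y\<bar> * \<bar>cut k y\<bar>) <= sqrt (2 * C + 2 * C0) * sqrt (LINT y|\<nu>. (cut k y)\<^sup>2)" by simp
   qed simp
   also have "... < \<epsilon>" using k elim by linarith
   finally show ?case by simp
  qed
  then show "\<exists>no. \<forall>n\<ge>no. norm ((LINT y|\<nu>. u n y) - 0) < \<epsilon>"
   by (simp add: eventually_sequentially)
 qed
 have "(%n. (LINT y|\<nu>. s n y * rem n y) + (1 / 2 * (LINT y|\<nu>. u n y) + (LINT y|\<nu>. \<xi> n y * g y * p0 y))) \<longlonglongrightarrow>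
   0 + (1 / 2 * 0 + (LINT y|\<nu>. \<phi> y * g y * p0 y))"
  by (intro tendsto_intros l1 l2 l3)
 then show ?thesis unfolding decomp by simp
qed

lemma score_mean_zero: "(LINT y|\<nu>. g y * p0 y) = 0"
proof -
 have "(%n. ((LINT y|\<nu>. 1 * p n y) - (LINT y|\<nu>. 1 * p0 y)) / t n) \<longlonglongrightarrow> (LINT y|\<nu>. 1 * g y * p0 y)"
  by (rule expectation_derivative[where C=1 and D="%_. 1"]) (simp_all add: p_integrable p0_integrable p_total)
 then have "(%n. 0) \<longlonglongrightarrow> (LINT y|\<nu>. g y * p0 y)" by (simp add: p_total p0_total)
 then show ?thesis by (simp add: LIMSEQ_const_iff)
qed

end

section \<open>Derivative of the estimand along a regular submodel\<close>

abbreviation obs_of :: "'x unit_data => 'x \<times> bool \<times> real" where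
 "obs_of z \<equiv> (cov z, trt z, obs_outcome z)"

context unit_law
begin

lemma obs_of_measurable [measurable]: "obs_of \<in> measurable Q obs_space"
 by measurable

lemma obs_integral:
 fixes k :: "'x \<times> bool \<times> real => real"
 assumes \<nu> [measurable_cong]: "sets \<nu> = sets obs_space" and p [measurable]: "p \<in> borel_measurable \<nu>" and pn: "!!y. 0 <= p y"
  and law: "obs_law Q = density \<nu> (%y. ennreal (p y))" and k [measurable]: "k \<in> borel_measurable obs_space"
 shows "(LINT z|Q. k (obs_of z)) = (LINT y|\<nu>. k y * p y)"
  and "integrable Q (%z. k (obs_of z)) \<longleftrightarrow> integrable \<nu> (%y. k y * p y)"
proof -
 have "(LINT z|Q. k (obs_of z)) = (\<integral>y. k y \<partial>obs_law Q)"
  unfolding obs_law_def by (rule integral_distr[symmetric]) measurable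
 also have "... = (LINT y|\<nu>. k y * p y)"
  unfolding law by (subst integral_density) (auto simp: pn mult.commute)
 finally show "(LINT z|Q. k (obs_of z)) = (LINT y|\<nu>. k y * p y)" .
 have "integrable Q (%z. k (obs_of z)) \<longleftrightarrow> integrable (obs_law Q) k"
  unfolding obs_law_def by (rule integrable_distr_eq[symmetric]) measurable
 also have "... \<longleftrightarrow> integrable \<nu> (%y. k y * p y)"
  unfolding law by (subst integrable_density) (auto simp: pn mult.commute)
 finally show "integrable Q (%z. k (obs_of z)) \<longleftrightarrow> integrable \<nu> (%y. k y * p y)" .
qed

lemma obs_AE:
 assumes \<nu> [measurable_cong]: "sets \<nu> = sets obs_space" and p [measurable]: "p \<in> borel_measurable \<nu>"
  and law: "obs_law Q = density \<nu> (%y. ennreal (p y))"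
  and P: "AE z in Q. P (cov z)" and Pm: "{x. P x} \<in> sets borel"
 shows "AE y in \<nu>. p y > 0 --> P (fst y)"
proof -
 have "{y \<in> space obs_space. P (fst y)} \<in> sets (obs_space :: ('x \<times> bool \<times> real) measure)"
  using measurable_sets[OF measurable_fst Pm, of "count_space UNIV \<Otimes>\<^sub>M borel :: (bool \<times> real) measure"] by (simp add: vimage_def)
 then have "AE y in obs_law Q. P (fst y)"
  unfolding obs_law_def using P by (subst AE_distr_iff) auto
 then show ?thesis unfolding law by (subst (asm) AE_density) auto
qed

end

text \<open>Each \<open>P n\<close> has its own overlap constants, so \<open>e n\<close> is only
  assumed to lie strictly between 0 and 1. The second moments of the outcomes are bounded uniformly
  by \<open>Bm\<close>.\<close>

locale regular_path = regression_setting Q s m c B for Q :: "'x::euclidean_space unit_data measure" and s m c B +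
 fixes P :: "nat => 'x unit_data measure" and e :: "nat => 'x => real" and \<nu> :: "('x \<times> bool \<times> real) measure"
  and p :: "nat => 'x \<times> bool \<times> real => real" and p0 g :: "'x \<times> bool \<times> real => real" and t :: "nat => real" and Bm :: real
 assumes sets_\<nu> [measurable_cong]: "sets \<nu> = sets obs_space"
  and dqm_seq: "dqm_sequence \<nu> p p0 g t"
  and laws: "!!n. unit_law (P n)" and P_outcomes: "!!n. square_integrable_outcomes (P n)"
  and P_moment: "!!n a. (\<integral>z. (pot a z)\<^sup>2 \<partial>P n) <= Bm"
  and law0: "obs_law Q = density \<nu> (%y. ennreal (p0 y))" and law: "!!n. obs_law (P n) = density \<nu> (%y. ennreal (p n y))"
  and e_measurable [measurable]: "!!n. e n \<in> borel_measurable borel" and e_pos: "!!n x. 0 < e n x" "!!n x. e n x < 1"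
  and e_ipw: "!!n. ipw (P n) (e n)"
begin

sublocale dqm: dqm_sequence \<nu> p p0 g t by (rule dqm_seq)

lemma obs0:
 fixes k :: "'x \<times> bool \<times> real => real"
 assumes "k \<in> borel_measurable obs_space"
 shows "(LINT z|Q. k (obs_of z)) = (LINT y|\<nu>. k y * p0 y)"
  and "integrable Q (%z. k (obs_of z)) \<longleftrightarrow> integrable \<nu> (%y. k y * p0 y)"
 by (rule obs_integral[OF sets_\<nu> _ _ law0 assms]; simp add: dqm.p0_nonneg)+

lemma obsn:
 fixes k :: "'x \<times> bool \<times> real => real"
 assumes "k \<in> borel_measurable obs_space"
 shows "(\<integral>z. k (obs_of z) \<partial>P n) = (LINT y|\<nu>. k y * p n y)"
  and "integrable (P n) (%z. k (obs_of z)) \<longleftrightarrow> integrable \<nu> (%y. k y * p n y)"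
 by (rule unit_law.obs_integral[OF laws sets_\<nu> _ _ law assms]; simp add: dqm.p_nonneg)+

lemma e_unit: "0 <= e n x" "e n x <= 1"
 using e_pos[of n x] by simp_all

text \<open>The test function sgn(e n - s) (e n - A) is bounded by 1. Its mean is 0 under
  \<open>P n\<close>, where e n is the propensity, and the L1 distance of the scores under Q. The
  difference of the two means is at most the L1 distance of the observed densities.\<close>

lemma score_L1: "(%n. \<integral>z. \<bar>e n (cov z) - s (cov z)\<bar> \<partial>Q) \<longlonglongrightarrow> 0"
proof (rule Lim_null_comparison[OF _ dqm.L1_null], intro always_eventually allI)
 fix n
 interpret Pn: unit_law "P n" by (rule laws)
 define b where "b x = sgn (e n x - s x)" for x
 have [measurable]: "b \<in> borel_measurable borel" unfolding b_def[abs_def] by measurable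
 have b1: "\<bar>b x\<bar> <= 1" for x by (simp add: b_def sgn_if)
 define k where "k y = b (fst y) * (e n (fst y) - of_bool (fst (snd y)))" for y :: "'x \<times> bool \<times> real"
 have km [measurable]: "k \<in> borel_measurable obs_space" unfolding k_def[abs_def] by measurable
 have k1: "\<bar>k y\<bar> <= 1" for y
 proof -
  have "\<bar>e n (fst y) - of_bool (fst (snd y))\<bar> <= 1" using e_unit[of n "fst y"] by (simp add: of_bool_def)
  then have "\<bar>b (fst y)\<bar> * \<bar>e n (fst y) - of_bool (fst (snd y))\<bar> <= 1 * 1" using b1 by (intro mult_mono) auto
  then show ?thesis by (simp add: k_def abs_mult)
 qed
 have ik: "integrable Q (%z. k (obs_of z))"
  by (rule integrable_const_bound[where B=1]) (use k1 in auto)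
 have ikn: "integrable (P n) (%z. k (obs_of z))"
  by (rule Pn.integrable_const_bound[where B=1]) (use k1 in auto)
 have split: "k (obs_of z) = b (cov z) * e n (cov z) - of_bool (trt z = True) * b (cov z)" for z
  by (simp add: k_def algebra_simps)
 have bm: "(%(x, y0, y1). b x) \<in> borel_measurable (borel \<Otimes>\<^sub>M (borel \<Otimes>\<^sub>M borel :: (real \<times> real) measure))"
  by measurable
 have be: "\<bar>b x * e n x\<bar> <= 1" for x
  unfolding abs_mult using b1[of x] e_unit[of n x] mult_mono[of "\<bar>b x\<bar>" 1 "\<bar>e n x\<bar>" 1] by simp
 have "(\<integral>z. k (obs_of z) \<partial>P n) = (\<integral>z. b (cov z) * e n (cov z) \<partial>P n) - (\<integral>z. of_bool (trt z = True) * b (cov z) \<partial>P n)"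
  unfolding split
  by (intro Bochner_Integration.integral_diff Pn.integrable_const_bound[where B=1]) (use be b1 in \<open>auto simp: of_bool_def\<close>)
 also have "(\<integral>z. of_bool (trt z = True) * b (cov z) \<partial>P n) = (\<integral>z. b (cov z) * e n (cov z) \<partial>P n)"
  using Pn.ipw_integral(1)[OF e_ipw e_measurable e_unit bm, of True] by (simp add: prop_of_def mult.commute)
 finally have zn: "(LINT y|\<nu>. k y * p n y) = 0" unfolding obsn[OF km] by simp
 have "(LINT z|Q. k (obs_of z)) = (LINT z|Q. b (cov z) * e n (cov z)) - (LINT z|Q. of_bool (trt z = True) * b (cov z))"
  unfolding split
  by (intro Bochner_Integration.integral_diff integrable_const_bound[where B=1]) (use be b1 in \<open>auto simp: of_bool_def\<close>)
 also have "(LINT z|Q. of_bool (trt z = True) * b (cov z)) = (LINT z|Q. b (cov z) * s (cov z))"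
  using ipw_integral(1)[OF s_ipw s_measurable s_unit bm, of True] by (simp add: prop_of_def mult.commute)
 also have "(LINT z|Q. b (cov z) * e n (cov z)) - (LINT z|Q. b (cov z) * s (cov z)) = (LINT z|Q. b (cov z) * e n (cov z) - b (cov z) * s (cov z))"
 proof (intro Bochner_Integration.integral_diff[symmetric] integrable_const_bound[where B=1])
  have "\<bar>b x * s x\<bar> <= 1" for x
   unfolding abs_mult using b1[of x] s_unit[of x] mult_mono[of "\<bar>b x\<bar>" 1 "\<bar>s x\<bar>" 1] by simp
  then show "AE z in Q. norm (b (cov z) * s (cov z)) <= 1" by simp
 qed (use be in auto)
 also have "... = (LINT z|Q. \<bar>e n (cov z) - s (cov z)\<bar>)"
  by (intro Bochner_Integration.integral_cong) (auto simp: b_def sgn_if abs_if algebra_simps)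
 finally have "(LINT z|Q. \<bar>e n (cov z) - s (cov z)\<bar>) = (LINT y|\<nu>. k y * p0 y) - (LINT y|\<nu>. k y * p n y)"
  unfolding zn obs0[OF km] by simp
 also have "... = (LINT y|\<nu>. k y * p0 y - k y * p n y)"
  using ik ikn unfolding obs0[OF km] obsn[OF km] by simp
 also have "... <= (LINT y|\<nu>. \<bar>p n y - p0 y\<bar>)"
 proof (rule integral_mono)
  show "integrable \<nu> (%y. k y * p0 y - k y * p n y)"
   using ik ikn unfolding obs0[OF km] obsn[OF km] by simp
  show "integrable \<nu> (%y. \<bar>p n y - p0 y\<bar>)" using dqm.p_integrable dqm.p0_integrable by simp
  fix y
  have "k y * p0 y - k y * p n y <= \<bar>k y * (p0 y - p n y)\<bar>" by (simp add: right_diff_distrib)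
  also have "... <= 1 * \<bar>p0 y - p n y\<bar>" unfolding abs_mult using k1 by (rule mult_right_mono) simp
  finally show "k y * p0 y - k y * p n y <= \<bar>p n y - p0 y\<bar>" by (simp add: abs_minus_commute)
 qed
 finally show "norm (LINT z|Q. \<bar>e n (cov z) - s (cov z)\<bar>) <= (LINT y|\<nu>. \<bar>p n y - p0 y\<bar>)" by simp
qed

text \<open>The uncentred influence function of the mean of arm \<open>a\<close>; the difference of
  the two arms minus the effect is \<open>eff_obs\<close>.\<close>

definition arm_phi :: "bool => 'x \<times> bool \<times> real => real" where
 "arm_phi a y = m a (fst y) + of_bool (fst (snd y) = a) * (snd (snd y) - m a (fst y)) / prop_of s a (fst y)"

text \<open>Inverse probability weighting with the current score \<open>e n\<close> but centred at the fixed regression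
 \<open>m a\<close>, on the covariates where both are under control: unbiased for the restricted mean under \<open>P n\<close> and under \<open>Q\<close>.\<close>

lemma arm_derivative:
 assumes e_conv: "AE z in Q. (%n. e n (cov z)) \<longlonglongrightarrow> s (cov z)"
 shows "(%n. ((\<integral>z. pot a z \<partial>P n) - (LINT z|Q. pot a z)) / t n) \<longlonglongrightarrow> (LINT y|\<nu>. arm_phi a y * g y * p0 y)"
proof -
 define \<pi> where "\<pi> n x = prop_of (e n) a x" for n x
 have \<pi>m [measurable]: "\<pi> n \<in> borel_measurable borel" for n unfolding \<pi>_def by measurable
 have \<pi>1: "0 < \<pi> n x" "\<pi> n x <= 1" for n x using e_pos[of n x] by (auto simp: \<pi>_def prop_of_def)
 \<comment> \<open>On this set the regression is bounded, hence integrable under \<open>P n\<close>,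
   and the weights are bounded. The level 1 / |t| grows slowly enough for the moment bound under
   \<open>P n\<close> and fast enough for an exceptional mass o(t^2); c / 8 is explained by the
   absorption in \<open>MS2\<close>.\<close>
 define G where "G n = {x. \<bar>m a x\<bar> <= 1 / \<bar>t n\<bar> & c / 8 <= \<pi> n x}" for n
 have Gm [measurable]: "G n \<in> sets borel" for n unfolding G_def by measurable
 define ind where "ind n x = (indicator (G n) x :: real)" for n x
 have indm [measurable]: "ind n \<in> borel_measurable borel" for n unfolding ind_def[abs_def] by measurable
 have ind01: "0 <= ind n x" "ind n x <= 1" "ind n x = 0 | ind n x = 1" for n x by (auto simp: ind_def indicator_def)
 have tpos: "0 < \<bar>t n\<bar>" for n using dqm.t_nz[of n] by simp
 have im: "\<bar>ind n x * m a x\<bar> <= 1 / \<bar>t n\<bar>" for n x using tpos[of n] by (auto simp: ind_def indicator_def G_def)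
 have ip: "\<bar>ind n x / \<pi> n x\<bar> <= 8 / c" for n x
  using c_pos \<pi>1[of n x] by (auto simp: ind_def indicator_def G_def field_simps)
 define \<xi> where "\<xi> n y = ind n (fst y) * m a (fst y) + of_bool (fst (snd y) = a) * (ind n (fst y) / \<pi> n (fst y) * (snd (snd y) - m a (fst y)))" for n and y :: "'x \<times> bool \<times> real"
 have \<xi>m [measurable]: "\<xi> n \<in> borel_measurable obs_space" for n
  unfolding \<xi>_def[abs_def] by measurable
 have \<xi>_obs: "\<xi> n (obs_of z) = ind n (cov z) * m a (cov z) + of_bool (trt z = a) * (ind n (cov z) / \<pi> n (cov z) * resid m a z)" for n z
  by (cases "trt z = a") (simp_all add: \<xi>_def obs_outcome_eq resid_def)
 have unb_n: "(LINT y|\<nu>. \<xi> n y * p n y) = (\<integral>z. ind n (cov z) * pot a z \<partial>P n)" for n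
 proof -
  interpret Pn: unit_law "P n" by (rule laws)
  have ipot: "integrable (P n) (pot a)"
  proof (rule Pn.square_integrable_imp_integrable)
   show "integrable (P n) (%z. (pot a z)^2)" using P_outcomes[of n] unfolding square_integrable_outcomes_def by blast
  qed measurable
  have i1: "integrable (P n) (%z. ind n (cov z) * m a (cov z))"
   by (rule Pn.integrable_const_bound[where B="1 / \<bar>t n\<bar>"]) (use im in auto)
  have i2: "integrable (P n) (%z. ind n (cov z) * pot a z)"
   by (rule Bochner_Integration.integrable_bound[OF ipot]) (auto simp: ind_def indicator_def)
  have h: "(%(x, y0, y1). ind n x / \<pi> n x * ((if a then y1 else y0) - m a x)) \<in> borel_measurable xyy_space"
   by (cases a) simp_all
  have r: "resid m a z = (if a then pot True z else pot False z) - m a (cov z)" for z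
   by (cases a) (simp_all add: resid_def)
  have eq: "prop_of (e n) a (cov z) * (ind n (cov z) / \<pi> n (cov z) * resid m a z) = ind n (cov z) * pot a z - ind n (cov z) * m a (cov z)" for z
   using \<pi>1(1)[of n "cov z"] by (simp add: \<pi>_def[symmetric] resid_def right_diff_distrib)
  have w: "(\<integral>z. of_bool (trt z = a) * (ind n (cov z) / \<pi> n (cov z) * resid m a z) \<partial>P n) =
    (\<integral>z. ind n (cov z) * pot a z - ind n (cov z) * m a (cov z) \<partial>P n)"
   "integrable (P n) (%z. of_bool (trt z = a) * (ind n (cov z) / \<pi> n (cov z) * resid m a z)) \<longleftrightarrow>
    integrable (P n) (%z. ind n (cov z) * pot a z - ind n (cov z) * m a (cov z))"
   using Pn.ipw_integral[OF e_ipw e_measurable e_unit h, of a] by (simp_all only: r[symmetric] eq)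
  have "(LINT y|\<nu>. \<xi> n y * p n y) = (\<integral>z. ind n (cov z) * m a (cov z) \<partial>P n) + (\<integral>z. of_bool (trt z = a) * (ind n (cov z) / \<pi> n (cov z) * resid m a z) \<partial>P n)"
   unfolding obsn(1)[OF \<xi>m, symmetric] \<xi>_obs by (rule Bochner_Integration.integral_add) (use i1 i2 w(2) in auto)
  then show ?thesis using i1 i2 w(1) by simp
 qed
 have unb_0: "(LINT y|\<nu>. \<xi> n y * p0 y) = (LINT z|Q. ind n (cov z) * pot a z)" for n
 proof -
  have i1: "integrable Q (%z. ind n (cov z) * m a (cov z))"
   by (rule integrable_const_bound[where B="1 / \<bar>t n\<bar>"]) (use im in auto)
  have i2: "integrable Q (%z. ind n (cov z) * pot a z)"
   by (rule Bochner_Integration.integrable_bound[OF integrable_pot(1)[of a]]) (auto simp: ind_def indicator_def)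
  have i3: "integrable Q (%z. of_bool (trt z = a) * (ind n (cov z) / \<pi> n (cov z) * resid m a z))"
  proof (rule integrable_const_bound[where B="8 / c * B"])
   show "AE z in Q. norm (of_bool (trt z = a) * (ind n (cov z) / \<pi> n (cov z) * resid m a z)) <= 8 / c * B"
    using resid_bound[of a]
   proof eventually_elim
    case (elim z)
    have "\<bar>ind n (cov z) / \<pi> n (cov z)\<bar> * \<bar>resid m a z\<bar> <= 8 / c * B"
     using ip elim c_pos by (intro mult_mono) auto
    moreover have "0 <= 8 / c * B" using c_pos B_nonneg by simp
    ultimately show ?case unfolding real_norm_def abs_mult by (cases "trt z = a") simp_all
   qed
  qed measurable
  have o1: "(LINT z|Q. of_bool (trt z = a) * (ind n (cov z) / \<pi> n (cov z) * resid m a z)) = 0"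
   using orthogonal(2)[of "%x. ind n x / \<pi> n x" "8 / c" a] ip by simp
  have "(LINT z|Q. ind n (cov z) * resid m a z) = 0"
   using orthogonal(1)[of "ind n" 1 a] ind01 by simp
  then have o2: "(LINT z|Q. ind n (cov z) * pot a z) = (LINT z|Q. ind n (cov z) * m a (cov z))"
   using i1 i2 by (simp add: resid_def right_diff_distrib)
  have "(LINT y|\<nu>. \<xi> n y * p0 y) = (LINT z|Q. ind n (cov z) * m a (cov z)) + (LINT z|Q. of_bool (trt z = a) * (ind n (cov z) / \<pi> n (cov z) * resid m a z))"
   unfolding obs0(1)[OF \<xi>m, symmetric] \<xi>_obs by (rule Bochner_Integration.integral_add[OF i1 i3])
  then show ?thesis using o1 o2 by simp
 qed
 define L where "L = 1 + 8 / c"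
 have L1: "1 <= L" "8 / c <= L" using c_pos by (auto simp: L_def)
 define D where "D y = L * (\<bar>m a (fst y)\<bar> + of_bool (fst (snd y) = a) * \<bar>snd (snd y)\<bar>)" for y :: "'x \<times> bool \<times> real"
 have Dm [measurable]: "D \<in> borel_measurable obs_space" unfolding D_def[abs_def] by measurable
 have \<xi>_le: "\<bar>\<xi> n y\<bar> <= L * (\<bar>ind n (fst y) * m a (fst y)\<bar> + of_bool (fst (snd y) = a) * \<bar>snd (snd y)\<bar>)" for n y
 proof -
  let ?m = "m a (fst y)" and ?i = "ind n (fst y)" and ?y = "snd (snd y)"
  have "\<bar>?i / \<pi> n (fst y) * (?y - ?m)\<bar> <= 8 / c * (\<bar>?y\<bar> + \<bar>?i * ?m\<bar>)"
  proof (cases "?i = 0")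
   case True
   then show ?thesis using c_pos by simp
  next
   case False
   then have "?i = 1" using ind01(3) by blast
   then show ?thesis using ip[of n "fst y"] c_pos unfolding abs_mult by (intro mult_mono) auto
  qed
  then have "\<bar>\<xi> n y\<bar> <= \<bar>?i * ?m\<bar> + of_bool (fst (snd y) = a) * (8 / c * (\<bar>?y\<bar> + \<bar>?i * ?m\<bar>))"
   unfolding \<xi>_def by (cases "fst (snd y) = a") (auto intro: order_trans[OF abs_triangle_ineq])
  also have "... <= L * (\<bar>?i * ?m\<bar> + of_bool (fst (snd y) = a) * \<bar>?y\<bar>)"
   using c_pos by (cases "fst (snd y) = a") (auto simp: L_def algebra_simps)
  finally show ?thesis .
 qed
 have \<xi>D: "\<bar>\<xi> n y\<bar> <= D y" for n y
 proof -
  have "\<bar>ind n (fst y) * m a (fst y)\<bar> <= \<bar>m a (fst y)\<bar>" using ind01(3)[of n "fst y"] by auto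
  then have "L * (\<bar>ind n (fst y) * m a (fst y)\<bar> + of_bool (fst (snd y) = a) * \<bar>snd (snd y)\<bar>) <= D y"
   unfolding D_def using L1 by (intro mult_left_mono add_right_mono) auto
  then show ?thesis using \<xi>_le[of n y] by linarith
 qed
 have D_int: "integrable \<nu> (%y. (D y)^2 * p0 y)"
 proof -
  have "integrable Q (%z. (D (obs_of z))^2)"
  proof (rule Bochner_Integration.integrable_bound[where f="%z. L\<^sup>2 * (2 * (m a (cov z))^2 + 2 * (pot a z)^2)"])
   show "integrable Q (%z. L\<^sup>2 * (2 * (m a (cov z))^2 + 2 * (pot a z)^2))"
    using integrable_m_sq integrable_pot(2) by simp
   show "AE z in Q. norm ((D (obs_of z))^2) <= norm (L\<^sup>2 * (2 * (m a (cov z))^2 + 2 * (pot a z)^2))"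
   proof (intro AE_I2)
    fix z
    have "(\<bar>m a (cov z)\<bar> + of_bool (trt z = a) * \<bar>obs_outcome z\<bar>)^2 <= 2 * (m a (cov z))^2 + 2 * (pot a z)^2"
     using sum_square_le[of "\<bar>m a (cov z)\<bar>" "\<bar>pot a z\<bar>"] by (cases "trt z = a") (auto simp: obs_outcome_eq)
    then show "norm ((D (obs_of z))^2) <= norm (L\<^sup>2 * (2 * (m a (cov z))^2 + 2 * (pot a z)^2))"
     unfolding D_def power_mult_distrib by (simp add: mult_left_mono)
   qed
  qed measurable
  then show ?thesis using obs0(2)[of "%y. (D y)^2"] by simp
 qed
 have e_AE: "AE y in \<nu>. p0 y > 0 --> (%n. e n (fst y)) \<longlonglongrightarrow> s (fst y)"
  by (rule obs_AE[OF sets_\<nu> _ law0 e_conv]) measurable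
 have \<pi>_lim: "(%n. \<pi> n x) \<longlonglongrightarrow> prop_of s a x" if "(%n. e n x) \<longlonglongrightarrow> s x" for x
  unfolding \<pi>_def prop_of_def using that by (cases a) (auto intro!: tendsto_intros)
 have \<pi>_ev: "\<forall>\<^sub>F n in sequentially. c / 8 < \<pi> n x" if "(%n. e n x) \<longlonglongrightarrow> s x" for x
  using order_tendstoD(1)[OF \<pi>_lim[OF that], of "c / 8"] prop_bounds(1)[of a x] c_pos by simp
 have m_ev: "\<forall>\<^sub>F n in sequentially. \<bar>m a x\<bar> < 1 / \<bar>t n\<bar>" for x
 proof -
  have "(%n. \<bar>m a x\<bar> * \<bar>t n\<bar>) \<longlonglongrightarrow> \<bar>m a x\<bar> * \<bar>0\<bar>" by (intro tendsto_intros dqm.t_null)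
  then have "\<forall>\<^sub>F n in sequentially. \<bar>m a x\<bar> * \<bar>t n\<bar> < 1" by (intro order_tendstoD(2)) auto
  then show ?thesis by eventually_elim (use tpos in \<open>simp add: pos_less_divide_eq\<close>)
 qed
 have G_ev: "\<forall>\<^sub>F n in sequentially. x \<in> G n" if "(%n. e n x) \<longlonglongrightarrow> s x" for x
  using \<pi>_ev[OF that] m_ev[of x] by eventually_elim (simp add: G_def)
 have fst_sets: "{y \<in> space \<nu>. fst y \<in> S} \<in> sets \<nu>" if [measurable]: "S \<in> sets borel" for S :: "'x set"
  by measurable
 have space_\<nu>: "space \<nu> = UNIV" using sets_eq_imp_space_eq[OF sets_\<nu>] by simp
 define S1 where "S1 n = {y \<in> space \<nu>. fst y \<in> {x. 1 / \<bar>t n\<bar> < \<bar>m a x\<bar>}}" for n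
 define S2 where "S2 n = {y \<in> space \<nu>. fst y \<in> {x. \<pi> n x < c / 8}}" for n
 define S where "S n = {y \<in> space \<nu>. fst y \<in> - G n}" for n
 have Sm: "S1 n \<in> sets \<nu>" "S2 n \<in> sets \<nu>" "S n \<in> sets \<nu>" for n
  unfolding S1_def S2_def S_def by (rule fst_sets; measurable)+
 have hS2: "(%n. dqm.h n (S2 n) / (t n)^2) \<longlonglongrightarrow> 0"
 proof (rule dqm.h_null[OF Sm(2)])
  show "AE y in \<nu>. p0 y > 0 --> (\<forall>\<^sub>F n in sequentially. y \<notin> S2 n)"
   using e_AE
  proof eventually_elim
   case (elim y)
   show ?case
   proof
    assume "p0 y > 0"
    with elim have "(%n. e n (fst y)) \<longlonglongrightarrow> s (fst y)" by blast
    from \<pi>_ev[OF this] show "\<forall>\<^sub>F n in sequentially. y \<notin> S2 n" by eventually_elim (simp add: S2_def)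
   qed
  qed
 qed
 have hS: "(%n. dqm.h n (S n) / (t n)^2) \<longlonglongrightarrow> 0"
 proof (rule dqm.h_null[OF Sm(3)])
  show "AE y in \<nu>. p0 y > 0 --> (\<forall>\<^sub>F n in sequentially. y \<notin> S n)"
   using e_AE
  proof eventually_elim
   case (elim y)
   show ?case
   proof
    assume "p0 y > 0"
    with elim have "(%n. e n (fst y)) \<longlonglongrightarrow> s (fst y)" by blast
    from G_ev[OF this] show "\<forall>\<^sub>F n in sequentially. y \<notin> S n" by eventually_elim (simp add: S_def)
   qed
  qed
 qed
 define M where "M A = (LINT y|\<nu>. indicator A y * p0 y)" for A
 have M_nonneg: "0 <= M A" for A unfolding M_def using dqm.p0_nonneg by simp
 \<comment> \<open>Chebyshev at level 1 / |t|, where the second moment of m is taken only over the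
   exceptional set and so tends to 0.\<close>
 have MS1: "(%n. M (S1 n) / (t n)^2) \<longlonglongrightarrow> 0"
 proof -
  have mi: "integrable \<nu> (%y. (m a (fst y))^2 * p0 y)"
   using obs0(2)[of "%y. (m a (fst y))^2"] integrable_m_sq[of a] by simp
  have lim: "(%n. \<integral>y. indicator (S1 n) y * ((m a (fst y))^2 * p0 y) \<partial>\<nu>) \<longlonglongrightarrow> (LINT y|\<nu>. 0)"
  proof (rule integral_dominated_convergence[OF _ _ mi])
   show "AE y in \<nu>. (%n. indicator (S1 n) y * ((m a (fst y))^2 * p0 y)) \<longlonglongrightarrow> 0"
   proof (intro AE_I2 tendsto_eventually)
    fix y
    show "\<forall>\<^sub>F n in sequentially. indicator (S1 n) y * ((m a (fst y))^2 * p0 y) = 0"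
     using m_ev[of "fst y"] by eventually_elim (simp add: S1_def indicator_def)
   qed
   show "AE y in \<nu>. norm (indicator (S1 n) y * ((m a (fst y))^2 * p0 y)) <= (m a (fst y))^2 * p0 y" for n
    using dqm.p0_nonneg by (auto simp: indicator_def)
   show "(%y. indicator (S1 n) y * ((m a (fst y))^2 * p0 y)) \<in> borel_measurable \<nu>" for n
    using Sm(1)[of n] by measurable
  qed simp
  have "M (S1 n) / (t n)^2 <= (LINT y|\<nu>. indicator (S1 n) y * ((m a (fst y))^2 * p0 y))" for n
  proof -
   have "M (S1 n) / (t n)^2 = (LINT y|\<nu>. indicator (S1 n) y * p0 y / (t n)^2)" unfolding M_def by simp
   also have "... <= (LINT y|\<nu>. indicator (S1 n) y * ((m a (fst y))^2 * p0 y))"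
   proof (rule integral_mono)
    show "integrable \<nu> (%y. indicator (S1 n) y * p0 y / (t n)^2)"
     using dqm.indicator_integrable[OF dqm.p0_integrable Sm(1)] by simp
    show "integrable \<nu> (%y. indicator (S1 n) y * ((m a (fst y))^2 * p0 y))"
     by (rule dqm.indicator_integrable[OF mi Sm(1)])
    fix y
    show "indicator (S1 n) y * p0 y / (t n)^2 <= indicator (S1 n) y * ((m a (fst y))^2 * p0 y)"
    proof (cases "y \<in> S1 n")
     case True
     then have "1 / \<bar>t n\<bar> <= \<bar>m a (fst y)\<bar>" by (simp add: S1_def)
     then have "(1 / \<bar>t n\<bar>)^2 <= \<bar>m a (fst y)\<bar>\<^sup>2" by (rule power_mono) simp
     then have "1 / (t n)^2 <= (m a (fst y))^2" by (simp add: power_divide)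
     then have "1 / (t n)^2 * p0 y <= (m a (fst y))^2 * p0 y" by (rule mult_right_mono[OF _ dqm.p0_nonneg])
     then show ?thesis using True by simp
    qed simp
   qed
   finally show ?thesis .
  qed
  then show ?thesis
   by (intro Lim_null_comparison[OF _ lim[simplified]] always_eventually allI) (simp add: M_nonneg)
 qed
 \<comment> \<open>On this set arm \<open>a\<close> has propensity at least c under Q but below c /
   8 under \<open>P n\<close>. Comparing arm masses through \<open>mass_le\<close> twice gives c M
   <= (c / 2) M + (c / 2 + 2) h, and the factor 2 * 2 * c / 8 = c / 2 is absorbed on the
   left.\<close>
 have MS2: "M (S2 n) <= (1 + 4 / c) * dqm.h n (S2 n)" for n
 proof -
  interpret Pn: unit_law "P n" by (rule laws)
  define I where "I x = (indicator {x. \<pi> n x < c / 8} x :: real)" for x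
  have Im [measurable]: "I \<in> borel_measurable borel" unfolding I_def[abs_def] by measurable
  have I01: "\<bar>I x\<bar> <= 1" "0 <= I x" for x by (auto simp: I_def indicator_def)
  define A where "A = {y \<in> space \<nu>. fst y \<in> {x. \<pi> n x < c / 8} & fst (snd y) = a}"
  have Am: "A \<in> sets \<nu>" unfolding A_def by measurable
  have A2: "A \<subseteq> S2 n" by (auto simp: A_def S2_def)
  have bm: "(%(x, y0, y1). I x) \<in> borel_measurable (borel \<Otimes>\<^sub>M (borel \<Otimes>\<^sub>M borel :: (real \<times> real) measure))" by measurable
  have kA: "(%y. of_bool (fst (snd y) = a) * I (fst y)) \<in> borel_measurable (obs_space :: ('x \<times> bool \<times> real) measure)" by measurable
  have kS: "(%y. I (fst y)) \<in> borel_measurable (obs_space :: ('x \<times> bool \<times> real) measure)" by measurable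
  have indA: "indicator A y = of_bool (fst (snd y) = a) * I (fst y)" and indS: "indicator (S2 n) y = I (fst y)" for y
   by (auto simp: A_def S2_def I_def indicator_def space_\<nu>)
  have iQ: "integrable Q (%z. I (cov z))" "integrable Q (%z. prop_of s a (cov z) * I (cov z))"
  proof -
   show "integrable Q (%z. I (cov z))" by (rule integrable_const_bound[where B=1]) (use I01 in auto)
   have "\<bar>prop_of s a x * I x\<bar> <= 1" for x
    unfolding abs_mult using mult_mono[of "\<bar>prop_of s a x\<bar>" 1 "\<bar>I x\<bar>" 1] I01[of x] prop_bounds[of a x] c_pos by simp
   then show "integrable Q (%z. prop_of s a (cov z) * I (cov z))"
    by (intro integrable_const_bound[where B=1]) auto
  qed
  have iP: "integrable (P n) (%z. I (cov z))" "integrable (P n) (%z. prop_of (e n) a (cov z) * I (cov z))"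
  proof -
   show "integrable (P n) (%z. I (cov z))" by (rule Pn.integrable_const_bound[where B=1]) (use I01 in auto)
   have "\<bar>prop_of (e n) a x * I x\<bar> <= 1" for x
    unfolding abs_mult using mult_mono[of "\<bar>prop_of (e n) a x\<bar>" 1 "\<bar>I x\<bar>" 1] I01[of x] \<pi>1[of n x] by (simp add: \<pi>_def)
   then show "integrable (P n) (%z. prop_of (e n) a (cov z) * I (cov z))"
    by (intro Pn.integrable_const_bound[where B=1]) auto
  qed
  have "c * M (S2 n) = (LINT z|Q. c * I (cov z))"
   unfolding M_def indS using obs0(1)[OF kS] by simp
  also have "... <= (LINT z|Q. prop_of s a (cov z) * I (cov z))"
   using iQ prop_bounds(1) I01(2) by (intro integral_mono) (auto intro: mult_right_mono)
  also have "... = (LINT z|Q. of_bool (trt z = a) * I (cov z))"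
   by (rule ipw_integral(1)[OF s_ipw s_measurable s_unit bm, symmetric])
  also have "... = (LINT y|\<nu>. indicator A y * p0 y)"
   unfolding indA using obs0(1)[OF kA] by simp
  also have "... <= 2 * (LINT y|\<nu>. indicator A y * p n y) + 2 * dqm.h n A"
   by (rule dqm.mass_le(2)[OF Am])
  also have "dqm.h n A <= dqm.h n (S2 n)"
   by (rule dqm.h_mono[OF A2 Am Sm(2)])
  also have "(LINT y|\<nu>. indicator A y * p n y) = (\<integral>z. of_bool (trt z = a) * I (cov z) \<partial>P n)"
   unfolding indA using obsn(1)[OF kA] by simp
  also have "... = (\<integral>z. prop_of (e n) a (cov z) * I (cov z) \<partial>P n)"
   by (rule Pn.ipw_integral(1)[OF e_ipw e_measurable e_unit bm])
  also have "... <= (\<integral>z. c / 8 * I (cov z) \<partial>P n)"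
   using iP by (intro integral_mono) (auto simp: I_def indicator_def \<pi>_def)
  also have "... = c / 8 * (LINT y|\<nu>. indicator (S2 n) y * p n y)"
   unfolding indS using obsn(1)[OF kS] by simp
  also have "(LINT y|\<nu>. indicator (S2 n) y * p n y) <= 2 * M (S2 n) + 2 * dqm.h n (S2 n)"
   unfolding M_def by (rule dqm.mass_le(1)[OF Sm(2)])
  finally have "c * M (S2 n) <= 2 * (c / 8 * (2 * M (S2 n) + 2 * dqm.h n (S2 n))) + 2 * dqm.h n (S2 n)"
   using c_pos by (simp add: mult_left_mono)
  moreover have "2 * (c / 8 * (2 * M (S2 n) + 2 * dqm.h n (S2 n))) = c / 2 * M (S2 n) + c / 2 * dqm.h n (S2 n)"
   by (simp add: field_simps)
  moreover have "c / 2 * ((1 + 4 / c) * dqm.h n (S2 n)) = c / 2 * dqm.h n (S2 n) + 2 * dqm.h n (S2 n)"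
   using c_pos by (simp add: field_simps)
  moreover have "c * M (S2 n) = c / 2 * M (S2 n) + c / 2 * M (S2 n)" by simp
  ultimately have "c / 2 * M (S2 n) <= c / 2 * ((1 + 4 / c) * dqm.h n (S2 n))"
   by linarith
  then show ?thesis using c_pos by (simp only: mult_le_cancel_left_pos half_gt_zero)
 qed
 define b0 bn where "b0 n = M (S n)" and "bn n = (LINT y|\<nu>. indicator (S n) y * p n y)" for n
 have b0_lim: "(%n. b0 n / (t n)^2) \<longlonglongrightarrow> 0"
 proof -
  have lim: "(%n. M (S1 n) / (t n)^2 + (1 + 4 / c) * (dqm.h n (S2 n) / (t n)^2)) \<longlonglongrightarrow> 0"
   using tendsto_add[OF MS1 tendsto_mult_left[OF hS2, of "1 + 4 / c"]] by simp
  have "b0 n <= M (S1 n) + M (S2 n)" for n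
  proof -
   have "b0 n <= (LINT y|\<nu>. indicator (S1 n) y * p0 y + indicator (S2 n) y * p0 y)"
    unfolding b0_def M_def
   proof (rule integral_mono)
    show "indicator (S n) y * p0 y <= indicator (S1 n) y * p0 y + indicator (S2 n) y * p0 y" for y
     using dqm.p0_nonneg[of y] by (auto simp: indicator_def S_def S1_def S2_def G_def)
   qed (use dqm.indicator_integrable[OF dqm.p0_integrable] Sm in auto)
   then show ?thesis unfolding M_def using dqm.indicator_integrable[OF dqm.p0_integrable] Sm by simp
  qed
  then have "b0 n <= M (S1 n) + (1 + 4 / c) * dqm.h n (S2 n)" for n
   using add_left_mono[OF MS2[of n], of "M (S1 n)"] by (rule order_trans)
  then have "b0 n / (t n)^2 <= (M (S1 n) + (1 + 4 / c) * dqm.h n (S2 n)) / (t n)^2" for n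
   by (rule divide_right_mono) simp
  then have "b0 n / (t n)^2 <= M (S1 n) / (t n)^2 + (1 + 4 / c) * (dqm.h n (S2 n) / (t n)^2)" for n
   by (simp add: add_divide_distrib)
  then show ?thesis
   by (intro Lim_null_comparison[OF _ lim] always_eventually allI) (simp add: b0_def M_nonneg)
 qed
 have bn_nonneg: "0 <= bn n" for n unfolding bn_def using dqm.p_nonneg by simp
 have bn_lim: "(%n. bn n / (t n)^2) \<longlonglongrightarrow> 0"
 proof -
  have lim: "(%n. 2 * (b0 n / (t n)^2) + 2 * (dqm.h n (S n) / (t n)^2)) \<longlonglongrightarrow> 0"
   using tendsto_add[OF tendsto_mult_left[OF b0_lim, of 2] tendsto_mult_left[OF hS, of 2]] by simp
  have "bn n <= 2 * b0 n + 2 * dqm.h n (S n)" for n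
   unfolding bn_def b0_def M_def by (rule dqm.mass_le(1)[OF Sm(3)])
  then have "bn n / (t n)^2 <= 2 * (b0 n / (t n)^2) + 2 * (dqm.h n (S n) / (t n)^2)" for n
   using divide_right_mono[of "bn n" "2 * b0 n + 2 * dqm.h n (S n)" "(t n)^2"] by (simp add: add_divide_distrib)
  then show ?thesis
   by (intro Lim_null_comparison[OF _ lim] always_eventually allI) (simp add: bn_nonneg)
 qed
 \<comment> \<open>By Cauchy-Schwarz, an exceptional mass o(t^2) together with bounded second
   moments changes a mean by o(t).\<close>
 have tail: "(%n. \<tau> n / t n) \<longlonglongrightarrow> 0" if \<tau>: "!!n. \<bar>\<tau> n\<bar> <= sqrt (b n) * sqrt C" and b: "(%n. b n / (t n)^2) \<longlonglongrightarrow> 0" for \<tau> b C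
 proof -
  have lim: "(%n. sqrt (b n / (t n)^2) * sqrt C) \<longlonglongrightarrow> 0"
   using tendsto_mult_right[OF tendsto_real_sqrt[OF b], of "sqrt C"] by simp
  have "\<bar>\<tau> n / t n\<bar> <= sqrt (b n / (t n)^2) * sqrt C" for n
   using divide_right_mono[OF \<tau>[of n], of "\<bar>t n\<bar>"] by (simp add: abs_divide real_sqrt_divide)
  then show ?thesis by (intro Lim_null_comparison[OF _ lim] always_eventually allI) simp
 qed
 have S_obs: "indicator (S n) (obs_of z) = 1 - ind n (cov z)" for n z
  by (auto simp: S_def ind_def indicator_def space_\<nu>)
 have sq: "(1 - ind n x)^2 = 1 - ind n x" for n x using ind01(3)[of n x] by auto
 have kS: "(%y. indicator (S n) y :: real) \<in> borel_measurable obs_space" for n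
  using Sm(3)[of n] sets_\<nu> by simp
 have tail_n: "(%n. (\<integral>z. (1 - ind n (cov z)) * pot a z \<partial>P n) / t n) \<longlonglongrightarrow> 0"
 proof (rule tail[OF _ bn_lim])
  fix n
  interpret Pn: unit_law "P n" by (rule laws)
  have ip2: "integrable (P n) (%z. (pot a z)^2)" using P_outcomes[of n] unfolding square_integrable_outcomes_def by blast
  have ii: "integrable (P n) (%z. (1 - ind n (cov z))^2)"
   unfolding sq by (rule Pn.integrable_const_bound[where B=1]) (use ind01 in auto)
  have "\<bar>\<integral>z. (1 - ind n (cov z)) * pot a z \<partial>P n\<bar> <= sqrt (\<integral>z. (1 - ind n (cov z))\<^sup>2 \<partial>P n) * sqrt (\<integral>z. (pot a z)\<^sup>2 \<partial>P n)"
   by (rule abs_integral_mult_le[OF _ _ ii ip2]) measurable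
  also have "(\<integral>z. (1 - ind n (cov z))\<^sup>2 \<partial>P n) = bn n"
   unfolding sq bn_def obsn(1)[OF kS, symmetric] S_obs ..
  also have "sqrt (bn n) * sqrt (\<integral>z. (pot a z)\<^sup>2 \<partial>P n) <= sqrt (bn n) * sqrt Bm"
   using P_moment bn_nonneg by (intro mult_left_mono real_sqrt_le_mono) auto
  finally show "\<bar>\<integral>z. (1 - ind n (cov z)) * pot a z \<partial>P n\<bar> <= sqrt (bn n) * sqrt Bm" .
 qed
 have tail_0: "(%n. (LINT z|Q. (1 - ind n (cov z)) * pot a z) / t n) \<longlonglongrightarrow> 0"
 proof (rule tail[OF _ b0_lim])
  fix n
  have ii: "integrable Q (%z. (1 - ind n (cov z))^2)"
   unfolding sq by (rule integrable_const_bound[where B=1]) (use ind01 in auto)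
  have "\<bar>\<integral>z. (1 - ind n (cov z)) * pot a z \<partial>Q\<bar> <= sqrt (LINT z|Q. (1 - ind n (cov z))^2) * sqrt (LINT z|Q. (pot a z)^2)"
   by (rule abs_integral_mult_le[OF _ _ ii integrable_pot(2)]) measurable
  also have "(LINT z|Q. (1 - ind n (cov z))^2) = b0 n"
   unfolding sq b0_def M_def obs0(1)[OF kS, symmetric] S_obs ..
  finally show "\<bar>\<integral>z. (1 - ind n (cov z)) * pot a z \<partial>Q\<bar> <= sqrt (b0 n) * sqrt (LINT z|Q. (pot a z)^2)" .
 qed
 have \<xi>2: "(\<xi> n y)^2 <= 2 * L\<^sup>2 * ((ind n (fst y) * m a (fst y))^2 + of_bool (fst (snd y) = a) * (snd (snd y))^2)" for n y
 proof -
  let ?u = "\<bar>ind n (fst y) * m a (fst y)\<bar>" and ?v = "of_bool (fst (snd y) = a) * \<bar>snd (snd y)\<bar> :: real"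
  have "0 <= L * (?u + ?v)" using L1 by (intro mult_nonneg_nonneg add_nonneg_nonneg) auto
  then have "(\<xi> n y)^2 <= (L * (?u + ?v))^2" using \<xi>_le[of n y] by (simp add: abs_le_square_iff[symmetric])
  also have "... <= L\<^sup>2 * (2 * ?u\<^sup>2 + 2 * ?v\<^sup>2)"
   unfolding power_mult_distrib[of L] by (intro mult_left_mono sum_square_le) simp
  also have "?v\<^sup>2 = of_bool (fst (snd y) = a) * (snd (snd y))^2" by (cases "fst (snd y) = a") auto
  finally show ?thesis by (simp add: algebra_simps)
 qed
 obtain C2 where C2: "!!n. dqm.h n (space \<nu>) <= C2 * (t n)^2" using dqm.h_bounded by blast
 define E0 where "E0 = (LINT z|Q. (m a (cov z))^2)"
 have \<xi>_moment: "integrable \<nu> (%y. (\<xi> n y)^2 * p n y)" "(LINT y|\<nu>. (\<xi> n y)\<^sup>2 * p n y) <= 2 * L\<^sup>2 * ((2 * E0 + 2 * C2) + Bm)" for n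
 proof -
  interpret Pn: unit_law "P n" by (rule laws)
  have ip2: "integrable (P n) (%z. (pot a z)^2)" using P_outcomes[of n] unfolding square_integrable_outcomes_def by blast
  have k1: "(%y. (ind n (fst y) * m a (fst y))^2) \<in> borel_measurable (obs_space :: ('x \<times> bool \<times> real) measure)" by measurable
  have k3: "(%y. (\<xi> n y)^2) \<in> borel_measurable obs_space" by measurable
  have ib: "(ind n x * m a x)^2 <= (1 / \<bar>t n\<bar>)^2" for x
   using power_mono[OF im[of n x], of 2] by simp
  have im2: "integrable (P n) (%z. (ind n (cov z) * m a (cov z))^2)"
   by (rule Pn.integrable_const_bound[where B="(1 / \<bar>t n\<bar>)^2"]) (use ib in auto)
  have iy: "integrable (P n) (%z. of_bool (trt z = a) * (pot a z)^2)"
   by (rule Bochner_Integration.integrable_bound[OF ip2]) auto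
  have le: "(\<xi> n (obs_of z))^2 <= 2 * L\<^sup>2 * ((ind n (cov z) * m a (cov z))^2 + of_bool (trt z = a) * (pot a z)^2)" for z
   using \<xi>2[of n "obs_of z"] by (cases "trt z = a") (auto simp: obs_outcome_eq)
  have i\<xi>: "integrable (P n) (%z. (\<xi> n (obs_of z))^2)"
  proof (rule Bochner_Integration.integrable_bound)
   show "integrable (P n) (%z. 2 * L\<^sup>2 * ((ind n (cov z) * m a (cov z))^2 + of_bool (trt z = a) * (pot a z)^2))"
    using im2 iy by simp
   show "AE z in P n. norm ((\<xi> n (obs_of z))^2) <= norm (2 * L\<^sup>2 * ((ind n (cov z) * m a (cov z))^2 + of_bool (trt z = a) * (pot a z)^2))"
    using le by (intro AE_I2) (simp add: abs_of_nonneg)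
  qed measurable
  then show "integrable \<nu> (%y. (\<xi> n y)^2 * p n y)" using obsn(2)[OF k3] by simp
  \<comment> \<open>Bound p n by 2 p0 plus twice the squared root difference. The first part gives
    the moment under Q; in the second the squared regression is at most 1 / t^2, which balances a
    Hellinger mass of order t^2.\<close>
  have bd1: "(\<integral>z. (ind n (cov z) * m a (cov z))\<^sup>2 \<partial>P n) <= 2 * E0 + 2 * C2"
  proof -
   have mi: "integrable \<nu> (%y. (m a (fst y))^2 * p0 y)"
    using obs0(2)[of "%y. (m a (fst y))^2"] integrable_m_sq[of a] by simp
   have ir: "integrable \<nu> (%y. indicator (space \<nu>) y * (dqm.root_diff n y)^2)"
    by (rule dqm.indicator_integrable[OF dqm.root_diff_integrable]) simp
   have "(\<integral>z. (ind n (cov z) * m a (cov z))\<^sup>2 \<partial>P n) = (LINT y|\<nu>. (ind n (fst y) * m a (fst y))\<^sup>2 * p n y)"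
    using obsn(1)[OF k1] by simp
   also have "... <= (LINT y|\<nu>. 2 * ((m a (fst y))^2 * p0 y) + 2 / (t n)^2 * (indicator (space \<nu>) y * (dqm.root_diff n y)^2))"
   proof (rule integral_mono)
    show "integrable \<nu> (%y. (ind n (fst y) * m a (fst y))^2 * p n y)" using im2 obsn(2)[OF k1] by simp
    show "integrable \<nu> (%y. 2 * ((m a (fst y))^2 * p0 y) + 2 / (t n)^2 * (indicator (space \<nu>) y * (dqm.root_diff n y)^2))"
     using mi ir by simp
    fix y
    let ?w = "(ind n (fst y) * m a (fst y))^2" and ?r = "(dqm.root_diff n y)^2"
    have w1: "?w <= (m a (fst y))^2" using ind01(3)[of n "fst y"] by auto
    have w2: "?w <= 1 / (t n)^2" using ib[of "fst y"] by (simp add: power_divide)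
    have "?w * p n y <= ?w * (2 * p0 y + 2 * ?r)" by (intro mult_left_mono dqm.p_le) simp
    also have "... = 2 * (?w * p0 y) + 2 * (?w * ?r)" by (simp add: algebra_simps)
    also have "... <= 2 * ((m a (fst y))^2 * p0 y) + 2 * (1 / (t n)^2 * ?r)"
     using w1 w2 dqm.p0_nonneg[of y] by (intro add_mono mult_left_mono mult_right_mono) auto
    finally show "?w * p n y <= 2 * ((m a (fst y))^2 * p0 y) + 2 / (t n)^2 * (indicator (space \<nu>) y * ?r)"
     by (simp add: space_\<nu>)
   qed
   also have "... = 2 * (LINT y|\<nu>. (m a (fst y))\<^sup>2 * p0 y) + 2 / (t n)^2 * dqm.h n (space \<nu>)"
    using mi ir by (simp add: dqm.h_def)
   also have "(LINT y|\<nu>. (m a (fst y))\<^sup>2 * p0 y) = E0"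
    using obs0(1)[of "%y. (m a (fst y))^2"] by (simp add: E0_def)
   also have "2 / (t n)^2 * dqm.h n (space \<nu>) <= 2 / (t n)^2 * (C2 * (t n)^2)"
    using C2 by (intro mult_left_mono) auto
   also have "... = 2 * C2" using dqm.t_nz[of n] by simp
   finally show ?thesis by simp
  qed
  have bd2: "(\<integral>z. of_bool (trt z = a) * (pot a z)^2 \<partial>P n) <= Bm"
  proof (rule order_trans[OF _ P_moment[where n=n and a=a]])
   show "(\<integral>z. of_bool (trt z = a) * (pot a z)^2 \<partial>P n) <= (\<integral>z. (pot a z)\<^sup>2 \<partial>P n)"
    by (rule integral_mono[OF iy ip2]) auto
  qed
  have "(LINT y|\<nu>. (\<xi> n y)\<^sup>2 * p n y) = (\<integral>z. (\<xi> n (obs_of z))\<^sup>2 \<partial>P n)" using obsn(1)[OF k3] by simp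
  also have "... <= (\<integral>z. 2 * L\<^sup>2 * ((ind n (cov z) * m a (cov z))^2 + of_bool (trt z = a) * (pot a z)^2) \<partial>P n)"
   by (rule integral_mono[OF i\<xi> _ le]) (use im2 iy in simp)
  also have "... = 2 * L\<^sup>2 * ((\<integral>z. (ind n (cov z) * m a (cov z))\<^sup>2 \<partial>P n) + (\<integral>z. of_bool (trt z = a) * (pot a z)^2 \<partial>P n))"
   using im2 iy by simp
  also have "... <= 2 * L\<^sup>2 * ((2 * E0 + 2 * C2) + Bm)"
   using bd1 bd2 by (intro mult_left_mono add_mono) auto
  finally show "(LINT y|\<nu>. (\<xi> n y)\<^sup>2 * p n y) <= 2 * L\<^sup>2 * ((2 * E0 + 2 * C2) + Bm)" .
 qed
 have main: "(%n. ((LINT y|\<nu>. \<xi> n y * p n y) - (LINT y|\<nu>. \<xi> n y * p0 y)) / t n) \<longlonglongrightarrow> (LINT y|\<nu>. arm_phi a y * g y * p0 y)"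
 proof (rule dqm.expectation_derivative[OF _ _ _ \<xi>_moment D_int \<xi>D])
  show "\<xi> n \<in> borel_measurable \<nu>" for n by measurable
  show "D \<in> borel_measurable \<nu>" by measurable
  show "arm_phi a \<in> borel_measurable \<nu>" unfolding arm_phi_def[abs_def] by measurable
  show "AE y in \<nu>. p0 y > 0 --> (%n. \<xi> n y) \<longlonglongrightarrow> arm_phi a y"
   using e_AE
  proof eventually_elim
   case (elim y)
   show ?case
   proof
    assume "p0 y > 0"
    with elim have e: "(%n. e n (fst y)) \<longlonglongrightarrow> s (fst y)" by blast
    have p: "prop_of s a (fst y) ~= 0" using prop_bounds(1)[of a "fst y"] c_pos by linarith
    have "(%n. ind n (fst y)) \<longlonglongrightarrow> 1"
     using G_ev[OF e] by (intro tendsto_eventually) (auto simp: ind_def elim: eventually_mono)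
    then have "(%n. ind n (fst y) * m a (fst y) + of_bool (fst (snd y) = a) * (ind n (fst y) / \<pi> n (fst y) * (snd (snd y) - m a (fst y)))) \<longlonglongrightarrow>
      1 * m a (fst y) + of_bool (fst (snd y) = a) * (1 / prop_of s a (fst y) * (snd (snd y) - m a (fst y)))"
     using \<pi>_lim[OF e] p by (intro tendsto_intros)
    then show "(%n. \<xi> n y) \<longlonglongrightarrow> arm_phi a y" unfolding \<xi>_def arm_phi_def by simp
   qed
  qed
 qed
 have decomp: "((\<integral>z. pot a z \<partial>P n) - (LINT z|Q. pot a z)) / t n =
   ((LINT y|\<nu>. \<xi> n y * p n y) - (LINT y|\<nu>. \<xi> n y * p0 y)) / t n +
   ((\<integral>z. (1 - ind n (cov z)) * pot a z \<partial>P n) / t n - (LINT z|Q. (1 - ind n (cov z)) * pot a z) / t n)" for n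
 proof -
  interpret Pn: unit_law "P n" by (rule laws)
  have split: "(LINT z|R. pot a z) = (LINT z|R. ind n (cov z) * pot a z) + (LINT z|R. (1 - ind n (cov z)) * pot a z)"
   if R: "unit_law R" "square_integrable_outcomes R" for R :: "'x unit_data measure"
  proof -
   interpret R: unit_law R by fact
   have ipot: "integrable R (pot a)"
   proof (rule R.square_integrable_imp_integrable)
    show "integrable R (%z. (pot a z)^2)" using R(2) unfolding square_integrable_outcomes_def by blast
   qed measurable
   have "integrable R (%z. ind n (cov z) * pot a z)"
    by (rule Bochner_Integration.integrable_bound[OF ipot]) (auto simp: ind_def indicator_def)
   moreover have "integrable R (%z. (1 - ind n (cov z)) * pot a z)"
    by (rule Bochner_Integration.integrable_bound[OF ipot]) (auto simp: ind_def indicator_def)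
   ultimately have "(LINT z|R. ind n (cov z) * pot a z) + (LINT z|R. (1 - ind n (cov z)) * pot a z) =
     (LINT z|R. ind n (cov z) * pot a z + (1 - ind n (cov z)) * pot a z)"
    by (rule Bochner_Integration.integral_add[symmetric])
   then show ?thesis by (simp add: algebra_simps)
  qed
  show ?thesis
   unfolding unb_n unb_0 split[OF laws P_outcomes] split[OF unit_law_axioms outcomes]
   by (simp add: diff_divide_distrib add_divide_distrib)
 qed
 show ?thesis
  unfolding decomp using tendsto_add[OF main tendsto_diff[OF tail_n tail_0]] by simp
qed

end

context regression_setting
begin

definition eff_obs :: "'x \<times> bool \<times> real => real" where
 "eff_obs y = eff (fst y) (fst (snd y)) (snd (snd y))"

lemma eff_obs_measurable [measurable]: "eff_obs \<in> borel_measurable obs_space"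
proof -
 have eq: "eff_obs = (%y. m True (fst y) - m False (fst y) - ate Q +
   (if fst (snd y) then (snd (snd y) - m True (fst y)) / prop_of s True (fst y) else - (snd (snd y) - m False (fst y)) / prop_of s False (fst y)))"
  by (auto simp: eff_obs_def eff_def fun_eq_iff)
 show ?thesis unfolding eq by measurable
qed

lemma eff_obs_of: "eff_obs (obs_of z) = infl z"
 by (simp add: eff_obs_def infl_def obs_outcome_eq)

lemma obs_law_integral:
 assumes [measurable]: "k \<in> borel_measurable obs_space"
 shows "(\<integral>y. k y \<partial>obs_law Q) = (\<integral>z. k (obs_of z) \<partial>Q :: real)"
  and "integrable (obs_law Q) k \<longleftrightarrow> integrable Q (%z. k (obs_of z))"
 unfolding obs_law_def by (rule integral_distr; measurable) (rule integrable_distr_eq; measurable)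

text \<open>Along a suitable null sequence the scores converge almost everywhere, so
  \<open>arm_derivative\<close> computes the limit of the difference quotients; it must be d, which
  exists by assumption. The inequality is then Cauchy-Schwarz.\<close>

theorem regular_submodel_derivative:
 assumes sub: "regular_submodel Q P g d"
 shows "d = (\<integral>y. eff_obs y * g y \<partial>obs_law Q)" "d\<^sup>2 <= (LINT z|Q. (infl z)^2) * (\<integral>y. (g y)\<^sup>2 \<partial>obs_law Q)"
proof -
 note S = sub[unfolded regular_submodel_def]
 note P0 = S[THEN conjunct1] and gm [measurable] = S[THEN conjunct2, THEN conjunct1]
  and gi = S[THEN conjunct2, THEN conjunct2, THEN conjunct1] and der = S[THEN conjunct2, THEN conjunct2, THEN conjunct2, THEN conjunct1]
 obtain \<epsilon> Bm \<nu> p where \<epsilon>: "0 < \<epsilon>" and \<nu> [measurable_cong]: "sets \<nu> = sets obs_space"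
  and local: "\<forall>t. \<bar>t\<bar> < \<epsilon> --> P t \<in> causal_model & (\<forall>a. (\<integral>z. (pot a z)\<^sup>2 \<partial>(P t)) <= Bm) &
      p t \<in> borel_measurable \<nu> & (\<forall>y. 0 <= p t y) & obs_law (P t) = density \<nu> (%y. ennreal (p t y))"
  and qmd: "((%t. \<integral>\<^sup>+ y. ennreal (((sqrt (p t y) - sqrt (p 0 y)) / t - g y * sqrt (p 0 y) / 2)^2) \<partial>\<nu>) \<longlongrightarrow> 0) (at 0)"
  using S[THEN conjunct2, THEN conjunct2, THEN conjunct2, THEN conjunct2] by (elim exE conjE) rule
 have in_model: "P t \<in> causal_model" and mom: "(\<integral>z. (pot a z)\<^sup>2 \<partial>(P t)) <= Bm"
  and pm: "p t \<in> borel_measurable \<nu>" and pn: "0 <= p t y"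
  and law: "obs_law (P t) = density \<nu> (%y. ennreal (p t y))" if "\<bar>t\<bar> < \<epsilon>" for t a y
 proof -
  note l = local[THEN spec, THEN mp, OF that]
  show "P t \<in> causal_model" by (rule l[THEN conjunct1])
  show "(\<integral>z. (pot a z)\<^sup>2 \<partial>(P t)) <= Bm" by (rule l[THEN conjunct2, THEN conjunct1, THEN spec])
  show "p t \<in> borel_measurable \<nu>" by (rule l[THEN conjunct2, THEN conjunct2, THEN conjunct1])
  show "0 <= p t y" by (rule l[THEN conjunct2, THEN conjunct2, THEN conjunct2, THEN conjunct1, THEN spec])
  show "obs_law (P t) = density \<nu> (%y. ennreal (p t y))" by (rule l[THEN conjunct2, THEN conjunct2, THEN conjunct2, THEN conjunct2])
 qed
 have UL: "unit_law (P t)" and SO: "square_integrable_outcomes (P t)" and A1: "assumption1 (P t)" if "\<bar>t\<bar> < \<epsilon>" for t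
  using in_model[OF that] by (auto simp: causal_model_def unit_law_def unit_law_axioms_def)
 have z: "\<bar>0\<bar> < \<epsilon>" using \<epsilon> by simp
 have law0: "obs_law Q = density \<nu> (%y. ennreal (p 0 y))" using law[OF z] P0 by simp
 have one: "integrable \<nu> (p t)" "(LINT y|\<nu>. p t y) = 1" if t: "\<bar>t\<bar> < \<epsilon>" for t
 proof -
  interpret Pt: unit_law "P t" by (rule UL[OF t])
  note o = Pt.obs_integral[OF \<nu> pm[OF t] pn[OF t] law[OF t], of "%_. 1"]
  show "integrable \<nu> (p t)" using o(2) by simp
  show "(LINT y|\<nu>. p t y) = 1" using o(1) Pt.prob_space by simp
 qed
 have g2: "integrable \<nu> (%y. (g y)^2 * p 0 y)"
  using gi obs_integral(2)[OF \<nu> pm[OF z] pn[OF z] law0, of "%y. (g y)^2"] obs_law_integral(2)[of "%y. (g y)^2"] by simp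
 have dqm: "dqm_sequence \<nu> (%n. p (r n)) (p 0) g r" if r: "!!n. \<bar>r n\<bar> < \<epsilon>" "!!n. r n ~= 0" "r \<longlonglongrightarrow> 0" for r :: "nat => real"
 proof
  have "filterlim r (at 0) sequentially" using r by (simp add: filterlim_at)
  from filterlim_compose[OF qmd this]
  show "(%n. \<integral>\<^sup>+ y. ennreal (((sqrt (p (r n) y) - sqrt (p 0 y)) / r n - g y * sqrt (p 0 y) / 2)^2) \<partial>\<nu>) \<longlonglongrightarrow> 0" .
  show "g \<in> borel_measurable \<nu>" by measurable
  show "p (r n) \<in> borel_measurable \<nu>" for n by (rule pm[OF r(1)])
  show "p 0 \<in> borel_measurable \<nu>" by (rule pm[OF z])
  show "0 <= p (r n) y" for n y by (rule pn[OF r(1)])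
  show "0 <= p 0 y" for y by (rule pn[OF z])
  show "integrable \<nu> (p (r n))" for n by (rule one[OF r(1)])
  show "integrable \<nu> (p 0)" by (rule one[OF z])
  show "(LINT y|\<nu>. p (r n) y) = 1" for n by (rule one[OF r(1)])
  show "(LINT y|\<nu>. p 0 y) = 1" by (rule one[OF z])
  show "integrable \<nu> (%y. (g y)^2 * p 0 y)" by (rule g2)
  show "r n ~= 0" for n by (rule r(2))
  show "r \<longlonglongrightarrow> 0" by (rule r(3))
 qed
 have "\<exists>e. e \<in> borel_measurable borel & (\<forall>x. 0 < e x & e x < 1) & ipw (P t) e" if t: "\<bar>t\<bar> < \<epsilon>" for t
 proof -
  interpret Pt: unit_law "P t" by (rule UL[OF t])
  obtain e k where e: "e \<in> borel_measurable borel" "0 < k" "!!x. k <= e x" "!!x. e x <= 1 - k"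
   "AE z in P t. e (cov z) = cprob (P t) cov trt z" "ipw (P t) e"
   by (rule Pt.assumption1_obtains_score[OF A1[OF t]]) (rule that)
  have "0 < e x & e x < 1" for x using e(2) e(3,4)[of x] by linarith
  then show ?thesis using e(1,6) by (intro exI[of _ e] conjI allI) auto
 qed
 then have "\<forall>t. \<exists>e. \<bar>t\<bar> < \<epsilon> --> e \<in> borel_measurable borel & (\<forall>x. 0 < e x & e x < 1) & ipw (P t) e" by blast
 from choice[OF this] obtain E where E0: "\<forall>t. \<bar>t\<bar> < \<epsilon> --> E t \<in> borel_measurable borel & (\<forall>x. 0 < E t x & E t x < 1) & ipw (P t) (E t)" ..
 have E: "E t \<in> borel_measurable borel" "0 < E t x" "E t x < 1" "ipw (P t) (E t)" if "\<bar>t\<bar> < \<epsilon>" for t x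
 proof -
  note e = E0[THEN spec, THEN mp, OF that]
  show "E t \<in> borel_measurable borel" by (rule e[THEN conjunct1])
  show "0 < E t x" by (rule e[THEN conjunct2, THEN conjunct1, THEN spec, THEN conjunct1])
  show "E t x < 1" by (rule e[THEN conjunct2, THEN conjunct1, THEN spec, THEN conjunct2])
  show "ipw (P t) (E t)" by (rule e[THEN conjunct2, THEN conjunct2])
 qed
 have path: "regular_path Q s m c B (%n. P (r n)) (%n. E (r n)) \<nu> (%n. p (r n)) (p 0) g r Bm"
  if r: "!!n. \<bar>r n\<bar> < \<epsilon>" "!!n. r n ~= 0" "r \<longlonglongrightarrow> 0" for r :: "nat => real"
 proof (rule regular_path.intro[OF regression_setting_axioms], rule regular_path_axioms.intro)
  show "sets \<nu> = sets obs_space" by (rule \<nu>)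
  show "dqm_sequence \<nu> (%n. p (r n)) (p 0) g r" by (rule dqm[OF r])
  show "unit_law (P (r n))" for n by (rule UL[OF r(1)])
  show "square_integrable_outcomes (P (r n))" for n by (rule SO[OF r(1)])
  show "(\<integral>z. (pot a z)\<^sup>2 \<partial>P (r n)) <= Bm" for n a by (rule mom[OF r(1)])
  show "obs_law Q = density \<nu> (%y. ennreal (p 0 y))" by (rule law0)
  show "obs_law (P (r n)) = density \<nu> (%y. ennreal (p (r n) y))" for n by (rule law[OF r(1)])
  show "E (r n) \<in> borel_measurable borel" for n by (rule E(1)[OF r(1)])
  show "0 < E (r n) x" "E (r n) x < 1" for n x by (rule E(2,3)[OF r(1)])+
  show "ipw (P (r n)) (E (r n))" for n by (rule E(4)[OF r(1)])
 qed
 \<comment> \<open>Any null sequence of nonzero points inside the neighbourhood would serve; the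
   shift by 2 keeps it strictly inside.\<close>
 define r where "r n = \<epsilon> / (real n + 2)" for n
 have r: "\<bar>r n\<bar> < \<epsilon>" "r n ~= 0" for n
 proof -
  have p: "0 < r n" using \<epsilon> by (simp add: r_def add_nonneg_pos)
  have "\<epsilon> * 1 < \<epsilon> * (real n + 2)" using \<epsilon> by (intro mult_strict_left_mono) auto
  then have "r n < \<epsilon>" by (simp add: r_def pos_divide_less_eq add_nonneg_pos)
  then show "\<bar>r n\<bar> < \<epsilon>" "r n ~= 0" using p by auto
 qed
 have r0: "r \<longlonglongrightarrow> 0" unfolding r_def by real_asymp
 interpret p1: regular_path Q s m c B "%n. P (r n)" "%n. E (r n)" \<nu> "%n. p (r n)" "p 0" g r Bm
  by (rule path[OF r r0])
 \<comment> \<open>The scores converge in L1 only, hence almost everywhere along a subsequence; the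
   derivative is the same along it.\<close>
 have "\<exists>q::nat=>nat. strict_mono q & (AE z in Q. (%n. E (r (q n)) (cov z) - s (cov z)) \<longlonglongrightarrow> 0)"
 proof (rule tendsto_L1_AE_subseq)
  show "integrable Q (%z. E (r n) (cov z) - s (cov z))" for n
  proof (rule integrable_const_bound[where B=1])
   have "\<bar>E (r n) x - s x\<bar> <= 1" for x
    using p1.e_unit[of n x] s_unit[of x] by linarith
   then show "AE z in Q. norm (E (r n) (cov z) - s (cov z)) <= 1" by simp
  qed (use E(1)[OF r(1)] in measurable)
  show "(%n. \<integral>z. norm (E (r n) (cov z) - s (cov z)) \<partial>Q) \<longlonglongrightarrow> 0"
   using p1.score_L1 by simp
 qed
 then obtain q :: "nat => nat" where q: "strict_mono q" "AE z in Q. (%n. E (r (q n)) (cov z) - s (cov z)) \<longlonglongrightarrow> 0"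
  by blast
 define v where "v n = r (q n)" for n
 have v: "\<bar>v n\<bar> < \<epsilon>" "v n ~= 0" for n using r by (auto simp: v_def)
 have v0: "v \<longlonglongrightarrow> 0" unfolding v_def using LIMSEQ_subseq_LIMSEQ[OF r0 q(1)] by (simp add: comp_def)
 interpret p2: regular_path Q s m c B "%n. P (v n)" "%n. E (v n)" \<nu> "%n. p (v n)" "p 0" g v Bm
  by (rule path[OF v v0])
 have conv: "AE z in Q. (%n. E (v n) (cov z)) \<longlonglongrightarrow> s (cov z)"
  using q(2) by eventually_elim (simp add: v_def LIM_zero_iff)
 have ate_eq: "ate (P t) = (\<integral>z. pot True z \<partial>P t) - (\<integral>z. pot False z \<partial>P t)" if t: "\<bar>t\<bar> < \<epsilon>" for t
 proof -
  interpret Pt: unit_law "P t" by (rule UL[OF t])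
  have "integrable (P t) (pot a)" for a
  proof (rule Pt.square_integrable_imp_integrable)
   show "integrable (P t) (%z. (pot a z)^2)" using SO[OF t] unfolding square_integrable_outcomes_def by blast
  qed measurable
  then show ?thesis by (simp add: ate_def)
 qed
 have lim1: "(%n. (ate (P (v n)) - ate Q) / v n) \<longlonglongrightarrow> (LINT y|\<nu>. p2.arm_phi True y * g y * p 0 y) - (LINT y|\<nu>. p2.arm_phi False y * g y * p 0 y)"
 proof -
  have "(ate (P (v n)) - ate Q) / v n = ((\<integral>z. pot True z \<partial>P (v n)) - (LINT z|Q. pot True z)) / v n - ((\<integral>z. pot False z \<partial>P (v n)) - (LINT z|Q. pot False z)) / v n" for n
   using ate_eq[OF v(1)] ate_eq[OF z] P0 by (simp add: diff_divide_distrib)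
  then show ?thesis using tendsto_diff[OF p2.arm_derivative[OF conv] p2.arm_derivative[OF conv]] by simp
 qed
 have lim2: "(%n. (ate (P (v n)) - ate Q) / v n) \<longlonglongrightarrow> d"
 proof -
  have "((%h. (ate (P (0 + h)) - ate (P 0)) / h) \<longlongrightarrow> d) (at 0)" using der by (simp add: DERIV_def)
  moreover have "filterlim v (at 0) sequentially" using v v0 by (simp add: filterlim_at)
  ultimately have "(%n. (ate (P (0 + v n)) - ate (P 0)) / v n) \<longlonglongrightarrow> d" by (rule filterlim_compose)
  then show ?thesis by (simp add: P0)
 qed
 have phi_m [measurable]: "p2.arm_phi a \<in> borel_measurable obs_space" for a unfolding p2.arm_phi_def[abs_def] by measurable
 have tau: "eff_obs y = p2.arm_phi True y - p2.arm_phi False y - ate Q" for y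
  by (cases "fst (snd y)") (simp_all add: eff_obs_def eff_def p2.arm_phi_def diff_divide_distrib)
 have phi_obs: "p2.arm_phi a (obs_of z) = m a (cov z) + of_bool (trt z = a) * (resid m a z / prop_of s a (cov z))" for a z
  by (cases "trt z = a") (simp_all add: p2.arm_phi_def obs_outcome_eq resid_def)
 have phi_sq: "integrable \<nu> (%y. (p2.arm_phi a y)^2 * p 0 y)" for a
 proof -
  have "integrable Q (%z. (m a (cov z) + of_bool (trt z = a) * (resid m a z / prop_of s a (cov z)))^2)"
  proof (rule integrable_add_square)
   show "integrable Q (%z. (of_bool (trt z = a) * (resid m a z / prop_of s a (cov z)))^2)"
   proof (rule Bochner_Integration.integrable_bound[OF integrable_wresid_sq(1)[of a]])
    show "AE z in Q. norm ((of_bool (trt z = a) * (resid m a z / prop_of s a (cov z)))^2) <= norm ((wresid a z)^2)"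
     by (intro AE_I2) (auto simp: wresid_def of_bool_def)
   qed measurable
   show "integrable Q (%z. (m a (cov z))^2)" by (rule integrable_m_sq)
  qed measurable
  then show ?thesis
   using p2.obs0(2)[of "%y. (p2.arm_phi a y)^2"] by (simp add: phi_obs)
 qed
 have phi_int: "integrable \<nu> (%y. p2.arm_phi a y * g y * p 0 y)" for a
 proof -
  have "integrable \<nu> (%y. (p2.arm_phi a y * sqrt (p 0 y)) * (g y * sqrt (p 0 y)))"
   using phi_sq[of a] g2 pn[OF z] by (intro integrable_mult_square) (auto simp: power_mult_distrib p2.dqm.p0_measurable)
  moreover have "(p2.arm_phi a y * sqrt (p 0 y)) * (g y * sqrt (p 0 y)) = p2.arm_phi a y * g y * p 0 y" for y
  proof -
   have "(p2.arm_phi a y * sqrt (p 0 y)) * (g y * sqrt (p 0 y)) = p2.arm_phi a y * g y * (sqrt (p 0 y) * sqrt (p 0 y))"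
    by (simp only: mult_ac)
   also have "sqrt (p 0 y) * sqrt (p 0 y) = p 0 y" using pn[OF z, of y] by simp
   finally show ?thesis .
  qed
  ultimately show ?thesis by simp
 qed
 have g_int: "integrable \<nu> (%y. g y * p 0 y)"
 proof -
  have "integrable \<nu> (%y. (g y * sqrt (p 0 y)) * sqrt (p 0 y))"
   using p2.dqm.g_root_integrable p2.dqm.root_integrable(2) by (intro integrable_mult_square) auto
  then show ?thesis using pn[OF z] by (simp add: mult.assoc)
 qed
 have conv_law: "(\<integral>y. k y \<partial>obs_law Q) = (LINT y|\<nu>. k y * p 0 y)" if "k \<in> borel_measurable obs_space" for k
  using obs_law_integral(1)[OF that] p2.obs0(1)[OF that] by simp
 have "d = (LINT y|\<nu>. p2.arm_phi True y * g y * p 0 y) - (LINT y|\<nu>. p2.arm_phi False y * g y * p 0 y)"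
  by (rule LIMSEQ_unique[OF lim2 lim1])
 \<comment> \<open>The centring of the influence function can be inserted because the score has mean
   zero.\<close>
 also have "... = (LINT y|\<nu>. p2.arm_phi True y * g y * p 0 y - p2.arm_phi False y * g y * p 0 y) - ate Q * (LINT y|\<nu>. g y * p 0 y)"
  using phi_int p2.dqm.score_mean_zero by simp
 also have "... = (LINT y|\<nu>. (p2.arm_phi True y * g y * p 0 y - p2.arm_phi False y * g y * p 0 y) - ate Q * (g y * p 0 y))"
  using phi_int g_int by simp
 also have "... = (LINT y|\<nu>. eff_obs y * g y * p 0 y)"
  by (intro Bochner_Integration.integral_cong) (auto simp: tau algebra_simps)
 also have "... = (\<integral>y. eff_obs y * g y \<partial>obs_law Q)"
  by (rule conv_law[symmetric]) measurable
 finally show d: "d = (\<integral>y. eff_obs y * g y \<partial>obs_law Q)" .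
 have "(\<integral>y. eff_obs y * g y \<partial>obs_law Q)^2 <= (\<integral>y. (eff_obs y)\<^sup>2 \<partial>obs_law Q) * (\<integral>y. (g y)\<^sup>2 \<partial>obs_law Q)"
 proof (rule Cauchy_Schwarz_integral[OF _ _ _ gi])
  show "eff_obs \<in> borel_measurable (obs_law Q)" "g \<in> borel_measurable (obs_law Q)"
   unfolding obs_law_def by simp_all
  show "integrable (obs_law Q) (%y. (eff_obs y)^2)"
   using obs_law_integral(2)[of "%y. (eff_obs y)^2"] infl_moments(1) by (simp add: eff_obs_of)
 qed
 also have "(\<integral>y. (eff_obs y)\<^sup>2 \<partial>obs_law Q) = (LINT z|Q. (infl z)^2)"
  using obs_law_integral(1)[of "%y. (eff_obs y)^2"] by (simp add: eff_obs_of)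
 finally show "d\<^sup>2 <= (LINT z|Q. (infl z)^2) * (\<integral>y. (g y)\<^sup>2 \<partial>obs_law Q)"
  unfolding d .
qed

end

section \<open>Redrawing a variable from its conditional law\<close>

abbreviation unif :: "real measure" where
 "unif \<equiv> uniform_measure lborel {0..1}"

interpretation unif: prob_space unif
 by (rule prob_space_uniform_measure) auto

lemma unif_less:
 assumes p: "0 <= p" "p <= 1"
 shows "(LINT u|unif. of_bool (u < p)) = p"
proof -
 have "(LINT u|unif. of_bool (u < p)) = (LINT u|unif. indicator {..<p} u)"
  by (intro Bochner_Integration.integral_cong) (auto simp: indicator_def)
 also have "... = measure unif {..<p}" by simp
 also have "{0..1} \<inter> {..<p} = {0..<p}" using p by auto
 then have "measure unif {..<p} = p"
  using p by (simp add: measure_def emeasure_uniform_measure divide_ennreal_def)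
 finally show ?thesis .
qed

text \<open>For fixed \<open>C\<close> the slices are finite measures on the line, determined by
  half-lines; the resulting rectangles determine the joint measures.\<close>

lemma measure_eqI_halflines:
 fixes M N :: "('a \<times> real) measure"
 assumes M: "sets M = sets (A \<Otimes>\<^sub>M borel)" and N: "sets N = sets (A \<Otimes>\<^sub>M borel)" and fin: "finite_measure M"
  and eq: "!!C y. C \<in> sets A ==> emeasure M (C \<times> {y<..}) = emeasure N (C \<times> {y<..})"
 shows "M = N"
proof (rule measure_eqI_rectangles[OF M N])
 interpret finite_measure M by (rule fin)
 show "emeasure M (space A \<times> space borel) ~= \<infinity>" by (simp add: emeasure_eq_measure)
 fix C and D :: "real set" assume C [measurable]: "C \<in> sets A" and D: "D \<in> sets borel"
 note [measurable_cong] = M N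
 have CU [measurable]: "C \<times> UNIV \<in> sets (A \<Otimes>\<^sub>M (borel :: real measure))" by (intro pair_measureI) auto
 have slice: "emeasure (distr (density L (indicator (C \<times> UNIV))) borel snd) E = emeasure L (C \<times> E)"
  if L [measurable_cong]: "sets L = sets (A \<Otimes>\<^sub>M borel)" and E [measurable]: "E \<in> sets borel" for L :: "('a \<times> real) measure" and E
 proof -
  have sn [measurable]: "snd \<in> measurable L borel" by measurable
  have CL: "C \<times> UNIV \<in> sets L" unfolding L by measurable
  have pre: "snd -` E \<inter> space L \<in> sets L" by (rule measurable_sets[OF sn E])
  have "emeasure (distr (density L (indicator (C \<times> UNIV))) borel snd) E = (\<integral>\<^sup>+ p. indicator (C \<times> UNIV) p * indicator (snd -` E \<inter> space L) p \<partial>L)"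
   using CL pre by (subst emeasure_distr) (auto simp: emeasure_density)
  also have "... = (\<integral>\<^sup>+ p. indicator (C \<times> E) p \<partial>L)"
   by (intro nn_integral_cong) (auto simp: indicator_def)
  also have "C \<times> E \<in> sets L" unfolding L by (intro pair_measureI) auto
  then have "(\<integral>\<^sup>+ p. indicator (C \<times> E) p \<partial>L) = emeasure L (C \<times> E)" by simp
  finally show ?thesis .
 qed
 have "distr (density M (indicator (C \<times> UNIV))) borel snd = distr (density N (indicator (C \<times> UNIV))) borel snd"
 proof (rule measure_eqI_lessThan)
  fix y :: real
  show "emeasure (distr (density M (indicator (C \<times> UNIV))) borel snd) {y<..} < \<infinity>"
   by (subst slice[OF M]) (simp_all add: emeasure_eq_measure)
  show "emeasure (distr (density M (indicator (C \<times> UNIV))) borel snd) {y<..} = emeasure (distr (density N (indicator (C \<times> UNIV))) borel snd) {y<..}"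
   using eq[OF C] by (simp add: slice M N)
 qed simp_all
 then show "emeasure M (C \<times> D) = emeasure N (C \<times> D)"
  using slice[OF M D] slice[OF N D] by simp
qed

text \<open>\<open>T x\<close> is the conditional quantile function of \<open>V\<close> given \<open>X = x\<close>, built from versions of
 \<open>P(V > q | X)\<close> for rational \<open>q\<close>; applied to independent uniform noise it reproduces the joint law
 of \<open>X\<close> and \<open>V\<close>.\<close>

lemma (in prob_space) noise_outsourcing:
 fixes X :: "'a => 'b::euclidean_space" and V :: "'a => real"
 assumes X [measurable]: "X \<in> borel_measurable M" and V [measurable]: "V \<in> borel_measurable M"
  and bound: "AE z in M. \<bar>V z\<bar> <= B"
 obtains T where "T \<in> borel_measurable (borel \<Otimes>\<^sub>M borel)"
  "distr (M \<Otimes>\<^sub>M unif) (borel \<Otimes>\<^sub>M borel) (%(z, u). (X z, T (X z, u))) = distr M (borel \<Otimes>\<^sub>M borel) (%z. (X z, V z))"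
proof -
 define L where "L = \<bar>B\<bar> + 1"
 have L: "0 < L" by (simp add: L_def)
 have VL: "AE z in M. - L < V z & V z < L" using bound by eventually_elim (auto simp: L_def)
 have "\<exists>F :: 'b => real. F \<in> borel_measurable borel & (\<forall>x. 0 <= F x & F x <= 1) & (\<forall>C \<in> sets borel.
   (LINT z|M. indicator C (X z) * F (X z)) = (LINT z|M. indicator C (X z) * of_bool (of_rat q < V z)))" for q :: rat
 proof -
  have pm: "Measurable.pred M (%z. of_rat q < V z)" by measurable
  show ?thesis
  proof (rule conditional_probability_version[OF X pm])
   fix G :: "'b => real"
   assume G: "G \<in> borel_measurable borel" "!!x. 0 <= G x" "!!x. G x <= 1"
    "!!C. C \<in> sets borel ==> (LINT z|M. indicator C (X z) * G (X z)) = (LINT z|M. indicator C (X z) * of_bool (of_rat q < V z))"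
   show ?thesis by (intro exI[of _ G] conjI allI ballI G)
  qed
 qed
 then have "\<forall>q::rat. \<exists>F :: 'b => real. F \<in> borel_measurable borel & (\<forall>x. 0 <= F x & F x <= 1) & (\<forall>C \<in> sets borel.
   (LINT z|M. indicator C (X z) * F (X z)) = (LINT z|M. indicator C (X z) * of_bool (of_rat q < V z)))" by (rule allI)
 from choice[OF this] obtain F :: "rat => 'b => real" where F0: "\<forall>q. F q \<in> borel_measurable borel & (\<forall>x. 0 <= F q x & F q x <= 1) & (\<forall>C \<in> sets borel.
   (LINT z|M. indicator C (X z) * F q (X z)) = (LINT z|M. indicator C (X z) * of_bool (of_rat q < V z)))" ..
 have F [measurable]: "F q \<in> borel_measurable borel" and F01: "0 <= F q x" "F q x <= 1"
  and Fint: "C \<in> sets borel ==> (LINT z|M. indicator C (X z) * F q (X z)) = (LINT z|M. indicator C (X z) * of_bool (of_rat q < V z))" for q x C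
  using F0 by simp_all
 define cl :: "rat => real" where "cl q = max (- L) (min L (of_rat q))" for q
 \<comment> \<open>The highest level whose conditional exceedance probability is still above u.
   Levels are clipped to [-L, L] and failing ones count as -L, so the supremum is over a bounded
   family and is measurable as a countable one.\<close>
 define T where "T p = (SUP q. if snd p < F q (fst p) then cl q else - L)" for p
 have cl: "- L <= cl q" "cl q <= L" for q using L by (auto simp: cl_def)
 have bdd: "bdd_above (range (%q. if snd p < F q (fst p) then cl q else - L))" for p
  using cl L by (intro bdd_aboveI2[where M=L]) auto
 have T_less: "y < T p \<longleftrightarrow> (\<exists>q. y < (if snd p < F q (fst p) then cl q else - L))" for y p
  unfolding T_def by (subst less_cSUP_iff) (use bdd in auto)
 have Tm [measurable]: "T \<in> borel_measurable (borel \<Otimes>\<^sub>M borel)"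
  unfolding T_def[abs_def] by (rule borel_measurable_cSUP) (use bdd in auto)
 interpret R: pair_prob_space M unif by unfold_locales
 \<comment> \<open>The versions are chosen separately for each rational, so monotonicity holds off a
   null set common to all pairs.\<close>
 have mono: "AE z in M. \<forall>q q'. q < q' --> F q' (X z) <= F q (X z)"
 proof -
  have Fi: "integrable M (%z. F q (X z))" for q
   by (rule integrable_const_bound[where B=1]) (use F01 in auto)
  have "AE z in M. F q' (X z) <= F q (X z)" if q: "q < q'" for q q'
  proof (rule AE_le_version[where X=X and F="F q'" and G="F q"])
   show "integrable M (%z. F q (X z))" "integrable M (%z. F q' (X z))" by (rule Fi)+
   fix C :: "'b set" assume [measurable]: "C \<in> sets borel"
   have "(LINT z|M. indicator C (X z) * of_bool (of_rat q' < V z)) <= (\<integral>z. indicator C (X z) * of_bool (of_rat q < V z) \<partial>M :: real)"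
   proof (intro integral_mono integrable_const_bound[where B=1])
    have "(of_rat q :: real) < of_rat q'" using q by (simp add: of_rat_less)
    then show "indicator C (X z) * of_bool (of_rat q' < V z) <= indicator C (X z) * (of_bool (of_rat q < V z) :: real)" for z
     by (auto simp: indicator_def of_bool_def)
   qed (auto simp: indicator_def of_bool_def)
   then show "(LINT z|M. indicator C (X z) * F q' (X z)) <= (LINT z|M. indicator C (X z) * F q (X z))"
    by (simp add: Fint)
  qed measurable
  then show ?thesis by (simp add: AE_all_countable)
 qed
 have key: "(LINT z|M. indicator C (X z) * (LINT u|unif. of_bool (y < T (X z, u)))) = (\<integral>z. indicator C (X z) * of_bool (y < V z) \<partial>M :: real)"
  if C [measurable]: "C \<in> sets borel" for C y
 proof -
  consider "y < - L" | "L <= y" | "- L <= y" "y < L" by linarith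
  then show ?thesis
  proof cases
   case 1
   then have y: "y < T p" for p unfolding T_less using cl[of 0] by (intro exI[of _ 0]) auto
   have "(LINT z|M. indicator C (X z) * (LINT u|unif. of_bool (y < T (X z, u)))) = (\<integral>z. indicator C (X z) * 1 \<partial>M :: real)"
    using y unif.prob_space by simp
   also have "... = (LINT z|M. indicator C (X z) * of_bool (y < V z))"
   proof (rule integral_cong_AE)
    show "AE z in M. indicator C (X z) * 1 = (indicator C (X z) * of_bool (y < V z) :: real)"
     using VL by eventually_elim (use 1 in auto)
   qed measurable
   finally show ?thesis .
  next
   case 2
   have "T p <= L" for p unfolding T_def by (rule cSUP_least) (use cl L in auto)
   then have y: "~ y < T p" for p using 2 by (meson not_less order_trans)
   have "(LINT z|M. indicator C (X z) * (LINT u|unif. of_bool (y < T (X z, u)))) = (\<integral>z. indicator C (X z) * 0 \<partial>M :: real)"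
    using y by simp
   also have "... = (LINT z|M. indicator C (X z) * of_bool (y < V z))"
   proof (rule integral_cong_AE)
    show "AE z in M. indicator C (X z) * 0 = (indicator C (X z) * of_bool (y < V z) :: real)"
     using VL by eventually_elim (use 2 in auto)
   qed measurable
   finally show ?thesis .
  next
   case 3
   have T_less': "y < T (x, u) \<longleftrightarrow> (\<exists>q. u < F q x & y < of_rat q)" for x u
   proof -
    have "y < cl q \<longleftrightarrow> y < of_rat q" for q
     using 3 by (auto simp: cl_def less_max_iff_disj)
    then have "y < (if u < F q x then cl q else - L) \<longleftrightarrow> u < F q x & y < of_rat q" for q
     using 3 by auto
    then show ?thesis by (simp add: T_less)
   qed
   have "\<exists>q::rat. y < of_rat q & of_rat q < y + inverse (real (Suc k))" for k
    by (rule of_rat_dense) simp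
   then obtain q :: "nat => rat" where q: "!!k. y < of_rat (q k)" "!!k. of_rat (q k) < y + inverse (real (Suc k))"
    by metis
   have q_lim: "(%k. of_rat (q k) :: real) \<longlonglongrightarrow> y"
   proof (rule tendsto_sandwich[of "%_. y" _ sequentially "%k. y + inverse (real (Suc k))"])
    show "\<forall>\<^sub>F k in sequentially. y <= of_rat (q k)" by (intro always_eventually allI less_imp_le q)
    show "\<forall>\<^sub>F k in sequentially. of_rat (q k) <= y + inverse (real (Suc k))" by (intro always_eventually allI less_imp_le q)
    show "(%k. y + inverse (real (Suc k))) \<longlonglongrightarrow> y" by (rule LIMSEQ_inverse_real_of_nat_add)
   qed simp
   \<comment> \<open>The event y < T(x, u) means u < F r x for some rational r > y. By monotonicity
     this is detected by rationals approaching y from above, and the probability of u < F is F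
     itself.\<close>
   have inner: "AE z in M. (%k. F (q k) (X z)) \<longlonglongrightarrow> (LINT u|unif. of_bool (y < T (X z, u)))"
    using mono
   proof eventually_elim
    case (elim z)
    have pt: "(%k. of_bool (u < F (q k) (X z)) :: real) \<longlonglongrightarrow> of_bool (y < T (X z, u))" for u
    proof (cases "y < T (X z, u)")
     case True
     then obtain r where r: "u < F r (X z)" "y < of_rat r" by (auto simp: T_less')
     have "eventually (%k. of_rat (q k) < (of_rat r :: real)) sequentially"
      using q_lim r(2) by (rule order_tendstoD)
     then have "eventually (%k. of_bool (u < F (q k) (X z)) = (1::real)) sequentially"
     proof eventually_elim
      case (elim k)
      then have "F r (X z) <= F (q k) (X z)" using \<open>\<forall>q q'. q < q' --> F q' (X z) <= F q (X z)\<close> by (simp add: of_rat_less)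
      then show ?case using r(1) by simp
     qed
     then show ?thesis using True by (simp add: tendsto_eventually)
    next
     case False
     then have "~ u < F (q k) (X z)" for k using q(1) by (auto simp: T_less')
     then show ?thesis using False by simp
    qed
    have "(%k. \<integral>u. of_bool (u < F (q k) (X z)) \<partial>unif) \<longlonglongrightarrow> (\<integral>u. of_bool (y < T (X z, u)) \<partial>unif :: real)"
    proof (rule integral_dominated_convergence[where w="%_. 1"])
     show "AE u in unif. (%k. of_bool (u < F (q k) (X z)) :: real) \<longlonglongrightarrow> of_bool (y < T (X z, u))"
      using pt by simp
    qed auto
    then show ?case by (simp add: unif_less F01)
   qed
   have l1: "(%k. \<integral>z. indicator C (X z) * F (q k) (X z) \<partial>M) \<longlonglongrightarrow> (LINT z|M. indicator C (X z) * (LINT u|unif. of_bool (y < T (X z, u))))"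
   proof (rule integral_dominated_convergence[where w="%_. 1"])
    show "AE z in M. (%k. indicator C (X z) * F (q k) (X z)) \<longlonglongrightarrow> indicator C (X z) * (LINT u|unif. of_bool (y < T (X z, u)))"
     using inner by eventually_elim (intro tendsto_mult_left)
    show "AE z in M. norm (indicator C (X z) * F (q k) (X z)) <= 1" for k
     using F01 by (auto simp: indicator_def)
   qed auto
   have l2: "(%k. \<integral>z. indicator C (X z) * of_bool (of_rat (q k) < V z) \<partial>M) \<longlonglongrightarrow> (\<integral>z. indicator C (X z) * of_bool (y < V z) \<partial>M :: real)"
   proof (rule integral_dominated_convergence[where w="%_. 1"])
    have pt: "(%k. of_bool (of_rat (q k) < v) :: real) \<longlonglongrightarrow> of_bool (y < v)" for v :: real
    proof (cases "y < v")
     case True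
     have "eventually (%k. of_rat (q k) < v) sequentially" using q_lim True by (rule order_tendstoD)
     then have "eventually (%k. of_bool (of_rat (q k) < v) = (1::real)) sequentially" by eventually_elim simp
     then show ?thesis using True by (simp add: tendsto_eventually)
    next
     case False
     then have "~ of_rat (q k) < v" for k using q(1)[of k] by linarith
     then show ?thesis using False by simp
    qed
    show "AE z in M. (%k. indicator C (X z) * of_bool (of_rat (q k) < V z)) \<longlonglongrightarrow> (indicator C (X z) * of_bool (y < V z) :: real)"
     by (intro AE_I2 tendsto_mult_left pt)
   qed (auto simp: indicator_def)
   show ?thesis by (rule LIMSEQ_unique[OF l1]) (use l2 in \<open>simp add: Fint\<close>)
  qed
 qed
 have "distr (M \<Otimes>\<^sub>M unif) (borel \<Otimes>\<^sub>M borel) (%(z, u). (X z, T (X z, u))) = distr M (borel \<Otimes>\<^sub>M borel) (%z. (X z, V z))"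
 proof (rule measure_eqI_halflines[where A=borel])
  have m1: "(%(z, u). (X z, T (X z, u))) \<in> measurable (M \<Otimes>\<^sub>M unif) (borel \<Otimes>\<^sub>M borel)" by measurable
  have m2: "(%z. (X z, V z)) \<in> measurable M (borel \<Otimes>\<^sub>M borel)" by measurable
  interpret D1: prob_space "distr (M \<Otimes>\<^sub>M unif) (borel \<Otimes>\<^sub>M borel) (%(z, u). (X z, T (X z, u)))" by (rule R.prob_space_distr[OF m1])
  interpret D2: prob_space "distr M (borel \<Otimes>\<^sub>M borel) (%z. (X z, V z))" by (rule prob_space_distr[OF m2])
  show "finite_measure (distr (M \<Otimes>\<^sub>M unif) (borel \<Otimes>\<^sub>M borel) (%(z, u). (X z, T (X z, u))))" by (rule D1.finite_measure_axioms)
  fix C :: "'b set" and y :: real assume [measurable]: "C \<in> sets borel"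
  have [measurable]: "C \<times> {y<..} \<in> sets (borel \<Otimes>\<^sub>M borel)" by (intro pair_measureI) auto
  have "D1.prob (C \<times> {y<..}) = (\<integral>p. indicator (C \<times> {y<..}) p \<partial>distr (M \<Otimes>\<^sub>M unif) (borel \<Otimes>\<^sub>M borel) (%(z, u). (X z, T (X z, u))))"
   by simp
  also have "... = (\<integral>p. indicator (C \<times> {y<..}) (X (fst p), T (X (fst p), snd p)) \<partial>(M \<Otimes>\<^sub>M unif))"
   using m1 by (subst integral_distr) (auto simp: case_prod_beta')
  also have "... = (LINT z|M. \<integral>u. indicator (C \<times> {y<..}) (X z, T (X z, u)) \<partial>unif)"
   by (subst R.integral_fst'[symmetric]) (auto intro!: R.integrable_const_bound[where B=1])
  also have "... = (LINT z|M. indicator C (X z) * (LINT u|unif. of_bool (y < T (X z, u))))"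
   by (intro Bochner_Integration.integral_cong) (auto simp: indicator_def of_bool_def)
  also have "... = (LINT z|M. indicator C (X z) * of_bool (y < V z))" by (rule key) simp
  also have "... = (LINT z|M. indicator (C \<times> {y<..}) (X z, V z))"
   by (intro Bochner_Integration.integral_cong) (auto simp: indicator_def of_bool_def)
  also have "... = (\<integral>p. indicator (C \<times> {y<..}) p \<partial>distr M (borel \<Otimes>\<^sub>M borel) (%z. (X z, V z)))"
   using m2 by (subst integral_distr) auto
  also have "... = D2.prob (C \<times> {y<..})" by simp
  finally show "emeasure (distr (M \<Otimes>\<^sub>M unif) (borel \<Otimes>\<^sub>M borel) (%(z, u). (X z, T (X z, u)))) (C \<times> {y<..}) =
    emeasure (distr M (borel \<Otimes>\<^sub>M borel) (%z. (X z, V z))) (C \<times> {y<..})"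
   by (simp add: D1.emeasure_eq_measure D2.emeasure_eq_measure)
 qed simp_all
 with Tm show ?thesis by (rule that)
qed

section \<open>Regularity of tilted submodels\<close>

text \<open>With r = sqrt (1 + v), the error is -(r - 1)^2 / 2 and v = (r - 1)(r + 1), where r + 1
  >= 1.\<close>

lemma sqrt_expansion:
 fixes v :: real
 assumes "- 1 <= v"
 shows "\<bar>sqrt (1 + v) - 1 - v / 2\<bar> <= v\<^sup>2 / 2"
proof -
 define r where "r = sqrt (1 + v)"
 have r: "0 <= r" "r\<^sup>2 = 1 + v" using assms by (auto simp: r_def)
 have v: "v = (r - 1) * (r + 1)" using r(2) by (simp add: power2_eq_square algebra_simps)
 have "r - 1 - v / 2 = - ((r - 1)^2 / 2)" by (simp add: v power2_eq_square field_simps)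
 moreover have "(r - 1)^2 * 1 <= (r - 1)^2 * (r + 1)^2"
  using r(1) by (intro mult_left_mono one_le_power) auto
 ultimately show ?thesis
  unfolding r_def[symmetric] by (simp add: v power_mult_distrib)
qed

context regression_setting
begin

text \<open>A version of \<open>wresid\<close>, as a function of covariate and outcome, that is
  bounded at every point. A density 1 + t times it is then nonnegative for small t without
  exception.\<close>

definition wclip :: "bool => 'x => real => real" where
 "wclip a x y = (if \<bar>y - m a x\<bar> <= B then (if a then 1 else - 1) * (y - m a x) / prop_of s a x else 0)"

definition wobs :: "'x \<times> bool \<times> real => real" where
 "wobs y = (if fst (snd y) then wclip True (fst y) (snd (snd y)) else wclip False (fst y) (snd (snd y)))"

definition tilt_score :: "('x => real) => 'x \<times> bool \<times> real => real" where
 "tilt_score b y = b (fst y) + wobs y"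

text \<open>One factor tilts the law of the covariates, the other the law of the observed outcome
  given them. The derivative at t = 0 is \<open>tilt_score b\<close>.\<close>

definition tilt_density :: "('x => real) => real => 'x \<times> bool \<times> real => real" where
 "tilt_density b t y = (1 + t * b (fst y)) * (1 + t * wobs y)"

lemma wclip_bound: "\<bar>wclip a x y\<bar> <= B / c"
proof -
 have p: "0 < prop_of s a x" using prop_bounds(1)[of a x] c_pos by linarith
 have "\<bar>y - m a x\<bar> / prop_of s a x <= B / c" if "\<bar>y - m a x\<bar> <= B"
  using that prop_bounds(1)[of a x] c_pos by (intro frac_le) auto
 moreover have "0 <= B / c" using B_nonneg c_pos by simp
 ultimately show ?thesis using p by (auto simp: wclip_def abs_mult abs_divide)
qed

lemma wclip_measurable [measurable (raw)]:
 assumes [measurable]: "f \<in> borel_measurable M" "g \<in> borel_measurable M"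
 shows "(%w. wclip a (f w) (g w)) \<in> borel_measurable M"
 unfolding wclip_def[abs_def] prop_of_def[abs_def] by measurable

lemma wclip_AE: "AE z in Q. wclip a (cov z) (pot a z) = wresid a z"
 using resid_bound[of a] by eventually_elim (simp add: wclip_def wresid_def resid_def)

lemma wobs_measurable [measurable]: "wobs \<in> borel_measurable obs_space"
 unfolding wobs_def[abs_def] by measurable

lemma wobs_bound: "\<bar>wobs y\<bar> <= B / c"
 using wclip_bound by (simp add: wobs_def)

lemma wobs_of: "wobs (obs_of z) = wclip (trt z) (cov z) (pot (trt z) z)"
 by (cases "trt z") (simp_all add: wobs_def obs_outcome_eq)

lemma wobs_AE: "AE z in Q. wobs (obs_of z) = wresid (trt z) z"
 using wclip_AE[of True] wclip_AE[of False]
proof eventually_elim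
 case (elim z)
 then show ?case unfolding wobs_of by (cases "trt z") simp_all
qed

lemma tilt_measurable [measurable]:
 assumes [measurable]: "b \<in> borel_measurable borel"
 shows "tilt_score b \<in> borel_measurable obs_space" "tilt_density b t \<in> borel_measurable obs_space"
 unfolding tilt_score_def[abs_def] tilt_density_def[abs_def] by measurable

end

text \<open>Collects what the regularity proof uses of a path: the observed density and an unchanged
  propensity. The bound 1 / 2 on \<epsilon> D keeps both factors of the density between 1 / 2 and 3
  / 2.\<close>

locale tilted_model = regression_setting Q s m c B for Q :: "'x::euclidean_space unit_data measure" and s m c B +
 fixes P :: "real => 'x unit_data measure" and b :: "'x => real" and D \<epsilon> :: real
 assumes P0: "P 0 = Q" and BcD: "B / c <= D" and b_measurable [measurable]: "b \<in> borel_measurable borel"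
  and b_bound: "!!x. \<bar>b x\<bar> <= D" and eps: "0 < \<epsilon>" "\<epsilon> * D <= 1 / 2"
  and P_law: "!!t. \<bar>t\<bar> < \<epsilon> ==> unit_law (P t)" and P_ipw: "!!t. \<bar>t\<bar> < \<epsilon> ==> ipw (P t) s"
  and P_obs: "!!t. \<bar>t\<bar> < \<epsilon> ==> obs_law (P t) = density (obs_law Q) (%y. ennreal (tilt_density b t y))"
begin

abbreviation dens :: "real => 'x \<times> bool \<times> real => real" where "dens \<equiv> tilt_density b"
abbreviation sc :: "'x \<times> bool \<times> real => real" where "sc \<equiv> tilt_score b"

lemma wobs_D: "\<bar>wobs y\<bar> <= D" using wobs_bound[of y] BcD by linarith

lemma D_nonneg: "0 <= D" using b_bound[of 0] by linarith

lemma small: "\<bar>t\<bar> < \<epsilon> ==> \<bar>x\<bar> <= D ==> \<bar>t * x\<bar> <= 1 / 2"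
 using mult_mono[of "\<bar>t\<bar>" \<epsilon> "\<bar>x\<bar>" D] eps by (simp add: abs_mult)

lemma dens_bounds:
 assumes t: "\<bar>t\<bar> < \<epsilon>"
 shows "0 <= dens t y" "dens t y <= 4"
proof -
 have 1: "\<bar>t * b (fst y)\<bar> <= 1 / 2" "\<bar>t * wobs y\<bar> <= 1 / 2"
  using small[OF t b_bound] small[OF t wobs_D] by auto
 have f: "0 <= 1 + t * b (fst y)" "1 + t * b (fst y) <= 2" "0 <= 1 + t * wobs y" "1 + t * wobs y <= 2"
  using 1 by linarith+
 show "0 <= dens t y" using f by (simp add: tilt_density_def)
 show "dens t y <= 4"
  using mult_mono[OF f(2) f(4)] f by (simp add: tilt_density_def)
qed

lemma dens_expand: "dens t y = 1 + t * sc y + t\<^sup>2 * (b (fst y) * wobs y)"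
 by (simp add: tilt_density_def tilt_score_def power2_eq_square algebra_simps)

lemma P_integral:
 fixes k :: "'x \<times> bool \<times> real => real"
 assumes t: "\<bar>t\<bar> < \<epsilon>" and k [measurable]: "k \<in> borel_measurable obs_space"
 shows "(\<integral>z. k (obs_of z) \<partial>P t) = (LINT z|Q. k (obs_of z) * dens t (obs_of z))"
  and "integrable (P t) (%z. k (obs_of z)) \<longleftrightarrow> integrable Q (%z. k (obs_of z) * dens t (obs_of z))"
proof -
 interpret Pt: unit_law "P t" by (rule P_law[OF t])
 have S: "sets (obs_law Q) = sets obs_space" by (simp add: obs_law_def)
 have pm: "dens t \<in> borel_measurable (obs_law Q)"
  unfolding measurable_cong_sets[OF S refl] by measurable
 have km: "(%y. k y * dens t y) \<in> borel_measurable obs_space" by measurable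
 note o = Pt.obs_integral[OF S pm dens_bounds(1)[OF t] P_obs[OF t] k]
 show "(\<integral>z. k (obs_of z) \<partial>P t) = (LINT z|Q. k (obs_of z) * dens t (obs_of z))"
  using o(1) obs_law_integral(1)[OF km] by simp
 show "integrable (P t) (%z. k (obs_of z)) \<longleftrightarrow> integrable Q (%z. k (obs_of z) * dens t (obs_of z))"
  using o(2) obs_law_integral(2)[OF km] by simp
qed

text \<open>Since the propensity is \<open>s\<close> along the whole path, the mean of this observed
  quantity is the j-th moment of the potential outcome under every \<open>P t\<close>.\<close>

definition arm_ipw :: "bool => nat => 'x \<times> bool \<times> real => real" where
 "arm_ipw a j y = of_bool (fst (snd y) = a) * (snd (snd y) ^ j / prop_of s a (fst y))"

lemma arm_ipw_measurable [measurable]: "arm_ipw a j \<in> borel_measurable obs_space"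
 unfolding arm_ipw_def[abs_def] by measurable

lemma arm_ipw_bound: "\<bar>arm_ipw a j (obs_of z)\<bar> <= \<bar>pot a z ^ j\<bar> / c"
proof -
 have "0 < prop_of s a (cov z)" using prop_bounds(1)[of a "cov z"] c_pos by linarith
 moreover have "\<bar>pot a z ^ j\<bar> / prop_of s a (cov z) <= \<bar>pot a z ^ j\<bar> / c"
  using prop_bounds(1)[of a "cov z"] c_pos by (intro frac_le) auto
 moreover have "0 <= \<bar>pot a z ^ j\<bar> / c" using c_pos by simp
 ultimately show ?thesis by (auto simp: arm_ipw_def obs_outcome_eq abs_divide)
qed

lemma integrable_arm_ipw:
 assumes j: "integrable Q (%z. pot a z ^ j)" and f [measurable]: "f \<in> borel_measurable obs_space" and C: "!!y. \<bar>f y\<bar> <= C"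
 shows "integrable Q (%z. arm_ipw a j (obs_of z) * f (obs_of z))"
proof (rule Bochner_Integration.integrable_bound)
 show "integrable Q (%z. C / c * \<bar>pot a z ^ j\<bar>)" using j by (intro integrable_mult_right integrable_abs)
 show "AE z in Q. norm (arm_ipw a j (obs_of z) * f (obs_of z)) <= norm (C / c * \<bar>pot a z ^ j\<bar>)"
 proof (rule AE_I2)
  fix z
  have "0 <= C" using C[of undefined] by linarith
  have "\<bar>arm_ipw a j (obs_of z)\<bar> * \<bar>f (obs_of z)\<bar> <= (\<bar>pot a z ^ j\<bar> / c) * C"
   using c_pos by (intro mult_mono arm_ipw_bound C) auto
  then show "norm (arm_ipw a j (obs_of z) * f (obs_of z)) <= norm (C / c * \<bar>pot a z ^ j\<bar>)"
   using \<open>0 <= C\<close> c_pos by (simp add: abs_mult abs_divide mult.commute)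
 qed
qed measurable

lemma arm_moment:
 assumes t: "\<bar>t\<bar> < \<epsilon>" and j: "integrable Q (%z. pot a z ^ j)"
 shows "(\<integral>z. pot a z ^ j \<partial>P t) = (LINT z|Q. arm_ipw a j (obs_of z) * dens t (obs_of z))"
  and "integrable (P t) (%z. pot a z ^ j)"
proof -
 interpret Pt: unit_law "P t" by (rule P_law[OF t])
 have hm: "(%(x, y0, y1). (if a then y1 else y0) ^ j / prop_of s a x) \<in> borel_measurable xyy_space"
  by measurable
 note w = Pt.ipw_integral[OF P_ipw[OF t] s_measurable s_unit hm, of a]
 have e1: "of_bool (trt z = a) * ((if a then pot True z else pot False z) ^ j / prop_of s a (cov z)) = arm_ipw a j (obs_of z)" for z
  by (cases a; cases "trt z") (simp_all add: arm_ipw_def obs_outcome_eq)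
 have e2: "prop_of s a (cov z) * ((if a then pot True z else pot False z) ^ j / prop_of s a (cov z)) = pot a z ^ j" for z
  using prop_bounds(1)[of a "cov z"] c_pos by (cases a) auto
 have w': "(\<integral>z. arm_ipw a j (obs_of z) \<partial>P t) = (\<integral>z. pot a z ^ j \<partial>P t)"
  "integrable (P t) (%z. arm_ipw a j (obs_of z)) \<longleftrightarrow> integrable (P t) (%z. pot a z ^ j)"
  using w by (simp_all only: e1 e2)
 have i: "integrable Q (%z. arm_ipw a j (obs_of z) * dens t (obs_of z))"
 proof (rule integrable_arm_ipw[OF j])
  show "\<bar>dens t y\<bar> <= 4" for y using dens_bounds[OF t, of y] by simp
 qed measurable
 show "(\<integral>z. pot a z ^ j \<partial>P t) = (LINT z|Q. arm_ipw a j (obs_of z) * dens t (obs_of z))"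
  using w'(1) P_integral(1)[OF t arm_ipw_measurable] by simp
 show "integrable (P t) (%z. pot a z ^ j)"
  using w'(2) P_integral(2)[OF t arm_ipw_measurable] i by simp
qed

text \<open>The constant is the bound 4 on the density times the bound 1 / c on the weight; summing
  over both arms gives one bound that serves both.\<close>

lemma P_second_moment:
 assumes t: "\<bar>t\<bar> < \<epsilon>"
 shows "(\<integral>z. (pot a z)\<^sup>2 \<partial>P t) <= 4 / c * ((LINT z|Q. (pot True z)^2) + (LINT z|Q. (pot False z)^2))"
proof -
 have i: "integrable Q (%z. arm_ipw a 2 (obs_of z) * dens t (obs_of z))"
 proof (rule integrable_arm_ipw)
  show "\<bar>dens t y\<bar> <= 4" for y using dens_bounds[OF t, of y] by simp
 qed (use integrable_pot(2) in auto)
 have "(\<integral>z. (pot a z)\<^sup>2 \<partial>P t) = (LINT z|Q. arm_ipw a 2 (obs_of z) * dens t (obs_of z))"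
  by (rule arm_moment(1)[OF t]) (rule integrable_pot(2))
 also have "... <= (LINT z|Q. 4 / c * (pot a z)^2)"
 proof (rule integral_mono[OF i])
  show "integrable Q (%z. 4 / c * (pot a z)^2)" using integrable_pot(2) by simp
  fix z
  have "\<bar>arm_ipw a 2 (obs_of z)\<bar> * \<bar>dens t (obs_of z)\<bar> <= (\<bar>(pot a z)\<^sup>2\<bar> / c) * 4"
   using c_pos dens_bounds[OF t, of "obs_of z"] by (intro mult_mono arm_ipw_bound) auto
  then show "arm_ipw a 2 (obs_of z) * dens t (obs_of z) <= 4 / c * (pot a z)^2"
   using abs_ge_self[of "arm_ipw a 2 (obs_of z) * dens t (obs_of z)"] by (simp add: abs_mult mult.commute)
 qed
 also have "... = 4 / c * (LINT z|Q. (pot a z)^2)" by simp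
 also have "... <= 4 / c * ((LINT z|Q. (pot True z)^2) + (LINT z|Q. (pot False z)^2))"
 proof (rule mult_left_mono)
  have "0 <= (LINT z|Q. (pot a z)^2)" for a by (rule Bochner_Integration.integral_nonneg) simp
  from this[of True] this[of False] show "(LINT z|Q. (pot a z)^2) <= (LINT z|Q. (pot True z)^2) + (LINT z|Q. (pot False z)^2)"
   by (cases a) auto
 qed (use c_pos in simp)
 finally show ?thesis .
qed

lemma P_causal:
 assumes t: "\<bar>t\<bar> < \<epsilon>"
 shows "P t \<in> causal_model"
proof -
 interpret Pt: unit_law "P t" by (rule P_law[OF t])
 have "assumption1 (P t)"
  by (rule Pt.ipw_imp_assumption1(1)[OF P_ipw[OF t] s_measurable c_pos s_bounds])
 moreover have "square_integrable_outcomes (P t)"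
  unfolding square_integrable_outcomes_def using arm_moment(2)[OF t integrable_pot(2)] by blast
 ultimately show ?thesis
  unfolding causal_model_def using Pt.prob_space_axioms Pt.sets_Q by simp
qed

text \<open>By weighting, the effect under \<open>P t\<close> is the integral of a fixed function
  against \<open>dens t\<close>, hence a quadratic polynomial in t near 0. The value of d is
  supplied by \<open>regular_submodel_derivative\<close>.\<close>

lemma ate_derivative: "\<exists>d. ((%t. ate (P t)) has_real_derivative d) (at 0)"
proof -
 define \<psi> where "\<psi> y = arm_ipw True 1 y - arm_ipw False 1 y" for y
 have int1: "integrable Q (%z. pot a z ^ 1)" for a using integrable_pot(1) by simp
 have I: "integrable Q (%z. \<psi> (obs_of z) * f (obs_of z))" if f: "f \<in> borel_measurable obs_space" and "!!y. \<bar>f y\<bar> <= C" for f C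
  using Bochner_Integration.integrable_diff[OF integrable_arm_ipw[OF int1 that] integrable_arm_ipw[OF int1 that]]
  by (simp add: \<psi>_def left_diff_distrib)
 have sb: "\<bar>sc y\<bar> <= 2 * D" for y using b_bound[of "fst y"] wobs_D[of y] by (simp add: tilt_score_def)
 have bb: "\<bar>b (fst y) * wobs y\<bar> <= D * D" for y
  using mult_mono[OF b_bound[of "fst y"] wobs_D[of y]] D_nonneg by (simp add: abs_mult)
 note I0 = I[of "%_. 1" 1] and I1 = I[OF _ sb] and I2 = I[OF _ bb]
 define A0 A1 A2 where "A0 = (LINT z|Q. \<psi> (obs_of z))" and "A1 = (LINT z|Q. \<psi> (obs_of z) * sc (obs_of z))"
  and "A2 = (LINT z|Q. \<psi> (obs_of z) * (b (fst (obs_of z)) * wobs (obs_of z)))"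
 have i0: "integrable Q (%z. \<psi> (obs_of z))" using I0 by simp
 have i1: "integrable Q (%z. \<psi> (obs_of z) * sc (obs_of z))" by (rule I1) measurable
 have i2: "integrable Q (%z. \<psi> (obs_of z) * (b (fst (obs_of z)) * wobs (obs_of z)))" by (rule I2) measurable
 have ate: "ate (P t) = A0 + t * A1 + t\<^sup>2 * A2" if t: "\<bar>t\<bar> < \<epsilon>" for t
 proof -
  have db: "\<bar>dens t y\<bar> <= 4" for y using dens_bounds[OF t, of y] by simp
  have j: "integrable Q (%z. arm_ipw a 1 (obs_of z) * dens t (obs_of z))" for a
   by (rule integrable_arm_ipw[OF int1 _ db]) measurable
  have "ate (P t) = (\<integral>z. pot True z ^ 1 \<partial>P t) - (\<integral>z. pot False z ^ 1 \<partial>P t)"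
   unfolding ate_def using arm_moment(2)[OF t int1, of True] arm_moment(2)[OF t int1, of False] by simp
  also have "... = (LINT z|Q. arm_ipw True 1 (obs_of z) * dens t (obs_of z) - arm_ipw False 1 (obs_of z) * dens t (obs_of z))"
   unfolding arm_moment(1)[OF t int1] using j by simp
  also have "... = (LINT z|Q. \<psi> (obs_of z) + t * (\<psi> (obs_of z) * sc (obs_of z)) + t\<^sup>2 * (\<psi> (obs_of z) * (b (fst (obs_of z)) * wobs (obs_of z))))"
   unfolding dens_expand \<psi>_def by (intro Bochner_Integration.integral_cong refl) (simp only: algebra_simps)
  also have "... = A0 + t * A1 + t\<^sup>2 * A2"
   unfolding A0_def A1_def A2_def using i0 i1 i2 by simp
  finally show ?thesis .
 qed
 have "((%t. A0 + t * A1 + t\<^sup>2 * A2) has_real_derivative A1) (at 0)"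
  by (auto intro!: derivative_eq_intros)
 then have "((%t. ate (P t)) has_real_derivative A1) (at 0)"
  by (rule has_field_derivative_transform_within[where d=\<epsilon>]) (use eps ate in \<open>auto simp: dist_real_def\<close>)
 then show ?thesis ..
qed

text \<open>Write the density as 1 + v with |v| <= 3 |t| D. The root expansion contributes (9 / 2)
  D^2 |t| and the quadratic term of v contributes D^2 |t| / 2; their sum 5 D^2 |t| is
  squared.\<close>

lemma root_remainder:
 assumes t: "\<bar>t\<bar> < \<epsilon>" "t ~= 0"
 shows "((sqrt (dens t y) - sqrt (dens 0 y)) / t - sc y * sqrt (dens 0 y) / 2)^2 <= 25 * D ^ 4 * t\<^sup>2"
proof -
 define w where "w = b (fst y) * wobs y"
 define v where "v = t * sc y + t\<^sup>2 * w"
 have d: "dens t y = 1 + v" by (simp add: dens_expand v_def w_def)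
 have v1: "- 1 <= v" using dens_bounds(1)[OF t(1), of y] d by simp
 have w: "\<bar>w\<bar> <= D\<^sup>2"
  using mult_mono[OF b_bound[of "fst y"] wobs_D[of y]] D_nonneg by (simp add: abs_mult w_def power2_eq_square)
 have tD: "\<bar>t\<bar> * D <= 1" using mult_right_mono[of "\<bar>t\<bar>" \<epsilon> D] t eps D_nonneg by simp
 have v2: "\<bar>v\<bar> <= 3 * (\<bar>t\<bar> * D)"
 proof -
  have "\<bar>sc y\<bar> <= 2 * D" using b_bound[of "fst y"] wobs_D[of y] by (simp add: tilt_score_def)
  then have "\<bar>t * sc y\<bar> <= \<bar>t\<bar> * (2 * D)" by (simp add: abs_mult mult_left_mono)
  moreover have "\<bar>t\<^sup>2 * w\<bar> <= \<bar>t\<bar> * D"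
  proof -
   have "\<bar>t\<^sup>2 * w\<bar> <= t\<^sup>2 * D\<^sup>2" using w by (simp add: abs_mult mult_left_mono)
   also have "... = (\<bar>t\<bar> * D) * (\<bar>t\<bar> * D)" by (simp add: power2_eq_square[symmetric] power_mult_distrib)
   also have "... <= 1 * (\<bar>t\<bar> * D)" using tD D_nonneg by (intro mult_right_mono) auto
   finally show ?thesis by simp
  qed
  ultimately show ?thesis unfolding v_def using abs_triangle_ineq[of "t * sc y" "t\<^sup>2 * w"] by linarith
 qed
 have "(sqrt (dens t y) - sqrt (dens 0 y)) / t - sc y * sqrt (dens 0 y) / 2 = (sqrt (1 + v) - 1 - v / 2) / t + t * w / 2"
  using t(2) unfolding d by (simp add: dens_expand v_def field_simps power2_eq_square)
 moreover have "\<bar>(sqrt (1 + v) - 1 - v / 2) / t\<bar> <= 9 / 2 * D\<^sup>2 * \<bar>t\<bar>"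
 proof -
  have "\<bar>v\<bar>\<^sup>2 <= (3 * (\<bar>t\<bar> * D))^2" using v2 by (intro power_mono) auto
  then have "v\<^sup>2 <= 9 * D\<^sup>2 * t\<^sup>2" by (simp add: power_mult_distrib mult.commute mult.left_commute)
  then have "v\<^sup>2 / 2 <= 9 / 2 * D\<^sup>2 * t\<^sup>2" by simp
  with sqrt_expansion[OF v1] have "\<bar>sqrt (1 + v) - 1 - v / 2\<bar> <= 9 / 2 * D\<^sup>2 * t\<^sup>2" by (rule order_trans)
  also have "... = (9 / 2 * D\<^sup>2 * \<bar>t\<bar>) * \<bar>t\<bar>" by (simp add: power2_eq_square mult.assoc)
  finally show ?thesis using t(2) by (simp add: abs_divide pos_divide_le_eq)
 qed
 moreover have "\<bar>t * w / 2\<bar> <= 1 / 2 * D\<^sup>2 * \<bar>t\<bar>"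
 proof -
  have "\<bar>t * w / 2\<bar> = \<bar>t\<bar> * \<bar>w\<bar> / 2" by (simp add: abs_mult)
  also have "... <= \<bar>t\<bar> * D\<^sup>2 / 2" using w by (intro divide_right_mono mult_left_mono) auto
  also have "... = 1 / 2 * D\<^sup>2 * \<bar>t\<bar>" by (simp add: mult.commute)
  finally show ?thesis .
 qed
 ultimately have "\<bar>(sqrt (dens t y) - sqrt (dens 0 y)) / t - sc y * sqrt (dens 0 y) / 2\<bar> <= 5 * D\<^sup>2 * \<bar>t\<bar>"
  using abs_triangle_ineq[of "(sqrt (1 + v) - 1 - v / 2) / t" "t * w / 2"] by linarith
 then have "\<bar>(sqrt (dens t y) - sqrt (dens 0 y)) / t - sc y * sqrt (dens 0 y) / 2\<bar>\<^sup>2 <= (5 * D\<^sup>2 * \<bar>t\<bar>)^2"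
  by (intro power_mono) auto
 then show ?thesis by (simp add: power_mult_distrib)
qed

lemma root_differentiable:
 "((%t. \<integral>\<^sup>+ y. ennreal (((sqrt (dens t y) - sqrt (dens 0 y)) / t - sc y * sqrt (dens 0 y) / 2)^2) \<partial>obs_law Q) \<longlongrightarrow> 0) (at 0)"
proof (rule tendsto_sandwich)
 have "prob_space (obs_law Q)" unfolding obs_law_def by (rule prob_space_distr) measurable
 then interpret o: prob_space "obs_law Q" .
 show "eventually (%t. 0 <= (\<integral>\<^sup>+ y. ennreal (((sqrt (dens t y) - sqrt (dens 0 y)) / t - sc y * sqrt (dens 0 y) / 2)^2) \<partial>obs_law Q)) (at 0)"
  by simp
 have "eventually (%t. \<bar>t\<bar> < \<epsilon> & t ~= 0) (at (0::real))"
  unfolding eventually_at using eps(1) by (auto simp: dist_real_def)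
 then show "eventually (%t. (\<integral>\<^sup>+ y. ennreal (((sqrt (dens t y) - sqrt (dens 0 y)) / t - sc y * sqrt (dens 0 y) / 2)^2) \<partial>obs_law Q) <= ennreal (25 * D ^ 4 * t\<^sup>2)) (at 0)"
 proof eventually_elim
  case (elim t)
  have "(\<integral>\<^sup>+ y. ennreal (((sqrt (dens t y) - sqrt (dens 0 y)) / t - sc y * sqrt (dens 0 y) / 2)^2) \<partial>obs_law Q) <= (\<integral>\<^sup>+ y. ennreal (25 * D ^ 4 * t\<^sup>2) \<partial>obs_law Q)"
   using elim by (intro nn_integral_mono ennreal_leI root_remainder) auto
  also have "... = ennreal (25 * D ^ 4 * t\<^sup>2)" by (simp add: o.emeasure_space_1)
  finally show ?case .
 qed
 have "((%t::real. 25 * D ^ 4 * t\<^sup>2) \<longlongrightarrow> 25 * D ^ 4 * 0\<^sup>2) (at 0)" by (intro tendsto_intros)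
 then show "((%t::real. ennreal (25 * D ^ 4 * t\<^sup>2)) \<longlongrightarrow> 0) (at 0)"
  using tendsto_ennrealI by fastforce
qed simp

theorem tilted_submodel: "\<exists>d. regular_submodel Q P sc d"
proof -
 obtain d where d: "((%t. ate (P t)) has_real_derivative d) (at 0)" using ate_derivative by (elim exE) (rule that)
 have S: "sets (obs_law Q) = sets obs_space" by (simp add: obs_law_def)
 have "prob_space (obs_law Q)" unfolding obs_law_def by (rule prob_space_distr) measurable
 then interpret o: prob_space "obs_law Q" .
 have scm: "sc \<in> borel_measurable obs_space" by measurable
 have sb: "\<bar>sc y\<bar> <= 2 * D" for y using b_bound[of "fst y"] wobs_D[of y] by (simp add: tilt_score_def)
 have si: "integrable (obs_law Q) (%y. (sc y)^2)"
 proof (rule o.integrable_const_bound[where B="(2 * D)^2"])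
  have "\<bar>sc y\<bar>\<^sup>2 <= (2 * D)^2" for y using sb by (intro power_mono) auto
  then show "AE y in obs_law Q. norm ((sc y)^2) <= (2 * D)^2" by simp
  show "(%y. (sc y)^2) \<in> borel_measurable (obs_law Q)"
   unfolding measurable_cong_sets[OF S refl] by measurable
 qed
 have dm: "dens t \<in> borel_measurable (obs_law Q)" for t
  unfolding measurable_cong_sets[OF S refl] by measurable
 let ?B = "4 / c * ((LINT z|Q. (pot True z)^2) + (LINT z|Q. (pot False z)^2))"
 have all: "\<forall>t. \<bar>t\<bar> < \<epsilon> --> P t \<in> causal_model & (\<forall>a. (\<integral>z. (pot a z)\<^sup>2 \<partial>(P t)) <= ?B) &
   dens t \<in> borel_measurable (obs_law Q) & (\<forall>y. 0 <= dens t y) & obs_law (P t) = density (obs_law Q) (%y. ennreal (dens t y))"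
  by (intro allI impI conjI P_causal P_second_moment dm dens_bounds(1) P_obs)
 have ex: "\<exists>B \<nu> p. sigma_finite_measure \<nu> & sets \<nu> = sets obs_space &
    (\<forall>t. \<bar>t\<bar> < \<epsilon> --> P t \<in> causal_model &
      (\<forall>a. (\<integral>z. (pot a z)\<^sup>2 \<partial>(P t)) <= B) &
      p t \<in> borel_measurable \<nu> & (\<forall>y. 0 <= p t y) &
      obs_law (P t) = density \<nu> (%y. ennreal (p t y))) &
    ((%t. \<integral>\<^sup>+ y. ennreal (((sqrt (p t y) - sqrt (p 0 y)) / t - sc y * sqrt (p 0 y) / 2)^2) \<partial>\<nu>)
      \<longlongrightarrow> 0) (at 0)"
  by (rule exI[of _ ?B], rule exI[of _ "obs_law Q"], rule exI[of _ dens])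
   (rule conjI[OF o.sigma_finite_measure_axioms conjI[OF S conjI[OF all root_differentiable]]])
 have "regular_submodel Q P sc d"
  unfolding regular_submodel_def
  by (intro conjI, rule P0, rule scm, rule si, rule d, rule exI[of _ \<epsilon>], rule conjI[OF eps(1) ex])
 then show ?thesis ..
qed

end

section \<open>The efficiency bound as a supremum over submodels\<close>

context regression_setting
begin

lemma efficiency_bound_le: "efficiency_bound Q <= ennreal (LINT z|Q. (infl z)^2)"
 unfolding efficiency_bound_def
proof (rule Sup_least)
 fix r assume "r \<in> {ennreal (d\<^sup>2 / (\<integral>y. (g y)\<^sup>2 \<partial>obs_law Q)) | P g d. regular_submodel Q P g d & 0 < (\<integral>y. (g y)\<^sup>2 \<partial>obs_law Q)}"
 then obtain P g d where r: "r = ennreal (d\<^sup>2 / (\<integral>y. (g y)\<^sup>2 \<partial>obs_law Q))" and sub: "regular_submodel Q P g d"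
  and pos: "0 < (\<integral>y. (g y)\<^sup>2 \<partial>obs_law Q)"
  by (elim CollectE exE conjE) rule
 have "d\<^sup>2 / (\<integral>y. (g y)\<^sup>2 \<partial>obs_law Q) <= (LINT z|Q. (infl z)^2)"
  using regular_submodel_derivative(2)[OF sub] pos by (simp only: pos_divide_le_eq)
 then show "r <= ennreal (LINT z|Q. (infl z)^2)" unfolding r by (rule ennreal_leI)
qed

text \<open>The derivative is the inner product of score and influence function by
  \<open>regular_submodel_derivative\<close>, so \<open>eff_inner\<close> evaluates both numerator
  and information from the score alone.\<close>

lemma submodel_bound_le:
 assumes b [measurable]: "b \<in> borel_measurable borel" and bb: "!!x. \<bar>b x\<bar> <= C"
  and sub: "regular_submodel Q P (tilt_score b) d"
  and pos: "0 < (LINT z|Q. (b (cov z))^2) + noise_var"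
 shows "ennreal (((LINT z|Q. base (cov z) * b (cov z)) + noise_var)^2 / ((LINT z|Q. (b (cov z))^2) + noise_var)) <= efficiency_bound Q"
proof -
 have bsq: "integrable Q (%z. (b (cov z))^2)"
 proof (rule integrable_const_bound[where B="C\<^sup>2"])
  have "\<bar>b x\<bar>\<^sup>2 <= C\<^sup>2" for x using bb by (intro power_mono) auto
  then show "AE z in Q. norm ((b (cov z))^2) <= C\<^sup>2" by simp
 qed measurable
 note e = eff_inner[OF b bsq]
 have ts: "AE z in Q. tilt_score b (obs_of z) = b (cov z) + wresid (trt z) z"
  using wobs_AE by eventually_elim (simp add: tilt_score_def)
 have m1: "(%z. wresid (trt z) z) \<in> borel_measurable Q"
 proof -
  have "(%z. if trt z then wresid True z else wresid False z) \<in> borel_measurable Q" by measurable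
  also have "(%z. if trt z then wresid True z else wresid False z) = (%z. wresid (trt z) z)" by (rule ext) simp
  finally show ?thesis .
 qed
 note [measurable] = m1
 have "(\<integral>y. (tilt_score b y)\<^sup>2 \<partial>obs_law Q) = (LINT z|Q. (tilt_score b (obs_of z))^2)"
  by (rule obs_law_integral(1)) measurable
 also have "... = (LINT z|Q. (b (cov z) + wresid (trt z) z)^2)"
  by (rule integral_cong_AE) (use ts in \<open>auto elim: eventually_mono\<close>)
 finally have g2: "(\<integral>y. (tilt_score b y)\<^sup>2 \<partial>obs_law Q) = (LINT z|Q. (b (cov z))^2) + noise_var" using e(4) by simp
 have "d = (\<integral>y. eff_obs y * tilt_score b y \<partial>obs_law Q)" by (rule regular_submodel_derivative(1)[OF sub])
 also have "... = (LINT z|Q. eff_obs (obs_of z) * tilt_score b (obs_of z))"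
  by (rule obs_law_integral(1)) measurable
 also have "... = (LINT z|Q. infl z * (b (cov z) + wresid (trt z) z))"
 proof (rule integral_cong_AE)
  show "AE z in Q. eff_obs (obs_of z) * tilt_score b (obs_of z) = infl z * (b (cov z) + wresid (trt z) z)"
   using ts by eventually_elim (simp add: eff_obs_of)
 qed measurable
 finally have d: "d = (LINT z|Q. base (cov z) * b (cov z)) + noise_var" using e(2) by simp
 show ?thesis
  unfolding efficiency_bound_def
 proof (rule Sup_upper, rule CollectI, intro exI conjI)
  show "ennreal (((LINT z|Q. base (cov z) * b (cov z)) + noise_var)^2 / ((LINT z|Q. (b (cov z))^2) + noise_var)) =
   ennreal (d\<^sup>2 / (\<integral>y. (tilt_score b y)\<^sup>2 \<partial>obs_law Q))" unfolding g2 d ..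
  show "0 < (\<integral>y. (tilt_score b y)\<^sup>2 \<partial>obs_law Q)" using pos unfolding g2 .
 qed (rule sub)
qed

text \<open>The scores \<open>b + wobs\<close>, with \<open>b\<close> a centred truncation of \<open>base\<close>, approach the influence function.\<close>

lemma efficiency_bound_eq:
 assumes ex: "!!b C. b \<in> borel_measurable borel ==> (!!x. \<bar>b x\<bar> <= C) ==> (LINT z|Q. b (cov z)) = 0 ==>
   \<exists>P d. regular_submodel Q P (tilt_score b) d"
 shows "efficiency_bound Q = ennreal (LINT z|Q. (infl z)^2)"
proof (rule antisym[OF efficiency_bound_le])
 define V where "V = (LINT z|Q. (infl z)^2)"
 have V: "V = (LINT z|Q. (base (cov z))^2) + noise_var" unfolding V_def by (rule infl_moments(2))
 have "0 <= V" unfolding V_def by (rule Bochner_Integration.integral_nonneg) simp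
 \<comment> \<open>If V = 0 the claim is that 0 lies below the bound. For V > 0 the information of
   the approximating scores is eventually positive, as the supremum requires.\<close>
 then consider "V = 0" | "0 < V" by linarith
 then show "ennreal (LINT z|Q. (infl z)^2) <= efficiency_bound Q"
 proof cases
  case 1
  then show ?thesis by (simp add: V_def)
 next
  case 2
  define cl :: "nat => 'x => real" where "cl k x = max (- real k) (min (real k) (base x))" for k x
  define \<mu> where "\<mu> k = (LINT z|Q. cl k (cov z))" for k
  \<comment> \<open>Truncation makes the tilt bounded; centring is needed for 1 + t b to be a
    probability density with respect to the law of X.\<close>
  define b where "b k x = cl k x - \<mu> k" for k x
  have clm [measurable]: "cl k \<in> borel_measurable borel" for k unfolding cl_def[abs_def] by measurable
  have clk: "\<bar>cl k x\<bar> <= real k" for k x by (auto simp: cl_def)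
  have clb: "\<bar>cl k x\<bar> <= \<bar>base x\<bar>" for k x by (auto simp: cl_def max_def min_def)
  have cl_lim: "(%k. cl k x) \<longlonglongrightarrow> base x" for x
  proof (rule tendsto_eventually)
   obtain N :: nat where "\<bar>base x\<bar> <= real N" using real_arch_simple by blast
   then have "cl k x = base x" if "N <= k" for k
    using that of_nat_mono[OF that, where ?'a=real] by (auto simp: cl_def)
   then show "eventually (%k. cl k x = base x) sequentially" unfolding eventually_sequentially by blast
  qed
  have icl: "integrable Q (%z. cl k (cov z))" for k
   by (rule integrable_const_bound[where B="real k"]) (use clk in auto)
  have \<mu>_lim: "\<mu> \<longlonglongrightarrow> 0"
  proof -
   have "(%k. \<integral>z. cl k (cov z) \<partial>Q) \<longlonglongrightarrow> (LINT z|Q. base (cov z))"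
    by (rule integral_dominated_convergence[where w="%z. \<bar>base (cov z)\<bar>"])
     (use integrable_base cl_lim clb in auto)
   then show ?thesis unfolding base_mean \<mu>_def .
  qed
  have icl2: "integrable Q (%z. (cl k (cov z))^2)" for k
  proof (rule integrable_const_bound[where B="(real k)^2"])
   have "\<bar>cl k x\<bar>\<^sup>2 <= (real k)^2" for x using clk by (intro power_mono) auto
   then show "AE z in Q. norm ((cl k (cov z))^2) <= (real k)^2" by simp
  qed measurable
  have sq_lim: "(%k. \<integral>z. (cl k (cov z))\<^sup>2 \<partial>Q) \<longlonglongrightarrow> (LINT z|Q. (base (cov z))^2)"
  proof (rule integral_dominated_convergence[where w="%z. (base (cov z))^2"])
   show "AE z in Q. (%k. (cl k (cov z))^2) \<longlonglongrightarrow> (base (cov z))\<^sup>2"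
    by (intro AE_I2 tendsto_power cl_lim)
   show "AE z in Q. norm ((cl k (cov z))^2) <= (base (cov z))^2" for k
    using clb by (simp add: abs_le_square_iff)
  qed (use integrable_base_sq in auto)
  have xb: "norm (base x * cl k x) <= (base x)^2" for k x
   using mult_left_mono[OF clb[of k x], of "\<bar>base x\<bar>"] by (simp add: abs_mult power2_eq_square)
  have ixb: "integrable Q (%z. base (cov z) * cl k (cov z))" for k
   by (rule Bochner_Integration.integrable_bound[OF integrable_base_sq]) (use xb in auto)
  have cross_lim: "(%k. \<integral>z. base (cov z) * cl k (cov z) \<partial>Q) \<longlonglongrightarrow> (LINT z|Q. (base (cov z))^2)"
  proof (rule integral_dominated_convergence[where w="%z. (base (cov z))^2"])
   show "AE z in Q. (%k. base (cov z) * cl k (cov z)) \<longlonglongrightarrow> (base (cov z))\<^sup>2"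
    unfolding power2_eq_square by (intro AE_I2 tendsto_mult_left cl_lim)
   show "AE z in Q. norm (base (cov z) * cl k (cov z)) <= (base (cov z))^2" for k using xb by simp
  qed (use integrable_base_sq in auto)
  have b1: "(LINT z|Q. base (cov z) * b k (cov z)) = (LINT z|Q. base (cov z) * cl k (cov z))" for k
  proof -
   have "(LINT z|Q. base (cov z) * b k (cov z)) = (LINT z|Q. base (cov z) * cl k (cov z) - \<mu> k * base (cov z))"
    by (simp add: b_def algebra_simps)
   then show ?thesis using ixb[of k] integrable_base base_mean by simp
  qed
  have b2: "(LINT z|Q. (b k (cov z))^2) = (LINT z|Q. (cl k (cov z))^2) - (\<mu> k)^2" for k
  proof -
   have "(LINT z|Q. (b k (cov z))^2) = (LINT z|Q. (cl k (cov z))^2 - 2 * \<mu> k * cl k (cov z) + (\<mu> k)^2)"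
    by (simp add: b_def power2_eq_square algebra_simps)
   also have "... = (LINT z|Q. (cl k (cov z))^2) - 2 * \<mu> k * (LINT z|Q. cl k (cov z)) + (\<mu> k)^2"
    using icl2[of k] icl[of k] prob_space by simp
   finally show ?thesis by (simp add: \<mu>_def[symmetric] power2_eq_square)
  qed
  have num: "(%k. (LINT z|Q. base (cov z) * b k (cov z)) + noise_var) \<longlonglongrightarrow> V"
   unfolding b1 V using cross_lim by (intro tendsto_add) auto
  have den: "(%k. (LINT z|Q. (b k (cov z))^2) + noise_var) \<longlonglongrightarrow> V"
  proof -
   have "(%k. (LINT z|Q. (cl k (cov z))^2) - (\<mu> k)^2 + noise_var) \<longlonglongrightarrow> (LINT z|Q. (base (cov z))^2) - 0\<^sup>2 + noise_var"
    by (intro tendsto_intros sq_lim \<mu>_lim)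
   then show ?thesis unfolding b2 V by simp
  qed
  have "(%k. ((LINT z|Q. base (cov z) * b k (cov z)) + noise_var)^2 / ((LINT z|Q. (b k (cov z))^2) + noise_var)) \<longlonglongrightarrow> V\<^sup>2 / V"
   using 2 by (intro tendsto_divide tendsto_power num den) simp
  then have "(%k. ennreal (((LINT z|Q. base (cov z) * b k (cov z)) + noise_var)^2 / ((LINT z|Q. (b k (cov z))^2) + noise_var))) \<longlonglongrightarrow> ennreal (V\<^sup>2 / V)"
   by (rule tendsto_ennrealI)
  moreover have "eventually (%k. ennreal (((LINT z|Q. base (cov z) * b k (cov z)) + noise_var)^2 / ((LINT z|Q. (b k (cov z))^2) + noise_var)) <= efficiency_bound Q) sequentially"
   using order_tendstoD(1)[OF den 2]
  proof eventually_elim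
   case (elim k)
   have bm: "b k \<in> borel_measurable borel" unfolding b_def[abs_def] by measurable
   have bb: "\<bar>b k x\<bar> <= real k + \<bar>\<mu> k\<bar>" for x
    using clk[of k x] by (simp add: b_def)
   have "(LINT z|Q. b k (cov z)) = 0" unfolding b_def using icl[of k] prob_space by (simp add: \<mu>_def)
   then obtain P d where "regular_submodel Q P (tilt_score (b k)) d" using ex[OF bm bb] by blast
   then show ?case by (rule submodel_bound_le[OF bm bb _ elim])
  qed
  ultimately have "ennreal (V\<^sup>2 / V) <= efficiency_bound Q"
   by (intro tendsto_upperbound[of _ _ sequentially]) auto
  moreover have VV: "V\<^sup>2 / V = V" using 2 by (simp add: power2_eq_square)
  ultimately have "ennreal V <= efficiency_bound Q" by (simp only:)
  then show ?thesis unfolding V_def .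
 qed
qed

end

section \<open>Construction of the tilted laws\<close>

lemma emeasure_distr_density:
 assumes [measurable]: "f \<in> borel_measurable N" "g \<in> measurable N S" "E \<in> sets S"
 shows "emeasure (distr (density N f) S g) E = (\<integral>\<^sup>+ z. f z * indicator E (g z) \<partial>N)"
proof -
 have [measurable]: "g -` E \<inter> space N \<in> sets N" by measurable
 have "emeasure (distr (density N f) S g) E = (\<integral>\<^sup>+ z. f z * indicator (g -` E \<inter> space N) z \<partial>N)"
  by (subst emeasure_distr) (auto simp: emeasure_density)
 also have "... = (\<integral>\<^sup>+ z. f z * indicator E (g z) \<partial>N)"
  by (intro nn_integral_cong) (auto simp: indicator_def)
 finally show ?thesis .
qed

text \<open>Away from \<open>t = 0\<close> the outcome \<open>Y(1)\<close> is redrawn from its conditional law given \<open>X\<close>, independently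
 of \<open>Y(0)\<close>. This does not change the law of the observations and makes the tilts of the two arms
 independent given \<open>X\<close>, so that each tilt disappears from the observations of the other arm.\<close>

locale tilted_path = regression_setting Q s m c B for Q :: "'x::euclidean_space unit_data measure" and s m c B +
 fixes b :: "'x => real" and T :: "'x \<times> real => real" and D \<epsilon> :: real
 assumes BcD: "B / c <= D" and b_measurable [measurable]: "b \<in> borel_measurable borel"
  and b_bound: "!!x. \<bar>b x\<bar> <= D" and b_mean: "(LINT z|Q. b (cov z)) = 0" and eps: "0 < \<epsilon>" "\<epsilon> * D <= 1 / 2"
  and T_measurable [measurable]: "T \<in> borel_measurable (borel \<Otimes>\<^sub>M borel)"
  and T_law: "distr (Q \<Otimes>\<^sub>M unif) (borel \<Otimes>\<^sub>M borel) (%(z, u). (cov z, T (cov z, u))) = distr Q (borel \<Otimes>\<^sub>M borel) (%z. (cov z, resid m True z))"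
begin

lemma R: "pair_prob_space Q unif" by unfold_locales

definition y1 :: "'x => real => real" where "y1 x u = m True x + T (x, u)"
definition w0 :: "'x => real => real" where "w0 x y = wclip False x y"
definition w1 :: "'x => real => real" where "w1 x u = wclip True x (y1 x u)"
definition tilt :: "real => 'x => real => real => real" where
 "tilt t x y u = (1 + t * b x) * (1 + t * w0 x y) * (1 + t * w1 x u)"
definition redraw :: "'x unit_data => real => 'x unit_data" where
 "redraw z u = (cov z, trt z, pot False z, y1 (cov z) u)"
text \<open>A regular submodel must pass through Q itself. The redrawn law at t = 0 would share only
  the observed law with Q, so the value at 0 is set by hand.\<close>

definition path :: "real => 'x unit_data measure" where
 "path t = (if t = 0 then Q else
   distr (density (Q \<Otimes>\<^sub>M unif) (%p. ennreal (tilt t (cov (fst p)) (pot False (fst p)) (snd p)))) full_space (%p. redraw (fst p) (snd p)))"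

lemma redraw_simps [simp]: "cov (redraw z u) = cov z" "trt (redraw z u) = trt z" "pot False (redraw z u) = pot False z"
  "pot True (redraw z u) = y1 (cov z) u"
 by (simp_all add: redraw_def cov_def trt_def pot_def)

lemma y1_measurable [measurable (raw)]:
 assumes [measurable]: "f \<in> borel_measurable N" "g \<in> borel_measurable N"
 shows "(%w. y1 (f w) (g w)) \<in> borel_measurable N"
proof -
 have "(%w. T (f w, g w)) \<in> borel_measurable N"
  by (rule measurable_compose[OF _ T_measurable]) measurable
 then show ?thesis unfolding y1_def by measurable
qed

lemma w_measurable [measurable (raw)]:
 assumes [measurable]: "f \<in> borel_measurable N" "g \<in> borel_measurable N"
 shows "(%w. w0 (f w) (g w)) \<in> borel_measurable N" "(%w. w1 (f w) (g w)) \<in> borel_measurable N"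
 unfolding w0_def w1_def by measurable

lemma tilt_measurable' [measurable (raw)]:
 assumes [measurable]: "f \<in> borel_measurable N" "g \<in> borel_measurable N" "h \<in> borel_measurable N"
 shows "(%w. tilt t (f w) (g w) (h w)) \<in> borel_measurable N"
 unfolding tilt_def by measurable

lemma redraw_measurable [measurable]: "(%p. redraw (fst p) (snd p)) \<in> measurable (Q \<Otimes>\<^sub>M unif) full_space"
 unfolding redraw_def by measurable

lemma w_bound: "\<bar>w0 x y\<bar> <= D" "\<bar>w1 x u\<bar> <= D"
 using wclip_bound[of False x y] wclip_bound[of True x "y1 x u"] BcD unfolding w0_def w1_def by linarith+

lemma factor:
 assumes "\<bar>t\<bar> < \<epsilon>" "\<bar>v\<bar> <= D"
 shows "0 <= 1 + t * v" "1 + t * v <= 2" "\<bar>1 + t * v\<bar> <= 2"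
proof -
 have "\<bar>t * v\<bar> <= 1 / 2"
  using mult_mono[of "\<bar>t\<bar>" \<epsilon> "\<bar>v\<bar>" D] assms eps by (simp add: abs_mult)
 then show "0 <= 1 + t * v" "1 + t * v <= 2" "\<bar>1 + t * v\<bar> <= 2" by linarith+
qed

lemma tilt_bounds:
 assumes t: "\<bar>t\<bar> < \<epsilon>"
 shows "0 <= tilt t x y u" "tilt t x y u <= 8"
proof -
 note fs = factor[OF t b_bound[of x]] factor[OF t w_bound(1)[of x y]] factor[OF t w_bound(2)[of x u]]
 show "0 <= tilt t x y u" unfolding tilt_def using fs by (intro mult_nonneg_nonneg)
 have "(1 + t * b x) * (1 + t * w0 x y) <= 2 * 2" using fs by (intro mult_mono) auto
 then have "(1 + t * b x) * (1 + t * w0 x y) * (1 + t * w1 x u) <= (2 * 2) * 2" using fs by (intro mult_mono) auto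
 then show "tilt t x y u <= 8" unfolding tilt_def by simp
qed

lemma bounded_integrable:
 assumes "f \<in> borel_measurable Q" "!!z. \<bar>f z\<bar> <= C"
 shows "integrable Q (f :: 'x unit_data => real)"
 by (rule integrable_const_bound[where B=C]) (use assms in auto)

lemma R_integral:
 fixes f :: "'x unit_data \<times> real => real"
 assumes f: "f \<in> borel_measurable (Q \<Otimes>\<^sub>M unif)" and C: "!!p. \<bar>f p\<bar> <= C"
 shows "integrable (Q \<Otimes>\<^sub>M unif) f" "(\<integral>p. f p \<partial>(Q \<Otimes>\<^sub>M unif)) = (LINT z|Q. \<integral>u. f (z, u) \<partial>unif)"
proof -
 interpret R: pair_prob_space Q unif by (rule R)
 show i: "integrable (Q \<Otimes>\<^sub>M unif) f"
  by (rule R.integrable_const_bound[where B=C]) (use f C in auto)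
 show "(\<integral>p. f p \<partial>(Q \<Otimes>\<^sub>M unif)) = (LINT z|Q. \<integral>u. f (z, u) \<partial>unif)"
  by (rule R.integral_fst'[OF i, symmetric])
qed

lemma path_nn_integral:
 assumes t: "\<bar>t\<bar> < \<epsilon>" "t ~= 0" and f [measurable]: "f \<in> borel_measurable full_space" and f0: "!!z. 0 <= f z" and fC: "!!z. f z <= C"
 shows "(\<integral>\<^sup>+ z. ennreal (f z) \<partial>path t) = ennreal (LINT z|Q. \<integral>u. tilt t (cov z) (pot False z) u * f (redraw z u) \<partial>unif)"
proof -
 let ?g = "%p. tilt t (cov (fst p)) (pot False (fst p)) (snd p) * f (redraw (fst p) (snd p))"
 have tm: "(%p. tilt t (cov (fst p)) (pot False (fst p)) (snd p)) \<in> borel_measurable (Q \<Otimes>\<^sub>M unif)" by measurable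
 have fm: "(%p. f (redraw (fst p) (snd p))) \<in> borel_measurable (Q \<Otimes>\<^sub>M unif)"
  by (rule measurable_compose[OF redraw_measurable f])
 note [measurable] = tm fm
 have gm: "?g \<in> borel_measurable (Q \<Otimes>\<^sub>M unif)" by measurable
 have g0: "0 <= ?g p" for p using tilt_bounds(1)[OF t(1)] f0 by simp
 have gC: "\<bar>?g p\<bar> <= 8 * C" for p
 proof -
  have "?g p <= 8 * C" using tilt_bounds[OF t(1)] f0 fC by (intro mult_mono) auto
  then show ?thesis using g0[of p] by linarith
 qed
 have "(\<integral>\<^sup>+ z. ennreal (f z) \<partial>path t) = (\<integral>\<^sup>+ p. ennreal (f (redraw (fst p) (snd p))) \<partial>density (Q \<Otimes>\<^sub>M unif) (%p. ennreal (tilt t (cov (fst p)) (pot False (fst p)) (snd p))))"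
  using t(2) unfolding path_def by (simp add: nn_integral_distr)
 also have "... = (\<integral>\<^sup>+ p. ennreal (tilt t (cov (fst p)) (pot False (fst p)) (snd p)) * ennreal (f (redraw (fst p) (snd p))) \<partial>(Q \<Otimes>\<^sub>M unif))"
  by (rule nn_integral_density) measurable
 also have "... = (\<integral>\<^sup>+ p. ennreal (?g p) \<partial>(Q \<Otimes>\<^sub>M unif))"
  using tilt_bounds(1)[OF t(1)] f0 by (simp add: ennreal_mult)
 also have "... = ennreal (\<integral>p. ?g p \<partial>(Q \<Otimes>\<^sub>M unif))"
  by (rule nn_integral_eq_integral[OF R_integral(1)[OF gm gC]]) (use g0 in auto)
 also have "(\<integral>p. ?g p \<partial>(Q \<Otimes>\<^sub>M unif)) = (LINT z|Q. \<integral>u. tilt t (cov z) (pot False z) u * f (redraw z u) \<partial>unif)"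
  unfolding R_integral(2)[OF gm gC] by simp
 finally show ?thesis .
qed

lemma outsourced:
 fixes h :: "'x \<times> real => real"
 assumes h [measurable]: "h \<in> borel_measurable (borel \<Otimes>\<^sub>M borel)" and C: "!!p. \<bar>h p\<bar> <= C"
 shows "(LINT z|Q. \<integral>u. h (cov z, T (cov z, u)) \<partial>unif) = (LINT z|Q. h (cov z, resid m True z))"
proof -
 have m1: "(%(z, u). (cov z, T (cov z, u))) \<in> measurable (Q \<Otimes>\<^sub>M unif) (borel \<Otimes>\<^sub>M borel)" by measurable
 have m2: "(%z. (cov z, resid m True z)) \<in> measurable Q (borel \<Otimes>\<^sub>M borel)" by measurable
 have m3: "(%p. h ((%(z, u). (cov z, T (cov z, u))) p)) \<in> borel_measurable (Q \<Otimes>\<^sub>M unif)"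
  by (rule measurable_compose[OF m1 h])
 have "(LINT z|Q. \<integral>u. h (cov z, T (cov z, u)) \<partial>unif) = (\<integral>p. h ((%(z, u). (cov z, T (cov z, u))) p) \<partial>(Q \<Otimes>\<^sub>M unif))"
  using R_integral(2)[OF m3 C] by simp
 also have "... = (\<integral>p. h p \<partial>distr (Q \<Otimes>\<^sub>M unif) (borel \<Otimes>\<^sub>M borel) (%(z, u). (cov z, T (cov z, u))))"
  by (rule integral_distr[OF m1 h, symmetric])
 also have "... = (LINT z|Q. h (cov z, resid m True z))"
  unfolding T_law by (rule integral_distr[OF m2 h])
 finally show ?thesis .
qed

text \<open>Up to a null set the clipped residual is the residual times a bounded function of the
  covariates.\<close>

lemma clip_orthogonal:
 assumes \<phi> [measurable]: "\<phi> \<in> borel_measurable borel" and C: "!!x. \<bar>\<phi> x\<bar> <= C"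
 shows "(LINT z|Q. \<phi> (cov z) * wclip a (cov z) (pot a z)) = 0"
proof -
 define \<psi> where "\<psi> x = \<phi> x * (if a then 1 else - 1) / prop_of s a x" for x
 have \<psi>m [measurable]: "\<psi> \<in> borel_measurable borel" unfolding \<psi>_def[abs_def] by measurable
 have \<psi>b: "\<bar>\<psi> x\<bar> <= C / c" for x
 proof -
  have "\<bar>\<psi> x\<bar> = \<bar>\<phi> x\<bar> / prop_of s a x"
   using prop_bounds(1)[of a x] c_pos by (simp add: \<psi>_def abs_mult abs_divide)
  also have "... <= C / c" using C[of x] prop_bounds(1)[of a x] c_pos by (intro frac_le) auto
  finally show ?thesis .
 qed
 have "(LINT z|Q. \<phi> (cov z) * wclip a (cov z) (pot a z)) = (LINT z|Q. \<psi> (cov z) * resid m a z)"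
 proof (rule integral_cong_AE)
  show "AE z in Q. \<phi> (cov z) * wclip a (cov z) (pot a z) = \<psi> (cov z) * resid m a z"
   using wclip_AE[of a] by eventually_elim (simp add: \<psi>_def wresid_def)
 qed measurable
 then show ?thesis using orthogonal(1)[OF \<psi>m \<psi>b] by simp
qed

lemma w0_null:
 assumes \<phi> [measurable]: "\<phi> \<in> borel_measurable borel" and C: "!!x. \<bar>\<phi> x\<bar> <= C"
 shows "(LINT z|Q. \<phi> (cov z) * (1 + t * w0 (cov z) (pot False z))) = (LINT z|Q. \<phi> (cov z))"
proof -
 have i1: "integrable Q (%z. \<phi> (cov z))" by (rule bounded_integrable[where C=C]) (use C in auto)
 have i2: "integrable Q (%z. \<phi> (cov z) * w0 (cov z) (pot False z))"
 proof (rule bounded_integrable[where C="C * D"])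
  show "\<bar>\<phi> (cov z) * w0 (cov z) (pot False z)\<bar> <= C * D" for z
   unfolding abs_mult using C[of "cov z"] w_bound(1)[of "cov z" "pot False z"] by (intro mult_mono) auto
 qed measurable
 have "(LINT z|Q. \<phi> (cov z) * (1 + t * w0 (cov z) (pot False z))) = (LINT z|Q. \<phi> (cov z) + t * (\<phi> (cov z) * w0 (cov z) (pot False z)))"
  by (simp add: algebra_simps)
 also have "... = (LINT z|Q. \<phi> (cov z)) + t * (LINT z|Q. \<phi> (cov z) * w0 (cov z) (pot False z))"
  using i1 i2 by simp
 also have "(LINT z|Q. \<phi> (cov z) * w0 (cov z) (pot False z)) = 0"
  unfolding w0_def by (rule clip_orthogonal[OF \<phi> C])
 finally show ?thesis by simp
qed

definition w1_mean :: "'x => real" where "w1_mean x = (LINT u|unif. w1 x u)"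

lemma w1_mean_measurable [measurable]: "w1_mean \<in> borel_measurable borel"
 unfolding w1_mean_def[abs_def] by measurable

lemma w1_integrable: "integrable unif (w1 x)"
 by (rule unif.integrable_const_bound[where B=D]) (use w_bound(2) in auto)

text \<open>Test with the sign of \<open>w1_mean\<close>: the mean of its absolute value becomes, by
  \<open>outsourced\<close>, an integral of the clipped residual against a bounded function of the
  covariates.\<close>

lemma w1_null: "AE z in Q. w1_mean (cov z) = 0"
proof -
 have hm: "(%p. sgn (w1_mean (fst p)) * wclip True (fst p) (m True (fst p) + snd p)) \<in> borel_measurable (borel \<Otimes>\<^sub>M borel)" by measurable
 have hb: "\<bar>sgn (w1_mean (fst p)) * wclip True (fst p) (m True (fst p) + snd p)\<bar> <= 1 * (B / c)" for p
  unfolding abs_mult using wclip_bound by (intro mult_mono) (auto simp: sgn_real_def)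
 have mb: "\<bar>w1_mean x\<bar> <= D" for x
 proof -
  have "\<bar>w1_mean x\<bar> <= (LINT u|unif. \<bar>w1 x u\<bar>)" unfolding w1_mean_def by (rule integral_abs_bound)
  also have "... <= (LINT u|unif. D)"
   using w_bound(2) w1_integrable by (intro integral_mono) auto
  finally show ?thesis using unif.prob_space by simp
 qed
 have "(LINT z|Q. \<bar>w1_mean (cov z)\<bar>) = (LINT z|Q. \<integral>u. sgn (w1_mean (cov z)) * wclip True (cov z) (m True (cov z) + T (cov z, u)) \<partial>unif)"
 proof (rule Bochner_Integration.integral_cong[OF refl])
  fix z
  have inner: "(LINT u|unif. sgn (w1_mean (cov z)) * wclip True (cov z) (m True (cov z) + T (cov z, u))) = sgn (w1_mean (cov z)) * w1_mean (cov z)"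
   by (simp add: w1_mean_def w1_def y1_def)
  have sg: "\<bar>r\<bar> = sgn r * r" for r :: real by (simp add: sgn_real_def)
  show "\<bar>w1_mean (cov z)\<bar> = (LINT u|unif. sgn (w1_mean (cov z)) * wclip True (cov z) (m True (cov z) + T (cov z, u)))"
   by (rule trans[OF sg inner[symmetric]])
 qed
 also have "... = (LINT z|Q. sgn (w1_mean (cov z)) * wclip True (cov z) (pot True z))"
  using outsourced[OF hm hb] by (simp add: resid_def)
 also have "... = 0"
 proof (rule clip_orthogonal[where C=1 and \<phi>="%x. sgn (w1_mean x)"])
  show "\<bar>sgn (w1_mean x)\<bar> <= 1" for x by (simp add: sgn_real_def)
 qed measurable
 finally have z: "(LINT z|Q. \<bar>w1_mean (cov z)\<bar>) = 0" .
 have "integrable Q (%z. \<bar>w1_mean (cov z)\<bar>)"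
  by (rule bounded_integrable[where C=D]) (use mb in auto)
 from integral_nonneg_eq_0_iff_AE[OF this] z have "AE z in Q. \<bar>w1_mean (cov z)\<bar> = 0" by simp
 then show ?thesis by eventually_elim simp
qed

lemma w1_factor: "(LINT u|unif. 1 + t * w1 x u) = 1 + t * w1_mean x"
 using w1_integrable[of x] unif.prob_space by (simp add: w1_mean_def)

lemma path_sets [measurable_cong]: "sets (path t) = sets full_space"
 by (simp add: path_def sets_Q)

text \<open>The factors are integrated out in turn: the redrawn outcome, then Y(0), then the
  covariate tilt, each centred given what remains.\<close>

lemma tilt_total: "\<bar>t\<bar> < \<epsilon> ==> (LINT z|Q. \<integral>u. tilt t (cov z) (pot False z) u \<partial>unif) = 1"
proof -
 assume t: "\<bar>t\<bar> < \<epsilon>"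
 have "(LINT z|Q. \<integral>u. tilt t (cov z) (pot False z) u \<partial>unif) = (LINT z|Q. (1 + t * b (cov z)) * (1 + t * w0 (cov z) (pot False z)) * (1 + t * w1_mean (cov z)))"
  unfolding tilt_def by (simp add: w1_factor)
 also have "... = (LINT z|Q. (1 + t * b (cov z)) * (1 + t * w0 (cov z) (pot False z)))"
 proof (rule integral_cong_AE)
  show "AE z in Q. (1 + t * b (cov z)) * (1 + t * w0 (cov z) (pot False z)) * (1 + t * w1_mean (cov z)) = (1 + t * b (cov z)) * (1 + t * w0 (cov z) (pot False z))"
   using w1_null by eventually_elim simp
 qed measurable
 also have "... = (LINT z|Q. 1 + t * b (cov z))"
  by (rule w0_null[where \<phi>="%x. 1 + t * b x" and C=2]) (use factor[OF t b_bound] in auto)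
 also have "... = 1"
 proof -
  have "integrable Q (%z. b (cov z))" by (rule bounded_integrable[where C=D]) (use b_bound in auto)
  then show ?thesis using b_mean prob_space by simp
 qed
 finally show ?thesis .
qed

lemma path_law:
 assumes t: "\<bar>t\<bar> < \<epsilon>"
 shows "unit_law (path t)"
proof (cases "t = 0")
 case True
 then show ?thesis using unit_law_axioms by (simp add: path_def)
next
 case False
 have "emeasure (path t) (space (path t)) = (\<integral>\<^sup>+ z. ennreal 1 \<partial>path t)" by simp
 also have "... = ennreal 1"
  by (subst path_nn_integral[OF t False, where C=1]) (simp_all add: tilt_total[OF t])
 finally have "prob_space (path t)" by (intro prob_spaceI) simp
 then show ?thesis by (intro unit_law.intro unit_law_axioms.intro path_sets)
qed

text \<open>Redrawing keeps covariates and treatment. Once the noise is integrated out, the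
  integrand is a function of X and Y(0), so the weighting identity of Q applies to it.\<close>

lemma path_ipw:
 assumes t: "\<bar>t\<bar> < \<epsilon>"
 shows "ipw (path t) s"
proof (cases "t = 0")
 case True
 then show ?thesis using s_ipw by (simp add: path_def)
next
 case False
 show ?thesis
  unfolding ipw_def
 proof (intro allI measure_eqI)
  fix a and E :: "('x \<times> real \<times> real) set"
  let ?g = "%z::'x unit_data. (cov z, pot False z, pot True z)"
  assume "E \<in> sets (distr (density (path t) (%z. of_bool (trt z = a))) xyy_space ?g)"
  then have E [measurable]: "E \<in> sets xyy_space" by simp
  define h where "h x y (y'::real) = (LINT u|unif. tilt t x y u * indicator E (x, y, y1 x u))" for x y y'
  have hm: "(%(x, y0, y1). h x y0 y1) \<in> borel_measurable xyy_space"
   unfolding h_def by measurable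
  have gm: "?g \<in> measurable (path t) xyy_space" by measurable
  have "emeasure (distr (density (path t) (%z. of_bool (trt z = a))) xyy_space ?g) E = (\<integral>\<^sup>+ z. of_bool (trt z = a) * indicator E (?g z) \<partial>path t)"
   by (rule emeasure_distr_density[OF _ gm E]) measurable
  also have "... = (\<integral>\<^sup>+ z. ennreal (of_bool (trt z = a) * indicator E (?g z)) \<partial>path t)"
   by (intro nn_integral_cong) (auto simp: indicator_def of_bool_def)
  also have "... = ennreal (LINT z|Q. \<integral>u. tilt t (cov z) (pot False z) u * (of_bool (trt (redraw z u) = a) * indicator E (?g (redraw z u))) \<partial>unif)"
   by (rule path_nn_integral[OF t False, where C=1]) (auto simp: indicator_def of_bool_def)
  also have "(LINT z|Q. \<integral>u. tilt t (cov z) (pot False z) u * (of_bool (trt (redraw z u) = a) * indicator E (?g (redraw z u))) \<partial>unif) = (LINT z|Q. of_bool (trt z = a) * h (cov z) (pot False z) (pot True z))"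
   by (simp add: h_def mult.left_commute[of _ "of_bool _"])
  also have "... = (LINT z|Q. prop_of s a (cov z) * h (cov z) (pot False z) (pot True z))"
   by (rule ipw_integral(1)[OF s_ipw s_measurable s_unit hm])
  also have "... = (LINT z|Q. \<integral>u. tilt t (cov z) (pot False z) u * (prop_of s a (cov (redraw z u)) * indicator E (?g (redraw z u))) \<partial>unif)"
   by (simp add: h_def mult.left_commute[of _ "prop_of s a _"])
  also have "ennreal ... = (\<integral>\<^sup>+ z. ennreal (prop_of s a (cov z) * indicator E (?g z)) \<partial>path t)"
  proof (rule path_nn_integral[OF t False, where C=1, symmetric])
   fix z
   have p: "0 <= prop_of s a (cov z)" using prop_bounds(1)[of a "cov z"] c_pos by linarith
   show "0 <= prop_of s a (cov z) * indicator E (?g z)" using p by simp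
   show "prop_of s a (cov z) * indicator E (?g z) <= 1" using prop_bounds(2)[of a "cov z"] by (simp add: indicator_def)
  qed measurable
  also have "... = (\<integral>\<^sup>+ z. ennreal (prop_of s a (cov z)) * indicator E (?g z) \<partial>path t)"
   by (intro nn_integral_cong) (auto simp: indicator_def)
  also have "... = emeasure (distr (density (path t) (%z. ennreal (prop_of s a (cov z)))) xyy_space ?g) E"
   by (rule emeasure_distr_density[OF _ gm E, symmetric]) measurable
  finally show "emeasure (distr (density (path t) (%z. of_bool (trt z = a))) xyy_space ?g) E =
   emeasure (distr (density (path t) (%z. ennreal (prop_of s a (cov z)))) xyy_space ?g) E" .
 qed simp
qed

text \<open>In the control arm the tilt of the redrawn Y(1) integrates to 1 given X. In the treated
  arm the tilt of Y(0) does, and the redrawn outcome may be replaced by Y(1), having the same joint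
  law with X.\<close>

lemma path_event:
 assumes t: "\<bar>t\<bar> < \<epsilon>" and E [measurable]: "E \<in> sets obs_space"
 shows "(LINT z|Q. \<integral>u. tilt t (cov z) (pot False z) u * indicator E (obs_of (redraw z u)) \<partial>unif) =
  (LINT z|Q. tilt_density b t (obs_of z) * indicator E (obs_of z))"
proof -
 define G0 where "G0 x y = (1 + t * b x) * (1 + t * w0 x y) * indicator E (x, False, y)" for x y
 define H where "H x = (LINT u|unif. (1 + t * b x) * (1 + t * w1 x u) * indicator E (x, True, y1 x u))" for x
 have mE: "(%w. indicator E (f w, a, g w) :: real) \<in> borel_measurable N"
  if [measurable]: "f \<in> borel_measurable N" "g \<in> borel_measurable N" for f and g :: "'z => real" and a and N :: "'z measure"
  by (rule measurable_compose[OF _ borel_measurable_indicator[OF E]]) measurable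
 have G0m [measurable]: "(%z. G0 (cov z) (pot False z)) \<in> borel_measurable Q"
  unfolding G0_def by (intro borel_measurable_times mE) measurable
 have Hi: "(%p. (1 + t * b (fst p)) * (1 + t * w1 (fst p) (snd p)) * indicator E (fst p, True, y1 (fst p) (snd p))) \<in> borel_measurable (borel \<Otimes>\<^sub>M unif)"
  by (intro borel_measurable_times mE) measurable
 have Hm [measurable]: "H \<in> borel_measurable borel"
  unfolding H_def[abs_def] by (rule unif.borel_measurable_lebesgue_integral) (use Hi in \<open>simp add: case_prod_beta'\<close>)
 have inb: "\<bar>(1 + t * b x) * (1 + t * w1 x u) * indicator E (x, True, y1 x u)\<bar> <= 2 * 2 * 1" for x u
  unfolding abs_mult using factor(3)[OF t b_bound[of x]] factor(3)[OF t w_bound(2)[of x u]]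
  by (intro mult_mono) (auto simp: indicator_def)
 have Hb: "\<bar>H x\<bar> <= 4" for x
 proof -
  have i: "integrable unif (%u. (1 + t * b x) * (1 + t * w1 x u) * indicator E (x, True, y1 x u))"
  proof (rule unif.integrable_const_bound[where B=4])
   show "(%u. (1 + t * b x) * (1 + t * w1 x u) * indicator E (x, True, y1 x u)) \<in> borel_measurable unif"
    by (intro borel_measurable_times mE) measurable
  qed (use inb in auto)
  have "\<bar>H x\<bar> <= (LINT u|unif. \<bar>(1 + t * b x) * (1 + t * w1 x u) * indicator E (x, True, y1 x u)\<bar>)"
   unfolding H_def by (rule integral_abs_bound)
  also have "... <= (LINT u|unif. 4)"
  proof (rule integral_mono)
   show "\<bar>(1 + t * b x) * (1 + t * w1 x u) * indicator E (x, True, y1 x u)\<bar> <= 4" for u using inb[of x u] by simp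
  qed (use i in auto)
  finally show ?thesis using unif.prob_space by simp
 qed
 have inner: "AE z in Q. (LINT u|unif. tilt t (cov z) (pot False z) u * indicator E (obs_of (redraw z u))) =
   of_bool (trt z = False) * G0 (cov z) (pot False z) + of_bool (trt z = True) * ((1 + t * w0 (cov z) (pot False z)) * H (cov z))"
  using w1_null
 proof eventually_elim
  case (elim z)
  show ?case
  proof (cases "trt z")
   case True
   then have "tilt t (cov z) (pot False z) u * indicator E (obs_of (redraw z u)) =
     (1 + t * w0 (cov z) (pot False z)) * ((1 + t * b (cov z)) * (1 + t * w1 (cov z) u) * indicator E (cov z, True, y1 (cov z) u))" for u
    by (simp add: tilt_def obs_outcome_eq)
   then show ?thesis using True by (simp add: H_def)
  next
   case False
   then have "tilt t (cov z) (pot False z) u * indicator E (obs_of (redraw z u)) =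
     G0 (cov z) (pot False z) * (1 + t * w1 (cov z) u)" for u
    by (simp add: tilt_def obs_outcome_eq G0_def)
   then show ?thesis using False elim by (simp add: w1_factor)
  qed
 qed
 have mL: "(%z. \<integral>u. tilt t (cov z) (pot False z) u * indicator E (obs_of (redraw z u)) \<partial>unif) \<in> borel_measurable Q"
 proof (rule unif.borel_measurable_lebesgue_integral)
  have om: "(%p. obs_of (redraw (fst p) (snd p))) \<in> measurable (Q \<Otimes>\<^sub>M unif) obs_space"
  proof -
   have "obs_of \<in> measurable full_space obs_space" by measurable
   from measurable_compose[OF redraw_measurable this] show ?thesis .
  qed
  have "(%p. indicator E (obs_of (redraw (fst p) (snd p))) :: real) \<in> borel_measurable (Q \<Otimes>\<^sub>M unif)"
   by (rule measurable_compose[OF om borel_measurable_indicator[OF E]])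
  then have "(%p. tilt t (cov (fst p)) (pot False (fst p)) (snd p) * indicator E (obs_of (redraw (fst p) (snd p)))) \<in> borel_measurable (Q \<Otimes>\<^sub>M unif)"
   by (intro borel_measurable_times) measurable
  then show "(%(z, u). tilt t (cov z) (pot False z) u * indicator E (obs_of (redraw z u))) \<in> borel_measurable (Q \<Otimes>\<^sub>M unif)"
   by (simp only: case_prod_beta')
 qed
 have i0: "integrable Q (%z. of_bool (trt z = False) * G0 (cov z) (pot False z))"
 proof (rule bounded_integrable[where C="1 * (2 * 2 * 1)"])
  show "\<bar>of_bool (trt z = False) * G0 (cov z) (pot False z)\<bar> <= 1 * (2 * 2 * 1)" for z
   unfolding G0_def abs_mult using factor(3)[OF t b_bound[of "cov z"]] factor(3)[OF t w_bound(1)[of "cov z" "pot False z"]]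
   by (intro mult_mono) (auto simp: indicator_def)
 qed measurable
 have i1: "integrable Q (%z. of_bool (trt z = True) * ((1 + t * w0 (cov z) (pot False z)) * H (cov z)))"
 proof (rule bounded_integrable[where C="1 * (2 * 4)"])
  show "\<bar>of_bool (trt z = True) * ((1 + t * w0 (cov z) (pot False z)) * H (cov z))\<bar> <= 1 * (2 * 4)" for z
   unfolding abs_mult using Hb[of "cov z"] factor(3)[OF t w_bound(1)[of "cov z" "pot False z"]]
   by (intro mult_mono) auto
 qed measurable
 define k where "k p = s (fst p) * ((1 + t * b (fst p)) * (1 + t * wclip True (fst p) (m True (fst p) + snd p)) * indicator E (fst p, True, m True (fst p) + snd p))" for p
 have km: "k \<in> borel_measurable (borel \<Otimes>\<^sub>M borel)"
  unfolding k_def[abs_def] by (intro borel_measurable_times mE) measurable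
 have kb: "\<bar>k p\<bar> <= 1 * (2 * 2 * 1)" for p
 proof -
  have "\<bar>wclip True (fst p) (m True (fst p) + snd p)\<bar> <= D" using wclip_bound BcD by (rule order_trans)
  note f = factor(3)[OF t this] factor(3)[OF t b_bound[of "fst p"]]
  show ?thesis unfolding k_def abs_mult using f s_unit[of "fst p"]
   by (intro mult_mono) (auto simp: indicator_def)
 qed
 have hm: "(%(x, y0, y1). (1 + t * w0 x y0) * H x) \<in> borel_measurable xyy_space" by measurable
 have hm2: "(%(x, y0, y1). (1 + t * b x) * (1 + t * wclip True x y1) * indicator E (x, True, y1)) \<in> borel_measurable xyy_space"
  unfolding case_prod_beta' by (intro borel_measurable_times mE) measurable
 \<comment> \<open>Trade the treatment indicator for the score, so that all but the tilt of Y(0)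
   depends on X and that tilt drops out; then undo the redrawing and trade the score back for the
   indicator.\<close>
 have "(LINT z|Q. of_bool (trt z = True) * ((1 + t * w0 (cov z) (pot False z)) * H (cov z))) = (LINT z|Q. prop_of s True (cov z) * ((1 + t * w0 (cov z) (pot False z)) * H (cov z)))"
  by (rule ipw_integral(1)[OF s_ipw s_measurable s_unit hm])
 also have "... = (LINT z|Q. (s (cov z) * H (cov z)) * (1 + t * w0 (cov z) (pot False z)))"
  by (intro Bochner_Integration.integral_cong) (simp_all add: prop_of_def)
 also have "... = (LINT z|Q. s (cov z) * H (cov z))"
 proof (rule w0_null[where \<phi>="%x. s x * H x" and C="1 * 4"])
  show "\<bar>s x * H x\<bar> <= 1 * 4" for x unfolding abs_mult using s_unit[of x] Hb[of x] by (intro mult_mono) auto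
 qed measurable
 also have "... = (LINT z|Q. \<integral>u. k (cov z, T (cov z, u)) \<partial>unif)"
  by (simp add: k_def H_def w1_def y1_def)
 also have "... = (LINT z|Q. k (cov z, resid m True z))"
  by (rule outsourced[OF km kb])
 also have "... = (LINT z|Q. prop_of s True (cov z) * ((1 + t * b (cov z)) * (1 + t * wclip True (cov z) (pot True z)) * indicator E (cov z, True, pot True z)))"
  by (simp add: k_def resid_def prop_of_def)
 also have "... = (LINT z|Q. of_bool (trt z = True) * ((1 + t * b (cov z)) * (1 + t * wclip True (cov z) (pot True z)) * indicator E (cov z, True, pot True z)))"
  by (rule ipw_integral(1)[OF s_ipw s_measurable s_unit hm2, symmetric])
 finally have arm1: "(LINT z|Q. of_bool (trt z = True) * ((1 + t * w0 (cov z) (pot False z)) * H (cov z))) =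
  (LINT z|Q. of_bool (trt z = True) * ((1 + t * b (cov z)) * (1 + t * wclip True (cov z) (pot True z)) * indicator E (cov z, True, pot True z)))" .
 have i2: "integrable Q (%z. of_bool (trt z = True) * ((1 + t * b (cov z)) * (1 + t * wclip True (cov z) (pot True z)) * indicator E (cov z, True, pot True z)))"
 proof (rule bounded_integrable[where C="1 * (2 * 2 * 1)"])
  show "\<bar>of_bool (trt z = True) * ((1 + t * b (cov z)) * (1 + t * wclip True (cov z) (pot True z)) * indicator E (cov z, True, pot True z))\<bar> <= 1 * (2 * 2 * 1)" for z
  proof -
   have "\<bar>wclip True (cov z) (pot True z)\<bar> <= D" using wclip_bound BcD by (rule order_trans)
   note f = factor(3)[OF t this] factor(3)[OF t b_bound[of "cov z"]]
   show ?thesis unfolding abs_mult using f by (intro mult_mono) (auto simp: indicator_def)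
  qed
  show "(%z. of_bool (trt z = True) * ((1 + t * b (cov z)) * (1 + t * wclip True (cov z) (pot True z)) * indicator E (cov z, True, pot True z))) \<in> borel_measurable Q"
   by (intro borel_measurable_times mE) measurable
 qed
 have mR: "(%z. of_bool (trt z = False) * G0 (cov z) (pot False z) + of_bool (trt z = True) * ((1 + t * w0 (cov z) (pot False z)) * H (cov z))) \<in> borel_measurable Q"
  by measurable
 have "(LINT z|Q. \<integral>u. tilt t (cov z) (pot False z) u * indicator E (obs_of (redraw z u)) \<partial>unif) =
   (LINT z|Q. of_bool (trt z = False) * G0 (cov z) (pot False z) + of_bool (trt z = True) * ((1 + t * w0 (cov z) (pot False z)) * H (cov z)))"
  by (rule integral_cong_AE[OF mL mR inner])
 also have "... = (LINT z|Q. of_bool (trt z = False) * G0 (cov z) (pot False z)) + (LINT z|Q. of_bool (trt z = True) * ((1 + t * w0 (cov z) (pot False z)) * H (cov z)))"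
  by (rule Bochner_Integration.integral_add[OF i0 i1])
 also have "... = (LINT z|Q. of_bool (trt z = False) * G0 (cov z) (pot False z) + of_bool (trt z = True) * ((1 + t * b (cov z)) * (1 + t * wclip True (cov z) (pot True z)) * indicator E (cov z, True, pot True z)))"
  unfolding arm1 by (rule Bochner_Integration.integral_add[OF i0 i2, symmetric])
 also have "... = (LINT z|Q. tilt_density b t (obs_of z) * indicator E (obs_of z))"
 proof (rule Bochner_Integration.integral_cong[OF refl])
  fix z
  show "of_bool (trt z = False) * G0 (cov z) (pot False z) + of_bool (trt z = True) * ((1 + t * b (cov z)) * (1 + t * wclip True (cov z) (pot True z)) * indicator E (cov z, True, pot True z)) = tilt_density b t (obs_of z) * indicator E (obs_of z)"
   by (cases "trt z") (simp_all add: G0_def w0_def tilt_density_def wobs_def obs_outcome_eq)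
 qed
 finally show ?thesis .
qed

lemma path_obs:
 assumes t: "\<bar>t\<bar> < \<epsilon>"
 shows "obs_law (path t) = density (obs_law Q) (%y. ennreal (tilt_density b t y))"
proof (cases "t = 0")
 case True
 then have "(%y. ennreal (tilt_density b t y)) = (%_. 1)" by (simp add: tilt_density_def)
 then show ?thesis using True by (simp add: path_def density_1)
next
 case False
 show ?thesis
 proof (rule measure_eqI)
  show "sets (obs_law (path t)) = sets (density (obs_law Q) (%y. ennreal (tilt_density b t y)))" by (simp add: obs_law_def)
  fix E assume "E \<in> sets (obs_law (path t))"
  then have E [measurable]: "E \<in> sets obs_space" by (simp add: obs_law_def)
  have om: "obs_of \<in> measurable full_space obs_space" by measurable
  have omp: "obs_of \<in> measurable (path t) obs_space" by measurable
  have iE: "(%z. indicator E (obs_of z) :: real) \<in> borel_measurable full_space"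
   by (rule measurable_compose[OF om borel_measurable_indicator[OF E]])
  have td: "0 <= tilt_density b t y" "tilt_density b t y <= 4" for y
  proof -
   have "\<bar>wobs y\<bar> <= D" using wobs_bound BcD by (rule order_trans)
   note f = factor[OF t this] factor[OF t b_bound[of "fst y"]]
   show "0 <= tilt_density b t y" unfolding tilt_density_def using f by (intro mult_nonneg_nonneg) auto
   have "(1 + t * b (fst y)) * (1 + t * wobs y) <= 2 * 2" using f by (intro mult_mono) auto
   then show "tilt_density b t y <= 4" unfolding tilt_density_def by simp
  qed
  have "emeasure (obs_law (path t)) E = (\<integral>\<^sup>+ y. indicator E y \<partial>obs_law (path t))"
   by (rule nn_integral_indicator[symmetric]) (simp add: obs_law_def)
  also have "... = (\<integral>\<^sup>+ z. indicator E (obs_of z) \<partial>path t)"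
   unfolding obs_law_def by (rule nn_integral_distr[OF omp]) measurable
  also have "... = (\<integral>\<^sup>+ z. ennreal (indicator E (obs_of z)) \<partial>path t)"
   by (intro nn_integral_cong) (auto simp: indicator_def)
  also have "... = ennreal (LINT z|Q. \<integral>u. tilt t (cov z) (pot False z) u * indicator E (obs_of (redraw z u)) \<partial>unif)"
   by (rule path_nn_integral[OF t False iE, where C=1]) (auto simp: indicator_def)
  also have "... = ennreal (LINT z|Q. tilt_density b t (obs_of z) * indicator E (obs_of z))"
   unfolding path_event[OF t E] ..
  also have "... = (\<integral>\<^sup>+ z. ennreal (tilt_density b t (obs_of z) * indicator E (obs_of z)) \<partial>Q)"
  proof (rule nn_integral_eq_integral[symmetric])
   show "integrable Q (%z. tilt_density b t (obs_of z) * indicator E (obs_of z))"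
    by (rule bounded_integrable[where C=4]) (use td in \<open>auto simp: indicator_def\<close>)
  qed (use td in auto)
  also have "... = (\<integral>\<^sup>+ z. ennreal (tilt_density b t (obs_of z)) * indicator E (obs_of z) \<partial>Q)"
   by (intro nn_integral_cong) (auto simp: indicator_def)
  also have "... = (\<integral>\<^sup>+ y. ennreal (tilt_density b t y) * indicator E y \<partial>obs_law Q)"
   unfolding obs_law_def by (rule nn_integral_distr[OF obs_of_measurable, symmetric]) measurable
  also have "... = emeasure (density (obs_law Q) (%y. ennreal (tilt_density b t y))) E"
  proof (rule emeasure_density[symmetric])
   have S: "sets (obs_law Q) = sets obs_space" by (simp add: obs_law_def)
   show "(%y. ennreal (tilt_density b t y)) \<in> borel_measurable (obs_law Q)"
    unfolding measurable_cong_sets[OF S refl] by measurable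
   show "E \<in> sets (obs_law Q)" unfolding S by (rule E)
  qed
  finally show "emeasure (obs_law (path t)) E = emeasure (density (obs_law Q) (%y. ennreal (tilt_density b t y))) E" .
 qed
qed

lemma tilted_model: "tilted_model Q s m c B path b D \<epsilon>"
proof (rule tilted_model.intro[OF regression_setting_axioms], rule tilted_model_axioms.intro)
 show "path 0 = Q" by (simp add: path_def)
 show "B / c <= D" by (rule BcD)
 show "b \<in> borel_measurable borel" by (rule b_measurable)
 show "\<bar>b x\<bar> <= D" for x by (rule b_bound)
 show "0 < \<epsilon>" "\<epsilon> * D <= 1 / 2" by (rule eps)+
 show "unit_law (path t)" if "\<bar>t\<bar> < \<epsilon>" for t by (rule path_law[OF that])
 show "ipw (path t) s" if "\<bar>t\<bar> < \<epsilon>" for t by (rule path_ipw[OF that])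
 show "obs_law (path t) = density (obs_law Q) (%y. ennreal (tilt_density b t y))" if "\<bar>t\<bar> < \<epsilon>" for t by (rule path_obs[OF that])
qed

end

context regression_setting
begin

lemma tilted_submodel_exists:
 assumes b: "b \<in> borel_measurable borel" and C: "!!x. \<bar>b x\<bar> <= C" and mean: "(LINT z|Q. b (cov z)) = 0"
 shows "\<exists>P d. regular_submodel Q P (tilt_score b) d"
proof -
 have cm: "cov \<in> borel_measurable Q" by measurable
 \<comment> \<open>The residual is redrawn rather than the outcome because it is bounded, as
   \<open>noise_outsourcing\<close> requires.\<close>
 obtain T where T: "T \<in> borel_measurable (borel \<Otimes>\<^sub>M borel)"
  "distr (Q \<Otimes>\<^sub>M unif) (borel \<Otimes>\<^sub>M borel) (%(z, u). (cov z, T (cov z, u))) = distr Q (borel \<Otimes>\<^sub>M borel) (%z. (cov z, resid m True z))"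
  by (rule noise_outsourcing[OF cm resid_measurable resid_bound]) (rule that)
 define D where "D = max C (B / c)"
 have "0 <= B / c" using B_nonneg c_pos by simp
 then have D: "0 <= D" by (simp add: D_def le_max_iff_disj)
 \<comment> \<open>The summand 1 keeps the radius well defined when D = 0.\<close>
 have tp: "tilted_path Q s m c B b T D (1 / (2 * (D + 1)))"
 proof (rule tilted_path.intro[OF regression_setting_axioms], rule tilted_path_axioms.intro)
  show "B / c <= D" by (simp add: D_def)
  show "b \<in> borel_measurable borel" by (rule b)
  show "\<bar>b x\<bar> <= D" for x using C[of x] by (simp add: D_def)
  show "(LINT z|Q. b (cov z)) = 0" by (rule mean)
  show "0 < 1 / (2 * (D + 1))" using D by simp
  show "1 / (2 * (D + 1)) * D <= 1 / 2" using D by (simp add: field_simps)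
 qed (rule T)+
 interpret tp: tilted_path Q s m c B b T D "1 / (2 * (D + 1))" by (rule tp)
 interpret tm: tilted_model Q s m c B tp.path b D "1 / (2 * (D + 1))" by (rule tp.tilted_model)
 show ?thesis using tm.tilted_submodel by blast
qed

theorem efficiency_bound_infl: "efficiency_bound Q = ennreal (LINT z|Q. (infl z)^2)"
proof (rule efficiency_bound_eq)
 fix b :: "'x => real" and C :: real
 assume "b \<in> borel_measurable borel" "!!x. \<bar>b x\<bar> <= C" "(LINT z|Q. b (cov z)) = 0"
 then show "\<exists>P d. regular_submodel Q P (tilt_score b) d" by (rule tilted_submodel_exists)
qed

end

section \<open>Limit law and efficiency under correct specification\<close>

theorem mainTheorem2:
  fixes \<Omega> :: "'w measure"
    and Z :: "nat \<Rightarrow> 'w \<Rightarrow> 'x::euclidean_space unit_data"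
    and Q :: "'x unit_data measure"
    and e :: "'x \<Rightarrow> 'p::euclidean_space \<Rightarrow> real"
    and u0 :: "'x \<Rightarrow> 'b0::euclidean_space \<Rightarrow> real"
    and u1 :: "'x \<Rightarrow> 'b1::euclidean_space \<Rightarrow> real"
    and \<alpha> :: 'p and \<beta>0 :: 'b0 and \<beta>1 :: 'b1
    and K :: "nat \<Rightarrow> nat"
  assumes "prob_space \<Omega>"
    and "prob_space Q" and "sets Q = sets full_space"
    and iid: "prob_space.indep_vars \<Omega> (\<lambda>_. full_space) Z UNIV"
             "\<And>i. distr \<Omega> full_space (Z i) = Q"
    and "square_integrable_outcomes Q"
    and "(\<lambda>x. e x \<alpha>) \<in> borel_measurable borel"
    and "assumption1 Q"
    and "assumption2 Q (\<lambda>x. e x \<alpha>) (outcome_model u0 u1 \<beta>0 \<beta>1)"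
    and correct_score: "AE z in Q. e (cov z) \<alpha> = cprob Q cov trt z"
    and correct_outcome0: "AE z in Q. u0 (cov z) \<beta>0 = cexp Q cov (pot False) z"
    and correct_outcome1: "AE z in Q. u1 (cov z) \<beta>1 = cexp Q cov (pot True) z"
    and "filterlim K at_top sequentially"
    and "(\<lambda>n. real (K n) / real n) \<longlonglongrightarrow> 0"
  shows "let \<tau> = ate Q;
             \<pi> = (\<lambda>a. cprob Q (\<lambda>z. e (cov z) \<alpha>) (\<lambda>z. trt z = a));
             V = (\<integral>z. cvar Q cov (pot False) z / \<pi> False z + cvar Q cov (pot True) z / \<pi> True z +
                   (u1 (cov z) \<beta>1 - u0 (cov z) \<beta>0 - \<tau>)\<^sup>2 \<partial>Q)
         in weak_conv_m
              (\<lambda>n. distr \<Omega> borel (\<lambda>\<omega>. sqrt (real n) *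
                 (amw (\<lambda>x. e x \<alpha>) (outcome_model u0 u1 \<beta>0 \<beta>1) n (K n) (\<lambda>i. Z i \<omega>) - \<tau>)))
              (centered_normal V) \<and>
            ennreal V = efficiency_bound Q"
proof -
 define m where "m = outcome_model u0 u1 \<beta>0 \<beta>1"
 define s0 where "s0 x = e x \<alpha>" for x
 have s0m [measurable]: "s0 \<in> borel_measurable borel" unfolding s0_def[abs_def] by (rule assms(7))
 have ul: "unit_law Q"
  by (intro unit_law.intro unit_law_axioms.intro assms(2) assms(3))
 interpret unit_law Q by (rule ul)
 have score: "AE z in Q. s0 (cov z) = cprob Q cov trt z" using correct_score by (simp add: s0_def)
 have ov: "overlap Q" and ign: "ignorability Q" using assms(8) by (simp_all add: assumption1_def)
 obtain c0 c1 where c01: "0 < c0" "c0 <= c1" "c1 < 1" and cb: "AE z in Q. c0 <= cprob Q cov trt z & cprob Q cov trt z <= c1"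
  using ov unfolding overlap_def by (elim exE conjE) (rule that)
 \<comment> \<open>One constant bounds both propensities from below; it is at most 1 / 2 because c
   <= c0 <= c1 <= 1 - c.\<close>
 define c where "c = min c0 (1 - c1)"
 have c: "0 < c" "c <= 1 / 2" "c <= 1 - c" "c <= c0" "c1 <= 1 - c" using c01 by (auto simp: c_def min_def)
 define s where "s x = max c (min (1 - c) (s0 x))" for x
 have sm [measurable]: "s \<in> borel_measurable borel" unfolding s_def[abs_def] by measurable
 have sb: "c <= s x" "s x <= 1 - c" for x using c(3) by (simp_all add: s_def)
 have sb': "0 <= s x" "s x <= 1" for x using sb[of x] c(1) by linarith+
 have s0b: "AE z in Q. c <= s0 (cov z) & s0 (cov z) <= 1 - c"
  using score cb by eventually_elim (use c(4,5) in linarith)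
 have s_s0: "AE z in Q. s (cov z) = s0 (cov z)"
  using s0b by eventually_elim (simp add: s_def)
 have s_score: "AE z in Q. s (cov z) = cprob Q cov trt z"
  using s_s0 score by eventually_elim simp
 have s_ipw: "ipw Q s" by (rule ignorability_imp_ipw[OF ign sm s_score sb'])
 note A2 = assms(9)[unfolded assumption2_def Let_def, folded m_def]
 have lip: "\<exists>L. L-lipschitz_on UNIV (m a)" for a using A2 by blast
 have mm [measurable]: "m a \<in> borel_measurable borel" for a
 proof -
  obtain L where "L-lipschitz_on UNIV (m a)" using lip[of a] by (elim exE) (rule that)
  then have "continuous_on UNIV (m a)" by (rule lipschitz_on_continuous_on)
  then show ?thesis by (rule borel_measurable_continuous_onI)
 qed
 have mc: "AE z in Q. m a (cov z) = cexp Q cov (pot a) z" for a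
  using correct_outcome0 correct_outcome1 by (cases a) (simp_all add: m_def outcome_model_def)
 have "\<exists>B. AE z in Q. \<bar>resid m (trt z) z\<bar> <= B" using A2 by blast
 then obtain B where B: "AE z in Q. \<bar>resid m (trt z) z\<bar> <= B" by (elim exE) (rule that)
 \<comment> \<open>The assumption bounds the residual of the received arm only. Weighting shows that
   an excess in arm \<open>a\<close> has propensity-weighted mass 0, and since the propensity is
   positive it is a null event for every unit, treated or not.\<close>
 have rb: "AE z in Q. \<bar>resid m a z\<bar> <= B" for a
 proof -
  define h :: "'x \<times> real \<times> real => ennreal" where "h p = of_bool (B < \<bar>(if a then snd (snd p) else fst (snd p)) - m a (fst p)\<bar>)" for p
  have hm [measurable]: "h \<in> borel_measurable (borel \<Otimes>\<^sub>M (borel \<Otimes>\<^sub>M borel))" unfolding h_def[abs_def] by measurable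
  have hz: "h (cov z, pot False z, pot True z) = of_bool (B < \<bar>resid m a z\<bar>)" for z by (cases a) (simp_all add: h_def resid_def)
  have "AE z in Q. of_bool (trt z = a) * h (cov z, pot False z, pot True z) = 0"
   using B
  proof eventually_elim
   case (elim z)
   then show ?case unfolding hz by (cases "trt z = a") auto
  qed
  then have "(\<integral>\<^sup>+ z. of_bool (trt z = a) * h (cov z, pot False z, pot True z) \<partial>Q) = 0"
   by (subst nn_integral_0_iff_AE) measurable
  then have "(\<integral>\<^sup>+ z. ennreal (prop_of s a (cov z)) * h (cov z, pot False z, pot True z) \<partial>Q) = 0"
   using ipw_nn_integral[OF s_ipw sm hm, of a] by simp
  then have "AE z in Q. ennreal (prop_of s a (cov z)) * h (cov z, pot False z, pot True z) = 0"
   by (subst (asm) nn_integral_0_iff_AE) measurable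
  then show ?thesis
  proof eventually_elim
   case (elim z)
   have "0 < prop_of s a (cov z)" using sb[of "cov z"] c(1) by (auto simp: prop_of_def)
   then have "h (cov z, pot False z, pot True z) = 0" using elim by (simp add: ennreal_eq_0_iff)
   then show ?case by (auto simp: hz not_less)
  qed
 qed
 interpret rs: regression_setting Q s m c B
 proof (rule regression_setting.intro[OF ul], rule regression_setting_axioms.intro)
  show "square_integrable_outcomes Q" by (rule assms(6))
  show "s \<in> borel_measurable borel" by (rule sm)
  show "m a \<in> borel_measurable borel" for a by (rule mm)
  show "0 < c" by (rule c)
  show "c <= s x" "s x <= 1 - c" for x by (rule sb)+
  show "ipw Q s" by (rule s_ipw)
  show "AE z in Q. m a (cov z) = cexp Q cov (pot a) z" for a by (rule mc)
  show "AE z in Q. \<bar>resid m a z\<bar> <= B" for a by (rule rb)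
 qed
 have "\<exists>l h f. (\<forall>x. 0 <= f x) & (\<forall>x. x \<notin> {l..h} --> f x = 0) &
   distributed Q lborel (%z. s0 (cov z)) (%x. ennreal (f x)) & C1_bounded_on {l..h} f"
  using A2 unfolding s0_def by blast
 then obtain lo hi f where f0: "\<forall>x. 0 <= f x" and fout: "\<forall>x. x \<notin> {lo..hi} --> f x = 0"
  and fd: "distributed Q lborel (%z. s0 (cov z)) (%x. ennreal (f x))" and fC: "C1_bounded_on {lo..hi} f"
  by (elim exE conjE) (rule that)
 have fcont: "continuous_on {lo..hi} f"
 proof -
  obtain f' where "\<forall>x\<in>{lo..hi}. (f has_real_derivative f' x) (at x within {lo..hi})"
   using fC unfolding C1_bounded_on_def by blast
  then show ?thesis by (intro DERIV_continuous_on) auto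
 qed
 have ind: "(LINT z|Q. of_bool (trt z = a) * indicator S (s0 (cov z))) = (\<integral>z. prop_of s a (cov z) * indicator S (s0 (cov z)) \<partial>Q :: real)"
  if [measurable]: "S \<in> sets borel" for a and S :: "real set"
 proof -
  have hm: "(%(x, y0, y1). indicator S (s0 x) :: real) \<in> borel_measurable (borel \<Otimes>\<^sub>M (borel \<Otimes>\<^sub>M borel))" by measurable
  show ?thesis by (rule ipw_integral(1)[OF s_ipw sm sb' hm])
 qed
 have mp: "matching_population Q trt (%z. s0 (cov z)) c f lo hi"
 proof (intro matching_population.intro matching_population_axioms.intro matching_sample.intro matching_sample_axioms.intro)
  show "prob_space Q" by (rule assms(2))
  show "trt \<in> measurable Q (count_space UNIV)" by measurable
  show "(%z. s0 (cov z)) \<in> borel_measurable Q" by measurable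
  show "0 < c" "c <= 1 / 2" by (rule c)+
  show "AE z in Q. c <= s0 (cov z) & s0 (cov z) <= 1 - c" by (rule s0b)
  show "distributed Q lborel (%z. s0 (cov z)) (%x. ennreal (f x))" by (rule fd)
  show "0 <= f x" for x using f0 by simp
  show "f x = 0" if "x \<notin> {lo..hi}" for x using fout that by blast
  show "continuous_on {lo..hi} f" by (rule fcont)
  fix S :: "real set" assume S [measurable]: "S \<in> sets borel"
  have "{z \<in> space Q. trt z & s0 (cov z) \<in> S} \<in> sets Q" by measurable
  then have "measure Q {z \<in> space Q. trt z & s0 (cov z) \<in> S} = (LINT z|Q. indicator {z \<in> space Q. trt z & s0 (cov z) \<in> S} z)"
   by simp
  also have "... = (LINT z|Q. of_bool (trt z = True) * indicator S (s0 (cov z)))"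
   by (intro Bochner_Integration.integral_cong) (auto simp: indicator_def of_bool_def)
  also have "... = (LINT z|Q. prop_of s True (cov z) * indicator S (s0 (cov z)))" by (rule ind[OF S])
  also have "... = (LINT z|Q. s0 (cov z) * indicator S (s0 (cov z)))"
  proof (rule integral_cong_AE)
   show "AE z in Q. prop_of s True (cov z) * indicator S (s0 (cov z)) = s0 (cov z) * indicator S (s0 (cov z))"
    using s_s0 by eventually_elim (simp add: prop_of_def)
  qed measurable
  finally show "measure Q {z \<in> space Q. trt z & s0 (cov z) \<in> S} = (LINT z|Q. s0 (cov z) * indicator S (s0 (cov z)))" .
 qed
 \<comment> \<open>Conditioning on the score gives the same probability as conditioning on X,
   because the latter is already a function of the score.\<close>
 have \<pi>: "AE z in Q. cprob Q (%z. s0 (cov z)) (%z. trt z = a) z = prop_of s a (cov z)" for a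
 proof (rule cprob_charact)
  have "(%x. prop_of (%x. max c (min (1 - c) x)) a x) \<in> borel_measurable borel" by measurable
  then have "(%z. prop_of (%x. max c (min (1 - c) x)) a (s0 (cov z))) \<in> borel_measurable (vimage_algebra (space Q) (%z. s0 (cov z)) borel)"
   by (intro vimage_borel_measurable) measurable
  moreover have "(%z. prop_of s a (cov z)) = (%z. prop_of (%x. max c (min (1 - c) x)) a (s0 (cov z)))"
   by (rule ext) (simp add: prop_of_def s_def)
  ultimately show "(%z. prop_of s a (cov z)) \<in> borel_measurable (vimage_algebra (space Q) (%z. s0 (cov z)) borel)"
   by (simp only:)
  show "integrable Q (%z. prop_of s a (cov z))"
  proof (rule integrable_const_bound[where B=1])
   have "\<bar>prop_of s a x\<bar> <= 1" for x using sb'[of x] by (simp add: prop_of_def)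
   then show "AE z in Q. norm (prop_of s a (cov z)) <= 1" by simp
  qed measurable
  show "(%z. s0 (cov z)) \<in> borel_measurable Q" "Measurable.pred Q (%z. trt z = a)" by measurable
  fix S :: "real set" assume S: "S \<in> sets borel"
  show "(LINT z|Q. indicator S (s0 (cov z)) * of_bool (trt z = a)) = (LINT z|Q. indicator S (s0 (cov z)) * prop_of s a (cov z))"
   using ind[OF S, of a] by (simp only: mult.commute)
 qed
 define V where "V = (LINT z|Q. cvar Q cov (pot False) z / cprob Q (%z. s0 (cov z)) (%z. trt z = False) z +
   cvar Q cov (pot True) z / cprob Q (%z. s0 (cov z)) (%z. trt z = True) z + (u1 (cov z) \<beta>1 - u0 (cov z) \<beta>0 - ate Q)^2)"
 have V: "V = (LINT z|Q. (rs.infl z)^2)"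
 proof -
  have u: "u1 x \<beta>1 - u0 x \<beta>0 - ate Q = rs.base x" for x
   unfolding rs.base_def by (simp add: m_def outcome_model_def)
  have cm: "(%z. s0 (cov z)) \<in> borel_measurable Q" by measurable
  have cvm [measurable]: "cvar Q cov (pot a) \<in> borel_measurable Q" "cprob Q (%z. s0 (cov z)) (%z. trt z = a) \<in> borel_measurable Q" for a
   unfolding cvar_def cprob_def by (rule cexp_measurable, measurable)+
  have "V = (LINT z|Q. (cvar Q cov (pot False) z / prop_of s False (cov z) + cvar Q cov (pot True) z / prop_of s True (cov z)) + (rs.base (cov z))^2)"
   unfolding V_def u
  proof (rule integral_cong_AE)
   show "AE z in Q. cvar Q cov (pot False) z / cprob Q (%z. s0 (cov z)) (%z. trt z = False) z +
     cvar Q cov (pot True) z / cprob Q (%z. s0 (cov z)) (%z. trt z = True) z + (rs.base (cov z))^2 =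
    (cvar Q cov (pot False) z / prop_of s False (cov z) + cvar Q cov (pot True) z / prop_of s True (cov z)) + (rs.base (cov z))^2"
    using \<pi>[of False] \<pi>[of True] by eventually_elim (simp only:)
  qed measurable
  also have "... = (LINT z|Q. cvar Q cov (pot False) z / prop_of s False (cov z) + cvar Q cov (pot True) z / prop_of s True (cov z)) + (LINT z|Q. (rs.base (cov z))^2)"
   by (rule Bochner_Integration.integral_add[OF Bochner_Integration.integrable_add[OF rs.resid_var(1) rs.resid_var(1)] rs.integrable_base_sq])
  also have "... = (LINT z|Q. (rs.infl z)^2)"
   unfolding rs.infl_moments(2) rs.noise_var_eq by (rule add.commute)
  finally show ?thesis .
 qed
 have "weak_conv_m (%n. distr \<Omega> borel (%\<omega>. sqrt (real n) * (amw s0 m n (K n) (%i. Z i \<omega>) - ate Q))) (centered_normal V)"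
  unfolding V by (rule rs.amw_weak_conv[OF assms(1) iid s_def s0m mp assms(13,14)])
 moreover have "ennreal V = efficiency_bound Q"
  unfolding V by (rule rs.efficiency_bound_infl[symmetric])
 ultimately show ?thesis
  unfolding Let_def V_def m_def s0_def by (rule conjI)
qed

end
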